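(* Let $n\geq 2$, let $\Omega\subset\mathbb{R}^n$ be a bounded domain of diameter at most $D$, and consider an active source $\chi_\Omega\varphi$ with $\varphi\in C^\alpha(\overline\Omega)$, $0<\alpha<1$. Assume that $p\in\partial\Omega$ is an admissible $K$-curvature point of $\Omega$ with parameters $L,M,\delta$ and with $K\geq e$, and that $p$ is connected to infinity through $\mathbb{R}^n\setminus\overline\Omega$. Then for any given wavenumber $k>0$ and Hölder index $\alpha$ there exists a positive constant $\mathcal E=\mathcal E(\alpha,\delta,n,D,L,M,k)$, depending only on $\alpha,\delta,n,D,L,M,k$, such that if \[ \frac{|\varphi(p)|}{\max\big(1,\|\varphi\|_{C^\alpha(\overline\Omega)}\big)}\geq \mathcal E\,(\ln K)^{(n+3)/2}K^{-\min(\alpha,\delta)/2}, \] then the source $\chi_\Omega\varphi$ radiates a non-zero far-field pattern at wavenumber $k$.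
   Context: Source scattering: for a bounded domain $\Omega$, $\varphi$ on $\overline\Omega$ and $k>0$, let $u\in H^2_{loc}(\mathbb{R}^n)$ be the unique solution of $(\Delta+k^2)u=\chi_\Omega\varphi$ satisfying the Sommerfeld radiation condition $\lim_{r\to\infty}r^{(n-1)/2}(\partial_r-ik)u=0$. Its far-field pattern is $u_\infty(\hat x)=C_{n,k}\int e^{-ik\hat x\cdot y}\chi_\Omega\varphi(y)\,dy$ with $C_{n,k}\neq0$ an explicit constant (the leading coefficient in $u(x)\sim \frac{e^{ik|x|}}{|x|^{(n-1)/2}}u_\infty(x/|x|)$). "Radiates a non-zero far-field pattern" means $u_\infty\not\equiv0$. Admissible $K$-curvature point: let $K,L,M,\delta>0$ and $\Omega\subset\mathbb{R}^n$ a bounded domain. A point $p\in\partial\Omega$ is an admissible $K$-curvature point with parameters $L,M,\delta$ if: (1) up to a rigid motion, $p=0$ and $e_n=(0,\dots,0,1)$ is the interior unit normal to $\partial\Omega$ at $0$; (2) with $b=\sqrt M/K$ and $h=1/K$, there is a $C^3$ function $\omega:B(0,b)\to[0,\infty)$, $B(0,b)\subset\mathbb{R}^{n-1}$, such that $\Omega_{b,h}:=(B(0,b)\times(-h,h))\cap\Omega=\{x=(x',x_n): |x'|<b,\ -h<x_n<h,\ \omega(x')<x_n<h\}$; (3) $\omega(x')=K|x'|^2+\mathcal O(|x'|^3)$ for $x'\in B(0,b)$; (4) $M\geq1$ and there are $0<K_-\leq K\leq K_+<\infty$ with $K_-|x'|^2\leq\omega(x')\leq K_+|x'|^2$ for $|x'|<b$,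 $M^{-1}\leq K_\pm/K\leq M$, and $K_+-K_-\leq LK^{1-\delta}$; (5) the set $\overline{\Omega_{b,h}}\cap(\mathbb{R}^{n-1}\times\{h\})$ is a Lipschitz domain. Connected to infinity: for an open $U\subset\mathbb{R}^n$, a point $p$ is connected to infinity through $U$ if there is a continuous path $\gamma:(0,\infty)\to U$ with $\lim_{s\to0}\gamma(s)=p$ and $\lim_{s\to\infty}|\gamma(s)|=\infty$. Standing assumption: bounded domains satisfy $H^2_0(\Omega)=\{u|_\Omega: u\in H^2(\mathbb{R}^n),\ u=0 \text{ in } \mathbb{R}^n\setminus\overline\Omega\}$. *)

theory Defs
  imports "HOL-Analysis.Analysis"
begin

text \<open>C^3 regularity of a real function on a set S (open in the intended use):
  the first, second and third Frechet derivatives exist on S and the third one is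
  continuous on S (each entry D3 y h k l, which suffices in finite dimension since the
  derivatives are multilinear).\<close>
definition C3_on :: "'a::euclidean_space set \<Rightarrow> ('a \<Rightarrow> real) \<Rightarrow> bool" where
  "C3_on S f \<longleftrightarrow>
     (\<exists>D1 D2 D3.
        (\<forall>x\<in>S. (f has_derivative D1 x) (at x)
           \<and> (\<forall>h. ((\<lambda>y. D1 y h) has_derivative D2 x h) (at x)
           \<and> (\<forall>k. ((\<lambda>y. D2 y h k) has_derivative D3 x h k) (at x))))
      \<and> (\<forall>h k l. continuous_on S (\<lambda>y. D3 y h k l)))"

text \<open>Lipschitz domain (bounded, open, connected, nonempty; boundary locally the graph of a
  Lipschitz function over a hyperplane, after a rotation; written coordinate-free with the
  local "vertical" unit vector nu).\<close>
definition lipschitz_domain :: "'a::euclidean_space set \<Rightarrow> bool" where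
  "lipschitz_domain U \<longleftrightarrow>
     open U \<and> bounded U \<and> connected U \<and> U \<noteq> {} \<and>
     (\<forall>q\<in>frontier U. \<exists>nu r a g C.
        norm nu = 1 \<and> r > 0 \<and> a > 0 \<and>
        lipschitz_on C {y. y \<bullet> nu = 0} g \<and>
        (\<forall>y. y \<bullet> nu = 0 \<and> norm y < r \<longrightarrow> \<bar>g y\<bar> < a) \<and>
        U \<inter> {q + y + t *\<^sub>R nu | y t. y \<bullet> nu = 0 \<and> norm y < r \<and> \<bar>t\<bar> < a}
          = {q + y + t *\<^sub>R nu | y t. y \<bullet> nu = 0 \<and> norm y < r \<and> g y < t \<and> t < a})"

text \<open>Admissible K-curvature point. Points of R^n are written as pairs (x', x_n) with
  x' in R^(n-1) = real^'m; the rigid motion T sends p to 0 (and the interior normal to e_n).\<close>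
definition admissible_curvature_point ::
  "real \<Rightarrow> real \<Rightarrow> real \<Rightarrow> real \<Rightarrow> ((real^'m) \<times> real) set \<Rightarrow> (real^'m) \<times> real \<Rightarrow> bool" where
  "admissible_curvature_point K L M \<delta> \<Omega> p \<longleftrightarrow>
     K > 0 \<and> L > 0 \<and> M > 0 \<and> \<delta> > 0 \<and> p \<in> frontier \<Omega> \<and>
     (\<exists>(T :: (real^'m) \<times> real \<Rightarrow> (real^'m) \<times> real) \<omega>. (\<forall>x y. dist (T x) (T y) = dist x y) \<and> T p = 0 \<and>
       (let b = sqrt M / K; h = 1 / K;
            \<Omega>bh = T ` \<Omega> \<inter> (ball 0 b \<times> {-h<..<h}) in
          \<Omega>bh = {(x', t). norm x' < b \<and> -h < t \<and> t < h \<and> \<omega> x' < t} \<and>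
          C3_on (ball 0 b) \<omega> \<and> (\<forall>x'\<in>ball 0 b. \<omega> x' \<ge> 0) \<and>
          (\<exists>C. \<forall>x'\<in>ball 0 b. \<bar>\<omega> x' - K * (norm x')\<^sup>2\<bar> \<le> C * (norm x') ^ 3) \<and>
          M \<ge> 1 \<and>
          (\<exists>Km Kp. 0 < Km \<and> Km \<le> K \<and> K \<le> Kp \<and>
             (\<forall>x'\<in>ball 0 b. Km * (norm x')\<^sup>2 \<le> \<omega> x' \<and> \<omega> x' \<le> Kp * (norm x')\<^sup>2) \<and>
             inverse M \<le> Km / K \<and> Km / K \<le> M \<and> inverse M \<le> Kp / K \<and> Kp / K \<le> M \<and>
             Kp - Km \<le> L * K powr (1 - \<delta>)) \<and>
          (\<exists>U. lipschitz_domain U \<and> closure U = {x'. (x', h) \<in> closure \<Omega>bh})))"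

definition connected_to_infinity :: "'a::real_normed_vector set \<Rightarrow> 'a \<Rightarrow> bool" where
  "connected_to_infinity U p \<longleftrightarrow>
     (\<exists>\<gamma> :: real \<Rightarrow> 'a. continuous_on {0<..} \<gamma> \<and> \<gamma> ` {0<..} \<subseteq> U \<and>
          (\<gamma> \<longlongrightarrow> p) (at_right 0) \<and> filterlim (\<lambda>s. norm (\<gamma> s)) at_top at_top)"

definition holder_continuous_on :: "real \<Rightarrow> 'a::metric_space set \<Rightarrow> ('a \<Rightarrow> complex) \<Rightarrow> bool" where
  "holder_continuous_on \<alpha> S f \<longleftrightarrow>
     bounded (f ` S) \<and> (\<exists>C. \<forall>x\<in>S. \<forall>y\<in>S. norm (f x - f y) \<le> C * dist x y powr \<alpha>)"

definition holder_norm :: "real \<Rightarrow> 'a::metric_space set \<Rightarrow> ('a \<Rightarrow> complex) \<Rightarrow> real" where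
  "holder_norm \<alpha> S f =
     (SUP x\<in>S. norm (f x)) +
     Sup {norm (f x - f y) / dist x y powr \<alpha> | x y. x \<in> S \<and> y \<in> S \<and> x \<noteq> y}"

text \<open>Far-field pattern of the radiating solution of (Delta + k^2) u = chi_Omega phi in
  R^n, n = DIM('a): u_infty(xh) = C_{n,k} * integral over Omega of exp(-i k xh.y) phi(y) dy,
  with C_{n,k} = -i e^{-i(n-1)pi/4} k^((n-3)/2) / (2 (2 pi)^((n-1)/2)).\<close>
definition far_field_const :: "nat \<Rightarrow> real \<Rightarrow> complex" where
  "far_field_const n k = - \<i> * cis (- (real n - 1) * pi / 4) *
     complex_of_real (k powr ((real n - 3) / 2) / (2 * (2 * pi) powr ((real n - 1) / 2)))"

definition far_field :: "real \<Rightarrow> 'a::euclidean_space set \<Rightarrow> ('a \<Rightarrow> complex) \<Rightarrow> 'a \<Rightarrow> complex" where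
  "far_field k \<Omega> \<phi> xh = far_field_const DIM('a) k *
     set_lebesgue_integral lborel \<Omega> (\<lambda>y. cis (- k * (xh \<bullet> y)) * \<phi> y)"

definition radiates_nonzero_far_field :: "real \<Rightarrow> 'a::euclidean_space set \<Rightarrow> ('a \<Rightarrow> complex) \<Rightarrow> bool" where
  "radiates_nonzero_far_field k \<Omega> \<phi> \<longleftrightarrow> (\<exists>xh. norm xh = 1 \<and> far_field k \<Omega> \<phi> xh \<noteq> 0)"

end

theory Submission
  imports Defs "HOL-Probability.Probability" "HOL-Complex_Analysis.Complex_Analysis" "HOL-Real_Asymp.Real_Asymp"
begin

text \<open>A source \<open>f\<close> that does not radiate has a Fourier transform vanishing on the sphere \<open>|\<xi>| = k\<close>, hence on
  its complexification. Solving the Helmholtz equation after a Fourier transform in \<open>x'\<close> then gives compactly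
  supported solutions of the one-dimensional equations in \<open>x\<^sub>n\<close>, and, after smoothing with the heat semigroup,
  a weak solution \<open>u\<close> of \<open>(\<Delta> + k\<^sup>2) u = f\<close> that vanishes for large \<open>x\<^sub>n\<close>. It is real analytic off
  the support of \<open>f\<close>, so it vanishes along the path from infinity to the curvature point \<open>p = 0\<close>, and below the graph
  there. Second differences of \<open>u\<close> over a distance \<open>v\<close> are of order \<open>v\<^sup>2 ln (1/v)\<close>, so \<open>u\<close> is of
  order \<open>K\<^sup>-\<^sup>2 ln K\<close> within distance \<open>1/K\<close> of \<open>p\<close>.

  Now test the equation with \<open>exp (\<i> s (e \<bullet> x') - \<tau> x\<^sub>n)\<close> cut off at the scale \<open>1/K\<close>, where
  \<open>s\<^sup>2 = \<tau>\<^sup>2 + k\<^sup>2\<close>. Replacing the domain by the paraboloid \<open>x\<^sub>n > K |x'|\<^sup>2\<close>, the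
  main term is \<open>f(p)\<close> times an explicit Gaussian integral of size about \<open>exp (- \<tau> / (4 K))\<close>. For
  \<open>\<tau> = 2 min(\<alpha>, \<delta>) K ln K\<close> the errors are smaller by the factor
  \<open>K powr (- min(\<alpha>, \<delta>) / 2)\<close> up to logarithms, which bounds \<open>|f(p)|\<close>.\<close>

section \<open>Integration on Euclidean spaces\<close>

text \<open>The constant must be fixed before the domain, the point and the source, so qualitative
  regularity of \<open>u\<close> is of no help. Hence \<open>u\<close> is written down explicitly,
  and its only quantitative regularity is the second-difference bound with factor
  \<open>N * CU\<close>, where \<open>CU\<close> depends on \<open>k\<close>, \<open>R\<close> and
  the dimension alone. Only values of \<open>u\<close> are estimated: the weak equation puts every
  derivative on the test function.

  The size of \<tau> is a balance. Put \<open>m = min \<alpha> \<delta>\<close> and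
  \<open>\<tau> = A * K * ln K\<close>. Relative to the volume scale, the oscillation reduces the
  main term to about \<open>K powr (- A / 4)\<close>, the Holder error and the deviation of the
  graph from the paraboloid are of order \<open>K powr - m\<close>, and the cutoff errors of order
  \<open>K powr (- 3 * A / 5)\<close> up to logarithms. Dividing by the main term leaves
  \<open>K powr (- m / 2)\<close> as long as \<open>A \<le> 2 * m\<close>, and the cutoff errors
  stay below \<open>K powr - m\<close> with room for logarithms as soon as
  \<open>A > 5 * m / 3\<close>. The choice \<open>A = 2 * m\<close> satisfies both. The logarithm in
  the final bound is the price of the Gaussian normalisation, since \<open>\<tau> * K\<close> is
  \<open>A * K\<^sup>2 * ln K\<close> and not a multiple of \<open>K\<^sup>2\<close>.\<close>

lemma
  fixes f :: "'a::euclidean_space \<Rightarrow> real \<Rightarrow> 'b::{real_normed_field, banach, second_countable_topology}"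
  assumes "\<And>b. b \<in> Basis \<Longrightarrow> integrable lborel (f b)"
  shows integrable_lborel_prod: "integrable lborel (\<lambda>x::'a. \<Prod>b\<in>Basis. f b (x \<bullet> b))"
    and integral_lborel_prod: "(\<integral>x. (\<Prod>b\<in>Basis. f b (x \<bullet> b)) \<partial>lborel) = (\<Prod>b\<in>Basis. \<integral>x. f b x \<partial>lborel)"
proof -
  let ?T = "\<lambda>g. \<Sum>b\<in>(Basis::'a set). g b *\<^sub>R b"
  interpret product_sigma_finite "\<lambda>b::'a. lborel::real measure" ..
  have [measurable]: "\<And>b. b \<in> Basis \<Longrightarrow> f b \<in> borel_measurable borel"
    using assms borel_measurable_integrable by fastforce
  have M: "?T \<in> (\<Pi>\<^sub>M b\<in>Basis. lborel) \<rightarrow>\<^sub>M borel"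
    by measurable
  have meas: "(\<lambda>x::'a. \<Prod>b\<in>Basis. f b (x \<bullet> b)) \<in> borel_measurable borel"
    by measurable
  have eq: "(\<Prod>b\<in>Basis. f b (?T g \<bullet> b)) = (\<Prod>b\<in>Basis. f b (g b))" for g
    by (intro prod.cong) auto
  show "integrable lborel (\<lambda>x::'a. \<Prod>b\<in>Basis. f b (x \<bullet> b))"
    unfolding lborel_eq[where 'a='a]
    by (subst integrable_distr_eq[OF M meas]) (use product_integrable_prod[OF _ assms] in \<open>simp add: eq\<close>)
  show "(\<integral>x. (\<Prod>b\<in>Basis. f b (x \<bullet> b)) \<partial>lborel) = (\<Prod>b\<in>Basis. \<integral>x. f b x \<partial>lborel)"
    unfolding lborel_eq[where 'a='a]
    by (subst integral_distr[OF M meas]) (use product_integral_prod[OF _ assms] in \<open>simp add: eq\<close>)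
qed

lemma nn_integral_lborel_shift:
  fixes c :: "'a::euclidean_space"
  assumes "g \<in> borel_measurable borel"
  shows "(\<integral>\<^sup>+x. g (x + c) \<partial>lborel) = (\<integral>\<^sup>+x. g x \<partial>lborel)"
proof -
  have "(\<integral>\<^sup>+x. g x \<partial>lborel) = (\<integral>\<^sup>+x. g x \<partial>distr lborel borel ((+) c))"
    by (simp add: lborel_distr_plus)
  also have "\<dots> = (\<integral>\<^sup>+x. g (c + x) \<partial>lborel)"
    using assms by (subst nn_integral_distr) auto
  finally show ?thesis by (simp add: add.commute)
qed

lemma integral_lborel_shift:
  fixes c :: "'a::euclidean_space" and g :: "'a \<Rightarrow> 'b::{banach, second_countable_topology}"
  assumes "g \<in> borel_measurable borel"
  shows "(\<integral>x. g (x + c) \<partial>lborel) = (\<integral>x. g x \<partial>lborel)"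
proof -
  have "(\<integral>x. g x \<partial>lborel) = (\<integral>x. g x \<partial>distr lborel borel ((+) c))"
    by (simp add: lborel_distr_plus)
  also have "\<dots> = (\<integral>x. g (c + x) \<partial>lborel)"
    using assms by (subst integral_distr) auto
  finally show ?thesis by (simp add: add.commute)
qed

lemma integrable_lborel_shift:
  fixes c :: "'a::euclidean_space" and g :: "'a \<Rightarrow> 'b::{banach, second_countable_topology}"
  assumes "integrable lborel g"
  shows "integrable lborel (\<lambda>x. g (x + c))"
proof -
  have m: "g \<in> borel_measurable borel" using assms borel_measurable_integrable by fastforce
  have "integrable (distr lborel borel ((+) c)) g"
    using assms by (simp add: lborel_distr_plus)
  then show ?thesis using m by (subst (asm) integrable_distr_eq) (auto simp: add.commute)
qed

lemma lborel_distr_uminus_euclidean: "distr lborel borel (uminus :: 'a::euclidean_space \<Rightarrow> 'a) = lborel"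
  using lborel_affine[of "-1" "0::'a"] by (simp add: density_1 one_ennreal_def[symmetric])

section \<open>The heat kernel\<close>

text \<open>Normalised to total mass 1 for \<open>t > 0\<close>. At \<open>t = 0\<close> the value
  is 0, because \<open>0 powr a = 0\<close>; the time integrals over \<open>{0..1}\<close> rely on
  this default at the left endpoint.\<close>

definition heat :: "real \<Rightarrow> 'a::euclidean_space \<Rightarrow> real" where
  "heat t z = (4 * pi * t) powr (- real DIM('a) / 2) * exp (- (norm z)\<^sup>2 / (4 * t))"

lemma heat_real: "t > 0 \<Longrightarrow> heat t (s::real) = exp (- s\<^sup>2 / (4 * t)) / sqrt (4 * pi * t)"
  by (simp add: heat_def powr_minus_divide powr_half_sqrt)

lemma heat_real_normal: "t > 0 \<Longrightarrow> heat t (s::real) = normal_density 0 (sqrt (2 * t)) s"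
  by (simp add: heat_real normal_density_def)

lemma heat_nonneg: "heat t z \<ge> 0" by (simp add: heat_def)

lemma heat_minus [simp]: "heat t (- z) = heat t z" by (simp add: heat_def)

lemma heat_measurable [measurable (raw)]:
  assumes [measurable]: "f \<in> borel_measurable M" "g \<in> borel_measurable M"
  shows "(\<lambda>x. heat (f x) (g x :: 'a::euclidean_space)) \<in> borel_measurable M"
  unfolding heat_def by measurable

lemma norm_eq_sum_Basis: "(norm (x::'a::euclidean_space))\<^sup>2 = (\<Sum>b\<in>Basis. (x \<bullet> b)\<^sup>2)"
  unfolding power2_norm_eq_inner by (subst euclidean_inner) (simp add: power2_eq_square)

lemma heat_prod:
  assumes "t > 0" shows "heat t (z::'a::euclidean_space) = (\<Prod>b\<in>Basis. heat t (z \<bullet> b))"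
proof -
  have "(\<Prod>b\<in>Basis. heat t (z \<bullet> b)) = (\<Prod>b\<in>(Basis::'a set). (4 * pi * t) powr (- 1 / 2)) * exp (\<Sum>b\<in>Basis. - (z \<bullet> b)\<^sup>2 / (4 * t))"
    unfolding heat_def by (simp add: prod.distrib exp_sum)
  also have "(\<Prod>b\<in>(Basis::'a set). (4 * pi * t) powr (- 1 / 2)) = (4 * pi * t) powr (- real DIM('a) / 2)"
    using assms by (simp add: powr_power)
  also have "(\<Sum>b\<in>Basis. - (z \<bullet> b)\<^sup>2 / (4 * t)) = - (norm z)\<^sup>2 / (4 * t)"
    unfolding norm_eq_sum_Basis by (simp add: sum_divide_distrib sum_negf)
  finally show ?thesis by (simp add: heat_def)
qed

lemma heat_pair:
  assumes "t > 0"
  shows "heat t (z::'a::euclidean_space \<times> 'b::euclidean_space) = heat t (fst z) * heat t (snd z)"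
proof -
  have n: "(norm z)\<^sup>2 = (norm (fst z))\<^sup>2 + (norm (snd z))\<^sup>2"
    by (simp add: norm_prod_def)
  have "(4 * pi * t) powr (- real DIM('a \<times> 'b) / 2) = (4 * pi * t) powr (- real DIM('a) / 2) * (4 * pi * t) powr (- real DIM('b) / 2)"
    by (simp add: powr_add[symmetric] add_divide_distrib diff_divide_distrib)
  then show ?thesis
    unfolding heat_def n by (simp add: add_divide_distrib minus_add_distrib diff_divide_distrib exp_add[symmetric])
qed

lemma
  assumes "t > 0"
  shows integrable_heat: "integrable lborel (heat t :: 'a::euclidean_space \<Rightarrow> real)"
    and integral_heat: "(\<integral>z. heat t (z::'a) \<partial>lborel) = 1"
proof -
  have 1: "integrable lborel (heat t :: real \<Rightarrow> real)" "(\<integral>s. heat t (s::real) \<partial>lborel) = 1"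
    using assms integrable_normal_density[of "sqrt (2 * t)" 0] integral_normal_density
    by (simp_all add: heat_real_normal[OF assms, abs_def])
  show "integrable lborel (heat t :: 'a \<Rightarrow> real)" "(\<integral>z. heat t (z::'a) \<partial>lborel) = 1"
    using integrable_lborel_prod[of "\<lambda>_::'a. heat t :: real \<Rightarrow> real"] integral_lborel_prod[of "\<lambda>_::'a. heat t :: real \<Rightarrow> real"] 1
    by (simp_all add: heat_prod[OF assms, where 'a='a, abs_def])
qed

lemma
  assumes "t > 0"
  shows integrable_heat_shift: "integrable lborel (\<lambda>y::'a::euclidean_space. heat t (x - y))"
    and integral_heat_shift: "(\<integral>y. heat t (x - y::'a) \<partial>lborel) = 1"
proof -
  have e: "(\<lambda>y::'a. heat t (x - y)) = (\<lambda>y. heat t (y + (-x)))"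
    using heat_minus[of t "x - _"] by (auto simp: fun_eq_iff)
  show "integrable lborel (\<lambda>y::'a. heat t (x - y))"
    unfolding e by (rule integrable_lborel_shift[OF integrable_heat[OF assms]])
  show "(\<integral>y. heat t (x - y::'a) \<partial>lborel) = 1"
    unfolding e by (subst integral_lborel_shift) (auto simp: integral_heat[OF assms])
qed

lemma borel_measurable_cis [measurable]: "cis \<in> borel_measurable borel"
  by (intro borel_measurable_continuous_onI continuous_intros)

text \<open>Rescaling by \<open>sqrt (2 * t)\<close> turns the Gaussian into the standard normal
  density, whose characteristic function is known; the constants only undo the rescaling.\<close>

lemma fourier_gauss_real:
  assumes "t > 0"
  shows "integrable lborel (\<lambda>x::real. cis (x * s) * exp (- t * x\<^sup>2))"
    and "(\<integral>x. cis (x * s) * complex_of_real (exp (- t * x\<^sup>2)) \<partial>lborel) = complex_of_real ((pi / t) powr (1/2) * exp (- s\<^sup>2 / (4 * t)))"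
proof -
  define c where "c = sqrt (2 * t)"
  have c: "c > 0" "c\<^sup>2 = 2 * t" using assms by (auto simp: c_def)
  let ?g = "\<lambda>x::real. cis (x * (s / c)) * complex_of_real (std_normal_density x)"
  have gi: "integrable lborel ?g"
    by (rule Bochner_Integration.integrable_bound[OF integrable_normal_density[of 1 0]]) (auto simp: norm_mult normal_density_nonneg)
  have gv: "(\<integral>x. ?g x \<partial>lborel) = exp (- (s / c)\<^sup>2 / 2)"
  proof -
    have "complex_of_real (exp (- (s / c)\<^sup>2 / 2)) = char std_normal_distribution (s / c)"
      by (simp add: char_std_normal_distribution)
    also have "\<dots> = (\<integral>x. std_normal_density x *\<^sub>R iexp (s / c * x) \<partial>lborel)"
      unfolding char_def
      by (subst integral_density) (auto simp: normal_density_nonneg)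
    also have "\<dots> = (\<integral>x. ?g x \<partial>lborel)"
      by (simp add: cis_conv_exp scaleR_conv_of_real mult.commute)
    finally show ?thesis by simp
  qed
  have sc: "?g (c * x) = complex_of_real (1 / sqrt (2 * pi)) * (cis (x * s) * exp (- t * x\<^sup>2))" for x
    using c assms by (simp add: normal_density_def power_mult_distrib field_simps)
  have i1: "integrable lborel (\<lambda>x. ?g (c * x))"
    using lborel_integrable_real_affine[OF gi, of c 0] c by simp
  then have i2: "integrable lborel (\<lambda>x. complex_of_real (1 / sqrt (2 * pi)) * (cis (x * s) * exp (- t * x\<^sup>2)))"
    unfolding sc .
  have "integrable lborel (\<lambda>x. complex_of_real (sqrt (2 * pi)) * (complex_of_real (1 / sqrt (2 * pi)) * (cis (x * s) * exp (- t * x\<^sup>2))))"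
    by (intro integrable_mult_right i2)
  moreover have "complex_of_real (sqrt (2 * pi)) * (complex_of_real (1 / sqrt (2 * pi)) * z) = z" for z
    by (simp add: mult.assoc[symmetric] of_real_mult[symmetric] del: of_real_mult)
  ultimately show "integrable lborel (\<lambda>x::real. cis (x * s) * exp (- t * x\<^sup>2))"
    by (simp only:)
  have "(\<integral>x. ?g x \<partial>lborel) = c *\<^sub>R (\<integral>x. ?g (c * x) \<partial>lborel)"
    using lborel_integral_real_affine[of c ?g 0] c by simp
  also have "\<dots> = c / sqrt (2 * pi) * (\<integral>x. cis (x * s) * complex_of_real (exp (- t * x\<^sup>2)) \<partial>lborel)"
    unfolding sc by (subst integral_mult_right_zero) (simp add: scaleR_conv_of_real)
  finally have "(\<integral>x. cis (x * s) * complex_of_real (exp (- t * x\<^sup>2)) \<partial>lborel) = complex_of_real (sqrt (2 * pi) / c * exp (- (s / c)\<^sup>2 / 2))"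
    using c unfolding gv by (simp add: field_simps)
  also have "sqrt (2 * pi) / c = (pi / t) powr (1/2)"
    using assms by (simp add: c_def powr_half_sqrt real_sqrt_divide[symmetric])
  also have "- (s / c)\<^sup>2 / 2 = - s\<^sup>2 / (4 * t)"
    using c by (simp add: power_divide)
  finally show "(\<integral>x. cis (x * s) * complex_of_real (exp (- t * x\<^sup>2)) \<partial>lborel) = complex_of_real ((pi / t) powr (1/2) * exp (- s\<^sup>2 / (4 * t)))" .
qed

lemma cis_sum: "finite A \<Longrightarrow> cis (\<Sum>b\<in>A. f b) = (\<Prod>b\<in>A. cis (f b))"
  by (induction A rule: finite_induct) (auto simp: cis_mult[symmetric])

lemma fourier_gauss:
  fixes z :: "'a::euclidean_space"
  assumes "t > 0"
  shows "integrable lborel (\<lambda>x. cis (x \<bullet> z) * complex_of_real (exp (- t * (norm x)\<^sup>2)))"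
    and "(\<integral>x. cis (x \<bullet> z) * complex_of_real (exp (- t * (norm x)\<^sup>2)) \<partial>lborel)
       = complex_of_real ((pi / t) powr (DIM('a)/2) * exp (- (norm z)\<^sup>2 / (4 * t)))"
proof -
  let ?f = "\<lambda>b s. cis (s * (z \<bullet> b)) * complex_of_real (exp (- t * s\<^sup>2))"
  have e: "cis (x \<bullet> z) * complex_of_real (exp (- t * (norm x)\<^sup>2)) = (\<Prod>b\<in>Basis. ?f b (x \<bullet> b))" for x
    unfolding norm_eq_sum_Basis sum_distrib_left exp_sum[OF finite_Basis]
    by (subst euclidean_inner) (simp add: cis_sum prod.distrib)
  show "integrable lborel (\<lambda>x. cis (x \<bullet> z) * complex_of_real (exp (- t * (norm x)\<^sup>2)))"
    unfolding e by (intro integrable_lborel_prod fourier_gauss_real assms)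
  have "(\<integral>x. cis (x \<bullet> z) * complex_of_real (exp (- t * (norm x)\<^sup>2)) \<partial>lborel) = (\<Prod>b\<in>Basis. \<integral>x. ?f b x \<partial>lborel)"
    unfolding e by (intro integral_lborel_prod fourier_gauss_real assms)
  also have "\<dots> = (\<Prod>b\<in>Basis. complex_of_real ((pi / t) powr (1/2) * exp (- (z \<bullet> b)\<^sup>2 / (4 * t))))"
    by (simp only: fourier_gauss_real[OF assms])
  also have "\<dots> = complex_of_real ((\<Prod>b\<in>(Basis::'a set). (pi / t) powr (1/2)) * exp (\<Sum>b\<in>Basis. - (z \<bullet> b)\<^sup>2 / (4 * t)))"
    by (simp add: prod.distrib exp_sum)
  also have "(\<Prod>b\<in>(Basis::'a set). (pi / t) powr (1/2)) = (pi / t) powr (DIM('a)/2)"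
    using assms by (simp add: powr_power)
  also have "(\<Sum>b\<in>Basis. - (z \<bullet> b)\<^sup>2 / (4 * t)) = - (norm z)\<^sup>2 / (4 * t)"
    unfolding norm_eq_sum_Basis by (simp add: sum_divide_distrib sum_negf)
  finally show "(\<integral>x. cis (x \<bullet> z) * complex_of_real (exp (- t * (norm x)\<^sup>2)) \<partial>lborel)
       = complex_of_real ((pi / t) powr (DIM('a)/2) * exp (- (norm z)\<^sup>2 / (4 * t)))" .
qed

text \<open>The two shifted kernels add up to \<open>heat t z * c\<close> times a sum
  \<open>exp (- a) + exp a \<ge> 2\<close>, so the second difference is bounded below by
  \<open>- 2 * (1 - c)\<close> times the kernel. As its total mass is 0, its mean absolute value is
  controlled by the negative part alone. This gives order \<open>(norm v)\<^sup>2 / t\<close> for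
  large \<open>t\<close> and never more than 4.\<close>

lemma heat_second_difference:
  fixes v x :: "'a::euclidean_space"
  assumes t: "t > 0"
  shows "integrable lborel (\<lambda>y. heat t (x + v - y) + heat t (x - v - y) - 2 * heat t (x - y))" (is ?I)
    and "(\<integral>y. \<bar>heat t (x + v - y) + heat t (x - v - y) - 2 * heat t (x - y)\<bar> \<partial>lborel) \<le> 4 * (1 - exp (- (norm v)\<^sup>2 / (4 * t)))"
proof -
  define c where "c = exp (- (norm v)\<^sup>2 / (4 * t))"
  let ?d = "\<lambda>y. heat t (x + v - y) + heat t (x - v - y) - 2 * heat t (x - y)"
  let ?b = "\<lambda>y. heat t (x + v - y) + heat t (x - v - y) + (2 - 4 * c) * heat t (x - y)"
  note I = integrable_heat_shift[OF t]
  have c1: "c \<le> 1" using t by (simp add: c_def)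
  have key: "heat t (z + v) + heat t (z - v) \<ge> 2 * c * heat t z" for z :: 'a
  proof -
    let ?a = "(z \<bullet> v) / (2 * t)"
    have e1: "- (norm (z + v))\<^sup>2 / (4 * t) = - (norm z)\<^sup>2 / (4 * t) + - (norm v)\<^sup>2 / (4 * t) + - ?a"
      using t by (simp add: power2_norm_eq_inner inner_simps inner_commute field_simps)
    have e2: "- (norm (z - v))\<^sup>2 / (4 * t) = - (norm z)\<^sup>2 / (4 * t) + - (norm v)\<^sup>2 / (4 * t) + ?a"
      using t by (simp add: power2_norm_eq_inner inner_simps inner_commute field_simps)
    have "heat t (z + v) + heat t (z - v) = heat t z * c * (exp (- ?a) + exp ?a)"
      unfolding heat_def c_def e1 e2 exp_add by (simp add: algebra_simps)
    moreover have "exp (- ?a) + exp ?a \<ge> 2"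
      using exp_ge_add_one_self[of ?a] exp_ge_add_one_self[of "- ?a"] by linarith
    moreover have "heat t z * c \<ge> 0" by (simp add: heat_nonneg c_def)
    ultimately show ?thesis
      using mult_left_mono[of 2 "exp (- ?a) + exp ?a" "heat t z * c"] by (simp add: mult_ac)
  qed
  have "\<bar>?d y\<bar> \<le> ?b y" for y
    using key[of "x - y"] mult_right_mono[OF c1 heat_nonneg[of t "x - y"]]
    by (auto simp: algebra_simps abs_le_iff)
  then have "(\<integral>y. \<bar>?d y\<bar> \<partial>lborel) \<le> (\<integral>y. ?b y \<partial>lborel)"
    by (intro integral_mono integrable_abs Bochner_Integration.integrable_add Bochner_Integration.integrable_diff integrable_mult_right I)
  also have "\<dots> = 4 * (1 - c)"
    by (simp add: I integral_heat_shift[OF t])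
  finally show "(\<integral>y. \<bar>?d y\<bar> \<partial>lborel) \<le> 4 * (1 - exp (- (norm v)\<^sup>2 / (4 * t)))" by (simp add: c_def)
  show ?I by (intro Bochner_Integration.integrable_add Bochner_Integration.integrable_diff integrable_mult_right I)
qed

section \<open>Integration by parts for compactly supported functions\<close>

lemma has_vector_derivative_support:
  fixes F :: "'a::real_normed_vector \<Rightarrow> 'b::real_normed_vector"
  assumes "((\<lambda>t. F (x + t *\<^sub>R v)) has_vector_derivative F') (at 0)"
    and "\<And>x. norm x > R \<Longrightarrow> F x = 0" "norm x > R"
  shows "F' = 0"
proof -
  have "((\<lambda>t. F (x + t *\<^sub>R v)) has_vector_derivative 0) (at 0)"
  proof (rule has_vector_derivative_transform_within_open[where f="\<lambda>_. 0" and S="{t. norm (x + t *\<^sub>R v) > R}"])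
    show "open {t. norm (x + t *\<^sub>R v) > R}"
      by (intro open_Collect_less continuous_intros)
  qed (use assms in auto)
  then show ?thesis using assms(1) vector_derivative_unique_at by blast
qed

text \<open>Difference quotients of \<open>F\<close> along \<open>v\<close> have integral 0 by
  translation invariance. They are dominated by a multiple of the indicator of a ball, because a
  bounded directional derivative makes \<open>F\<close> Lipschitz along lines, so the limit of the
  integrals is the integral of \<open>F'\<close>.\<close>

lemma integral_directional_derivative_zero:
  fixes F F' :: "'a::euclidean_space \<Rightarrow> complex"
  assumes der: "\<And>x. ((\<lambda>t. F (x + t *\<^sub>R v)) has_vector_derivative F' x) (at 0)"
    and cF: "continuous_on UNIV F" and cF': "continuous_on UNIV F'"
    and supp: "\<And>x. norm x > R \<Longrightarrow> F x = 0"
  shows "(\<integral>x. F' x \<partial>lborel) = 0"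
proof -
  have supp': "F' x = 0" if "norm x > R" for x
    using has_vector_derivative_support[OF der supp that] .
  obtain B where B: "\<And>x. norm (F' x) \<le> B"
  proof -
    have "compact (F' ` cball 0 R)"
      by (intro compact_continuous_image continuous_on_subset[OF cF']) auto
    then obtain B where B: "\<And>x. x \<in> cball 0 R \<Longrightarrow> norm (F' x) \<le> B"
      using compact_imp_bounded bounded_iff by (metis imageI)
    have "norm (F' x) \<le> max B 0" for x
    proof (cases "norm x \<le> R")
      case True then show ?thesis using B[of x] by auto
    qed (simp add: supp')
    then show ?thesis using that by blast
  qed
  have lip: "norm (F (x + s *\<^sub>R v) - F x) \<le> B * \<bar>s\<bar>" for x s
  proof -
    have "((\<lambda>t. F (x + t *\<^sub>R v)) has_vector_derivative F' (x + t *\<^sub>R v)) (at t)" for t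
    proof -
      have "((\<lambda>u. F (x + t *\<^sub>R v + u *\<^sub>R v)) \<circ> (\<lambda>u. u - t) has_vector_derivative (1 *\<^sub>R F' (x + t *\<^sub>R v))) (at t)"
        by (rule vector_diff_chain_at) (auto intro!: derivative_eq_intros der)
      then show ?thesis by (simp add: o_def scaleR_diff_left)
    qed
    then have d: "((\<lambda>t. F (x + t *\<^sub>R v)) has_derivative (\<lambda>h. h *\<^sub>R F' (x + t *\<^sub>R v))) (at t within UNIV)" for t
      by (simp add: has_vector_derivative_def)
    have o: "onorm (\<lambda>h. h *\<^sub>R F' y) \<le> B" for y
    proof (rule onorm_bound)
      show "0 \<le> B" by (rule order_trans[OF norm_ge_zero B[of y]])
      show "norm (h *\<^sub>R F' y) \<le> B * norm h" for h
        using mult_left_mono[OF B[of y] abs_ge_zero[of h]] by (simp add: mult.commute)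
    qed
    have "norm (F (x + s *\<^sub>R v) - F (x + 0 *\<^sub>R v)) \<le> B * norm (s - 0)"
      by (rule differentiable_bound[OF convex_UNIV d o]) simp_all
    then show ?thesis by simp
  qed
  define D where "D n x = of_real (real (Suc n)) * (F (x + (1 / real (Suc n)) *\<^sub>R v) - F x)" for n x
  have [measurable]: "F \<in> borel_measurable borel" "F' \<in> borel_measurable borel"
    using cF cF' by (auto intro: borel_measurable_continuous_onI)
  have Fi: "integrable lborel F"
  proof -
    have "integrable lborel (\<lambda>x. indicator (cball 0 R) x *\<^sub>R F x)"
      by (intro borel_integrable_compact continuous_on_subset[OF cF]) auto
    also have "(\<lambda>x. indicator (cball 0 R) x *\<^sub>R F x) = F"
      using supp by (force simp: indicator_def)
    finally show ?thesis .
  qed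
  have D0: "(\<integral>x. D n x \<partial>lborel) = 0" for n
    unfolding D_def
    by (simp add: integrable_lborel_shift[OF Fi] Fi integral_lborel_shift)
  have "(\<lambda>n. \<integral>x. D n x \<partial>lborel) \<longlonglongrightarrow> (\<integral>x. F' x \<partial>lborel)"
  proof (rule integral_dominated_convergence)
    show "integrable lborel (\<lambda>x. indicator (cball 0 (\<bar>R\<bar> + norm v)) x *\<^sub>R B)"
      by (intro borel_integrable_compact) auto
    show "AE x in lborel. norm (D n x) \<le> indicator (cball 0 (\<bar>R\<bar> + norm v)) x *\<^sub>R B" for n
    proof (intro AE_I2)
      fix x
      show "norm (D n x) \<le> indicator (cball 0 (\<bar>R\<bar> + norm v)) x *\<^sub>R B"
      proof (cases "norm x \<le> \<bar>R\<bar> + norm v")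
        case True
        have "norm (D n x) = real (Suc n) * norm (F (x + (1 / real (Suc n)) *\<^sub>R v) - F x)"
          by (simp add: D_def norm_mult del: of_nat_Suc)
        also have "\<dots> \<le> real (Suc n) * (B * \<bar>1 / real (Suc n)\<bar>)"
          by (intro mult_left_mono lip) auto
        also have "\<dots> = B" by simp
        finally show ?thesis using True by simp
      next
        case False
        have n1: "norm ((1 / real (Suc n)) *\<^sub>R v) \<le> norm v"
          using mult_left_le_one_le[of "norm v" "1 / real (Suc n)"] by simp
        have "norm (x + (1 / real (Suc n)) *\<^sub>R v) > R"
          using False n1 norm_triangle_ineq2[of x "- ((1 / real (Suc n)) *\<^sub>R v)"] by simp
        moreover have "norm x > R" using False by (smt (verit) norm_ge_zero)
        ultimately have "D n x = 0" by (simp add: D_def supp)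
        then show ?thesis using False by simp
      qed
    qed
    show "AE x in lborel. (\<lambda>n. D n x) \<longlonglongrightarrow> F' x"
    proof (intro AE_I2)
      fix x
      have "((\<lambda>h. norm (F (x + h *\<^sub>R v) - F x - h *\<^sub>R F' x) / norm h) \<longlongrightarrow> 0) (at 0)"
        using der[of x] by (simp add: has_vector_derivative_def has_derivative_at)
      moreover have "\<forall>\<^sub>F h in at 0. norm (F (x + h *\<^sub>R v) - F x - h *\<^sub>R F' x) / norm h = norm ((F (x + h *\<^sub>R v) - F x) /\<^sub>R h - F' x)"
      proof (unfold eventually_at_filter, rule always_eventually, intro allI impI)
        fix h :: real assume h: "h \<noteq> 0"
        have "(F (x + h *\<^sub>R v) - F x) /\<^sub>R h - F' x = (F (x + h *\<^sub>R v) - F x - h *\<^sub>R F' x) /\<^sub>R h"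
          using h by (simp add: scaleR_diff_right)
        then show "norm (F (x + h *\<^sub>R v) - F x - h *\<^sub>R F' x) / norm h = norm ((F (x + h *\<^sub>R v) - F x) /\<^sub>R h - F' x)"
          by (simp only: norm_scaleR norm_inverse) (simp add: divide_inverse mult.commute)
      qed
      ultimately have "((\<lambda>y. norm ((F (x + y *\<^sub>R v) - F x) /\<^sub>R y - F' x)) \<longlongrightarrow> 0) (at 0)"
        by (rule Lim_transform_eventually)
      then have "((\<lambda>y. (F (x + y *\<^sub>R v) - F x) /\<^sub>R y) \<longlongrightarrow> F' x) (at 0)"
        by (simp only: tendsto_norm_zero_iff Lim_null[symmetric])
      moreover have "filterlim (\<lambda>n. 1 / real (Suc n)) (at 0) sequentially"
        using LIMSEQ_inverse_real_of_nat by (auto simp: filterlim_at divide_inverse)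
      ultimately have "(\<lambda>n. (F (x + (1 / real (Suc n)) *\<^sub>R v) - F x) /\<^sub>R (1 / real (Suc n))) \<longlonglongrightarrow> F' x"
        by (rule filterlim_compose)
      then show "(\<lambda>n. D n x) \<longlonglongrightarrow> F' x"
        by (simp add: D_def scaleR_conv_of_real)
    qed
  qed (auto simp: D_def)
  then show ?thesis unfolding D0 using LIMSEQ_unique tendsto_const by blast
qed

text \<open>The directional derivative of \<open>A * w1 - A1 * w\<close> is
  \<open>A * w2 - A2 * w\<close>, since the mixed terms cancel. One application of the preceding
  lemma therefore moves two derivatives at once.\<close>

lemma integral_by_parts2:
  fixes A A1 A2 w w1 w2 :: "'a::euclidean_space \<Rightarrow> complex"
  assumes A: "\<And>x. ((\<lambda>t. A (x + t *\<^sub>R v)) has_vector_derivative A1 x) (at 0)"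
     "\<And>x. ((\<lambda>t. A1 (x + t *\<^sub>R v)) has_vector_derivative A2 x) (at 0)"
    and w: "\<And>x. ((\<lambda>t. w (x + t *\<^sub>R v)) has_vector_derivative w1 x) (at 0)"
     "\<And>x. ((\<lambda>t. w1 (x + t *\<^sub>R v)) has_vector_derivative w2 x) (at 0)"
    and cA: "continuous_on UNIV A" "continuous_on UNIV A1" "continuous_on UNIV A2"
    and cw: "continuous_on UNIV w" "continuous_on UNIV w1" "continuous_on UNIV w2"
    and supp: "\<And>x. norm x > R \<Longrightarrow> w x = 0"
  shows "(\<integral>x. A x * w2 x \<partial>lborel) = (\<integral>x. A2 x * w x \<partial>lborel)"
proof -
  have s1: "\<And>x. norm x > R \<Longrightarrow> w1 x = 0"
    using has_vector_derivative_support[OF w(1) supp] .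
  have s2: "\<And>x. norm x > R \<Longrightarrow> w2 x = 0"
    using has_vector_derivative_support[OF w(2) s1] .
  have I: "integrable lborel (\<lambda>x. G x * u x)" if "continuous_on UNIV G" "continuous_on UNIV u" "\<And>x. norm x > R \<Longrightarrow> u x = 0"
    for G u :: "'a \<Rightarrow> complex"
  proof -
    have "integrable lborel (\<lambda>x. indicator (cball 0 R) x *\<^sub>R (G x * u x))"
      by (intro borel_integrable_compact continuous_intros continuous_on_subset[OF that(1)] continuous_on_subset[OF that(2)]) auto
    also have "(\<lambda>x. indicator (cball 0 R) x *\<^sub>R (G x * u x)) = (\<lambda>x. G x * u x)"
      using that(3) by (force simp: indicator_def)
    finally show ?thesis .
  qed
  have "(\<integral>x. (A x * w2 x - A2 x * w x) \<partial>lborel) = 0"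
  proof (rule integral_directional_derivative_zero[where F="\<lambda>x. A x * w1 x - A1 x * w x" and v=v and R=R])
    fix x
    show "((\<lambda>t. A (x + t *\<^sub>R v) * w1 (x + t *\<^sub>R v) - A1 (x + t *\<^sub>R v) * w (x + t *\<^sub>R v)) has_vector_derivative
          A x * w2 x - A2 x * w x) (at 0)"
      using has_vector_derivative_diff[OF has_vector_derivative_mult[OF A(1)[of x] w(2)[of x]] has_vector_derivative_mult[OF A(2)[of x] w(1)[of x]]]
      by (simp add: algebra_simps)
  qed (use supp s1 in \<open>auto intro!: continuous_intros cA cw\<close>)
  then show ?thesis
    by (simp add: I cA cw supp s2)
qed

text \<open>A bound on the integrand alone is enough: Cauchy's inequality on discs of radius
  \<open>r / 4\<close> turns it into the bound \<open>4 * B y / r\<close> for the derivative, hence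
  for the difference quotients, and dominated convergence gives complex differentiability of the
  integral.\<close>

lemma holomorphic_on_integral:
  fixes F :: "complex \<Rightarrow> 'b \<Rightarrow> complex"
  assumes S: "open S" and hol: "\<And>y. (\<lambda>z. F z y) holomorphic_on S"
    and meas: "\<And>z. z \<in> S \<Longrightarrow> F z \<in> borel_measurable M"
    and bound: "\<And>z y. z \<in> S \<Longrightarrow> norm (F z y) \<le> B y"
    and B: "integrable M B"
  shows "(\<lambda>z. \<integral>y. F z y \<partial>M) holomorphic_on S"
  unfolding holomorphic_on_open[OF S]
proof
  fix z0 assume z0: "z0 \<in> S"
  obtain r where r: "r > 0" "ball z0 r \<subseteq> S" using S z0 open_contains_ball by blast
  define D where "D y = deriv (\<lambda>z. F z y) z0" for y
  have Fi: "integrable M (F z)" if "z \<in> S" for z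
    by (rule Bochner_Integration.integrable_bound[OF B meas[OF that]])
      (auto intro!: order_trans[OF bound[OF that]])
  have lip: "norm (F z y - F z0 y) \<le> (4 * B y / r) * norm (z - z0)" if z: "z \<in> ball z0 (r/2)" for z y
  proof (rule field_differentiable_bound[where S="ball z0 (r/2)" and f'="deriv (\<lambda>z. F z y)"])
    fix w assume w: "w \<in> ball z0 (r/2)"
    have sub: "cball w (r/4) \<subseteq> S" "ball w (r/4) \<subseteq> S"
      using r w by (auto simp: subset_iff dist_norm intro!: subsetD[OF r(2)]) (smt (verit) norm_triangle_ineq4 diff_diff_eq2 diff_add_cancel norm_minus_commute dist_norm dist_triangle)+
    show "((\<lambda>z. F z y) has_field_derivative deriv (\<lambda>z. F z y) w) (at w within ball z0 (r/2))"
      using hol[of y] sub(1) S r by (intro DERIV_subset[OF holomorphic_derivI[where T=UNIV]]) (auto)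
    have "norm ((deriv ^^ 1) (\<lambda>z. F z y) w) \<le> fact 1 * B y / (r/4) ^ 1"
    proof (rule Cauchy_inequality)
      show "(\<lambda>z. F z y) holomorphic_on ball w (r/4)" using hol holomorphic_on_subset sub by blast
      show "continuous_on (cball w (r/4)) (\<lambda>z. F z y)"
        using hol holomorphic_on_imp_continuous_on holomorphic_on_subset sub by blast
      show "norm (F x y) \<le> B y" if "norm (w - x) = r/4" for x
        using that sub(1) by (intro bound) (auto simp: dist_norm subset_iff)
    qed (use r in auto)
    then show "norm (deriv (\<lambda>z. F z y) w) \<le> 4 * B y / r" by (simp add: field_simps)
  qed (use z r in auto)
  have lim: "((\<lambda>z. (F z y - F z0 y) / (z - z0)) \<longlongrightarrow> D y) (at z0)" for y
    using holomorphic_derivI[OF hol S z0, of y] unfolding D_def has_field_derivative_iff .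
  have "((\<lambda>z. ((\<integral>y. F z y \<partial>M) - (\<integral>y. F z0 y \<partial>M)) / (z - z0)) \<longlongrightarrow> (\<integral>y. D y \<partial>M)) (at z0)"
    unfolding tendsto_at_iff_sequentially comp_def
  proof (intro allI impI)
    fix X assume X: "\<forall>i. X i \<in> UNIV - {z0}" "X \<longlonglongrightarrow> z0"
    have "\<forall>\<^sub>F n in sequentially. X n \<in> ball z0 (r/2)"
      using X(2) r by (intro topological_tendstoD) auto
    then obtain N where N: "\<And>n. n \<ge> N \<Longrightarrow> X n \<in> ball z0 (r/2)"
      unfolding eventually_sequentially by blast
    have inS: "X (n + N) \<in> S" for n using N[of "n + N"] r by (auto simp: subset_iff)
    have XN: "filterlim (\<lambda>n. X (n + N)) (at z0) sequentially"
      using X LIMSEQ_ignore_initial_segment[OF X(2), of N] by (auto simp: filterlim_at)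
    let ?q = "\<lambda>n y. (F (X (n + N)) y - F z0 y) / (X (n + N) - z0)"
    have qm: "?q n \<in> borel_measurable M" for n
      using meas[OF inS] meas[OF z0] by measurable
    have ql: "(\<lambda>n. ?q n y) \<longlonglongrightarrow> D y" for y
      by (rule filterlim_compose[OF lim XN])
    have "(\<lambda>n. \<integral>y. ?q n y \<partial>M) \<longlonglongrightarrow> (\<integral>y. D y \<partial>M)"
    proof (rule integral_dominated_convergence[where w="\<lambda>y. 4 * B y / r"])
      show "D \<in> borel_measurable M" by (rule borel_measurable_LIMSEQ_metric[OF qm ql])
      show "integrable M (\<lambda>y. 4 * B y / r)" using B by simp
      show "AE y in M. norm (?q n y) \<le> 4 * B y / r" for n
      proof (intro AE_I2)
        fix y
        have ne: "X (n + N) \<noteq> z0" using X(1) by auto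
        show "norm (?q n y) \<le> 4 * B y / r"
          using lip[OF N[of "n + N"], of y] ne by (simp add: norm_divide divide_le_eq)
      qed
    qed (use qm ql in auto)
    also have "(\<lambda>n. \<integral>y. ?q n y \<partial>M) = (\<lambda>n. ((\<integral>y. F (X (n+N)) y \<partial>M) - (\<integral>y. F z0 y \<partial>M)) / (X (n+N) - z0))"
      by (intro ext) (simp only: integral_divide_zero Bochner_Integration.integral_diff[OF Fi[OF inS] Fi[OF z0]])
    finally show "(\<lambda>n. ((\<integral>y. F (X n) y \<partial>M) - (\<integral>y. F z0 y \<partial>M)) / (X n - z0)) \<longlonglongrightarrow> (\<integral>y. D y \<partial>M)"
      by (rule LIMSEQ_offset)
  qed
  then show "\<exists>f'. ((\<lambda>z. \<integral>y. F z y \<partial>M) has_field_derivative f') (at z0)"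
    unfolding has_field_derivative_iff by blast
qed

text \<open>No determinant is computed. The integral of \<open>g\<close> is multiplied by the mass 1
  of the rotation-invariant Gaussian \<open>q\<close>, taken in the variable \<open>A y + x\<close>;
  exchanging the integrals and translating by \<open>A y\<close> leaves \<open>g\<close> rotated and
  \<open>q\<close> bare, so the mass 1 can be removed again.\<close>

lemma nn_integral_orthogonal_transformation:
  fixes A :: "'a::euclidean_space \<Rightarrow> 'a"
  assumes A: "orthogonal_transformation A" and g: "g \<in> borel_measurable borel"
  shows "(\<integral>\<^sup>+x. g (A x) \<partial>lborel) = (\<integral>\<^sup>+x. g x \<partial>lborel)"
proof -
  have lin: "linear A" using A orthogonal_transformation_linear by blast
  have [measurable]: "A \<in> borel_measurable borel"
    by (intro borel_measurable_continuous_onI linear_continuous_on) (use lin linear_conv_bounded_linear in blast)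
  have [measurable]: "g \<in> borel_measurable borel" by (fact g)
  define q where "q x = ennreal (heat 1 x)" for x :: 'a
  have [measurable]: "q \<in> borel_measurable borel" unfolding q_def by measurable
  have qA: "q (A x) = q x" for x
    using orthogonal_transformation_norm[OF A, of x] by (simp add: q_def heat_def)
  have q1: "(\<integral>\<^sup>+x. q x \<partial>lborel) = 1"
    unfolding q_def by (subst nn_integral_eq_integral) (auto simp: heat_nonneg integrable_heat integral_heat)
  \<comment> \<open>By linearity and surjectivity a translation after \<open>A\<close> is a
    translation before it, so translation invariance applies under the rotation.\<close>
  have shift: "(\<integral>\<^sup>+y. j (A y + x) \<partial>lborel) = (\<integral>\<^sup>+y. j (A y) \<partial>lborel)" if [measurable]: "j \<in> borel_measurable borel" for j :: "'a \<Rightarrow> ennreal" and x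
  proof -
    obtain x' where x': "x = A x'" using orthogonal_transformation_surj[OF A] by (metis surjD)
    have "(\<integral>\<^sup>+y. j (A y + x) \<partial>lborel) = (\<integral>\<^sup>+y. (\<lambda>y. j (A y)) (y + x') \<partial>lborel)"
      by (simp add: x' linear_add[OF lin])
    also have "\<dots> = (\<integral>\<^sup>+y. j (A y) \<partial>lborel)" by (rule nn_integral_lborel_shift) measurable
    finally show ?thesis .
  qed
  have Am: "A (- y) = - A y" for y using linear_neg[OF lin] by simp
  have "(\<integral>\<^sup>+x. g x \<partial>lborel) = (\<integral>\<^sup>+x. g x * (\<integral>\<^sup>+y. q (A y) \<partial>lborel) \<partial>lborel)"
    by (simp add: qA q1)
  also have "\<dots> = (\<integral>\<^sup>+x. g x * (\<integral>\<^sup>+y. q (A y + x) \<partial>lborel) \<partial>lborel)"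
    by (simp add: shift)
  also have "\<dots> = (\<integral>\<^sup>+x. (\<integral>\<^sup>+y. g x * q (A y + x) \<partial>lborel) \<partial>lborel)"
    by (subst nn_integral_cmult) auto
  also have "\<dots> = (\<integral>\<^sup>+y. (\<integral>\<^sup>+x. g x * q (A y + x) \<partial>lborel) \<partial>lborel)"
    by (rule lborel_pair.Fubini') measurable
  also have "\<dots> = (\<integral>\<^sup>+y. (\<integral>\<^sup>+x. g (x + - A y) * q (A y + (x + - A y)) \<partial>lborel) \<partial>lborel)"
    by (intro nn_integral_cong nn_integral_lborel_shift[symmetric]) measurable
  also have "\<dots> = (\<integral>\<^sup>+x. (\<integral>\<^sup>+y. g (A (- y) + x) * q x \<partial>lborel) \<partial>lborel)"
    by (subst lborel_pair.Fubini') (auto simp: Am algebra_simps)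
  also have "\<dots> = (\<integral>\<^sup>+x. (\<integral>\<^sup>+y. g (A (- y) + x) \<partial>lborel) * q x \<partial>lborel)"
    by (subst nn_integral_multc) auto
  also have "\<dots> = (\<integral>\<^sup>+x. (\<integral>\<^sup>+y. g (A y) \<partial>lborel) * q x \<partial>lborel)"
  proof -
    have "(\<integral>\<^sup>+y. g (A (- y) + x) \<partial>lborel) = (\<integral>\<^sup>+y. g (A y + x) \<partial>lborel)" for x
    proof -
      have "(\<integral>\<^sup>+y. g (A y + x) \<partial>lborel) = (\<integral>\<^sup>+y. g (A y + x) \<partial>distr lborel borel uminus)"
        by (simp add: lborel_distr_uminus_euclidean)
      then show ?thesis by (subst (asm) nn_integral_distr) auto
    qed
    then show ?thesis by (simp add: shift)
  qed
  also have "\<dots> = (\<integral>\<^sup>+y. g (A y) \<partial>lborel)"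
    by (subst nn_integral_cmult) (auto simp: q1)
  finally show ?thesis ..
qed

lemma lborel_distr_orthogonal:
  fixes A :: "'a::euclidean_space \<Rightarrow> 'a"
  assumes A: "orthogonal_transformation A"
  shows "distr lborel borel A = lborel"
proof (rule measure_eqI)
  have lin: "linear A" using A orthogonal_transformation_linear by blast
  have [measurable]: "A \<in> borel_measurable borel"
    by (intro borel_measurable_continuous_onI linear_continuous_on) (use lin linear_conv_bounded_linear in blast)
  fix X assume "X \<in> sets (distr lborel borel A)"
  then have [measurable]: "X \<in> sets borel" by simp
  have "emeasure (distr lborel borel A) X = (\<integral>\<^sup>+x. indicator X x \<partial>distr lborel borel A)"
    by simp
  also have "\<dots> = (\<integral>\<^sup>+x. indicator X (A x) \<partial>lborel)" by (subst nn_integral_distr) auto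
  also have "\<dots> = (\<integral>\<^sup>+x. indicator X x \<partial>lborel)"
    by (rule nn_integral_orthogonal_transformation[OF A]) measurable
  finally show "emeasure (distr lborel borel A) X = emeasure lborel X" by simp
qed simp

lemma borel_measurable_fst_snd [measurable (raw)]:
  fixes f :: "'c \<Rightarrow> 'a::second_countable_topology \<times> 'b::second_countable_topology"
  assumes "f \<in> borel_measurable M"
  shows "(\<lambda>x. fst (f x)) \<in> borel_measurable M" "(\<lambda>x. snd (f x)) \<in> borel_measurable M"
  using assms measurable_compose[OF assms, of fst borel] measurable_compose[OF assms, of snd borel]
  by (simp_all add: borel_measurable_continuous_onI continuous_on_fst continuous_on_snd continuous_on_id)

text \<open>One term \<open>(r / t) ^ j / fact j\<close> of the exponential series beats any power
  of \<open>1 / t\<close>. This is what removes every singularity of the heat kernel at time 0 away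
  from the origin.\<close>

lemma powr_exp_inverse_bounded:
  fixes p r :: real
  assumes r: "r > 0"
  shows "\<exists>C\<ge>0. \<forall>t. 0 < t \<longrightarrow> t \<le> 1 \<longrightarrow> t powr p * exp (- (r / t)) \<le> C"
proof -
  define j where "j = nat \<lceil>- p\<rceil>"
  have jp: "- real j \<le> p" unfolding j_def by linarith
  show ?thesis
  proof (intro exI[of _ "fact j / r ^ j"] conjI allI impI)
    fix t :: real assume t: "0 < t" "t \<le> 1"
    have "t powr p \<le> t powr (- real j)" using t jp by (intro powr_mono') auto
    also have "\<dots> = 1 / t ^ j" using t by (simp add: powr_minus_divide powr_realpow)
    finally have 1: "t powr p \<le> 1 / t ^ j" .
    have "(r / t) ^ j / fact j \<le> exp (r / t)"
    proof -
      have "(r / t) ^ j / fact j = (\<Sum>n\<in>{j}. (r / t) ^ n /\<^sub>R fact n)" by (simp add: divide_inverse mult.commute)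
      also have "\<dots> \<le> (\<Sum>n. (r / t) ^ n /\<^sub>R fact n)"
        using r t by (intro sum_le_suminf summable_exp_generic) auto
      finally show ?thesis by (simp add: exp_def)
    qed
    then have "exp (- (r / t)) \<le> fact j * t ^ j / r ^ j"
      using r t by (simp add: exp_minus inverse_eq_divide divide_le_eq le_divide_eq power_divide field_simps)
    then have "t powr p * exp (- (r / t)) \<le> 1 / t ^ j * (fact j * t ^ j / r ^ j)"
      using 1 t by (intro mult_mono) auto
    then show "t powr p * exp (- (r / t)) \<le> fact j / r ^ j" using t by simp
  qed (use r in auto)
qed

text \<open>Completing the square:
  \<open>c * a - a\<^sup>2 \<le> c\<^sup>2 / 2 - a\<^sup>2 / 2\<close>. It is needed because the
  transformed solution grows exponentially in the frequency and is paired with a Gaussian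
  weight.\<close>

lemma integrable_exp_norm_gauss:
  "integrable lborel (\<lambda>x::'a::euclidean_space. exp (c * norm x - (norm x)\<^sup>2))"
proof (rule Bochner_Integration.integrable_bound)
  have "integrable lborel (\<lambda>x::'a. norm (cis (x \<bullet> 0) * complex_of_real (exp (- (1/2) * (norm x)\<^sup>2))))"
    by (intro integrable_norm fourier_gauss) auto
  then show "integrable lborel (\<lambda>x::'a. exp (c\<^sup>2 / 2) * exp (- (1/2) * (norm x)\<^sup>2))"
    by (intro integrable_mult_right) simp
  have "c * norm x - (norm x)\<^sup>2 \<le> c\<^sup>2 / 2 + - (1/2) * (norm x)\<^sup>2" for x :: 'a
    using zero_le_power2[of "c - norm x"] by (simp add: power2_diff field_simps)
  then show "AE x in lborel. norm (exp (c * norm x - (norm x)\<^sup>2)) \<le> norm (exp (c\<^sup>2 / 2) * exp (- (1/2) * (norm (x::'a))\<^sup>2))"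
    by (simp add: exp_add[symmetric])
qed measurable

lemma integrable_bounded_support:
  fixes g :: "'a::euclidean_space \<Rightarrow> 'b::{banach, second_countable_topology}"
  assumes "g \<in> borel_measurable borel" "\<And>x. norm (g x) \<le> B" "\<And>x. norm x > r \<Longrightarrow> g x = 0"
  shows "integrable lborel g"
proof (rule Bochner_Integration.integrable_bound)
  show "integrable lborel (\<lambda>x::'a. indicator (cball 0 r) x *\<^sub>R B)"
    by (intro borel_integrable_compact) auto
  show "AE x in lborel. norm (g x) \<le> norm (indicator (cball 0 r) x *\<^sub>R B)"
    using assms(2,3) order_trans[OF assms(2) abs_ge_self] by (intro AE_I2) (auto simp: indicator_def)
qed (use assms in auto)

section \<open>Derivatives and small-time bounds of the one-dimensional heat kernel\<close>

definition heat1 :: "real \<Rightarrow> real \<Rightarrow> real" where "heat1 t s = - (s / (2 * t)) * heat t s"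
definition heat2 :: "real \<Rightarrow> real \<Rightarrow> real" where "heat2 t s = (s\<^sup>2 / (4 * t\<^sup>2) - 1 / (2 * t)) * heat t s"

lemma heat1_measurable [measurable (raw)]:
  assumes [measurable]: "f \<in> borel_measurable M" "g \<in> borel_measurable M"
  shows "(\<lambda>x. heat1 (f x) (g x)) \<in> borel_measurable M" "(\<lambda>x. heat2 (f x) (g x)) \<in> borel_measurable M"
  unfolding heat1_def heat2_def by measurable

lemma DERIV_heat:
  assumes "t > 0"
  shows "(heat t has_field_derivative heat1 t s) (at s within S)"
    and "(heat1 t has_field_derivative heat2 t s) (at s within S)"
    and "((\<lambda>t. heat t s) has_field_derivative heat2 t s) (at t within S)"
proof -
  show 1: "(heat t has_field_derivative heat1 t s) (at s within S)" for S
    unfolding heat_def[abs_def] heat1_def using assms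
    by (auto intro!: derivative_eq_intros simp: heat_def power2_eq_square field_simps)
  show "(heat1 t has_field_derivative heat2 t s) (at s within S)"
    unfolding heat1_def[abs_def] heat2_def using assms
    by (auto intro!: derivative_eq_intros 1 simp: heat1_def power2_eq_square field_simps)
  \<comment> \<open>Differentiating the power in \<open>t\<close> lowers the exponent by one; this
    identity returns from the exponent \<open>-3/2\<close> to \<open>-1/2\<close>.\<close>
  have p: "(pi * (t * 4)) powr - (1 / 2) = pi * (t * (4 * (pi * (t * 4)) powr - (3 / 2)))"
    using assms powr_add[of "pi * (t * 4)" "- (3/2)" "1"] by (simp add: mult_ac)
  show "((\<lambda>t. heat t s) has_field_derivative heat2 t s) (at t within S)"
    unfolding heat_def[abs_def] heat2_def using assms
    by (auto intro!: derivative_eq_intros simp: heat_def power2_eq_square field_simps p)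
qed

text \<open>For \<open>\<bar>s\<bar> \<ge> 1\<close> the kernel is in fact of order
  \<open>t\<^sup>2\<close>, by the bound with exponent \<open>-5/2\<close>: the power
  \<open>t powr (-1/2)\<close> is \<open>t\<^sup>2\<close> times that. The two extra powers pay for
  the factor \<open>1 / t\<^sup>2\<close> in \<open>heat2\<close>.\<close>

lemma heat_time_zero:
  "\<exists>C\<ge>0. \<forall>t s. 0 < t \<longrightarrow> t \<le> 1 \<longrightarrow> 1 \<le> \<bar>s\<bar> \<longrightarrow> heat t (s::real) \<le> C * t \<and> \<bar>heat2 t s\<bar> \<le> C * (s\<^sup>2 + 1)"
proof -
  have "\<exists>C\<ge>0. \<forall>t. 0 < t \<longrightarrow> t \<le> 1 \<longrightarrow> (t::real) powr (-5/2) * exp (- ((1/4) / t)) \<le> C"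
    by (rule powr_exp_inverse_bounded) simp
  then obtain C where C: "C \<ge> 0" "\<forall>t. 0 < t \<longrightarrow> t \<le> 1 \<longrightarrow> (t::real) powr (-5/2) * exp (- ((1/4) / t)) \<le> C"
    by (elim exE conjE)
  have h: "heat t s \<le> C * t\<^sup>2" if t: "0 < t" "t \<le> 1" and s: "1 \<le> \<bar>s\<bar>" for t s :: real
  proof -
    have "(4 * pi * t) powr (-1/2) \<le> t powr (-1/2)"
      using t pi_gt3 by (intro powr_mono2') auto
    also have "\<dots> = t\<^sup>2 * t powr (-5/2)"
      using t powr_add[of t 2 "-5/2"] by simp
    finally have 1: "(4 * pi * t) powr (-1/2) \<le> t\<^sup>2 * t powr (-5/2)" .
    have "1 \<le> s\<^sup>2" using s by (metis one_power2 power_mono power2_abs zero_le_one)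
    then have 2: "exp (- s\<^sup>2 / (4 * t)) \<le> exp (- ((1/4) / t))"
      using t by (simp add: divide_right_mono field_simps)
    have "heat t s \<le> t\<^sup>2 * t powr (-5/2) * exp (- ((1/4) / t))"
      unfolding heat_def using 1 2 by (intro mult_mono) auto
    also have "\<dots> \<le> t\<^sup>2 * C" using mult_left_mono[OF C(2)[rule_format, OF t], of "t\<^sup>2"] by (simp add: mult_ac)
    finally show ?thesis by (simp add: mult.commute)
  qed
  show ?thesis
  proof (intro exI[of _ C] conjI allI impI)
    show "C \<ge> 0" by (fact C(1))
    fix t s :: real assume t: "0 < t" "t \<le> 1" and s: "1 \<le> \<bar>s\<bar>"
    have "C * t\<^sup>2 \<le> C * t" using C(1) t by (intro mult_left_mono) (auto simp: power2_eq_square mult_left_le)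
    then show "heat t s \<le> C * t" using h[OF t s] by linarith
    have "\<bar>heat2 t s\<bar> = \<bar>s\<^sup>2 / (4 * t\<^sup>2) - 1 / (2 * t)\<bar> * heat t s"
      by (simp add: heat2_def abs_mult heat_nonneg)
    also have "\<dots> \<le> (s\<^sup>2 / (4 * t\<^sup>2) + 1 / (2 * t)) * (C * t\<^sup>2)"
      using t h[OF t s] by (intro mult_mono heat_nonneg) (auto simp: abs_le_iff)
    also have "\<dots> = C * (s\<^sup>2 / 4 + t / 2)" using t by (simp add: field_simps power2_eq_square)
    also have "\<dots> \<le> C * (s\<^sup>2 + 1)" using t C(1) zero_le_power2[of s] by (intro mult_left_mono) linarith+
    finally show "\<bar>heat2 t s\<bar> \<le> C * (s\<^sup>2 + 1)" .
  qed
qed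

text \<open>A square root of \<open>|\<eta>|\<^sup>2 - k\<^sup>2\<close>; only even functions of it are used, so the choice of the branch is immaterial.\<close>

definition lam :: "real \<Rightarrow> 'v::real_normed_vector \<Rightarrow> complex" where
  "lam k \<eta> = Complex (sqrt (max 0 ((norm \<eta>)\<^sup>2 - k\<^sup>2))) (sqrt (max 0 (k\<^sup>2 - (norm \<eta>)\<^sup>2)))"

lemma lam_eq: "lam k \<eta> = complex_of_real (sqrt (max 0 ((norm \<eta>)\<^sup>2 - k\<^sup>2))) + \<i> * complex_of_real (sqrt (max 0 (k\<^sup>2 - (norm \<eta>)\<^sup>2)))"
  by (simp add: lam_def complex_eq_iff)

lemma lam_sq: "(lam k \<eta>)\<^sup>2 = complex_of_real ((norm \<eta>)\<^sup>2 - k\<^sup>2)"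
proof (cases "(norm \<eta>)\<^sup>2 \<ge> k\<^sup>2")
  case True
  then show ?thesis unfolding lam_eq by (simp add: max_def flip: of_real_power)
next
  case False
  then have "lam k \<eta> = \<i> * complex_of_real (sqrt (k\<^sup>2 - (norm \<eta>)\<^sup>2))" unfolding lam_eq by (simp add: max_def)
  then have "(lam k \<eta>)\<^sup>2 = - complex_of_real ((sqrt (k\<^sup>2 - (norm \<eta>)\<^sup>2))\<^sup>2)"
    by (simp only: power_mult_distrib power2_i of_real_power) simp
  then show ?thesis using False by simp
qed

lemma norm_lam: assumes "k \<ge> 0" shows "norm (lam k \<eta>) \<le> norm \<eta> + k"
proof -
  have "(norm (lam k \<eta>))\<^sup>2 = \<bar>(norm \<eta>)\<^sup>2 - k\<^sup>2\<bar>"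
    unfolding norm_power[symmetric] lam_sq by (simp only: norm_of_real)
  also have "\<dots> \<le> (norm \<eta>)\<^sup>2 + k\<^sup>2" by (auto simp: abs_le_iff)
  also have "\<dots> \<le> (norm \<eta> + k)\<^sup>2" using assms by (simp add: power2_sum)
  finally show ?thesis by (rule power2_le_imp_le) (use assms in simp)
qed

lemma lam_measurable [measurable]: "lam k \<in> borel_measurable (borel :: 'v::euclidean_space measure)"
  unfolding lam_eq[abs_def] by measurable

lemma borel_measurable_sinh_complex [measurable (raw)]:
  fixes f :: "'a \<Rightarrow> complex"
  assumes [measurable]: "f \<in> borel_measurable M"
  shows "(\<lambda>x. sinh (f x)) \<in> borel_measurable M"
  unfolding sinh_def by measurable

text \<open>The mean value inequality on the disc of radius \<open>norm z\<close>, where the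
  derivative \<open>cosh\<close> is at most \<open>exp (norm z)\<close>.\<close>

lemma norm_sinh_le: "norm (sinh (z::complex)) \<le> norm z * exp (norm z)"
proof -
  have "norm (sinh z - sinh 0) \<le> exp (norm z) * norm (z - 0)"
  proof (rule field_differentiable_bound[where S="cball 0 (norm z)" and f'=cosh])
    fix w :: complex assume "w \<in> cball 0 (norm z)"
    then have w: "norm w \<le> norm z" by simp
    have "norm (cosh w) \<le> (norm (exp w) + norm (exp (- w))) / 2"
      unfolding cosh_def using norm_triangle_ineq[of "exp w" "exp (- w)"] by (simp only: norm_scaleR) simp
    also have "\<dots> \<le> (exp (norm z) + exp (norm z)) / 2"
      using w abs_Re_le_cmod[of w] by (intro divide_right_mono add_mono) (auto simp: norm_exp_eq_Re)
    finally show "norm (cosh w) \<le> exp (norm z)" by simp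
  qed (auto intro!: derivative_eq_intros)
  then show ?thesis by (simp add: mult.commute)
qed

text \<open>Uniform in \<open>l\<close>, including the removable singularity. At
  \<open>l = 0\<close> division gives 0 rather than the limit \<open>s\<close>, which satisfies the
  bound as well; the solution formula is only used for \<open>l \<noteq> 0\<close>.\<close>

lemma norm_sinh_div_le: "norm (sinh (l * complex_of_real s) / l) \<le> \<bar>s\<bar> * exp (norm l * \<bar>s\<bar>)"
proof (cases "l = 0")
  case False
  then show ?thesis
    using norm_sinh_le[of "l * complex_of_real s"]
    by (simp add: norm_divide norm_mult divide_le_eq mult_ac)
qed simp

section \<open>Sources with vanishing far field\<close>

text \<open>The source in coordinates where the curvature point is the origin, extended by 0 and
  known only through a bound \<open>N\<close> and a radius \<open>R\<close>. The last assumption is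
  the vanishing of the far field in every direction. Holder continuity and the geometry at the
  curvature point enter only in \<open>core_estimate\<close>, so everything built here depends on
  \<open>f\<close> through these data.\<close>

locale source =
  fixes k N R :: real and f :: "'v::euclidean_space \<times> real \<Rightarrow> complex"
  assumes k: "k > 0" and R: "R > 0"
    and f_meas [measurable]: "f \<in> borel_measurable borel"
    and f_bound: "norm (f x) \<le> N"
    and f_supp: "norm x > R \<Longrightarrow> f x = 0"
    and f_sphere: "norm \<omega> = 1 \<Longrightarrow> (\<integral>y. f y * cis (- k * (\<omega> \<bullet> y)) \<partial>lborel) = 0"
begin

lemma N: "N \<ge> 0" using f_bound[of 0] norm_ge_zero order_trans by blast

definition "vol = measure lborel (cball (0 :: 'v \<times> real) R)"

lemma f_integrable:
  assumes [measurable]: "g \<in> borel_measurable borel" and "\<And>y. norm y \<le> R \<Longrightarrow> norm (g y) \<le> B"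
  shows "integrable lborel (\<lambda>y. f y * (g y :: complex))"
proof (rule integrable_bounded_support)
  fix y
  show "norm (f y * g y) \<le> N * max B 0"
  proof (cases "norm y \<le> R")
    case True then show ?thesis unfolding norm_mult using assms(2)[OF True] f_bound[of y] N by (intro mult_mono) auto
  qed (use f_supp N in auto)
qed (use f_supp in auto)

lemma f_integral_bound:
  assumes [measurable]: "g \<in> borel_measurable borel" and "\<And>y. norm y \<le> R \<Longrightarrow> norm (g y) \<le> B" and "B \<ge> 0"
  shows "norm (\<integral>y. f y * (g y :: complex) \<partial>lborel) \<le> N * B * vol"
proof -
  have "norm (\<integral>y. f y * g y \<partial>lborel) \<le> (\<integral>y. indicator (cball (0 :: 'v \<times> real) R) y *\<^sub>R (N * B) \<partial>lborel)"
  proof (rule Bochner_Integration.integral_norm_bound_integral)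
    show "integrable lborel (\<lambda>y. f y * g y)" using assms by (intro f_integrable)
    show "integrable lborel (\<lambda>y :: 'v \<times> real. indicator (cball 0 R) y *\<^sub>R (N * B))"
      by (intro borel_integrable_compact) auto
    fix y show "norm (f y * g y) \<le> indicator (cball 0 R) y *\<^sub>R (N * B)"
    proof (cases "norm y \<le> R")
      case True then show ?thesis using assms(2)[OF True] f_bound[of y] N by (auto simp: norm_mult intro!: mult_mono)
    qed (use f_supp in auto)
  qed
  also have "\<dots> = N * B * vol"
    unfolding vol_def by simp
  finally show ?thesis .
qed

text \<open>The Fourier transform of \<open>f\<close> vanishes on the complexification of the sphere \<open>|\<xi>| = k\<close>.\<close>

lemma f_variety:
  fixes \<eta> :: 'v and c :: complex
  assumes c: "c\<^sup>2 = complex_of_real ((norm \<eta>)\<^sup>2 - k\<^sup>2)"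
  shows "(\<integral>y. f y * (cis (- (\<eta> \<bullet> fst y)) * exp (c * complex_of_real (snd y))) \<partial>lborel) = 0"
proof -
  obtain \<omega> :: 'v where om: "norm \<omega> = 1" "\<eta> = norm \<eta> *\<^sub>R \<omega>"
  proof (cases "\<eta> = 0")
    case True
    obtain b :: 'v where "b \<in> Basis" using nonempty_Basis by blast
    then show ?thesis using that[of b] True by simp
  next
    case False then show ?thesis using that[of "\<eta> /\<^sub>R norm \<eta>"] by simp
  qed
  \<comment> \<open>The circle with axis \<open>\<omega>\<close> on the sphere of radius
    \<open>k\<close>, with the angle \<theta> made complex. The integral against \<open>f\<close> is
    holomorphic in \<theta> and is known to vanish for real \<theta>.\<close>
  define E where "E \<theta> y = exp (- \<i> * complex_of_real k * (cos \<theta> * complex_of_real (\<omega> \<bullet> fst y) + sin \<theta> * complex_of_real (snd y)))"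
    for \<theta> :: complex and y :: "'v \<times> real"
  define g where "g \<theta> = (\<integral>y. f y * E \<theta> y \<partial>lborel)" for \<theta>
  have Em: "E \<theta> \<in> borel_measurable borel" for \<theta> unfolding E_def by measurable
  have g0: "g \<theta> = 0" for \<theta>
  proof -
    define r where "r = norm \<theta> + 1"
    have r: "r > 0" "\<theta> \<in> ball 0 r" by (auto simp: r_def add_nonneg_pos)
    have nt: "norm (cos z) \<le> exp r" "norm (sin z) \<le> exp r" if "z \<in> ball 0 r" for z :: complex
    proof -
      have e: "norm (exp (\<i> * z)) \<le> exp r" "norm (exp (- (\<i> * z))) \<le> exp r"
        using that abs_Im_le_cmod[of z] by (auto simp: norm_exp_eq_Re)
      show "norm (cos z) \<le> exp r"
        unfolding cos_exp_eq using order_trans[OF norm_triangle_ineq add_mono[OF e]] by (simp add: norm_divide)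
      show "norm (sin z) \<le> exp r"
        unfolding sin_exp_eq using order_trans[OF norm_triangle_ineq4 add_mono[OF e]] by (simp add: norm_divide norm_mult)
    qed
    have Eb: "norm (E z y) \<le> exp (k * (exp r * R + exp r * R))" if z: "z \<in> ball 0 r" and y: "norm y \<le> R" for z y
    proof -
      have n1: "\<bar>\<omega> \<bullet> fst y\<bar> \<le> R" using Cauchy_Schwarz_ineq2[of \<omega> "fst y"] om norm_fst_le[of "fst y" "snd y"] y by simp
      have n2: "\<bar>snd y\<bar> \<le> R" using norm_snd_le[of "snd y" "fst y"] y by simp
      let ?w = "- \<i> * complex_of_real k * (cos z * complex_of_real (\<omega> \<bullet> fst y) + sin z * complex_of_real (snd y))"
      have "Re ?w \<le> norm ?w" by (rule complex_Re_le_cmod)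
      also have "norm ?w = k * norm (cos z * complex_of_real (\<omega> \<bullet> fst y) + sin z * complex_of_real (snd y))"
        using k by (simp add: norm_mult)
      also have "\<dots> \<le> k * (norm (cos z) * \<bar>\<omega> \<bullet> fst y\<bar> + norm (sin z) * \<bar>snd y\<bar>)"
        using k norm_triangle_ineq[of "cos z * complex_of_real (\<omega> \<bullet> fst y)" "sin z * complex_of_real (snd y)"]
        by (intro mult_left_mono) (auto simp: norm_mult)
      also have "\<dots> \<le> k * (exp r * R + exp r * R)"
        using k nt[OF z] n1 n2 by (intro mult_left_mono add_mono mult_mono) auto
      finally show ?thesis unfolding E_def norm_exp_eq_Re by (simp only: exp_le_cancel_iff)
    qed
    have hol: "g holomorphic_on ball 0 r"
      unfolding g_def
    proof (rule holomorphic_on_integral[where B="\<lambda>y. norm (f y * (complex_of_real (exp (k * (exp r * R + exp r * R)))))"])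
      show "(\<lambda>z. f y * E z y) holomorphic_on ball 0 r" for y
        unfolding E_def by (intro holomorphic_intros)
      show "(\<lambda>y. f y * E z y) \<in> borel_measurable lborel" if "z \<in> ball 0 r" for z
        using Em[of z] by measurable
      show "norm (f y * E z y) \<le> norm (f y * (complex_of_real (exp (k * (exp r * R + exp r * R)))))" if "z \<in> ball 0 r" for z y
        using Eb[OF that, of y] f_supp[of y] by (cases "norm y \<le> R") (auto simp: norm_mult intro!: mult_left_mono)
      show "integrable lborel (\<lambda>y. norm (f y * (complex_of_real (exp (k * (exp r * R + exp r * R))))))"
        by (intro integrable_norm f_integrable[where B="exp (k * (exp r * R + exp r * R))"]) auto
    qed simp
    have real0: "g (complex_of_real u) = 0" for u
    proof -
      have n: "norm (cos u *\<^sub>R \<omega>, sin u) = 1" using om by (simp add: norm_prod_def power_mult_distrib)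
      have "E (complex_of_real u) y = cis (- k * ((cos u *\<^sub>R \<omega>, sin u) \<bullet> y))" for y
        unfolding E_def cis_conv_exp by (simp add: inner_prod_def cos_of_real sin_of_real algebra_simps)
      then show ?thesis using f_sphere[OF n] by (simp add: g_def)
    qed
    show ?thesis
    proof (rule analytic_continuation[OF hol, where U="complex_of_real ` {-r<..<r}" and \<xi>=0])
      show "0 islimpt complex_of_real ` {-r<..<r}"
        unfolding islimpt_approachable
      proof (intro allI impI)
        fix e :: real assume e: "e > 0"
        show "\<exists>x'\<in>complex_of_real ` {- r<..<r}. x' \<noteq> 0 \<and> dist x' 0 < e"
          using e r by (intro bexI[of _ "complex_of_real (min e r / 2)"] image_eqI[of _ _ "min e r / 2"]) auto
      qed
    qed (use r real0 in auto)
  qed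
  \<comment> \<open>Any complex angle with the right cosine; for \<open>norm \<eta> > k\<close> it
    is not real. Its sine is determined up to sign, and replacing the angle by its negative reaches
    whichever of the two roots \<open>c\<close> is prescribed.\<close>
  define t0 where "t0 = Arccos (complex_of_real (norm \<eta> / k))"
  have ct: "cos t0 = complex_of_real (norm \<eta> / k)" by (simp add: t0_def)
  have "(- \<i> * complex_of_real k * sin t0)\<^sup>2 = - (complex_of_real k)\<^sup>2 * (1 - (cos t0)\<^sup>2)"
    by (simp add: power_mult_distrib sin_squared_eq)
  also have "\<dots> = c\<^sup>2" unfolding c ct using k by (simp add: field_simps)
  finally have "- \<i> * complex_of_real k * sin t0 = c \<or> - \<i> * complex_of_real k * sin t0 = - c"
    by (simp only: power2_eq_iff)
  then obtain t1 where t1: "cos t1 = complex_of_real (norm \<eta> / k)" "- \<i> * complex_of_real k * sin t1 = c"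
  proof (elim disjE)
    assume "- \<i> * complex_of_real k * sin t0 = c" then show ?thesis using that[of t0] ct by simp
  next
    assume "- \<i> * complex_of_real k * sin t0 = - c" then show ?thesis using that[of "- t0"] ct by simp
  qed
  have "E t1 y = cis (- (\<eta> \<bullet> fst y)) * exp (c * complex_of_real (snd y))" for y
  proof -
    have "cis (- (\<eta> \<bullet> fst y)) = exp (- \<i> * complex_of_real k * (cos t1 * complex_of_real (\<omega> \<bullet> fst y)))"
      unfolding t1(1) cis_conv_exp by (subst om(2)) (use k in simp)
    then show ?thesis
      unfolding E_def t1(2)[symmetric] by (simp add: exp_add[symmetric] algebra_simps)
  qed
  then show ?thesis using g0[of t1] by (simp add: g_def)
qed

end

section \<open>Fubini's theorem on products and one-dimensional identities for the heat
  kernel\<close>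

lemma
  fixes g :: "'a::euclidean_space \<Rightarrow> 'b::euclidean_space \<Rightarrow> 'c::{banach, second_countable_topology}"
  assumes "integrable lborel (\<lambda>p. g (fst p) (snd p))"
  shows lborel_Fubini: "(\<integral>x. \<integral>y. g x y \<partial>lborel \<partial>lborel) = (\<integral>y. \<integral>x. g x y \<partial>lborel \<partial>lborel)"
    and lborel_iterated: "(\<integral>p. g (fst p) (snd p) \<partial>lborel) = (\<integral>x. \<integral>y. g x y \<partial>lborel \<partial>lborel)"
    and lborel_integrable_fst: "integrable lborel (\<lambda>x. \<integral>y. g x y \<partial>lborel)"
    and lborel_integrable_snd: "integrable lborel (\<lambda>y. \<integral>x. g x y \<partial>lborel)"
    and lborel_AE_integrable: "AE x in lborel. integrable lborel (\<lambda>y. g x y)"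
proof -
  have i: "integrable (lborel \<Otimes>\<^sub>M lborel) (case_prod g)"
    using assms by (simp add: lborel_prod case_prod_beta')
  show "(\<integral>x. \<integral>y. g x y \<partial>lborel \<partial>lborel) = (\<integral>y. \<integral>x. g x y \<partial>lborel \<partial>lborel)"
    by (rule lborel_pair.Fubini_integral[OF i, symmetric])
  show "(\<integral>p. g (fst p) (snd p) \<partial>lborel) = (\<integral>x. \<integral>y. g x y \<partial>lborel \<partial>lborel)"
    using lborel_pair.integral_fst[OF i] by (simp add: lborel_prod case_prod_beta')
  show "integrable lborel (\<lambda>x. \<integral>y. g x y \<partial>lborel)"
    by (rule lborel_pair.integrable_fst[OF i])
  show "integrable lborel (\<lambda>y. \<integral>x. g x y \<partial>lborel)"
    by (rule lborel_pair.integrable_snd[OF i])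
  show "AE x in lborel. integrable lborel (\<lambda>y. g x y)"
    using lborel_pair.AE_integrable_fst[OF i] by simp
qed

lemma lborel_integrable_iterated:
  fixes g :: "'a::euclidean_space \<Rightarrow> 'b::euclidean_space \<Rightarrow> 'c::{banach, second_countable_topology}"
  assumes m: "(\<lambda>p. g (fst p) (snd p)) \<in> borel_measurable borel"
    and 1: "\<And>x. integrable lborel (\<lambda>y. g x y)"
    and 2: "\<And>x. (\<integral>y. norm (g x y) \<partial>lborel) \<le> B x" and B: "integrable lborel B"
  shows "integrable lborel (\<lambda>p. g (fst p) (snd p))"
proof -
  have [measurable]: "(\<lambda>p. g (fst p) (snd p)) \<in> borel_measurable (lborel \<Otimes>\<^sub>M lborel)"
    using m by (simp add: lborel_prod)
  have "(\<lambda>x. \<integral>y. norm (g x y) \<partial>lborel) \<in> borel_measurable lborel"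
    by (rule lborel.borel_measurable_lebesgue_integral) (simp add: case_prod_beta')
  then have "integrable lborel (\<lambda>x. \<integral>y. norm (g x y) \<partial>lborel)"
    by (rule Bochner_Integration.integrable_bound[OF B])
      (auto intro!: AE_I2 order_trans[OF 2])
  then have "integrable (lborel \<Otimes>\<^sub>M lborel) (\<lambda>p. g (fst p) (snd p))"
    using 1 by (intro lborel_pair.Fubini_integrable) auto
  then show ?thesis by (simp add: lborel_prod)
qed

lemma continuous_on_Icc_abs_bounded:
  fixes g :: "real \<Rightarrow> real"
  assumes "continuous_on {a..b} g"
  shows "\<exists>G. \<forall>s\<in>{a..b}. \<bar>g s\<bar> \<le> G"
  using compact_imp_bounded[OF compact_continuous_image[OF assms compact_Icc]] unfolding bounded_iff by auto

lemma has_vector_derivative_complex_of_real: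
  assumes "(g has_field_derivative D) (at x within S)"
  shows "((\<lambda>x. complex_of_real (g x)) has_vector_derivative complex_of_real D) (at x within S)"
  using bounded_linear.has_vector_derivative[OF bounded_linear_of_real] assms
  by (simp add: has_real_derivative_iff_has_vector_derivative)

lemma heat1_real_chain:
  assumes "t > 0"
  shows "((\<lambda>s. heat t (x - s)) has_field_derivative - heat1 t (x - s)) (at s within S)"
    and "((\<lambda>s. heat1 t (x - s)) has_field_derivative - heat2 t (x - s)) (at s within S)"
proof -
  have d: "((\<lambda>s. x - s) has_field_derivative -1) (at s within S)"
    by (auto intro!: derivative_eq_intros)
  show "((\<lambda>s. heat t (x - s)) has_field_derivative - heat1 t (x - s)) (at s within S)"
    "((\<lambda>s. heat1 t (x - s)) has_field_derivative - heat2 t (x - s)) (at s within S)"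
    using DERIV_chain2[OF DERIV_heat(1)[OF assms] d] DERIV_chain2[OF DERIV_heat(2)[OF assms] d] by simp_all
qed

lemma continuous_on_heat12:
  assumes "t > 0" and c: "continuous_on S g"
  shows "continuous_on S (\<lambda>s. heat t (g s :: real))" "continuous_on S (\<lambda>s. heat1 t (g s))" "continuous_on S (\<lambda>s. heat2 t (g s))"
  using assms unfolding heat1_def heat2_def heat_def by (auto intro!: continuous_intros)

text \<open>Green's identity on \<open>{r..r'}\<close>: \<open>sinh (l * (s - r)) / l\<close> solves
  \<open>y'' = l\<^sup>2 * y\<close> with value 0 and slope 1 at \<open>r\<close>. The lower
  endpoint therefore reproduces the kernel at \<open>r\<close>, and the upper one leaves the
  boundary terms that are to be eliminated later.\<close>

lemma integral_heat_sinh: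
  fixes l :: complex
  assumes t: "t > 0" and l: "l \<noteq> 0" "l\<^sup>2 = complex_of_real a" and r: "r \<le> r'"
  shows "(\<integral>s. indicator {r..r'} s *\<^sub>R (complex_of_real (heat2 t (x - s) - a * heat t (x - s)) * (sinh (l * complex_of_real (s - r)) / l)) \<partial>lborel)
     = complex_of_real (heat t (x - r)) - (complex_of_real (heat t (x - r')) * cosh (l * complex_of_real (r' - r))
         + complex_of_real (heat1 t (x - r')) * (sinh (l * complex_of_real (r' - r)) / l))"
proof -
  let ?F = "\<lambda>s. - (complex_of_real (heat t (x - s)) * cosh (l * complex_of_real (s - r))
         + complex_of_real (heat1 t (x - s)) * (sinh (l * complex_of_real (s - r)) / l))"
  let ?f = "\<lambda>s. complex_of_real (heat2 t (x - s) - a * heat t (x - s)) * (sinh (l * complex_of_real (s - r)) / l)"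
  have dc: "((\<lambda>s. cosh (l * complex_of_real (s - r))) has_vector_derivative l * sinh (l * complex_of_real (s - r))) (at s within S)" for s S
  proof -
    have "((\<lambda>z. cosh (l * (z - of_real r))) has_field_derivative l * sinh (l * (complex_of_real s - of_real r))) (at (of_real s))"
      by (auto intro!: derivative_eq_intros)
    from has_vector_derivative_real_field[OF this] show ?thesis by simp
  qed
  have ds: "((\<lambda>s. sinh (l * complex_of_real (s - r)) / l) has_vector_derivative cosh (l * complex_of_real (s - r))) (at s within S)" for s S
  proof -
    have "((\<lambda>z. sinh (l * (z - of_real r)) / l) has_field_derivative cosh (l * (complex_of_real s - of_real r))) (at (of_real s))"
      using l by (auto intro!: derivative_eq_intros)
    from has_vector_derivative_real_field[OF this] show ?thesis by simp
  qed
  have "(\<integral>s. indicator {r..r'} s *\<^sub>R ?f s \<partial>lborel) = ?F r' - ?F r"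
  proof (rule integral_FTC_Icc[OF r])
    fix s
    have "(?F has_vector_derivative - ((complex_of_real (heat t (x - s)) * (l * sinh (l * complex_of_real (s - r))) + complex_of_real (- heat1 t (x - s)) * cosh (l * complex_of_real (s - r)))
       + (complex_of_real (heat1 t (x - s)) * cosh (l * complex_of_real (s - r)) + complex_of_real (- heat2 t (x - s)) * (sinh (l * complex_of_real (s - r)) / l)))) (at s within {r..r'})"
      by (intro has_vector_derivative_minus has_vector_derivative_add has_vector_derivative_mult dc ds
          has_vector_derivative_complex_of_real heat1_real_chain t)
    also have "- ((complex_of_real (heat t (x - s)) * (l * sinh (l * complex_of_real (s - r))) + complex_of_real (- heat1 t (x - s)) * cosh (l * complex_of_real (s - r)))
       + (complex_of_real (heat1 t (x - s)) * cosh (l * complex_of_real (s - r)) + complex_of_real (- heat2 t (x - s)) * (sinh (l * complex_of_real (s - r)) / l)))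
       = (complex_of_real (heat2 t (x - s)) - l\<^sup>2 * complex_of_real (heat t (x - s))) * (sinh (l * complex_of_real (s - r)) / l)"
      using l(1) by (simp add: field_simps power2_eq_square)
    also have "\<dots> = ?f s" unfolding l(2) by simp
    finally show "(?F has_vector_derivative ?f s) (at s within {r..r'})" .
  next
    show "continuous_on {r..r'} ?f"
      using l(1) t unfolding sinh_def by (intro continuous_intros continuous_on_heat12) auto
  qed
  then show ?thesis by simp
qed

text \<open>By the heat equation the integrand is the time derivative of
  \<open>exp (- a * t) * heat t s\<close>. The contribution of time 0 vanishes because
  \<open>s\<close> keeps away from the origin.\<close>

lemma integral_heat_time:
  assumes s: "\<bar>s\<bar> \<ge> (1::real)"
  shows "(\<integral>t. indicator {0..1} t *\<^sub>R (exp (- a * t) * (heat2 t s - a * heat t s)) \<partial>lborel) = exp (- a) * heat 1 s"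
proof -
  let ?f = "\<lambda>t. exp (- a * t) * (heat2 t s - a * heat t s)"
  obtain C where C: "C \<ge> 0" "\<And>t. 0 < t \<Longrightarrow> t \<le> 1 \<Longrightarrow> heat t s \<le> C * t" "\<And>t. 0 < t \<Longrightarrow> t \<le> 1 \<Longrightarrow> \<bar>heat2 t s\<bar> \<le> C * (s\<^sup>2 + 1)"
    using heat_time_zero s by blast
  \<comment> \<open>Default values at time 0. For \<open>\<bar>s\<bar> \<ge> 1\<close> the value of
    \<open>heat\<close> agrees with the limit from the right, so the fundamental theorem applies on
    the closed interval.\<close>
  have h0: "heat 0 s = 0" "heat2 0 s = 0" by (simp_all add: heat_def heat2_def)
  have d: "((\<lambda>t. exp (- a * t) * heat t s) has_field_derivative ?f t) (at t)" if "t > 0" for t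
    using that by (auto intro!: derivative_eq_intros DERIV_heat(3) simp: algebra_simps)
  have c: "continuous_on {0..1} (\<lambda>t. exp (- a * t) * heat t s)"
  proof (intro continuous_on_mult continuous_intros, unfold continuous_on_eq_continuous_within, intro ballI)
    fix t :: real assume t: "t \<in> {0..1}"
    show "continuous (at t within {0..1}) (\<lambda>t. heat t s)"
    proof (cases "t = 0")
      case False
      with t have "t > 0" by simp
      from DERIV_isCont[OF DERIV_heat(3)[OF this]] show ?thesis by (rule continuous_at_imp_continuous_at_within)
    next
      case True
      have "((\<lambda>t. heat t s) \<longlongrightarrow> 0) (at 0 within {0..1})"
      proof (rule tendsto_sandwich[where f="\<lambda>_. 0" and h="\<lambda>t. C * t"])
        show "\<forall>\<^sub>F t in at 0 within {0..1}. heat t s \<le> C * t"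
          unfolding eventually_at_filter by (rule always_eventually) (auto intro: C)
        have "((\<lambda>t. C * t) \<longlongrightarrow> C * 0) (at 0 within {0..1})" by (intro tendsto_intros)
        then show "((\<lambda>t. C * t) \<longlongrightarrow> 0) (at 0 within {0..1})" by simp
      qed (auto simp: heat_nonneg)
      then show ?thesis unfolding True continuous_within by (simp add: h0)
    qed
  qed
  have hi: "(?f has_integral (exp (- a * 1) * heat 1 s - exp (- a * 0) * heat 0 s)) {0..1}"
    by (rule fundamental_theorem_of_calculus_interior[OF _ c])
      (use d in \<open>auto simp: has_real_derivative_iff_has_vector_derivative\<close>)
  have li: "set_integrable lborel {0..1} ?f"
    unfolding set_integrable_def
  proof (rule integrable_bounded_support[where r=1 and B="exp \<bar>a\<bar> * (C * (s\<^sup>2 + 1) + \<bar>a\<bar> * C)"])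
    fix t :: real
    show "norm (indicator {0..1} t *\<^sub>R ?f t) \<le> exp \<bar>a\<bar> * (C * (s\<^sup>2 + 1) + \<bar>a\<bar> * C)"
    proof (cases "0 < t \<and> t \<le> 1")
      case True
      have e: "exp (- a * t) \<le> exp \<bar>a\<bar>"
      proof -
        have "- a * t \<le> \<bar>a\<bar> * t" using True by (intro mult_right_mono) auto
        also have "\<dots> \<le> \<bar>a\<bar>" using True by (simp add: mult_left_le)
        finally show ?thesis by simp
      qed
      have hC: "heat t s \<le> C" using C(2)[of t] True mult_left_le[of t C] C(1) by linarith
      have "\<bar>heat2 t s - a * heat t s\<bar> \<le> \<bar>heat2 t s\<bar> + \<bar>a\<bar> * heat t s"
        using abs_triangle_ineq4[of "heat2 t s" "a * heat t s"] by (simp add: abs_mult heat_nonneg)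
      also have "\<dots> \<le> C * (s\<^sup>2 + 1) + \<bar>a\<bar> * C"
        using C(3)[of t] True hC by (intro add_mono mult_left_mono) auto
      finally show ?thesis using True e by (auto simp: abs_mult intro!: mult_mono)
    next
      case False
      then have e: "indicator {0..1} t *\<^sub>R ?f t = 0" using h0 by (cases "t = 0") auto
      show ?thesis using C(1) by (subst e) simp
    qed
  qed (auto simp: indicator_def)
  have "(\<integral>t. indicator {0..1} t *\<^sub>R ?f t \<partial>lborel) = integral {0..1} ?f"
    using set_borel_integral_eq_integral(2)[OF li] by (simp add: set_lebesgue_integral_def)
  also have "\<dots> = exp (- a) * heat 1 s" using integral_unique[OF hi] by (simp add: h0)
  finally show ?thesis .
qed

section \<open>The transformed solution in the vertical variable\<close>

context source
begin

text \<open>Plane wave in \<open>x'\<close> times the fundamental solution of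
  \<open>y'' = l\<^sup>2 * y\<close> supported above the source point, with
  \<open>l = lam k \<eta>\<close>: variation of constants, started from below.\<close>

definition Pint :: "'v \<Rightarrow> real \<Rightarrow> 'v \<times> real \<Rightarrow> complex" where
  "Pint \<eta> s y = (if snd y < s then cis (- (\<eta> \<bullet> fst y)) * (sinh (lam k \<eta> * complex_of_real (s - snd y)) / lam k \<eta>) else 0)"

text \<open>\<open>P \<eta>\<close> solves \<open>P'' - (|\<eta>|\<^sup>2 - k\<^sup>2) P = f\<close> after a Fourier transform in the first factor. Integrating
  from below gives \<open>0\<close> above the support of \<open>f\<close> by \<open>f_variety\<close>, so the indicator cuts nothing off.\<close>

definition P :: "'v \<Rightarrow> real \<Rightarrow> complex" where
  "P \<eta> s = indicator {-R..R} s *\<^sub>R (\<integral>y. f y * Pint \<eta> s y \<partial>lborel)"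

text \<open>The distance of two heights in \<open>{-R..R}\<close> is at most \<open>2 * R\<close>,
  and \<open>lam\<close> is at most \<open>norm \<eta> + k\<close>. The resulting growth rate
  \<open>2 * R\<close> in the frequency is what the Gaussian weight must overcome.\<close>

definition pb :: "'v \<Rightarrow> real" where
  "pb \<eta> = N * (2 * R * exp (2 * R * (norm \<eta> + k))) * vol"

lemma Pint_measurable [measurable (raw)]:
  assumes [measurable]: "g1 \<in> borel_measurable M" "g2 \<in> borel_measurable M" "g3 \<in> borel_measurable M"
  shows "(\<lambda>x. Pint (g1 x) (g2 x) (g3 x)) \<in> borel_measurable M"
proof -
  have [measurable]: "(\<lambda>x. fst (g3 x)) \<in> borel_measurable M" "(\<lambda>x. snd (g3 x)) \<in> borel_measurable M" by measurable
  show ?thesis unfolding Pint_def by measurable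
qed

lemma P_measurable [measurable (raw)]:
  assumes [measurable]: "g1 \<in> borel_measurable M" "g2 \<in> borel_measurable M"
  shows "(\<lambda>x. P (g1 x) (g2 x)) \<in> borel_measurable M"
proof -
  have "(\<lambda>x. \<integral>y. f y * Pint (g1 x) (g2 x) y \<partial>lborel) \<in> borel_measurable M"
    by (rule lborel.borel_measurable_lebesgue_integral) measurable
  then show ?thesis unfolding P_def by measurable
qed

lemma Pint_bound:
  assumes "\<bar>s\<bar> \<le> R" "norm y \<le> R"
  shows "norm (Pint \<eta> s y) \<le> 2 * R * exp (2 * R * (norm \<eta> + k))"
proof -
  have "\<bar>snd y\<bar> \<le> R" using norm_snd_le[of "snd y" "fst y"] assms by simp
  then have d: "\<bar>s - snd y\<bar> \<le> 2 * R" using assms by linarith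
  have "norm (Pint \<eta> s y) \<le> norm (sinh (lam k \<eta> * complex_of_real (s - snd y)) / lam k \<eta>)"
    by (simp add: Pint_def norm_mult norm_divide)
  also have "\<dots> \<le> \<bar>s - snd y\<bar> * exp (norm (lam k \<eta>) * \<bar>s - snd y\<bar>)" by (rule norm_sinh_div_le)
  also have "norm (lam k \<eta>) * \<bar>s - snd y\<bar> \<le> (norm \<eta> + k) * (2 * R)"
    using norm_lam[of k \<eta>] k d by (intro mult_mono) auto
  then have "\<bar>s - snd y\<bar> * exp (norm (lam k \<eta>) * \<bar>s - snd y\<bar>) \<le> 2 * R * exp ((norm \<eta> + k) * (2 * R))"
    using d by (intro mult_mono) auto
  finally show ?thesis by (simp add: mult_ac)
qed

lemma pb_nonneg: "pb \<eta> \<ge> 0" unfolding pb_def vol_def using N R by simp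

lemma P_bound: "norm (P \<eta> s) \<le> indicator {-R..R} s * pb \<eta>"
proof (cases "s \<in> {-R..R}")
  case True
  have "norm (\<integral>y. f y * Pint \<eta> s y \<partial>lborel) \<le> N * (2 * R * exp (2 * R * (norm \<eta> + k))) * vol"
    by (rule f_integral_bound) (use True R in \<open>auto intro!: Pint_bound\<close>)
  then show ?thesis using True by (simp add: P_def pb_def)
qed (simp add: P_def)

text \<open>The one-dimensional equation in weak form, tested with a heat kernel. After exchanging
  the integrals, Green's identity on the interval from \<open>snd y\<close> to \<open>R\<close>
  gives the right-hand side plus boundary terms at \<open>R\<close>. Those are combinations of
  \<open>exp (l * snd y)\<close> and \<open>exp (- l * snd y)\<close>, and their integrals against
  the transformed source vanish because \<eta> with either root lies on the complexified sphere.
  This is what makes the truncation of \<open>P\<close> at \<open>R\<close> harmless.\<close>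

lemma P_ode:
  assumes \<eta>: "norm \<eta> \<noteq> k" and t: "t > 0"
  shows "(\<integral>s. complex_of_real (heat2 t (x - s) - ((norm \<eta>)\<^sup>2 - k\<^sup>2) * heat t (x - s)) * P \<eta> s \<partial>lborel)
    = (\<integral>y. f y * (cis (- (\<eta> \<bullet> fst y)) * complex_of_real (heat t (x - snd y))) \<partial>lborel)"
proof -
  define a where "a = (norm \<eta>)\<^sup>2 - k\<^sup>2"
  define l where "l = lam k \<eta>"
  have l2: "l\<^sup>2 = complex_of_real a" unfolding l_def a_def by (rule lam_sq)
  have "a \<noteq> 0" using \<eta> k norm_ge_zero[of \<eta>] by (auto simp: a_def power2_eq_iff simp del: norm_ge_zero)
  with l2 have l0: "l \<noteq> 0" by auto
  define g where "g s = heat2 t (x - s) - a * heat t (x - s)" for s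
  have gc: "continuous_on {-R..R} g"
    unfolding g_def using t by (intro continuous_intros continuous_on_heat12) auto
  have [measurable]: "g \<in> borel_measurable borel" unfolding g_def by measurable
  obtain G where G: "\<And>s. s \<in> {-R..R} \<Longrightarrow> \<bar>g s\<bar> \<le> G"
    using continuous_on_Icc_abs_bounded[OF gc] by blast
  have G0: "G \<ge> 0" using G[of 0] R by auto
  define K where "K s y = f y * (complex_of_real (indicator {-R..R} s * g s) * Pint \<eta> s y)" for s y
  have Ki: "integrable lborel (\<lambda>p. K (fst p) (snd p))"
  proof (rule integrable_bounded_support[where r="2 * R" and B="N * (G * (2 * R * exp (2 * R * (norm \<eta> + k))))"])
    show "(\<lambda>p. K (fst p) (snd p)) \<in> borel_measurable borel" unfolding K_def by measurable
    show "norm (K (fst p) (snd p)) \<le> N * (G * (2 * R * exp (2 * R * (norm \<eta> + k))))" for p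
    proof (cases "\<bar>fst p\<bar> \<le> R \<and> norm (snd p) \<le> R")
      case True
      then have "indicator {-R..R} (fst p) * \<bar>g (fst p)\<bar> \<le> G" using G[of "fst p"] by (auto simp: abs_le_iff indicator_def)
      then show ?thesis unfolding K_def norm_mult using True N G0 R f_bound[of "snd p"] Pint_bound[of "fst p" "snd p" \<eta>]
        by (intro mult_mono) (auto simp: norm_mult abs_mult)
    next
      case False
      then have "K (fst p) (snd p) = 0" unfolding K_def using f_supp[of "snd p"] by (auto simp: indicator_def)
      then show ?thesis using N G0 R by simp
    qed
    fix p :: "real \<times> ('v \<times> real)" assume p: "norm p > 2 * R"
    have "norm p \<le> \<bar>fst p\<bar> + norm (snd p)" using norm_Pair_le[of "fst p" "snd p"] by simp
    then have "\<bar>fst p\<bar> > R \<or> norm (snd p) > R" using p by linarith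
    then show "K (fst p) (snd p) = 0" unfolding K_def using f_supp[of "snd p"] by (auto simp: indicator_def)
  qed
  \<comment> \<open>The coefficients of the two exponentials in \<open>snd y\<close> once
    \<open>cosh\<close> and \<open>sinh\<close> in the boundary terms are expanded; they do not
    depend on \<open>y\<close>.\<close>
  define A1 where "A1 = (complex_of_real (heat t (x - R)) - complex_of_real (heat1 t (x - R)) / l) / 2 * exp (- (l * complex_of_real R))"
  define A2 where "A2 = (complex_of_real (heat t (x - R)) + complex_of_real (heat1 t (x - R)) / l) / 2 * exp (l * complex_of_real R)"
  have inner: "(\<integral>s. K s y \<partial>lborel) = f y * (cis (- (\<eta> \<bullet> fst y)) * complex_of_real (heat t (x - snd y)))
     - (A1 * (f y * (cis (- (\<eta> \<bullet> fst y)) * exp (l * complex_of_real (snd y)))) + A2 * (f y * (cis (- (\<eta> \<bullet> fst y)) * exp (- l * complex_of_real (snd y)))))" for y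
  proof (cases "norm y \<le> R")
    case True
    have yn: "- R \<le> snd y" "snd y \<le> R" using norm_snd_le[of "snd y" "fst y"] True by (auto simp: abs_le_iff)
    have "K s y = (f y * cis (- (\<eta> \<bullet> fst y))) * (indicator {snd y..R} s *\<^sub>R (complex_of_real (g s) * (sinh (l * complex_of_real (s - snd y)) / l)))" for s
      using yn by (auto simp: K_def Pint_def indicator_def l_def[symmetric])
    then have "(\<integral>s. K s y \<partial>lborel) = (f y * cis (- (\<eta> \<bullet> fst y))) *
        (\<integral>s. indicator {snd y..R} s *\<^sub>R (complex_of_real (g s) * (sinh (l * complex_of_real (s - snd y)) / l)) \<partial>lborel)"
      by (simp only: integral_mult_right_zero)
    also have "\<dots> = (f y * cis (- (\<eta> \<bullet> fst y))) * (complex_of_real (heat t (x - snd y)) - (complex_of_real (heat t (x - R)) * cosh (l * complex_of_real (R - snd y))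
         + complex_of_real (heat1 t (x - R)) * (sinh (l * complex_of_real (R - snd y)) / l)))"
      unfolding g_def by (subst integral_heat_sinh[OF t l0 l2 yn(2)]) simp
    also have "complex_of_real (heat t (x - R)) * cosh (l * complex_of_real (R - snd y))
         + complex_of_real (heat1 t (x - R)) * (sinh (l * complex_of_real (R - snd y)) / l)
         = A1 * exp (l * complex_of_real (snd y)) + A2 * exp (- l * complex_of_real (snd y))"
    proof -
      have e1: "exp (l * complex_of_real (R - snd y)) = exp (l * complex_of_real R) * exp (- l * complex_of_real (snd y))"
        by (simp add: exp_add[symmetric] algebra_simps)
      have e2: "exp (- (l * complex_of_real (R - snd y))) = exp (- (l * complex_of_real R)) * exp (l * complex_of_real (snd y))"
        by (simp add: exp_add[symmetric] algebra_simps)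
      show ?thesis unfolding cosh_def sinh_def e1 e2 A1_def A2_def using l0
        by (simp add: scaleR_conv_of_real field_simps)
    qed
    finally show ?thesis by (simp add: algebra_simps)
  next
    case False
    then show ?thesis by (simp add: K_def f_supp)
  qed
  have b: "norm (cis (- (\<eta> \<bullet> fst y)) * exp (c * complex_of_real (snd y))) \<le> exp (norm c * R)" if "norm y \<le> R" for y c
  proof -
    have "\<bar>snd y\<bar> \<le> R" using norm_snd_le[of "snd y" "fst y"] that by simp
    then have "norm (c * complex_of_real (snd y)) \<le> norm c * R" by (auto simp: norm_mult intro: mult_left_mono)
    then have "Re (c * complex_of_real (snd y)) \<le> norm c * R" using complex_Re_le_cmod order_trans by blast
    then show ?thesis by (simp only: norm_mult norm_cis norm_exp_eq_Re) simp
  qed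
  have i1: "integrable lborel (\<lambda>y. f y * (cis (- (\<eta> \<bullet> fst y)) * exp (c * complex_of_real (snd y))))" for c
    by (rule f_integrable[OF _ b]) measurable
  obtain H where H: "\<And>s. s \<in> {-R..R} \<Longrightarrow> \<bar>heat t (x - s)\<bar> \<le> H"
  proof -
    have "continuous_on {-R..R} (\<lambda>s. heat t (x - s))" using t by (intro continuous_on_heat12 continuous_intros)
    from continuous_on_Icc_abs_bounded[OF this] show ?thesis using that by blast
  qed
  have i2: "integrable lborel (\<lambda>y. f y * (cis (- (\<eta> \<bullet> fst y)) * complex_of_real (heat t (x - snd y))))"
  proof (rule f_integrable[where B=H])
    fix y :: "'v \<times> real" assume "norm y \<le> R"
    then have "snd y \<in> {-R..R}" using norm_snd_le[of "snd y" "fst y"] by (auto simp: abs_le_iff)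
    from H[OF this] show "norm (cis (- (\<eta> \<bullet> fst y)) * complex_of_real (heat t (x - snd y))) \<le> H" by (simp add: norm_mult)
  qed measurable
  have l2': "(- l)\<^sup>2 = complex_of_real a" using l2 by simp
  note v = f_variety[OF l2[unfolded a_def]] f_variety[OF l2'[unfolded a_def]]
  have "(\<integral>s. complex_of_real (g s) * P \<eta> s \<partial>lborel) = (\<integral>s. \<integral>y. K s y \<partial>lborel \<partial>lborel)"
  proof (intro Bochner_Integration.integral_cong refl)
    fix s
    show "complex_of_real (g s) * P \<eta> s = (\<integral>y. K s y \<partial>lborel)"
      unfolding K_def P_def by (subst mult.left_commute, subst integral_mult_right_zero) (simp add: scaleR_conv_of_real)
  qed
  also have "\<dots> = (\<integral>y. \<integral>s. K s y \<partial>lborel \<partial>lborel)" by (rule lborel_Fubini[OF Ki])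
  also have "\<dots> = (\<integral>y. f y * (cis (- (\<eta> \<bullet> fst y)) * complex_of_real (heat t (x - snd y))) \<partial>lborel)
      - (A1 * (\<integral>y. f y * (cis (- (\<eta> \<bullet> fst y)) * exp (l * complex_of_real (snd y))) \<partial>lborel)
        + A2 * (\<integral>y. f y * (cis (- (\<eta> \<bullet> fst y)) * exp (- l * complex_of_real (snd y))) \<partial>lborel))"
    unfolding inner
    by (subst Bochner_Integration.integral_diff Bochner_Integration.integral_add integral_mult_right_zero;
        (intro i2 Bochner_Integration.integrable_add integrable_mult_right i1)?)+ simp
  also have "\<dots> = (\<integral>y. f y * (cis (- (\<eta> \<bullet> fst y)) * complex_of_real (heat t (x - snd y))) \<partial>lborel)"
    unfolding v by simp
  finally show ?thesis unfolding g_def a_def .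
qed

text \<open>\<open>P_ode\<close> is multiplied by \<open>exp (- a * t)\<close> and integrated over
  the time from 0 to 1. More than distance 1 above the support of \<open>P\<close> the kernel side
  is an exact time derivative without a contribution from time 0, so only time 1 survives. This is
  the identity behind \<open>V = U0\<close> above the source, before the Fourier inversion.\<close>

lemma P_time:
  assumes \<eta>: "norm \<eta> \<noteq> k" and x: "x > R + 1"
  shows "(\<integral>t. indicator {0..1} t *\<^sub>R (complex_of_real (exp (- ((norm \<eta>)\<^sup>2 - k\<^sup>2) * t)) *
            (\<integral>y. f y * (cis (- (\<eta> \<bullet> fst y)) * complex_of_real (heat t (x - snd y))) \<partial>lborel)) \<partial>lborel)
       = complex_of_real (exp (- ((norm \<eta>)\<^sup>2 - k\<^sup>2))) * (\<integral>s. complex_of_real (heat 1 (x - s)) * P \<eta> s \<partial>lborel)"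
proof -
  define a where "a = (norm \<eta>)\<^sup>2 - k\<^sup>2"
  define q where "q t s = indicator {0..1} t *\<^sub>R (exp (- a * t) * (heat2 t s - a * heat t s))" for t s :: real
  obtain C where C: "C \<ge> 0" "\<And>t s. 0 < t \<Longrightarrow> t \<le> 1 \<Longrightarrow> 1 \<le> \<bar>s\<bar> \<Longrightarrow> heat t s \<le> C * t \<and> \<bar>heat2 t s\<bar> \<le> C * (s\<^sup>2 + 1)"
    using heat_time_zero by blast
  have h0: "heat 0 s = 0" "heat2 0 s = 0" for s :: real by (simp_all add: heat_def heat2_def)
  define B where "B = exp \<bar>a\<bar> * (C * ((x + R)\<^sup>2 + 1) + \<bar>a\<bar> * C)"
  have B0: "B \<ge> 0" using C(1) by (simp add: B_def)
  have qb: "\<bar>q t (x - s)\<bar> \<le> B" if s: "s \<in> {-R..R}" for t s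
  proof (cases "0 < t \<and> t \<le> 1")
    case True
    have s1: "1 \<le> \<bar>x - s\<bar>" using s x by auto
    have e: "exp (- a * t) \<le> exp \<bar>a\<bar>"
    proof -
      have "- a * t \<le> \<bar>a\<bar> * t" using True by (intro mult_right_mono) auto
      also have "\<dots> \<le> \<bar>a\<bar>" using True by (simp add: mult_left_le)
      finally show ?thesis by simp
    qed
    note CC = C(2)[of t "x - s"]
    have hC: "heat t (x - s) \<le> C" using CC True s1 mult_left_le[of t C] C(1) by linarith
    have sq: "(x - s)\<^sup>2 \<le> (x + R)\<^sup>2" using s x R by (intro power_mono) auto
    have "\<bar>heat2 t (x - s) - a * heat t (x - s)\<bar> \<le> \<bar>heat2 t (x - s)\<bar> + \<bar>a\<bar> * heat t (x - s)"
      using abs_triangle_ineq4[of "heat2 t (x - s)" "a * heat t (x - s)"] by (simp add: abs_mult heat_nonneg)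
    also have "\<dots> \<le> C * ((x + R)\<^sup>2 + 1) + \<bar>a\<bar> * C"
    proof (intro add_mono mult_left_mono hC)
      have "\<bar>heat2 t (x - s)\<bar> \<le> C * ((x - s)\<^sup>2 + 1)" using CC True s1 by blast
      also have "\<dots> \<le> C * ((x + R)\<^sup>2 + 1)" using sq C(1) by (intro mult_left_mono) auto
      finally show "\<bar>heat2 t (x - s)\<bar> \<le> C * ((x + R)\<^sup>2 + 1)" .
    qed auto
    finally have "\<bar>exp (- a * t) * (heat2 t (x - s) - a * heat t (x - s))\<bar> \<le> B"
      unfolding B_def abs_mult using e by (intro mult_mono) auto
    then show ?thesis using True by (simp add: q_def)
  next
    case False
    then have "q t (x - s) = 0" using h0 by (cases "t = 0") (auto simp: q_def indicator_def)
    then show ?thesis using B0 by simp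
  qed
  have I: "integrable lborel (\<lambda>p. complex_of_real (q (fst p) (x - snd p)) * P \<eta> (snd p))"
  proof (rule integrable_bounded_support[where r="1 + R" and B="B * pb \<eta>"])
    show "(\<lambda>p. complex_of_real (q (fst p) (x - snd p)) * P \<eta> (snd p)) \<in> borel_measurable borel"
      unfolding q_def by measurable
    fix p :: "real \<times> real"
    show "norm (complex_of_real (q (fst p) (x - snd p)) * P \<eta> (snd p)) \<le> B * pb \<eta>"
    proof (cases "snd p \<in> {-R..R}")
      case True
      then show ?thesis using qb[OF True, of "fst p"] P_bound[of \<eta> "snd p"] B0 by (auto simp: norm_mult intro!: mult_mono)
    qed (use B0 pb_nonneg in \<open>auto simp: P_def\<close>)
    assume "norm p > 1 + R"
    then have "\<bar>fst p\<bar> + \<bar>snd p\<bar> > 1 + R" using norm_Pair_le[of "fst p" "snd p"] by simp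
    then have "\<bar>fst p\<bar> > 1 \<or> \<bar>snd p\<bar> > R" by linarith
    then show "complex_of_real (q (fst p) (x - snd p)) * P \<eta> (snd p) = 0"
      by (auto simp: q_def P_def indicator_def)
  qed
  have "(\<integral>t. indicator {0..1} t *\<^sub>R (complex_of_real (exp (- a * t)) *
            (\<integral>y. f y * (cis (- (\<eta> \<bullet> fst y)) * complex_of_real (heat t (x - snd y))) \<partial>lborel)) \<partial>lborel)
      = (\<integral>t. \<integral>s. complex_of_real (q t (x - s)) * P \<eta> s \<partial>lborel \<partial>lborel)"
  proof (intro Bochner_Integration.integral_cong refl)
    fix t :: real
    show "indicator {0..1} t *\<^sub>R (complex_of_real (exp (- a * t)) *
            (\<integral>y. f y * (cis (- (\<eta> \<bullet> fst y)) * complex_of_real (heat t (x - snd y))) \<partial>lborel))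
        = (\<integral>s. complex_of_real (q t (x - s)) * P \<eta> s \<partial>lborel)"
    proof (cases "0 < t \<and> t \<le> 1")
      case True
      then have "t > 0" by simp
      have e: "complex_of_real (q t (x - s)) * P \<eta> s = complex_of_real (exp (- a * t)) * (complex_of_real (heat2 t (x - s) - a * heat t (x - s)) * P \<eta> s)" for s
        using True by (simp add: q_def)
      show ?thesis unfolding e integral_mult_right_zero
        using P_ode[OF \<eta> \<open>t > 0\<close>, of x] True by (simp add: a_def)
    next
      case False
      then show ?thesis using h0 by (cases "t = 0") (auto simp: q_def indicator_def)
    qed
  qed
  also have "\<dots> = (\<integral>s. \<integral>t. complex_of_real (q t (x - s)) * P \<eta> s \<partial>lborel \<partial>lborel)"
    by (rule lborel_Fubini[OF I])
  also have "\<dots> = (\<integral>s. complex_of_real (exp (- a)) * (complex_of_real (heat 1 (x - s)) * P \<eta> s) \<partial>lborel)"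
  proof (intro Bochner_Integration.integral_cong refl)
    fix s
    show "(\<integral>t. complex_of_real (q t (x - s)) * P \<eta> s \<partial>lborel) = complex_of_real (exp (- a)) * (complex_of_real (heat 1 (x - s)) * P \<eta> s)"
    proof (cases "s \<in> {-R..R}")
      case True
      then have "1 \<le> \<bar>x - s\<bar>" using x by auto
      from integral_heat_time[OF this, of a] show ?thesis
        unfolding integral_mult_left_zero integral_complex_of_real q_def by simp
    qed (simp add: P_def)
  qed
  also have "\<dots> = complex_of_real (exp (- a)) * (\<integral>s. complex_of_real (heat 1 (x - s)) * P \<eta> s \<partial>lborel)"
    by (rule integral_mult_right_zero)
  finally show ?thesis unfolding a_def .
qed

end

section \<open>The wave field of a nonradiating source\<close>

lemma fourier_heat:
  fixes z :: "'a::euclidean_space"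
  assumes t: "t > 0"
  shows "(\<integral>\<eta>. cis (\<eta> \<bullet> z) * complex_of_real (exp (- t * (norm \<eta>)\<^sup>2)) \<partial>lborel) = complex_of_real ((2 * pi) ^ DIM('a) * heat t z)"
proof -
  have "(pi / t) powr (DIM('a) / 2) = ((2 * pi) powr 2 * inverse (4 * pi * t)) powr (DIM('a) / 2)"
    using t by (simp add: field_simps power2_eq_square)
  also have "\<dots> = ((2 * pi) powr 2) powr (DIM('a) / 2) * (inverse (4 * pi * t)) powr (DIM('a) / 2)"
    by (rule powr_mult)
  also have "((2 * pi) powr 2) powr (DIM('a) / 2) = (2 * pi) ^ DIM('a)"
    by (simp add: powr_powr powr_realpow del: powr_numeral)
  also have "(inverse (4 * pi * t)) powr (DIM('a) / 2) = (4 * pi * t) powr (- real DIM('a) / 2)"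
    using t by (simp only: powr_minus minus_divide_left[symmetric] inverse_powr)
  finally have e: "(pi / t) powr (DIM('a) / 2) = (2 * pi) ^ DIM('a) * (4 * pi * t) powr (- real DIM('a) / 2)" .
  show ?thesis unfolding fourier_gauss(2)[OF t] heat_def e mult.assoc ..
qed

text \<open>\<open>(pi / t) powr (n / 2)\<close> is the mass in frequency space of the Gaussian
  \<open>exp (- t * (norm \<eta>)\<^sup>2)\<close>. It blows up as \<open>t\<close> tends to 0, and
  the vertical kernel at distance at least 1 compensates; this is the absolute integrability needed
  to exchange frequency and time.\<close>

lemma heat_gauss_bounded:
  "\<exists>C\<ge>0. \<forall>t s. 0 < t \<longrightarrow> t \<le> 1 \<longrightarrow> 1 \<le> \<bar>s\<bar> \<longrightarrow> (pi / t) powr (real n / 2) * heat t (s::real) \<le> C"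
proof -
  have "\<exists>C\<ge>0. \<forall>t. 0 < t \<longrightarrow> t \<le> 1 \<longrightarrow> (t::real) powr (- (real n + 1) / 2) * exp (- ((1/4) / t)) \<le> C"
    by (rule powr_exp_inverse_bounded) simp
  then obtain C where C: "C \<ge> 0" "\<forall>t. 0 < t \<longrightarrow> t \<le> 1 \<longrightarrow> (t::real) powr (- (real n + 1) / 2) * exp (- ((1/4) / t)) \<le> C"
    by (elim exE conjE)
  show ?thesis
  proof (intro exI[of _ "pi powr (real n / 2) * C"] conjI allI impI)
    show "pi powr (real n / 2) * C \<ge> 0" using C(1) by simp
    fix t s :: real assume t: "0 < t" "t \<le> 1" and s: "1 \<le> \<bar>s\<bar>"
    have h1: "(4 * pi * t) powr (-1/2) \<le> t powr (-1/2)"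
      using t pi_gt3 by (intro powr_mono2') auto
    have "1 \<le> s\<^sup>2" using s by (metis one_power2 power_mono power2_abs zero_le_one)
    then have h2: "exp (- s\<^sup>2 / (4 * t)) \<le> exp (- ((1/4) / t))"
      using t by (simp add: divide_right_mono field_simps)
    have "heat t s \<le> t powr (-1/2) * exp (- ((1/4) / t))"
      unfolding heat_def using h1 h2 by (intro mult_mono) auto
    moreover have "(pi / t) powr (real n / 2) = pi powr (real n / 2) * t powr (- (real n / 2))"
      by (simp only: powr_divide powr_minus_divide times_divide_eq_right mult_1_right)
    ultimately have "(pi / t) powr (real n / 2) * heat t s \<le> pi powr (real n / 2) * t powr (- (real n / 2)) * (t powr (-1/2) * exp (- ((1/4) / t)))"
      by (auto intro!: mult_left_mono)
    also have "\<dots> = pi powr (real n / 2) * (t powr (- (real n + 1) / 2) * exp (- ((1/4) / t)))"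
    proof -
      have "- (real n + 1) / 2 = - (real n / 2) + (-1/2)" by (simp add: field_simps)
      then have "t powr (- (real n + 1) / 2) = t powr (- (real n / 2)) * t powr (-1/2)" by (simp only: powr_add)
      then show ?thesis by (simp only: mult.assoc)
    qed
    also have "\<dots> \<le> pi powr (real n / 2) * C" using C(2) t by (intro mult_left_mono) auto
    finally show "(pi / t) powr (real n / 2) * heat t s \<le> pi powr (real n / 2) * C" .
  qed
qed

lemma heat_1_le: "heat 1 (s::real) \<le> 1"
proof -
  have "heat 1 s = exp (- s\<^sup>2 / 4) / sqrt (4 * pi)" by (simp add: heat_real)
  also have "\<dots> \<le> 1 / 1" using pi_gt3 by (intro frac_le) auto
  finally show ?thesis by simp
qed

context source
begin

text \<open>The heat flow at time 1 is a multiplication by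
  \<open>exp (- (norm \<eta>)\<^sup>2)\<close> in the frequency and a convolution with
  \<open>heat 1\<close> in the height; the factor \<open>exp (k\<^sup>2)\<close> belongs to the
  zero-order term of the Helmholtz operator.\<close>

definition Vint :: "'v \<times> real \<Rightarrow> 'v \<Rightarrow> real \<Rightarrow> complex" where
  "Vint x \<eta> s = cis (\<eta> \<bullet> fst x) * complex_of_real (exp (- ((norm \<eta>)\<^sup>2 - k\<^sup>2)) * heat 1 (snd x - s)) * P \<eta> s"

text \<open>Inverting the Fourier transform of \<open>P \<eta> s\<close> directly diverges, as it grows exponentially in \<open>|\<eta>|\<close>. The
  solution is therefore split by the heat semigroup: \<open>V\<close> is its image at time \<open>1\<close>, and \<open>U0\<close> is the Duhamel
  integral of \<open>f\<close> over the times before.\<close>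

definition V :: "'v \<times> real \<Rightarrow> complex" where
  "V x = complex_of_real (1 / (2 * pi) ^ DIM('v)) * (\<integral>\<eta>. \<integral>s. Vint x \<eta> s \<partial>lborel \<partial>lborel)"

definition U0 :: "'v \<times> real \<Rightarrow> complex" where
  "U0 x = (\<integral>t. indicator {0..1} t *\<^sub>R (complex_of_real (exp (k\<^sup>2 * t)) * (\<integral>y. f y * complex_of_real (heat t (x - y)) \<partial>lborel)) \<partial>lborel)"

text \<open>Formally, with \<open>A\<close> for the Helmholtz operator,
  \<open>A U0 = exp A f - f\<close> and \<open>A V = exp A f\<close>, so the difference solves
  \<open>A u = f\<close>. The weak form of these three identities is \<open>pairing_U0\<close>,
  \<open>pairing_V\<close> and \<open>pairing\<close>.\<close>

definition u :: "'v \<times> real \<Rightarrow> complex" where "u x = V x - U0 x"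

text \<open>\<open>W\<close> does not involve \<open>f\<close> or \<open>N\<close>, which makes the constant \<open>CU\<close> below uniform over all sources.\<close>

definition W :: "'v \<Rightarrow> real" where "W \<eta> = exp (k\<^sup>2) * (2 * R * exp (2 * R * k)) * vol * exp (2 * R * norm \<eta> - (norm \<eta>)\<^sup>2)"

lemma W_nonneg: "W \<eta> \<ge> 0" unfolding W_def vol_def using R by simp

lemma W_eq: "exp (- ((norm \<eta>)\<^sup>2 - k\<^sup>2)) * pb \<eta> = N * W \<eta>"
  unfolding W_def pb_def by (simp add: exp_diff exp_minus exp_add distrib_left field_simps)

lemma W_integrable: "integrable lborel W"
  unfolding W_def by (intro integrable_mult_right integrable_exp_norm_gauss)

lemma WP_bound: "norm (complex_of_real (exp (- ((norm \<eta>)\<^sup>2 - k\<^sup>2))) * P \<eta> s) \<le> N * W \<eta> * indicator {-R..R} s"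
proof -
  have "norm (complex_of_real (exp (- ((norm \<eta>)\<^sup>2 - k\<^sup>2))) * P \<eta> s) \<le> exp (- ((norm \<eta>)\<^sup>2 - k\<^sup>2)) * (indicator {-R..R} s * pb \<eta>)"
    using P_bound[of \<eta> s] by (simp add: norm_mult mult_left_mono)
  also have "\<dots> = N * W \<eta> * indicator {-R..R} s" using W_eq[of \<eta>] by (simp add: mult_ac)
  finally show ?thesis .
qed

lemma integrable_WP:
  assumes m: "(\<lambda>p. G (fst p) (snd p)) \<in> borel_measurable borel"
    and G: "\<And>\<eta> s. s \<in> {-R..R} \<Longrightarrow> norm (G \<eta> s :: complex) \<le> B"
  shows "integrable lborel (\<lambda>p. G (fst p) (snd p) * (complex_of_real (exp (- ((norm (fst p))\<^sup>2 - k\<^sup>2))) * P (fst p) (snd p)))"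
proof -
  have "(0::real) \<in> {-R..R}" using R by simp
  from order_trans[OF norm_ge_zero G[OF this]] have B: "B \<ge> 0" .
  define h where "h \<eta> s = B * (N * W \<eta> * indicator {-R..R} s)" for \<eta> :: 'v and s :: real
  have h: "integrable lborel (\<lambda>p. h (fst p) (snd p))"
  proof (rule lborel_integrable_iterated[where g=h and B="\<lambda>\<eta>. B * N * (2 * R) * W \<eta>"])
    show "integrable lborel (\<lambda>\<eta>. B * N * (2 * R) * W \<eta>)" by (intro integrable_mult_right W_integrable)
    show "(\<lambda>p. h (fst p) (snd p)) \<in> borel_measurable borel" unfolding h_def W_def by measurable
    fix \<eta>
    show "integrable lborel (h \<eta>)"
      unfolding h_def by (intro integrable_mult_right integrable_real_indicator) (use R in auto)
    have "(\<lambda>s. norm (h \<eta> s)) = (\<lambda>s. B * N * W \<eta> * indicator {-R..R} s)"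
      using B N W_nonneg[of \<eta>] by (auto simp: h_def abs_mult fun_eq_iff)
    then show "(\<integral>s. norm (h \<eta> s) \<partial>lborel) \<le> B * N * (2 * R) * W \<eta>"
      using R by simp
  qed
  show ?thesis
  proof (rule Bochner_Integration.integrable_bound[OF h])
    show "AE p in lborel. norm (G (fst p) (snd p) * (complex_of_real (exp (- ((norm (fst p))\<^sup>2 - k\<^sup>2))) * P (fst p) (snd p)))
        \<le> norm (h (fst p) (snd p))"
    proof (intro AE_I2)
      fix p
      show "norm (G (fst p) (snd p) * (complex_of_real (exp (- ((norm (fst p))\<^sup>2 - k\<^sup>2))) * P (fst p) (snd p))) \<le> norm (h (fst p) (snd p))"
      proof (cases "snd p \<in> {-R..R}")
        case True
        have "norm (G (fst p) (snd p) * (complex_of_real (exp (- ((norm (fst p))\<^sup>2 - k\<^sup>2))) * P (fst p) (snd p))) \<le> h (fst p) (snd p)"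
          unfolding norm_mult[of "G _ _"] h_def by (intro mult_mono WP_bound G True) (use B in auto)
        then show ?thesis by simp
      qed (simp add: P_def)
    qed
    show "(\<lambda>p. G (fst p) (snd p) * (complex_of_real (exp (- ((norm (fst p))\<^sup>2 - k\<^sup>2))) * P (fst p) (snd p))) \<in> borel_measurable lborel"
      using m by measurable
  qed
qed

lemma Vint_alt: "Vint x \<eta> s = (cis (\<eta> \<bullet> fst x) * complex_of_real (heat 1 (snd x - s))) * (complex_of_real (exp (- ((norm \<eta>)\<^sup>2 - k\<^sup>2))) * P \<eta> s)"
  by (simp add: Vint_def mult_ac)

lemma Vint_integrable: "integrable lborel (\<lambda>p. Vint x (fst p) (snd p))"
  unfolding Vint_alt by (rule integrable_WP[where B=1]) (auto simp: norm_mult heat_nonneg heat_1_le)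

definition K0 :: "'v \<times> real \<Rightarrow> real \<Rightarrow> 'v \<times> real \<Rightarrow> complex" where
  "K0 x t y = indicator {0..1} t *\<^sub>R (complex_of_real (exp (k\<^sup>2 * t)) * (f y * complex_of_real (heat t (x - y))))"

lemma K0_measurable [measurable (raw)]:
  assumes [measurable]: "g1 \<in> borel_measurable M" "g2 \<in> borel_measurable M" "g3 \<in> borel_measurable M"
  shows "(\<lambda>p. K0 (g1 p) (g2 p) (g3 p)) \<in> borel_measurable M"
  unfolding K0_def by measurable

lemma U0_alt: "U0 x = (\<integral>t. \<integral>y. K0 x t y \<partial>lborel \<partial>lborel)"
  unfolding U0_def K0_def by simp

lemma f_heat_integrable: assumes "t > 0" shows "integrable lborel (\<lambda>y. f y * complex_of_real (heat t (x - y)))"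
proof (rule Bochner_Integration.integrable_bound)
  show "integrable lborel (\<lambda>y. N * heat t (x - y))" by (intro integrable_mult_right integrable_heat_shift assms)
  show "AE y in lborel. norm (f y * complex_of_real (heat t (x - y))) \<le> norm (N * heat t (x - y))"
    using f_bound N by (intro AE_I2) (auto simp: norm_mult heat_nonneg intro!: mult_right_mono)
qed measurable

lemma K0_norm_integral:
  "integrable lborel (K0 x t)" "(\<integral>y. norm (K0 x t y) \<partial>lborel) \<le> indicator {0..1} t * (exp (k\<^sup>2) * N)"
proof -
  have "integrable lborel (\<lambda>y. K0 x t y) \<and> (\<integral>y. norm (K0 x t y) \<partial>lborel) \<le> indicator {0..1} t * (exp (k\<^sup>2) * N)"
  proof (cases "0 < t \<and> t \<le> 1")
    case True
    then have t: "t > 0" by simp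
    have i: "integrable lborel (\<lambda>y. K0 x t y)" unfolding K0_def by (intro integrable_scaleR_right integrable_mult_right f_heat_integrable t)
    have e: "exp (k\<^sup>2 * t) \<le> exp (k\<^sup>2)" using True by (simp add: mult_left_le)
    have "(\<integral>y. norm (K0 x t y) \<partial>lborel) \<le> (\<integral>y. exp (k\<^sup>2) * N * heat t (x - y) \<partial>lborel)"
    proof (intro integral_mono integrable_norm i integrable_mult_right integrable_heat_shift t)
      fix y
      have "norm (K0 x t y) = exp (k\<^sup>2 * t) * norm (f y) * heat t (x - y)" using True by (simp add: K0_def norm_mult heat_nonneg)
      also have "\<dots> \<le> exp (k\<^sup>2) * N * heat t (x - y)" using e f_bound[of y] N by (intro mult_mono heat_nonneg) auto
      finally show "norm (K0 x t y) \<le> exp (k\<^sup>2) * N * heat t (x - y)" .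
    qed
    also have "\<dots> = exp (k\<^sup>2) * N" by (simp add: integral_heat_shift[OF t])
    finally show ?thesis using True i by simp
  next
    case False
    then have "K0 x t = (\<lambda>y. 0)" by (cases "t = 0") (auto simp: K0_def heat_def indicator_def fun_eq_iff)
    then show ?thesis using N by simp
  qed
  then show "integrable lborel (\<lambda>y. K0 x t y)" "(\<integral>y. norm (K0 x t y) \<partial>lborel) \<le> indicator {0..1} t * (exp (k\<^sup>2) * N)" by auto
qed

lemma K0_integrable: "integrable lborel (\<lambda>p. K0 x (fst p) (snd p))"
proof (rule lborel_integrable_iterated[where g="K0 x" and B="\<lambda>t. indicator {0..1} t * (exp (k\<^sup>2) * N)"])
  show "integrable lborel (\<lambda>t::real. indicator {0..1} t * (exp (k\<^sup>2) * N))"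
    by (intro integrable_mult_left integrable_real_indicator) auto
qed (use K0_norm_integral in auto)

text \<open>On this sphere \<open>lam\<close> vanishes and the solution formula degenerates; a
  sphere is a null set, so it may be left out of the frequency integrals.\<close>

lemma AE_norm_neq_k: "AE \<eta> in lborel. norm (\<eta>::'v) \<noteq> k"
proof -
  have "sphere (0::'v) k \<in> null_sets lebesgue" using negligible_sphere[of "0::'v" k] by (simp add: negligible_iff_null_sets)
  then have "sphere (0::'v) k \<in> null_sets lborel" by (simp add: null_sets_completion_iff)
  then have "AE \<eta> in lborel. \<eta> \<notin> sphere (0::'v) k" by (rule AE_not_in)
  then show ?thesis by simp
qed

text \<open>Above the source \<open>V\<close> and \<open>U0\<close> are the same absolutely
  convergent integral over time, source point and frequency, taken in two orders. Frequency first is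
  Gaussian Fourier inversion and gives the kernel of \<open>U0\<close>; time and source point first
  is \<open>P_time\<close> and gives \<open>V\<close>.\<close>

lemma u_zero_top:
  assumes x: "snd x > R + 1"
  shows "u x = 0"
proof -
  define c where "c = (2 * pi) ^ DIM('v)"
  have c0: "c > 0" by (simp add: c_def)
  \<comment> \<open>The common integrand: the kernel of \<open>U0\<close> with its horizontal factor
    written as a Fourier integral over \<eta>.\<close>
  define Q where "Q p \<eta> = indicator {0..1} (fst p) *\<^sub>R (complex_of_real (exp (- ((norm \<eta>)\<^sup>2 - k\<^sup>2) * fst p)) *
      (f (snd p) * (cis (\<eta> \<bullet> (fst x - fst (snd p))) * complex_of_real (heat (fst p) (snd x - snd (snd p))))))" for p :: "real \<times> ('v \<times> real)" and \<eta> :: 'v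
  have sx: "1 \<le> \<bar>snd x - snd y\<bar>" if "norm y \<le> R" for y :: "'v \<times> real"
    using norm_snd_le[of "snd y" "fst y"] that x by auto
  obtain C where C: "C \<ge> 0" "\<And>t s. 0 < t \<Longrightarrow> t \<le> 1 \<Longrightarrow> 1 \<le> \<bar>s\<bar> \<Longrightarrow> (pi / t) powr (real DIM('v) / 2) * heat t (s::real) \<le> C"
    using heat_gauss_bounded[of "DIM('v)"] by blast
  obtain C' where C': "C' \<ge> 0" "\<And>t s. 0 < t \<Longrightarrow> t \<le> 1 \<Longrightarrow> 1 \<le> \<bar>s\<bar> \<Longrightarrow> heat t s \<le> C' * t \<and> \<bar>heat2 t s\<bar> \<le> C' * (s\<^sup>2 + 1)"
    using heat_time_zero by blast
  have Qm: "(\<lambda>p. Q (fst p) (snd p)) \<in> borel_measurable borel" unfolding Q_def by measurable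
  have Q0: "Q p \<eta> = 0" if "\<not> (0 < fst p \<and> fst p \<le> 1 \<and> norm (snd p) \<le> R)" for p \<eta>
    using that f_supp[of "snd p"] by (cases "fst p = 0") (auto simp: Q_def heat_def indicator_def)
  have Qe: "Q p \<eta> = (complex_of_real (exp (k\<^sup>2 * fst p)) * f (snd p) * complex_of_real (heat (fst p) (snd x - snd (snd p)))) *
       (cis (\<eta> \<bullet> (fst x - fst (snd p))) * complex_of_real (exp (- fst p * (norm \<eta>)\<^sup>2)))" if "0 < fst p \<and> fst p \<le> 1" for p \<eta>
  proof -
    have "exp (- ((norm \<eta>)\<^sup>2 - k\<^sup>2) * fst p) = exp (k\<^sup>2 * fst p) * exp (- fst p * (norm \<eta>)\<^sup>2)"
      by (simp add: exp_add[symmetric] algebra_simps)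
    then show ?thesis using that by (simp add: Q_def mult_ac)
  qed
  have Qi: "integrable lborel (\<lambda>p. Q (fst p) (snd p))"
  proof (rule lborel_integrable_iterated[where g=Q, OF Qm, where B="\<lambda>p. indicator (cball 0 (1 + R)) p *\<^sub>R (exp (k\<^sup>2) * N * C)"])
    show "integrable lborel (\<lambda>p :: real \<times> ('v \<times> real). indicator (cball 0 (1 + R)) p *\<^sub>R (exp (k\<^sup>2) * N * C))"
      by (intro borel_integrable_compact) auto
    fix p :: "real \<times> ('v \<times> real)"
    have "integrable lborel (Q p) \<and> (\<integral>\<eta>. norm (Q p \<eta>) \<partial>lborel) \<le> indicator (cball 0 (1 + R)) p *\<^sub>R (exp (k\<^sup>2) * N * C)"
    proof (cases "0 < fst p \<and> fst p \<le> 1 \<and> norm (snd p) \<le> R")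
      case True
      then have t: "fst p > 0" "0 < fst p \<and> fst p \<le> 1" by auto
      have i: "integrable lborel (Q p)"
        unfolding Qe[OF t(2), abs_def] by (intro integrable_mult_right fourier_gauss t)
      have g: "(\<integral>\<eta>. exp (- fst p * (norm (\<eta>::'v))\<^sup>2) \<partial>lborel) = (pi / fst p) powr (real DIM('v) / 2)"
      proof -
        have "complex_of_real (\<integral>\<eta>. exp (- fst p * (norm (\<eta>::'v))\<^sup>2) \<partial>lborel) = complex_of_real ((pi / fst p) powr (real DIM('v) / 2))"
          using fourier_gauss(2)[OF t(1), of "0::'v"] by simp
        then show ?thesis by (simp only: of_real_eq_iff)
      qed
      have "(\<integral>\<eta>. norm (Q p \<eta>) \<partial>lborel) = exp (k\<^sup>2 * fst p) * norm (f (snd p)) * ((pi / fst p) powr (real DIM('v) / 2) * heat (fst p) (snd x - snd (snd p)))"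
        unfolding Qe[OF t(2)] norm_mult using g by (simp add: heat_nonneg)
      also have "\<dots> \<le> exp (k\<^sup>2) * N * C"
        using C(2)[OF t(1) _ sx] True f_bound[of "snd p"] N C(1)
        by (intro mult_mono) (auto simp: mult_left_le heat_nonneg)
      also have "norm p \<le> 1 + R"
        using norm_Pair_le[of "fst p" "snd p"] True by simp
      then have "exp (k\<^sup>2) * N * C = indicator (cball 0 (1 + R)) p *\<^sub>R (exp (k\<^sup>2) * N * C)" by simp
      finally show ?thesis using i by simp
    next
      case False
      then have "Q p = (\<lambda>\<eta>. 0)" using Q0 by blast
      then show ?thesis using N C by simp
    qed
    then show "integrable lborel (Q p)" "(\<integral>\<eta>. norm (Q p \<eta>) \<partial>lborel) \<le> indicator (cball 0 (1 + R)) p *\<^sub>R (exp (k\<^sup>2) * N * C)" by auto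
  qed
  have inner_p: "(\<integral>\<eta>. Q p \<eta> \<partial>lborel) = complex_of_real c * K0 x (fst p) (snd p)" for p
  proof (cases "0 < fst p \<and> fst p \<le> 1")
    case True
    then have t: "fst p > 0" by simp
    have "(\<integral>\<eta>. Q p \<eta> \<partial>lborel) = (complex_of_real (exp (k\<^sup>2 * fst p)) * f (snd p) * complex_of_real (heat (fst p) (snd x - snd (snd p)))) *
       complex_of_real (c * heat (fst p) (fst x - fst (snd p)))"
      unfolding Qe[OF True] integral_mult_right_zero fourier_heat[OF t] c_def ..
    then show ?thesis using True by (simp add: K0_def heat_pair[OF t])
  next
    case False
    then have "Q p = (\<lambda>\<eta>. 0)" using Q0 by blast
    moreover have "K0 x (fst p) (snd p) = 0" using False by (cases "fst p = 0") (auto simp: K0_def heat_def indicator_def)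
    ultimately show ?thesis by simp
  qed
  have inner_\<eta>: "(\<integral>p. Q p \<eta> \<partial>lborel) = (\<integral>s. Vint x \<eta> s \<partial>lborel)" if \<eta>: "norm \<eta> \<noteq> k" for \<eta>
  proof -
    have "integrable lborel (\<lambda>p. Q (fst p, snd p) \<eta>)"
    proof (rule integrable_bounded_support[where r="1 + R" and B="exp \<bar>(norm \<eta>)\<^sup>2 - k\<^sup>2\<bar> * (N * C')"])
      show "(\<lambda>p. Q (fst p, snd p) \<eta>) \<in> borel_measurable borel" unfolding Q_def by measurable
      fix p :: "real \<times> ('v \<times> real)"
      show "norm (Q (fst p, snd p) \<eta>) \<le> exp \<bar>(norm \<eta>)\<^sup>2 - k\<^sup>2\<bar> * (N * C')"
      proof (cases "0 < fst p \<and> fst p \<le> 1 \<and> norm (snd p) \<le> R")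
        case True
        have e: "exp (- ((norm \<eta>)\<^sup>2 - k\<^sup>2) * fst p) \<le> exp \<bar>(norm \<eta>)\<^sup>2 - k\<^sup>2\<bar>"
        proof -
          have "- ((norm \<eta>)\<^sup>2 - k\<^sup>2) * fst p \<le> \<bar>(norm \<eta>)\<^sup>2 - k\<^sup>2\<bar> * fst p" using True by (intro mult_right_mono) auto
          also have "\<dots> \<le> \<bar>(norm \<eta>)\<^sup>2 - k\<^sup>2\<bar>" using True by (simp add: mult_left_le)
          finally show ?thesis by simp
        qed
        have "heat (fst p) (snd x - snd (snd p)) \<le> C' * fst p" using C'(2) sx True by blast
        also have "\<dots> \<le> C'" using True C'(1) by (simp add: mult_left_le)
        finally have h: "heat (fst p) (snd x - snd (snd p)) \<le> C'" .
        have "norm (Q (fst p, snd p) \<eta>) = exp (- ((norm \<eta>)\<^sup>2 - k\<^sup>2) * fst p) * (norm (f (snd p)) * heat (fst p) (snd x - snd (snd p)))"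
          using True by (simp add: Q_def norm_mult heat_nonneg)
        also have "\<dots> \<le> exp \<bar>(norm \<eta>)\<^sup>2 - k\<^sup>2\<bar> * (N * C')"
          using f_bound[of "snd p"] h e N C'(1) by (intro mult_mono) (auto simp: heat_nonneg)
        finally show ?thesis .
      next
        case False
        then show ?thesis using Q0[of "(fst p, snd p)"] N C'(1) by simp
      qed
      assume "norm p > 1 + R"
      then have "\<bar>fst p\<bar> + norm (snd p) > 1 + R" using norm_Pair_le[of "fst p" "snd p"] by simp
      then have "\<not> (0 < fst p \<and> fst p \<le> 1 \<and> norm (snd p) \<le> R)" by auto
      then show "Q (fst p, snd p) \<eta> = 0" using Q0[of "(fst p, snd p)"] by simp
    qed
    from lborel_iterated[OF this] have "(\<integral>p. Q p \<eta> \<partial>lborel) = (\<integral>t. \<integral>y. Q (t, y) \<eta> \<partial>lborel \<partial>lborel)" by simp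
    also have "\<dots> = (\<integral>t. cis (\<eta> \<bullet> fst x) * (indicator {0..1} t *\<^sub>R (complex_of_real (exp (- ((norm \<eta>)\<^sup>2 - k\<^sup>2) * t)) *
            (\<integral>y. f y * (cis (- (\<eta> \<bullet> fst y)) * complex_of_real (heat t (snd x - snd y))) \<partial>lborel))) \<partial>lborel)"
    proof (intro Bochner_Integration.integral_cong refl)
      fix t
      have "Q (t, y) \<eta> = (cis (\<eta> \<bullet> fst x) * (indicator {0..1} t *\<^sub>R complex_of_real (exp (- ((norm \<eta>)\<^sup>2 - k\<^sup>2) * t)))) *
          (f y * (cis (- (\<eta> \<bullet> fst y)) * complex_of_real (heat t (snd x - snd y))))" for y
        by (simp add: Q_def inner_diff_right cis_mult[symmetric] cis_divide[symmetric] scaleR_conv_of_real divide_inverse cis_inverse mult_ac)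
      then have "(\<integral>y. Q (t, y) \<eta> \<partial>lborel) = (cis (\<eta> \<bullet> fst x) * (indicator {0..1} t *\<^sub>R complex_of_real (exp (- ((norm \<eta>)\<^sup>2 - k\<^sup>2) * t)))) *
          (\<integral>y. f y * (cis (- (\<eta> \<bullet> fst y)) * complex_of_real (heat t (snd x - snd y))) \<partial>lborel)"
        by (simp only: integral_mult_right_zero)
      then show "(\<integral>y. Q (t, y) \<eta> \<partial>lborel) = cis (\<eta> \<bullet> fst x) * (indicator {0..1} t *\<^sub>R (complex_of_real (exp (- ((norm \<eta>)\<^sup>2 - k\<^sup>2) * t)) *
            (\<integral>y. f y * (cis (- (\<eta> \<bullet> fst y)) * complex_of_real (heat t (snd x - snd y))) \<partial>lborel)))"
        by (simp add: scaleR_conv_of_real mult_ac)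
    qed
    also have "\<dots> = cis (\<eta> \<bullet> fst x) * (complex_of_real (exp (- ((norm \<eta>)\<^sup>2 - k\<^sup>2))) * (\<integral>s. complex_of_real (heat 1 (snd x - s)) * P \<eta> s \<partial>lborel))"
      unfolding integral_mult_right_zero P_time[OF \<eta> x] ..
    also have "\<dots> = (\<integral>s. Vint x \<eta> s \<partial>lborel)"
    proof -
      have "Vint x \<eta> s = (cis (\<eta> \<bullet> fst x) * complex_of_real (exp (- ((norm \<eta>)\<^sup>2 - k\<^sup>2)))) * (complex_of_real (heat 1 (snd x - s)) * P \<eta> s)" for s
        by (simp add: Vint_def mult_ac)
      then show ?thesis by (simp only: integral_mult_right_zero mult.assoc)
    qed
    finally show ?thesis .
  qed
  have "complex_of_real c * V x = (\<integral>\<eta>. \<integral>s. Vint x \<eta> s \<partial>lborel \<partial>lborel)"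
    using c0 by (simp add: V_def c_def)
  also have "\<dots> = (\<integral>\<eta>. \<integral>p. Q p \<eta> \<partial>lborel \<partial>lborel)"
  proof (rule integral_cong_AE)
    show "AE \<eta> in lborel. (\<integral>s. Vint x \<eta> s \<partial>lborel) = (\<integral>p. Q p \<eta> \<partial>lborel)"
      using AE_norm_neq_k by eventually_elim (simp add: inner_\<eta>)
    show "(\<lambda>\<eta>. \<integral>s. Vint x \<eta> s \<partial>lborel) \<in> borel_measurable lborel"
      using lborel_integrable_fst[OF Vint_integrable] borel_measurable_integrable by blast
    show "(\<lambda>\<eta>. \<integral>p. Q p \<eta> \<partial>lborel) \<in> borel_measurable lborel"
      using lborel_integrable_snd[OF Qi] borel_measurable_integrable by blast
  qed
  also have "\<dots> = (\<integral>p. \<integral>\<eta>. Q p \<eta> \<partial>lborel \<partial>lborel)" by (rule lborel_Fubini[OF Qi, symmetric])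
  also have "\<dots> = complex_of_real c * (\<integral>p. K0 x (fst p) (snd p) \<partial>lborel)"
    unfolding inner_p by (rule integral_mult_right_zero)
  also have "(\<integral>p. K0 x (fst p) (snd p) \<partial>lborel) = U0 x"
    unfolding U0_alt by (rule lborel_iterated[OF K0_integrable])
  finally show ?thesis using c0 by (simp add: u_def)
qed

section \<open>Vertical second differences of the wave field\<close>

definition CU :: real where
  "CU = (\<integral>\<eta>. W \<eta> \<partial>lborel) / (2 * pi) ^ DIM('v) + 4 * exp (k\<^sup>2)"

lemma one_minus_exp_le: "4 * (1 - exp (- (a::real))) \<le> 4 * a" using exp_ge_add_one_self[of "- a"] by simp

text \<open>The shift is vertical, so it acts on the factor \<open>heat 1\<close> only, while the
  plane wave in \<open>x'\<close> keeps modulus 1. The bound for the kernel at time 1 already gives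
  the clean order \<open>v\<^sup>2\<close>.\<close>

lemma V_second_difference:
  "norm (V (x + (0, v)) + V (x - (0, v)) - 2 * V x) \<le> N * ((\<integral>\<eta>. W \<eta> \<partial>lborel) / (2 * pi) ^ DIM('v)) * v\<^sup>2"
proof -
  define c where "c = (2 * pi) ^ DIM('v)"
  have c0: "c > 0" by (simp add: c_def)
  let ?D = "\<lambda>s. heat 1 (snd x + v - s) + heat 1 (snd x - v - s) - 2 * heat 1 (snd x - s)"
  have D: "integrable lborel ?D" "(\<integral>s. \<bar>?D s\<bar> \<partial>lborel) \<le> v\<^sup>2"
    using heat_second_difference[of 1 "snd x" v] one_minus_exp_le[of "(norm v)\<^sup>2 / 4"] by auto
  define q where "q \<eta> s = Vint (x + (0, v)) \<eta> s + Vint (x - (0, v)) \<eta> s - 2 * Vint x \<eta> s" for \<eta> s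
  have qi: "integrable lborel (\<lambda>p. q (fst p) (snd p))"
    unfolding q_def by (intro Bochner_Integration.integrable_add Bochner_Integration.integrable_diff integrable_mult_right Vint_integrable)
  have qe: "q \<eta> s = (cis (\<eta> \<bullet> fst x) * complex_of_real (?D s)) * (complex_of_real (exp (- ((norm \<eta>)\<^sup>2 - k\<^sup>2))) * P \<eta> s)" for \<eta> s
    unfolding q_def Vint_alt by (simp add: algebra_simps)
  have qb: "norm (q \<eta> s) \<le> N * W \<eta> * \<bar>?D s\<bar>" for \<eta> s
  proof -
    have "norm (q \<eta> s) = \<bar>?D s\<bar> * norm (complex_of_real (exp (- ((norm \<eta>)\<^sup>2 - k\<^sup>2))) * P \<eta> s)"
      unfolding qe by (simp only: norm_mult norm_cis norm_of_real mult_1_left)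
    also have "\<dots> \<le> \<bar>?D s\<bar> * (N * W \<eta>)"
      using order_trans[OF WP_bound[of \<eta> s], of "N * W \<eta>"] N W_nonneg[of \<eta>]
      by (intro mult_left_mono) (auto simp: indicator_def)
    finally show ?thesis by (simp add: mult_ac)
  qed
  have "complex_of_real c * (V (x + (0, v)) + V (x - (0, v)) - 2 * V x) =
     (\<integral>\<eta>. \<integral>s. Vint (x + (0, v)) \<eta> s \<partial>lborel \<partial>lborel) + (\<integral>\<eta>. \<integral>s. Vint (x - (0, v)) \<eta> s \<partial>lborel \<partial>lborel) - 2 * (\<integral>\<eta>. \<integral>s. Vint x \<eta> s \<partial>lborel \<partial>lborel)"
    using c0 by (simp add: V_def c_def field_simps)
  also have "\<dots> = (\<integral>p. q (fst p) (snd p) \<partial>lborel)"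
    unfolding q_def lborel_iterated[OF Vint_integrable, symmetric] by (simp add: Vint_integrable)
  also have "norm \<dots> \<le> (\<integral>p. norm (q (fst p) (snd p)) \<partial>lborel)" by (rule integral_norm_bound)
  also have "\<dots> = (\<integral>\<eta>. \<integral>s. norm (q \<eta> s) \<partial>lborel \<partial>lborel)"
    using lborel_iterated[of "\<lambda>\<eta> s. norm (q \<eta> s)"] qi by simp
  also have "\<dots> \<le> (\<integral>\<eta>. N * v\<^sup>2 * W \<eta> \<partial>lborel)"
  proof (rule integral_mono_AE)
    show "integrable lborel (\<lambda>\<eta>. \<integral>s. norm (q \<eta> s) \<partial>lborel)"
      using lborel_integrable_fst[of "\<lambda>\<eta> s. norm (q \<eta> s)"] qi by simp
    show "integrable lborel (\<lambda>\<eta>. N * v\<^sup>2 * W \<eta>)" by (intro integrable_mult_right W_integrable)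
    show "AE \<eta> in lborel. (\<integral>s. norm (q \<eta> s) \<partial>lborel) \<le> N * v\<^sup>2 * W \<eta>"
      using lborel_AE_integrable[OF qi]
    proof eventually_elim
      case (elim \<eta>)
      have "(\<integral>s. norm (q \<eta> s) \<partial>lborel) \<le> (\<integral>s. N * W \<eta> * \<bar>?D s\<bar> \<partial>lborel)"
        by (intro integral_mono integrable_norm elim integrable_mult_right integrable_abs D qb)
      also have "\<dots> = N * W \<eta> * (\<integral>s. \<bar>?D s\<bar> \<partial>lborel)" by (rule integral_mult_right_zero)
      also have "\<dots> \<le> N * W \<eta> * v\<^sup>2" using D(2) N W_nonneg[of \<eta>] by (intro mult_left_mono) auto
      finally show ?case by (simp add: mult_ac)
    qed
  qed
  also have "\<dots> = N * v\<^sup>2 * (\<integral>\<eta>. W \<eta> \<partial>lborel)" by (rule integral_mult_right_zero)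
  finally have "c * norm (V (x + (0, v)) + V (x - (0, v)) - 2 * V x) \<le> N * v\<^sup>2 * (\<integral>\<eta>. W \<eta> \<partial>lborel)"
    using c0 by (simp add: norm_mult)
  then show ?thesis using c0 unfolding c_def[symmetric] by (simp add: field_simps)
qed

text \<open>The time integral is split at \<open>v\<^sup>2\<close>. Before that time the second
  difference of the kernel has mass at most 4, afterwards at most \<open>v\<^sup>2 / t\<close>;
  integrating \<open>v\<^sup>2 / t\<close> up to time 1 is the origin of the logarithm.\<close>

lemma U0_second_difference:
  assumes v: "0 < v" "v \<le> 1"
  shows "norm (U0 (x + (0, v)) + U0 (x - (0, v)) - 2 * U0 x) \<le> N * (4 * exp (k\<^sup>2)) * (v\<^sup>2 * (1 + ln (1 / v)))"
proof -
  let ?e = "(0::'v, v)"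
  define D where "D t y = heat t (x + ?e - y) + heat t (x - ?e - y) - 2 * heat t (x - y)" for t y
  have ne: "norm ?e = v" using v by (simp add: norm_prod_def)
  define J where "J t = (\<integral>y. K0 (x + ?e) t y \<partial>lborel) + (\<integral>y. K0 (x - ?e) t y \<partial>lborel) - 2 * (\<integral>y. K0 x t y \<partial>lborel)" for t
  have Ji: "integrable lborel J"
    unfolding J_def by (intro Bochner_Integration.integrable_add Bochner_Integration.integrable_diff integrable_mult_right lborel_integrable_fst[OF K0_integrable])
  have "U0 (x + ?e) + U0 (x - ?e) - 2 * U0 x = (\<integral>t. J t \<partial>lborel)"
    unfolding J_def U0_alt by (simp add: lborel_integrable_fst[OF K0_integrable])
  define m where "m t = exp (k\<^sup>2) * N * (4 * indicator {0..v\<^sup>2} t + (v\<^sup>2 / t) * indicator {v\<^sup>2..1} t)" for t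
  have v2: "v\<^sup>2 \<le> 1" "0 < v\<^sup>2" using v by (auto simp: power_le_one)
  have lni: "has_bochner_integral lborel (\<lambda>t. (v\<^sup>2 / t) * indicator {v\<^sup>2..1} t) (v\<^sup>2 * ln 1 - v\<^sup>2 * ln (v\<^sup>2))"
    using v2 less_le_trans[OF v2(2)]
    by (intro has_bochner_integral_FTC_Icc_real[where F="\<lambda>t. v\<^sup>2 * ln t"]) (auto intro!: derivative_eq_intros continuous_intros)
  have mi: "has_bochner_integral lborel m (exp (k\<^sup>2) * N * (4 * v\<^sup>2 + (v\<^sup>2 * ln 1 - v\<^sup>2 * ln (v\<^sup>2))))"
    unfolding m_def
  proof (intro has_bochner_integral_mult_right has_bochner_integral_add lni)
    show "has_bochner_integral lborel (\<lambda>t. indicator {0..v\<^sup>2} t :: real) (v\<^sup>2)"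
      using v2 has_bochner_integral_real_indicator[of "{0..v\<^sup>2}" lborel] by simp
  qed
  have Jb: "norm (J t) \<le> m t" for t
  proof (cases "0 < t \<and> t \<le> 1")
    case True
    then have t: "t > 0" by simp
    have "J t = complex_of_real (exp (k\<^sup>2 * t)) * (\<integral>y. f y * complex_of_real (D t y) \<partial>lborel)"
      unfolding J_def K0_def D_def using True
      by (simp add: distrib_left right_diff_distrib mult.left_commute[of _ 2] f_heat_integrable[OF t])
    moreover have "norm (\<integral>y. f y * complex_of_real (D t y) \<partial>lborel) \<le> N * (4 * (1 - exp (- v\<^sup>2 / (4 * t))))"
    proof -
      note sd = heat_second_difference[OF t, of x ?e, folded D_def, unfolded ne]
      have "norm (\<integral>y. f y * complex_of_real (D t y) \<partial>lborel) \<le> (\<integral>y. N * \<bar>D t y\<bar> \<partial>lborel)"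
      proof (rule Bochner_Integration.integral_norm_bound_integral)
        show "integrable lborel (\<lambda>y. N * \<bar>D t y\<bar>)" by (intro integrable_mult_right integrable_abs sd)
        show b: "norm (f y * complex_of_real (D t y)) \<le> N * \<bar>D t y\<bar>" for y
          using f_bound[of y] by (auto simp: norm_mult intro: mult_right_mono)
        show "integrable lborel (\<lambda>y. f y * complex_of_real (D t y))"
          unfolding D_def by (simp add: distrib_left right_diff_distrib mult.left_commute[of _ 2] f_heat_integrable[OF t])
      qed
      also have "\<dots> = N * (\<integral>y. \<bar>D t y\<bar> \<partial>lborel)" by (rule integral_mult_right_zero)
      also have "\<dots> \<le> N * (4 * (1 - exp (- v\<^sup>2 / (4 * t))))" using sd(2) N by (intro mult_left_mono) auto
      finally show ?thesis .
    qed
    ultimately have "norm (J t) \<le> exp (k\<^sup>2 * t) * (N * (4 * (1 - exp (- v\<^sup>2 / (4 * t)))))"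
      by (simp add: norm_mult)
    also have "\<dots> \<le> exp (k\<^sup>2) * (N * (4 * (1 - exp (- v\<^sup>2 / (4 * t)))))"
      using True N by (intro mult_right_mono) (auto simp: mult_left_le)
    also have "4 * (1 - exp (- v\<^sup>2 / (4 * t))) \<le> 4 * indicator {0..v\<^sup>2} t + (v\<^sup>2 / t) * indicator {v\<^sup>2..1} t"
    proof (cases "t \<le> v\<^sup>2")
      case True
      have "4 * (1 - exp (- v\<^sup>2 / (4 * t))) \<le> 4" by simp
      also have "4 \<le> 4 * indicator {0..v\<^sup>2} t + (v\<^sup>2 / t) * indicator {v\<^sup>2..1} t" using t True by simp
      finally show ?thesis .
    next
      case False
      then show ?thesis using one_minus_exp_le[of "v\<^sup>2 / (4 * t)"] \<open>0 < t \<and> t \<le> 1\<close> by (simp add: indicator_def)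
    qed
    then have "exp (k\<^sup>2) * (N * (4 * (1 - exp (- v\<^sup>2 / (4 * t))))) \<le> m t"
      unfolding m_def mult.assoc using N by (intro mult_left_mono) auto
    finally show ?thesis .
  next
    case False
    then have "K0 z t = (\<lambda>y. 0)" for z by (cases "t = 0") (auto simp: K0_def heat_def indicator_def fun_eq_iff)
    then have "J t = 0" by (simp add: J_def)
    moreover have "m t \<ge> 0"
    proof (cases "v\<^sup>2 \<le> t")
      case True
      then have "t > 0" using v2 by linarith
      then show ?thesis unfolding m_def using N by simp
    next
      case False
      then show ?thesis unfolding m_def using N by simp
    qed
    ultimately show ?thesis by simp
  qed
  have "norm (\<integral>t. J t \<partial>lborel) \<le> (\<integral>t. m t \<partial>lborel)"
    by (intro Bochner_Integration.integral_norm_bound_integral Ji Jb) (use mi has_bochner_integral_iff in blast)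
  also have "\<dots> = exp (k\<^sup>2) * N * (4 * v\<^sup>2 + (v\<^sup>2 * ln 1 - v\<^sup>2 * ln (v\<^sup>2)))"
    using mi has_bochner_integral_iff by blast
  also have "\<dots> = exp (k\<^sup>2) * N * (4 * v\<^sup>2 + 2 * (v\<^sup>2 * ln (1 / v)))"
    using v by (simp add: ln_div ln_realpow)
  also have "\<dots> \<le> exp (k\<^sup>2) * N * (4 * v\<^sup>2 + 4 * (v\<^sup>2 * ln (1 / v)))"
    using v N by (intro mult_left_mono add_left_mono mult_right_mono) auto
  also have "\<dots> = N * (4 * exp (k\<^sup>2)) * (v\<^sup>2 * (1 + ln (1 / v)))" by (simp add: algebra_simps)
  finally show ?thesis unfolding \<open>U0 (x + ?e) + U0 (x - ?e) - 2 * U0 x = (\<integral>t. J t \<partial>lborel)\<close> .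
qed

lemma CU_nonneg: "CU \<ge> 0" unfolding CU_def using W_nonneg by (simp add: integral_nonneg)

lemma u_second_difference:
  assumes v: "0 < v" "v \<le> 1"
  shows "norm (u (x + (0, v)) + u (x - (0, v)) - 2 * u x) \<le> N * CU * (v\<^sup>2 * (1 + ln (1 / v)))"
proof -
  let ?I = "(\<integral>\<eta>. W \<eta> \<partial>lborel) / (2 * pi) ^ DIM('v)"
  have I0: "?I \<ge> 0" using W_nonneg by (simp add: integral_nonneg)
  have "norm (u (x + (0, v)) + u (x - (0, v)) - 2 * u x) \<le> norm (V (x + (0, v)) + V (x - (0, v)) - 2 * V x) + norm (U0 (x + (0, v)) + U0 (x - (0, v)) - 2 * U0 x)"
    using norm_triangle_ineq4[of "V (x + (0, v)) + V (x - (0, v)) - 2 * V x" "U0 (x + (0, v)) + U0 (x - (0, v)) - 2 * U0 x"]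
    by (simp add: u_def algebra_simps)
  also have "\<dots> \<le> N * ?I * v\<^sup>2 + N * (4 * exp (k\<^sup>2)) * (v\<^sup>2 * (1 + ln (1 / v)))"
    by (intro add_mono V_second_difference U0_second_difference v)
  also have "N * ?I * v\<^sup>2 \<le> N * ?I * (v\<^sup>2 * (1 + ln (1 / v)))"
  proof (intro mult_left_mono mult_nonneg_nonneg N I0)
    have "0 \<le> ln (1 / v)" using v by simp
    then show "v\<^sup>2 \<le> v\<^sup>2 * (1 + ln (1 / v))"
      using mult_left_mono[of 1 "1 + ln (1 / v)" "v\<^sup>2"] by simp
  qed
  finally show ?thesis by (simp add: CU_def algebra_simps)
qed

end

section \<open>The weak Helmholtz equation\<close>

definition heat_dir1 :: "real \<Rightarrow> 'a::euclidean_space \<Rightarrow> 'a \<Rightarrow> real" where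
  "heat_dir1 t v z = - (z \<bullet> v) / (2 * t) * heat t z"
definition heat_dir2 :: "real \<Rightarrow> 'a::euclidean_space \<Rightarrow> 'a \<Rightarrow> real" where
  "heat_dir2 t v z = ((z \<bullet> v)\<^sup>2 / (4 * t\<^sup>2) - (v \<bullet> v) / (2 * t)) * heat t z"
definition heat_dt :: "real \<Rightarrow> 'a::euclidean_space \<Rightarrow> real" where
  "heat_dt t z = ((norm z)\<^sup>2 / (4 * t\<^sup>2) - real DIM('a) / (2 * t)) * heat t z"

lemma heat_line:
  "heat t (z + \<tau> *\<^sub>R v :: 'a::euclidean_space) = (4 * pi * t) powr (- real DIM('a) / 2) * exp (- (z \<bullet> z + 2 * \<tau> * (z \<bullet> v) + \<tau>\<^sup>2 * (v \<bullet> v)) / (4 * t))"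
  unfolding heat_def power2_norm_eq_inner by (simp add: inner_simps inner_commute power2_eq_square algebra_simps)

lemma DERIV_heat_dir:
  fixes z v :: "'a::euclidean_space"
  assumes "t > 0"
  shows "((\<lambda>\<tau>. heat t (z + \<tau> *\<^sub>R v)) has_field_derivative heat_dir1 t v z) (at 0)"
    and "((\<lambda>\<tau>. heat_dir1 t v (z + \<tau> *\<^sub>R v)) has_field_derivative heat_dir2 t v z) (at 0)"
proof -
  have h0: "heat t z = (4 * pi * t) powr (- real DIM('a) / 2) * exp (- (z \<bullet> z) / (4 * t))"
    using heat_line[of t z 0 v] by simp
  show 1: "((\<lambda>\<tau>. heat t (z + \<tau> *\<^sub>R v)) has_field_derivative heat_dir1 t v z) (at 0)"
    unfolding heat_line heat_dir1_def h0 using assms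
    by (auto intro!: derivative_eq_intros simp: field_simps)
  have e: "heat_dir1 t v (z + \<tau> *\<^sub>R v) = - (z \<bullet> v + \<tau> * (v \<bullet> v)) / (2 * t) * heat t (z + \<tau> *\<^sub>R v)" for \<tau>
    by (simp add: heat_dir1_def inner_simps)
  have "((\<lambda>\<tau>. - (z \<bullet> v + \<tau> * (v \<bullet> v)) / (2 * t) * heat t (z + \<tau> *\<^sub>R v)) has_field_derivative
     - (z \<bullet> v + 0 * (v \<bullet> v)) / (2 * t) * heat_dir1 t v z + (- (v \<bullet> v) / (2 * t)) * heat t (z + 0 *\<^sub>R v)) (at 0)"
    using assms by (intro DERIV_mult' 1) (auto intro!: derivative_eq_intros)
  then show "((\<lambda>\<tau>. heat_dir1 t v (z + \<tau> *\<^sub>R v)) has_field_derivative heat_dir2 t v z) (at 0)"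
    unfolding e by (rule DERIV_cong) (use assms in \<open>simp add: heat_dir1_def heat_dir2_def field_simps power2_eq_square\<close>)
qed

lemma DERIV_heat_dt:
  fixes z :: "'a::euclidean_space"
  assumes "t > 0"
  shows "((\<lambda>t. heat t z) has_field_derivative heat_dt t z) (at t)"
proof -
  have p: "(4 * pi * t) powr (- real DIM('a) / 2 - 1) = (4 * pi * t) powr (- real DIM('a) / 2) / (4 * pi * t)"
    using assms by (simp add: powr_diff)
  have "((\<lambda>t. (4 * pi * t) powr (- real DIM('a) / 2)) has_field_derivative (- real DIM('a) / 2) * (4 * pi * t) powr (- real DIM('a) / 2 - 1) * (4 * pi)) (at t)"
  proof -
    have d: "((\<lambda>t. 4 * pi * t) has_field_derivative 4 * pi) (at t)"
      by (auto intro!: derivative_eq_intros)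
    show ?thesis using DERIV_chain2[OF has_real_derivative_powr d, of "- real DIM('a) / 2"] assms by simp
  qed
  moreover have "((\<lambda>t. exp (- (norm z)\<^sup>2 / (4 * t))) has_field_derivative exp (- (norm z)\<^sup>2 / (4 * t)) * ((norm z)\<^sup>2 / (4 * t\<^sup>2))) (at t)"
    using assms by (auto intro!: derivative_eq_intros simp: power2_eq_square)
  ultimately have "((\<lambda>t. heat t z) has_field_derivative
      (4 * pi * t) powr (- real DIM('a) / 2) * (exp (- (norm z)\<^sup>2 / (4 * t)) * ((norm z)\<^sup>2 / (4 * t\<^sup>2)))
      + (- real DIM('a) / 2) * (4 * pi * t) powr (- real DIM('a) / 2 - 1) * (4 * pi) * exp (- (norm z)\<^sup>2 / (4 * t))) (at t)"
    unfolding heat_def by (rule DERIV_mult')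
  then show ?thesis
    by (rule DERIV_cong) (use assms in \<open>unfold p heat_dt_def heat_def, simp add: field_simps\<close>)
qed

text \<open>The heat equation, in closed form.\<close>

lemma heat_dir2_sum: "(\<Sum>b\<in>Basis. heat_dir2 t b z) = heat_dt t (z::'a::euclidean_space)"
proof -
  have "(\<Sum>b\<in>Basis. heat_dir2 t b z) = (\<Sum>b\<in>Basis. (z \<bullet> b)\<^sup>2 / (4 * t\<^sup>2) - 1 / (2 * t)) * heat t z"
    unfolding heat_dir2_def sum_distrib_right by (intro sum.cong) auto
  also have "(\<Sum>b\<in>(Basis::'a set). (z \<bullet> b)\<^sup>2 / (4 * t\<^sup>2) - 1 / (2 * t)) = (norm z)\<^sup>2 / (4 * t\<^sup>2) - real DIM('a) / (2 * t)"
    unfolding norm_eq_sum_Basis sum_divide_distrib by (simp add: sum_subtractf)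
  finally show ?thesis by (simp add: heat_dt_def)
qed

lemma continuous_on_heat_comp:
  fixes b :: "'b::topological_space \<Rightarrow> 'a::euclidean_space"
  assumes "continuous_on S a" "continuous_on S b" "\<And>p. p \<in> S \<Longrightarrow> a p > 0"
  shows "continuous_on S (\<lambda>p. heat (a p) (b p))" "continuous_on S (\<lambda>p. heat_dt (a p) (b p))"
     "continuous_on S (\<lambda>p. heat_dir1 (a p) v (b p))" "continuous_on S (\<lambda>p. heat_dir2 (a p) v (b p))"
proof -
  have [simp]: "a p \<noteq> 0" if "p \<in> S" for p using assms(3)[OF that] by simp
  show "continuous_on S (\<lambda>p. heat (a p) (b p))"
    unfolding heat_def by (intro continuous_intros assms) auto
  then show "continuous_on S (\<lambda>p. heat_dt (a p) (b p))"
     "continuous_on S (\<lambda>p. heat_dir1 (a p) v (b p))" "continuous_on S (\<lambda>p. heat_dir2 (a p) v (b p))"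
    unfolding heat_dt_def heat_dir1_def heat_dir2_def by (auto intro!: continuous_intros assms)
qed

lemma integrable_continuous_support:
  fixes g :: "'a::euclidean_space \<Rightarrow> 'b::{banach, second_countable_topology}"
  assumes "continuous_on UNIV g" "\<And>x. norm x > r \<Longrightarrow> g x = 0"
  shows "integrable lborel g" "\<exists>B. \<forall>x. norm (g x) \<le> B"
proof -
  have "integrable lborel (\<lambda>x. indicator (cball 0 r) x *\<^sub>R g x)"
    by (intro borel_integrable_compact continuous_on_subset[OF assms(1)]) auto
  also have "(\<lambda>x. indicator (cball 0 r) x *\<^sub>R g x) = g"
    using assms(2) by (force simp: indicator_def)
  finally show "integrable lborel g" .
  have "bounded (g ` cball 0 r)"
    by (intro compact_imp_bounded compact_continuous_image continuous_on_subset[OF assms(1)]) auto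
  then obtain B where B: "\<And>x. x \<in> cball 0 r \<Longrightarrow> norm (g x) \<le> B" unfolding bounded_iff by blast
  have "norm (g x) \<le> max B 0" for x
  proof (cases "norm x \<le> r")
    case True then show ?thesis using B[of x] by simp
  qed (simp add: assms(2))
  then show "\<exists>B. \<forall>x. norm (g x) \<le> B" by blast
qed

text \<open>Near \<open>y\<close> continuity suffices. Away from \<open>y\<close> the kernel is
  compared with the one at twice the time: the quotient is \<open>c0 * exp (- u)\<close> with
  \<open>u\<close> at least \<open>d\<^sup>2 / (8 * t)\<close>, and
  \<open>exp (- u) \<le> 1 / u\<close> leaves a factor proportional to \<open>t\<close> in front of
  a kernel of mass 1.\<close>

lemma heat_approx_identity:
  fixes w :: "'a::euclidean_space \<Rightarrow> complex"
  assumes c: "continuous_on UNIV w" and s: "\<And>x. norm x > r \<Longrightarrow> w x = 0"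
  shows "((\<lambda>t. \<integral>x. complex_of_real (heat t (x - y)) * w x \<partial>lborel) \<longlongrightarrow> w y) (at_right 0)"
proof (rule tendstoI)
  fix e :: real assume e: "e > 0"
  have wi: "integrable lborel w" using integrable_continuous_support[OF c s] by blast
  obtain M where M: "\<And>x. norm (w x) \<le> M" using integrable_continuous_support[OF c s] by blast
  have M0: "M \<ge> 0" using M[of 0] norm_ge_zero order_trans by blast
  obtain d where d: "d > 0" "\<And>x. dist x y < d \<Longrightarrow> dist (w x) (w y) < e / 2"
    using c e unfolding continuous_on_iff by (metis UNIV_I half_gt_zero)
  \<comment> \<open>The quotient of the normalising factors at the times \<open>t\<close> and
    \<open>2 * t\<close>.\<close>
  define c0 where "c0 = 2 powr (real DIM('a) / 2)"
  define A where "A = 2 * M * c0 * 8 / d\<^sup>2"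
  have A0: "A \<ge> 0" unfolding A_def c0_def using M0 by simp
  have main: "norm ((\<integral>x. complex_of_real (heat t (x - y)) * w x \<partial>lborel) - w y) \<le> e / 2 + A * t" if t: "t > 0" for t
  proof -
    have sw: "heat t (x - y) = heat t (y - x)" for t and x :: 'a using heat_minus[of t "y - x"] by simp
    have i1: "integrable lborel (\<lambda>x. complex_of_real (heat t (x - y)) * w x)"
    proof (rule Bochner_Integration.integrable_bound)
      show "integrable lborel (\<lambda>x. M * heat t (y - x))" by (intro integrable_mult_right integrable_heat_shift t)
      show "AE x in lborel. norm (complex_of_real (heat t (x - y)) * w x) \<le> norm (M * heat t (y - x))"
        using M M0 by (intro AE_I2) (auto simp: norm_mult heat_nonneg sw abs_mult mult.commute intro!: mult_right_mono)
      have "w \<in> borel_measurable borel" using c by (rule borel_measurable_continuous_onI)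
      then show "(\<lambda>x. complex_of_real (heat t (x - y)) * w x) \<in> borel_measurable lborel" by measurable
    qed
    have i2: "integrable lborel (\<lambda>x. complex_of_real (heat t (x - y)) * w y)"
      unfolding sw by (intro integrable_mult_left integrable_of_real integrable_heat_shift t)
    have "w y = (\<integral>x. complex_of_real (heat t (x - y)) * w y \<partial>lborel)"
      unfolding sw by (simp add: integral_heat_shift[OF t])
    then have "(\<integral>x. complex_of_real (heat t (x - y)) * w x \<partial>lborel) - w y = (\<integral>x. complex_of_real (heat t (x - y)) * w x - complex_of_real (heat t (x - y)) * w y \<partial>lborel)"
      using i1 i2 by simp
    also have "norm \<dots> \<le> (\<integral>x. e / 2 * heat t (y - x) + A * t * heat (2 * t) (y - x) \<partial>lborel)"
    proof (rule Bochner_Integration.integral_norm_bound_integral)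
      show "integrable lborel (\<lambda>x. complex_of_real (heat t (x - y)) * w x - complex_of_real (heat t (x - y)) * w y)"
        using i1 i2 by simp
      show "integrable lborel (\<lambda>x. e / 2 * heat t (y - x) + A * t * heat (2 * t) (y - x))"
        using t by (intro Bochner_Integration.integrable_add integrable_mult_right integrable_heat_shift) auto
      fix x
      have n: "norm (complex_of_real (heat t (x - y)) * w x - complex_of_real (heat t (x - y)) * w y) = heat t (y - x) * dist (w x) (w y)"
        unfolding right_diff_distrib[symmetric] norm_mult dist_norm by (simp add: heat_nonneg sw)
      show "norm (complex_of_real (heat t (x - y)) * w x - complex_of_real (heat t (x - y)) * w y) \<le> e / 2 * heat t (y - x) + A * t * heat (2 * t) (y - x)"
      proof (cases "dist x y < d")
        case True
        have "heat t (y - x) * dist (w x) (w y) \<le> heat t (y - x) * (e / 2)"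
          using d(2)[OF True] by (intro mult_left_mono heat_nonneg) auto
        moreover have "0 \<le> A * t * heat (2 * t) (y - x)" by (intro mult_nonneg_nonneg heat_nonneg) (use A0 t in auto)
        ultimately show ?thesis unfolding n by (simp add: mult.commute)
      next
        case False
        then have nd: "d\<^sup>2 \<le> (norm (y - x))\<^sup>2" using d(1) by (intro power_mono) (auto simp: dist_norm norm_minus_commute)
        let ?u = "(norm (y - x))\<^sup>2 / (8 * t)"
        have u0: "?u > 0" using nd d(1) t by (intro divide_pos_pos) (auto intro: less_le_trans[of 0 "d\<^sup>2"])
        have "(4 * pi * t) powr (- real DIM('a) / 2) = c0 * (4 * pi * (2 * t)) powr (- real DIM('a) / 2)"
        proof -
          have "(4 * pi * (2 * t)) powr (- real DIM('a) / 2) = 2 powr (- real DIM('a) / 2) * (4 * pi * t) powr (- real DIM('a) / 2)"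
            using powr_mult[of 2 "4 * pi * t" "- real DIM('a) / 2"] t by (simp add: mult_ac)
          moreover have "c0 * 2 powr (- real DIM('a) / 2) = 1"
            unfolding c0_def by (simp flip: powr_add)
          ultimately show ?thesis by (simp add: mult.assoc[symmetric])
        qed
        moreover have "exp (- (norm (y - x))\<^sup>2 / (4 * t)) = exp (- (norm (y - x))\<^sup>2 / (4 * (2 * t))) * exp (- ?u)"
          using t by (simp add: exp_add[symmetric] field_simps)
        ultimately have "heat t (y - x) = c0 * heat (2 * t) (y - x) * exp (- ?u)"
          unfolding heat_def by simp
        also have "exp (- ?u) \<le> 1 / ?u"
        proof -
          have "?u \<le> exp ?u" using exp_ge_add_one_self[of ?u] by linarith
          then have "1 / exp ?u \<le> 1 / ?u" using u0 by (intro frac_le) auto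
          then show ?thesis by (simp only: exp_minus inverse_eq_divide)
        qed
        then have "c0 * heat (2 * t) (y - x) * exp (- ?u) \<le> c0 * heat (2 * t) (y - x) * (1 / ?u)"
          unfolding c0_def by (intro mult_left_mono) (auto simp: heat_nonneg)
        also have "1 / ?u \<le> 8 * t / d\<^sup>2" using nd d(1) t by (simp add: frac_le)
        then have "c0 * heat (2 * t) (y - x) * (1 / ?u) \<le> c0 * heat (2 * t) (y - x) * (8 * t / d\<^sup>2)"
          unfolding c0_def by (intro mult_left_mono) (auto simp: heat_nonneg)
        finally have h: "heat t (y - x) \<le> c0 * heat (2 * t) (y - x) * (8 * t / d\<^sup>2)" .
        have "dist (w x) (w y) \<le> 2 * M" using M[of x] M[of y] norm_triangle_ineq4[of "w x" "w y"] by (simp add: dist_norm)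
        then have "heat t (y - x) * dist (w x) (w y) \<le> (c0 * heat (2 * t) (y - x) * (8 * t / d\<^sup>2)) * (2 * M)"
          using h t by (intro mult_mono) (auto simp: heat_nonneg c0_def)
        also have "\<dots> = A * t * heat (2 * t) (y - x)" by (simp add: A_def)
        moreover have "0 \<le> e / 2 * heat t (y - x)" by (intro mult_nonneg_nonneg heat_nonneg) (use e in auto)
        ultimately show ?thesis unfolding n by linarith
      qed
    qed
    also have "\<dots> = e / 2 + A * t"
      using t by (simp add: integrable_heat_shift integral_heat_shift)
    finally show ?thesis .
  qed
  have "\<forall>\<^sub>F t in at_right 0. t \<in> {0<..<e / (2 * (A + 1))}"
    by (rule eventually_at_right_real) (use e A0 in auto)
  then show "\<forall>\<^sub>F t in at_right 0. dist (\<integral>x. complex_of_real (heat t (x - y)) * w x \<partial>lborel) (w y) < e"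
  proof eventually_elim
    case (elim t)
    then have t: "t > 0" "t * (2 * (A + 1)) < e" using A0 by (auto simp: field_simps)
    then have "A * t < e / 2" by (simp add: algebra_simps)
    then show ?case using main[OF t(1)] by (simp add: dist_norm)
  qed
qed

text \<open>Derivatives are recorded along the coordinate axes only and carried as explicit
  functions, which is what integration by parts axis by axis and the Laplacian use. Two continuous
  derivatives are demanded, so a cutoff built from cubes qualifies.\<close>

locale test_function =
  fixes r :: real and w :: "'a::euclidean_space \<Rightarrow> complex" and w1 w2 :: "'a \<Rightarrow> 'a \<Rightarrow> complex"
  assumes w_der: "\<And>b x. b \<in> Basis \<Longrightarrow> ((\<lambda>t. w (x + t *\<^sub>R b)) has_vector_derivative w1 b x) (at 0)"
      "\<And>b x. b \<in> Basis \<Longrightarrow> ((\<lambda>t. w1 b (x + t *\<^sub>R b)) has_vector_derivative w2 b x) (at 0)"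
    and w_cont: "continuous_on UNIV w" "\<And>b. b \<in> Basis \<Longrightarrow> continuous_on UNIV (w1 b)" "\<And>b. b \<in> Basis \<Longrightarrow> continuous_on UNIV (w2 b)"
    and w_supp: "\<And>x. norm x > r \<Longrightarrow> w x = 0"
begin

definition lap :: "'a \<Rightarrow> complex" where "lap x = (\<Sum>b\<in>Basis. w2 b x)"

lemma w2_supp:
  assumes b: "b \<in> Basis" and x: "norm x > r"
  shows "w2 b x = 0"
proof -
  have "w1 b x = 0" if "norm x > r" for x
    using has_vector_derivative_support[OF w_der(1)[OF b] w_supp that] .
  from has_vector_derivative_support[OF w_der(2)[OF b] this x] show ?thesis .
qed

lemma lap_cont: "continuous_on UNIV lap" unfolding lap_def by (intro continuous_intros w_cont)
lemma lap_supp: "norm x > r \<Longrightarrow> lap x = 0" unfolding lap_def by (simp add: w2_supp)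

lemma integral_lap:
  fixes A :: "'a \<Rightarrow> complex" and A1 A2 :: "'a \<Rightarrow> 'a \<Rightarrow> complex"
  assumes A: "\<And>b x. b \<in> Basis \<Longrightarrow> ((\<lambda>t. A (x + t *\<^sub>R b)) has_vector_derivative A1 b x) (at 0)"
     "\<And>b x. b \<in> Basis \<Longrightarrow> ((\<lambda>t. A1 b (x + t *\<^sub>R b)) has_vector_derivative A2 b x) (at 0)"
    and cA: "continuous_on UNIV A" "\<And>b. b \<in> Basis \<Longrightarrow> continuous_on UNIV (A1 b)" "\<And>b. b \<in> Basis \<Longrightarrow> continuous_on UNIV (A2 b)"
  shows "(\<integral>x. A x * lap x \<partial>lborel) = (\<integral>x. (\<Sum>b\<in>Basis. A2 b x) * w x \<partial>lborel)"
proof -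
  have i1: "integrable lborel (\<lambda>x. A x * w2 b x)" if "b \<in> Basis" for b
    by (rule integrable_continuous_support(1)[where r=r]) (use that in \<open>auto intro!: continuous_intros cA w_cont simp: w2_supp\<close>)
  have i2: "integrable lborel (\<lambda>x. A2 b x * w x)" if "b \<in> Basis" for b
    by (rule integrable_continuous_support(1)[where r=r]) (use that in \<open>auto intro!: continuous_intros cA w_cont simp: w_supp\<close>)
  have "(\<integral>x. A x * lap x \<partial>lborel) = (\<Sum>b\<in>Basis. \<integral>x. A x * w2 b x \<partial>lborel)"
    unfolding lap_def sum_distrib_left by (intro Bochner_Integration.integral_sum i1)
  also have "\<dots> = (\<Sum>b\<in>Basis. \<integral>x. A2 b x * w x \<partial>lborel)"
  proof (intro sum.cong refl)
    fix b :: 'a assume b: "b \<in> Basis"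
    show "(\<integral>x. A x * w2 b x \<partial>lborel) = (\<integral>x. A2 b x * w x \<partial>lborel)"
      by (rule integral_by_parts2[OF A(1)[OF b] A(2)[OF b] w_der(1)[OF b] w_der(2)[OF b] cA(1) cA(2)[OF b] cA(3)[OF b]
            w_cont(1) w_cont(2)[OF b] w_cont(3)[OF b] w_supp])
  qed
  also have "\<dots> = (\<integral>x. (\<Sum>b\<in>Basis. A2 b x) * w x \<partial>lborel)"
    unfolding sum_distrib_right by (intro Bochner_Integration.integral_sum[symmetric] i2)
  finally show ?thesis .
qed

lemma integral_heat_lap:
  assumes t: "t > 0"
  shows "(\<integral>x. complex_of_real (heat t (x - y)) * lap x \<partial>lborel) = (\<integral>x. complex_of_real (heat_dt t (x - y)) * w x \<partial>lborel)"
proof -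
  have "(\<integral>x. complex_of_real (heat t (x - y)) * lap x \<partial>lborel) = (\<integral>x. (\<Sum>b\<in>Basis. complex_of_real (heat_dir2 t b (x - y))) * w x \<partial>lborel)"
  proof (rule integral_lap[where ?A1.0="\<lambda>b x. complex_of_real (heat_dir1 t b (x - y))"])
    fix b x :: 'a
    have e: "x + \<tau> *\<^sub>R b - y = (x - y) + \<tau> *\<^sub>R b" for \<tau> by simp
    show "((\<lambda>\<tau>. complex_of_real (heat t (x + \<tau> *\<^sub>R b - y))) has_vector_derivative complex_of_real (heat_dir1 t b (x - y))) (at 0)"
      "((\<lambda>\<tau>. complex_of_real (heat_dir1 t b (x + \<tau> *\<^sub>R b - y))) has_vector_derivative complex_of_real (heat_dir2 t b (x - y))) (at 0)"
      unfolding e by (intro has_vector_derivative_complex_of_real DERIV_heat_dir t)+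
  qed (use t in \<open>auto intro!: continuous_intros continuous_on_heat_comp\<close>)
  also have "\<dots> = (\<integral>x. complex_of_real (heat_dt t (x - y)) * w x \<partial>lborel)"
    unfolding heat_dir2_sum[symmetric] by simp
  finally show ?thesis .
qed

lemma heat_dt_measurable [measurable (raw)]:
  assumes [measurable]: "f \<in> borel_measurable M" "g \<in> borel_measurable M"
  shows "(\<lambda>x. heat_dt (f x) (g x :: 'a)) \<in> borel_measurable M"
  unfolding heat_dt_def by measurable

lemma w_measurable [measurable]: "w \<in> borel_measurable borel" "lap \<in> borel_measurable borel"
  using w_cont lap_cont by (auto intro: borel_measurable_continuous_onI)

text \<open>Duhamel's formula on the side of the test function: the integrand is the time derivative
  of \<open>exp (\<kappa> * t)\<close> times the heat evolution of \<open>w\<close>, after the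
  Laplacian has been moved onto the kernel. It is integrated from a positive time, where the kernel
  is smooth, and the limit at time 0 is the approximate identity.\<close>

lemma heat_parametrix:
  "(\<integral>t. indicator {0..1} t *\<^sub>R (complex_of_real (exp (\<kappa> * t)) * (\<integral>x. complex_of_real (heat t (x - y)) * (lap x + complex_of_real \<kappa> * w x) \<partial>lborel)) \<partial>lborel)
     = complex_of_real (exp \<kappa>) * (\<integral>x. complex_of_real (heat 1 (x - y)) * w x \<partial>lborel) - w y"
proof -
  define g where "g x = lap x + complex_of_real \<kappa> * w x" for x
  have gc: "continuous_on UNIV g" unfolding g_def by (intro continuous_intros lap_cont w_cont)
  have gs: "norm x > r \<Longrightarrow> g x = 0" for x unfolding g_def by (simp add: lap_supp w_supp)
  have [measurable]: "g \<in> borel_measurable borel" using gc by (rule borel_measurable_continuous_onI)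
  obtain M where M: "\<And>x. norm (g x) \<le> M" using integrable_continuous_support[OF gc gs] by blast
  have M0: "M \<ge> 0" using M[of 0] norm_ge_zero order_trans by blast
  define G where "G t = complex_of_real (exp (\<kappa> * t)) * (\<integral>x. complex_of_real (heat t (x - y)) * g x \<partial>lborel)" for t
  have [measurable]: "G \<in> borel_measurable borel"
  proof -
    have "(\<lambda>t. \<integral>x. complex_of_real (heat t (x - y)) * g x \<partial>lborel) \<in> borel_measurable borel"
      by (rule lborel.borel_measurable_lebesgue_integral) measurable
    then show ?thesis unfolding G_def by measurable
  qed
  \<comment> \<open>Default value of the kernel at time 0; it lets the truncated integrands converge
    at every \<open>t\<close>.\<close>
  have G0: "G 0 = 0" by (simp add: G_def heat_def)
  have Gb: "norm (G t) \<le> exp \<bar>\<kappa>\<bar> * M" if t: "0 < t" "t \<le> 1" for t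
  proof -
    have sw: "heat t (x - y) = heat t (y - x)" for x :: 'a using heat_minus[of t "y - x"] by simp
    have "norm (\<integral>x. complex_of_real (heat t (x - y)) * g x \<partial>lborel) \<le> (\<integral>x. M * heat t (y - x) \<partial>lborel)"
    proof (rule Bochner_Integration.integral_norm_bound_integral)
      show "integrable lborel (\<lambda>x. complex_of_real (heat t (x - y)) * g x)"
        by (rule integrable_continuous_support(1)[where r=r]) (use t in \<open>auto intro!: continuous_intros gc continuous_on_heat_comp simp: gs\<close>)
      show "integrable lborel (\<lambda>x. M * heat t (y - x))" by (intro integrable_mult_right integrable_heat_shift t)
      show "norm (complex_of_real (heat t (x - y)) * g x) \<le> M * heat t (y - x)" for x
        using M[of x] by (auto simp: norm_mult heat_nonneg sw mult.commute[of M] intro!: mult_left_mono)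
    qed
    also have "\<dots> = M" by (simp add: integral_heat_shift[OF t(1)])
    finally have 1: "norm (\<integral>x. complex_of_real (heat t (x - y)) * g x \<partial>lborel) \<le> M" .
    have "\<kappa> * t \<le> \<bar>\<kappa>\<bar> * t" using t by (intro mult_right_mono) auto
    also have "\<dots> \<le> \<bar>\<kappa>\<bar>" using t by (simp add: mult_left_le)
    finally have "exp (\<kappa> * t) \<le> exp \<bar>\<kappa>\<bar>" by simp
    then show ?thesis unfolding G_def norm_mult using 1 M0 by (intro mult_mono) auto
  qed
  have step: "(\<integral>t. indicator {\<epsilon>..1} t *\<^sub>R G t \<partial>lborel) = complex_of_real (exp \<kappa>) * (\<integral>x. complex_of_real (heat 1 (x - y)) * w x \<partial>lborel)
      - complex_of_real (exp (\<kappa> * \<epsilon>)) * (\<integral>x. complex_of_real (heat \<epsilon> (x - y)) * w x \<partial>lborel)" if \<epsilon>: "0 < \<epsilon>" "\<epsilon> \<le> 1" for \<epsilon>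
  proof -
    define Z where "Z t x = indicator {\<epsilon>..1} t *\<^sub>R (complex_of_real (exp (\<kappa> * t) * (heat_dt t (x - y) + \<kappa> * heat t (x - y))) * w x)" for t x
    have Zi: "integrable lborel (\<lambda>p. Z (fst p) (snd p))"
    proof -
      have "integrable lborel (\<lambda>p. indicator ({\<epsilon>..1} \<times> cball 0 r) p *\<^sub>R (complex_of_real (exp (\<kappa> * fst p) * (heat_dt (fst p) (snd p - y) + \<kappa> * heat (fst p) (snd p - y))) * w (snd p)))"
        using \<epsilon> by (intro borel_integrable_compact compact_Times continuous_intros continuous_on_heat_comp continuous_on_compose2[OF w_cont(1)]) auto
      also have "(\<lambda>p. indicator ({\<epsilon>..1} \<times> cball 0 r) p *\<^sub>R (complex_of_real (exp (\<kappa> * fst p) * (heat_dt (fst p) (snd p - y) + \<kappa> * heat (fst p) (snd p - y))) * w (snd p)))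
          = (\<lambda>p. Z (fst p) (snd p))"
        using w_supp by (force simp: Z_def indicator_def fun_eq_iff)
      finally show ?thesis .
    qed
    have ic: "integrable lborel (\<lambda>x. complex_of_real (h x) * w x)" if "continuous_on UNIV h" for h
      by (rule integrable_continuous_support(1)[where r=r]) (use that in \<open>auto intro!: continuous_intros w_cont simp: w_supp\<close>)
    have "indicator {\<epsilon>..1} t *\<^sub>R G t = (\<integral>x. Z t x \<partial>lborel)" for t
    proof (cases "t \<in> {\<epsilon>..1}")
      case True
      then have t: "t > 0" using \<epsilon> by auto
      have il: "integrable lborel (\<lambda>x. complex_of_real (heat t (x - y)) * lap x)"
        by (rule integrable_continuous_support(1)[where r=r]) (use t in \<open>auto intro!: continuous_intros lap_cont continuous_on_heat_comp simp: lap_supp\<close>)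
      have iw: "integrable lborel (\<lambda>x. complex_of_real (heat t (x - y)) * w x)" "integrable lborel (\<lambda>x. complex_of_real (heat_dt t (x - y)) * w x)"
        using t by (intro ic continuous_on_heat_comp continuous_intros; simp)+
      have "(\<integral>x. complex_of_real (heat t (x - y)) * g x \<partial>lborel) = (\<integral>x. complex_of_real (heat t (x - y)) * lap x \<partial>lborel) + complex_of_real \<kappa> * (\<integral>x. complex_of_real (heat t (x - y)) * w x \<partial>lborel)"
        unfolding g_def using il iw by (simp add: distrib_left mult.left_commute)
      also have "\<dots> = (\<integral>x. complex_of_real (heat_dt t (x - y)) * w x + complex_of_real \<kappa> * (complex_of_real (heat t (x - y)) * w x) \<partial>lborel)"
        unfolding integral_heat_lap[OF t] using iw by simp
      also have "complex_of_real (exp (\<kappa> * t)) * \<dots> = (\<integral>x. Z t x \<partial>lborel)"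
        unfolding integral_mult_right_zero[symmetric] Z_def using True by (intro Bochner_Integration.integral_cong) (auto simp: algebra_simps)
      finally show ?thesis using True by (simp add: G_def)
    qed (simp add: Z_def)
    then have "(\<integral>t. indicator {\<epsilon>..1} t *\<^sub>R G t \<partial>lborel) = (\<integral>t. \<integral>x. Z t x \<partial>lborel \<partial>lborel)" by simp
    also have "\<dots> = (\<integral>x. \<integral>t. Z t x \<partial>lborel \<partial>lborel)" by (rule lborel_Fubini[where g=Z, OF Zi])
    also have "\<dots> = (\<integral>x. complex_of_real (exp \<kappa>) * (complex_of_real (heat 1 (x - y)) * w x) - complex_of_real (exp (\<kappa> * \<epsilon>)) * (complex_of_real (heat \<epsilon> (x - y)) * w x) \<partial>lborel)"
    proof (intro Bochner_Integration.integral_cong refl)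
      fix x
      have "(\<integral>t. indicator {\<epsilon>..1} t *\<^sub>R (exp (\<kappa> * t) * (heat_dt t (x - y) + \<kappa> * heat t (x - y))) \<partial>lborel) = exp (\<kappa> * 1) * heat 1 (x - y) - exp (\<kappa> * \<epsilon>) * heat \<epsilon> (x - y)"
      proof (rule integral_FTC_Icc[OF \<epsilon>(2)])
        fix t assume "\<epsilon> \<le> t" "t \<le> 1"
        then have t: "t > 0" using \<epsilon> by simp
        have d: "((\<lambda>t. exp (\<kappa> * t) * heat t (x - y)) has_field_derivative (exp (\<kappa> * t) * heat_dt t (x - y) + (exp (\<kappa> * t) * \<kappa>) * heat t (x - y))) (at t)"
          by (intro DERIV_mult' DERIV_heat_dt t) (auto intro!: derivative_eq_intros)
        have e: "exp (\<kappa> * t) * heat_dt t (x - y) + (exp (\<kappa> * t) * \<kappa>) * heat t (x - y) = exp (\<kappa> * t) * (heat_dt t (x - y) + \<kappa> * heat t (x - y))"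
          by (simp only: distrib_left mult.assoc)
        show "((\<lambda>t. exp (\<kappa> * t) * heat t (x - y)) has_vector_derivative exp (\<kappa> * t) * (heat_dt t (x - y) + \<kappa> * heat t (x - y))) (at t within {\<epsilon>..1})"
          using has_field_derivative_at_within[OF d, of "{\<epsilon>..1}"] unfolding e has_real_derivative_iff_has_vector_derivative .
      qed (use \<epsilon> in \<open>auto intro!: continuous_intros continuous_on_heat_comp\<close>)
      moreover have "(\<integral>t. Z t x \<partial>lborel) = complex_of_real (\<integral>t. indicator {\<epsilon>..1} t *\<^sub>R (exp (\<kappa> * t) * (heat_dt t (x - y) + \<kappa> * heat t (x - y))) \<partial>lborel) * w x"
        unfolding integral_complex_of_real[symmetric] integral_mult_left_zero[symmetric]
        by (intro Bochner_Integration.integral_cong) (auto simp: Z_def scaleR_conv_of_real mult.assoc)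
      ultimately have "(\<integral>t. Z t x \<partial>lborel) = complex_of_real (exp (\<kappa> * 1) * heat 1 (x - y) - exp (\<kappa> * \<epsilon>) * heat \<epsilon> (x - y)) * w x"
        by (simp only:)
      then show "(\<integral>t. Z t x \<partial>lborel) = complex_of_real (exp \<kappa>) * (complex_of_real (heat 1 (x - y)) * w x) - complex_of_real (exp (\<kappa> * \<epsilon>)) * (complex_of_real (heat \<epsilon> (x - y)) * w x)"
        by (simp add: algebra_simps)
    qed
    also have "\<dots> = complex_of_real (exp \<kappa>) * (\<integral>x. complex_of_real (heat 1 (x - y)) * w x \<partial>lborel)
      - complex_of_real (exp (\<kappa> * \<epsilon>)) * (\<integral>x. complex_of_real (heat \<epsilon> (x - y)) * w x \<partial>lborel)"
      using \<epsilon> by (subst Bochner_Integration.integral_diff) (auto intro!: integrable_mult_right ic continuous_on_heat_comp continuous_intros)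
    finally show ?thesis .
  qed
  define \<epsilon> where "\<epsilon> n = 1 / real (Suc n)" for n
  have \<epsilon>: "0 < \<epsilon> n" "\<epsilon> n \<le> 1" for n by (auto simp: \<epsilon>_def)
  have \<epsilon>0: "\<epsilon> \<longlonglongrightarrow> 0" using LIMSEQ_inverse_real_of_nat by (simp add: \<epsilon>_def[abs_def] divide_inverse)
  have \<epsilon>1: "filterlim \<epsilon> (at_right 0) sequentially"
  proof -
    have "\<epsilon> n \<noteq> 0" for n using \<epsilon>(1)[of n] by linarith
    then show ?thesis using \<epsilon>0 \<epsilon> by (simp add: filterlim_at)
  qed
  have "(\<lambda>n. \<integral>t. indicator {\<epsilon> n..1} t *\<^sub>R G t \<partial>lborel) \<longlonglongrightarrow> (\<integral>t. indicator {0..1} t *\<^sub>R G t \<partial>lborel)"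
  proof (rule integral_dominated_convergence[where w="\<lambda>t. indicator {0..1} t * (exp \<bar>\<kappa>\<bar> * M)"])
    show "integrable lborel (\<lambda>t::real. indicator {0..1} t * (exp \<bar>\<kappa>\<bar> * M))"
      by (intro integrable_mult_left integrable_real_indicator) auto
    show "AE t in lborel. norm (indicator {\<epsilon> n..1} t *\<^sub>R G t) \<le> indicator {0..1} t * (exp \<bar>\<kappa>\<bar> * M)" for n
    proof (intro AE_I2)
      fix t show "norm (indicator {\<epsilon> n..1} t *\<^sub>R G t) \<le> indicator {0..1} t * (exp \<bar>\<kappa>\<bar> * M)"
        using Gb[of t] \<epsilon>[of n] M0 by (cases "t \<in> {\<epsilon> n..1}") auto
    qed
    show "AE t in lborel. (\<lambda>n. indicator {\<epsilon> n..1} t *\<^sub>R G t) \<longlonglongrightarrow> indicator {0..1} t *\<^sub>R G t"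
    proof (intro AE_I2)
      fix t :: real
      show "(\<lambda>n. indicator {\<epsilon> n..1} t *\<^sub>R G t) \<longlonglongrightarrow> indicator {0..1} t *\<^sub>R G t"
      proof (cases "0 < t")
        case True
        have "\<forall>\<^sub>F n in sequentially. \<epsilon> n < t" using \<epsilon>0 True by (rule order_tendstoD(2))
        then have "\<forall>\<^sub>F n in sequentially. indicator {\<epsilon> n..1} t *\<^sub>R G t = indicator {0..1} t *\<^sub>R G t"
          by eventually_elim (use True in \<open>auto simp: indicator_def\<close>)
        then show ?thesis by (rule tendsto_eventually)
      next
        case False
        then have i: "indicator {\<epsilon> n..1} t = (0::real)" for n using \<epsilon>[of n] by (auto simp: indicator_def)
        have z: "indicator {0..1} t *\<^sub>R G t = 0" using False G0 by (cases "t = 0") auto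
        show ?thesis unfolding i z by simp
      qed
    qed
  qed measurable
  moreover have "(\<lambda>n. \<integral>t. indicator {\<epsilon> n..1} t *\<^sub>R G t \<partial>lborel) \<longlonglongrightarrow> complex_of_real (exp \<kappa>) * (\<integral>x. complex_of_real (heat 1 (x - y)) * w x \<partial>lborel) - complex_of_real (exp (\<kappa> * 0)) * w y"
    unfolding step[OF \<epsilon>]
    by (intro tendsto_intros \<epsilon>0 filterlim_compose[OF heat_approx_identity[OF w_cont(1) w_supp] \<epsilon>1])
  ultimately have "(\<integral>t. indicator {0..1} t *\<^sub>R G t \<partial>lborel) = complex_of_real (exp \<kappa>) * (\<integral>x. complex_of_real (heat 1 (x - y)) * w x \<partial>lborel) - complex_of_real (exp (\<kappa> * 0)) * w y"
    by (rule LIMSEQ_unique)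
  then show ?thesis unfolding G_def g_def by simp
qed

end

section \<open>The wave field paired with test functions\<close>

lemma sum_Basis_prod_real:
  fixes F :: "'v::euclidean_space \<times> real \<Rightarrow> 'b::ab_group_add"
  shows "(\<Sum>b\<in>Basis. F b) = (\<Sum>i\<in>Basis. F (i, 0)) + F (0, 1)"
proof -
  have B: "(Basis :: ('v \<times> real) set) = (\<lambda>i. (i, 0)) ` Basis \<union> {(0, 1)}"
    by (auto simp: Basis_prod_def)
  have "(0, 1) \<notin> (\<lambda>i::'v. (i, 0::real)) ` Basis" by auto
  then have "(\<Sum>b\<in>Basis. F b) = (\<Sum>b\<in>(\<lambda>i. (i, 0)) ` Basis. F b) + F (0, 1)"
    unfolding B by (subst sum.union_disjoint) auto
  also have "(\<Sum>b\<in>(\<lambda>i. (i, 0)) ` Basis. F b) = (\<Sum>i\<in>Basis. F (i, 0))"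
    by (subst sum.reindex) (auto simp: inj_on_def)
  finally show ?thesis .
qed

lemma has_vector_derivative_cis_line:
  "((\<lambda>t. cis (a + t * b)) has_vector_derivative \<i> * complex_of_real b * cis a) (at 0)"
proof -
  have "((\<lambda>z. exp (\<i> * (complex_of_real a + z * complex_of_real b))) has_field_derivative
      exp (\<i> * (complex_of_real a + complex_of_real 0 * complex_of_real b)) * (\<i> * complex_of_real b)) (at (complex_of_real 0))"
    by (auto intro!: derivative_eq_intros)
  from has_vector_derivative_real_field[OF this] show ?thesis
    by (simp add: cis_conv_exp mult_ac)
qed

lemma has_vector_derivative_heat_line:
  assumes "t > 0"
  shows "((\<lambda>\<tau>. complex_of_real (heat t (s + \<tau> * v))) has_vector_derivative complex_of_real (v * heat1 t s)) (at 0)"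
    and "((\<lambda>\<tau>. complex_of_real (heat1 t (s + \<tau> * v))) has_vector_derivative complex_of_real (v * heat2 t s)) (at 0)"
proof -
  have d: "((\<lambda>\<tau>. s + \<tau> * v) has_field_derivative v) (at 0)" by (auto intro!: derivative_eq_intros)
  show "((\<lambda>\<tau>. complex_of_real (heat t (s + \<tau> * v))) has_vector_derivative complex_of_real (v * heat1 t s)) (at 0)"
    by (rule has_vector_derivative_complex_of_real) (use DERIV_chain2[OF DERIV_heat(1)[OF assms] d] in \<open>simp add: mult.commute\<close>)
  show "((\<lambda>\<tau>. complex_of_real (heat1 t (s + \<tau> * v))) has_vector_derivative complex_of_real (v * heat2 t s)) (at 0)"
    by (rule has_vector_derivative_complex_of_real) (use DERIV_chain2[OF DERIV_heat(2)[OF assms] d] in \<open>simp add: mult.commute\<close>)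
qed

context source
begin

text \<open>A plane wave in \<open>x'\<close> times a vertical heat kernel is mapped by the
  Laplacian to the same wave with \<open>heat\<close> replaced by
  \<open>heat2 - (norm \<eta>)\<^sup>2 * heat\<close>. Integrating by parts onto it produces exactly
  the kernel of \<open>P_ode\<close> at time 1.\<close>

lemma plane_wave_lap:
  fixes w :: "'v \<times> real \<Rightarrow> complex"
  assumes T: "test_function r w w1 w2"
  shows "(\<integral>x. cis (\<eta> \<bullet> fst x) * complex_of_real (heat 1 (snd x - s)) * (test_function.lap w2 x + complex_of_real (k\<^sup>2) * w x) \<partial>lborel)
    = (\<integral>x. cis (\<eta> \<bullet> fst x) * complex_of_real (heat2 1 (snd x - s) - ((norm \<eta>)\<^sup>2 - k\<^sup>2) * heat 1 (snd x - s)) * w x \<partial>lborel)"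
proof -
  interpret tf: test_function r w w1 w2 by (rule T)
  define A :: "'v \<times> real \<Rightarrow> complex" where "A x = cis (\<eta> \<bullet> fst x) * complex_of_real (heat 1 (snd x - s))" for x
  define A1 :: "'v \<times> real \<Rightarrow> 'v \<times> real \<Rightarrow> complex" where
    "A1 b x = \<i> * complex_of_real (\<eta> \<bullet> fst b) * A x + complex_of_real (snd b) * (cis (\<eta> \<bullet> fst x) * complex_of_real (heat1 1 (snd x - s)))" for b x
  define A2 :: "'v \<times> real \<Rightarrow> 'v \<times> real \<Rightarrow> complex" where
    "A2 b x = \<i> * complex_of_real (\<eta> \<bullet> fst b) * A1 b x + complex_of_real (snd b) *
       (\<i> * complex_of_real (\<eta> \<bullet> fst b) * (cis (\<eta> \<bullet> fst x) * complex_of_real (heat1 1 (snd x - s)))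
         + cis (\<eta> \<bullet> fst x) * complex_of_real (snd b * heat2 1 (snd x - s)))" for b x
  have cis_l: "((\<lambda>t. cis (\<eta> \<bullet> fst (x + t *\<^sub>R b))) has_vector_derivative \<i> * complex_of_real (\<eta> \<bullet> fst b) * cis (\<eta> \<bullet> fst x)) (at 0)" for x b :: "'v \<times> real"
    using has_vector_derivative_cis_line[of "\<eta> \<bullet> fst x" "\<eta> \<bullet> fst b"] by (simp add: inner_simps)
  have sl: "snd (x + t *\<^sub>R b) - s = (snd x - s) + t * snd b" for x b :: "'v \<times> real" and t by simp
  have h_l: "((\<lambda>t. complex_of_real (heat 1 (snd (x + t *\<^sub>R b) - s))) has_vector_derivative complex_of_real (snd b * heat1 1 (snd x - s))) (at 0)"
     "((\<lambda>t. complex_of_real (heat1 1 (snd (x + t *\<^sub>R b) - s))) has_vector_derivative complex_of_real (snd b * heat2 1 (snd x - s))) (at 0)" for x b :: "'v \<times> real"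
    unfolding sl by (intro has_vector_derivative_heat_line; simp)+
  have dA: "((\<lambda>t. A (x + t *\<^sub>R b)) has_vector_derivative A1 b x) (at 0)" for x b
    using has_vector_derivative_mult[OF cis_l[of x b] h_l(1)[of x b]]
    unfolding A_def A1_def by (simp add: algebra_simps)
  have dA1: "((\<lambda>t. A1 b (x + t *\<^sub>R b)) has_vector_derivative A2 b x) (at 0)" for x b
  proof -
    have "((\<lambda>t. cis (\<eta> \<bullet> fst (x + t *\<^sub>R b)) * complex_of_real (heat1 1 (snd (x + t *\<^sub>R b) - s))) has_vector_derivative
        \<i> * complex_of_real (\<eta> \<bullet> fst b) * (cis (\<eta> \<bullet> fst x) * complex_of_real (heat1 1 (snd x - s)))
         + cis (\<eta> \<bullet> fst x) * complex_of_real (snd b * heat2 1 (snd x - s))) (at 0)"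
      using has_vector_derivative_mult[OF cis_l[of x b] h_l(2)[of x b]] by (simp add: algebra_simps)
    then show ?thesis unfolding A1_def[of b "_ + _"] A2_def
      by (intro has_vector_derivative_add has_vector_derivative_mult_right dA)
  qed
  have "(\<integral>x. A x * tf.lap x \<partial>lborel) = (\<integral>x. (\<Sum>b\<in>Basis. A2 b x) * w x \<partial>lborel)"
    by (rule tf.integral_lap[OF dA dA1]) (auto simp: A_def A1_def A2_def intro!: continuous_intros continuous_on_heat12)
  moreover have "(\<Sum>b\<in>Basis. A2 b x) = cis (\<eta> \<bullet> fst x) * complex_of_real (heat2 1 (snd x - s) - (norm \<eta>)\<^sup>2 * heat 1 (snd x - s))" for x
  proof -
    have "(\<Sum>i\<in>Basis. A2 (i, 0) x) = (\<Sum>i\<in>Basis. - complex_of_real ((\<eta> \<bullet> i)\<^sup>2) * A x)"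
      by (intro sum.cong) (auto simp: A2_def A1_def power2_eq_square algebra_simps)
    also have "\<dots> = - complex_of_real ((norm \<eta>)\<^sup>2) * A x"
      unfolding norm_eq_sum_Basis[of \<eta>] by (simp add: sum_distrib_right sum_negf)
    finally show ?thesis
      unfolding sum_Basis_prod_real by (simp add: A2_def A1_def A_def algebra_simps)
  qed
  ultimately have 1: "(\<integral>x. A x * tf.lap x \<partial>lborel) = (\<integral>x. cis (\<eta> \<bullet> fst x) * complex_of_real (heat2 1 (snd x - s) - (norm \<eta>)\<^sup>2 * heat 1 (snd x - s)) * w x \<partial>lborel)"
    by simp
  have cA: "continuous_on UNIV A" unfolding A_def by (intro continuous_intros continuous_on_heat12) auto
  have i1: "integrable lborel (\<lambda>x. A x * tf.lap x)"
    by (rule integrable_continuous_support(1)[where r=r]) (auto intro!: continuous_intros cA tf.lap_cont simp: tf.lap_supp)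
  have i2: "integrable lborel (\<lambda>x. A x * w x)"
    by (rule integrable_continuous_support(1)[where r=r]) (auto intro!: continuous_intros cA tf.w_cont simp: tf.w_supp)
  have i3: "integrable lborel (\<lambda>x. cis (\<eta> \<bullet> fst x) * complex_of_real (heat2 1 (snd x - s) - (norm \<eta>)\<^sup>2 * heat 1 (snd x - s)) * w x)"
    by (rule integrable_continuous_support(1)[where r=r]) (auto intro!: continuous_intros continuous_on_heat12 tf.w_cont simp: tf.w_supp)
  have "(\<integral>x. A x * (tf.lap x + complex_of_real (k\<^sup>2) * w x) \<partial>lborel) = (\<integral>x. A x * tf.lap x + complex_of_real (k\<^sup>2) * (A x * w x) \<partial>lborel)"
    by (intro Bochner_Integration.integral_cong) (auto simp: algebra_simps)
  also have "\<dots> = (\<integral>x. A x * tf.lap x \<partial>lborel) + (\<integral>x. complex_of_real (k\<^sup>2) * (A x * w x) \<partial>lborel)"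
    by (intro Bochner_Integration.integral_add i1 integrable_mult_right i2)
  also have "\<dots> = (\<integral>x. cis (\<eta> \<bullet> fst x) * complex_of_real (heat2 1 (snd x - s) - (norm \<eta>)\<^sup>2 * heat 1 (snd x - s)) * w x + complex_of_real (k\<^sup>2) * (A x * w x) \<partial>lborel)"
    unfolding 1 by (intro Bochner_Integration.integral_add[symmetric] i3 integrable_mult_right i2)
  also have "\<dots> = (\<integral>x. cis (\<eta> \<bullet> fst x) * complex_of_real (heat2 1 (snd x - s) - ((norm \<eta>)\<^sup>2 - k\<^sup>2) * heat 1 (snd x - s)) * w x \<partial>lborel)"
    by (intro Bochner_Integration.integral_cong) (auto simp: A_def algebra_simps)
  finally show ?thesis unfolding A_def .
qed

lemma K0_norm: "(\<integral>p. norm (K0 x (fst p) (snd p)) \<partial>lborel) \<le> exp (k\<^sup>2) * N"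
proof -
  have i: "integrable lborel (\<lambda>p. norm (K0 x (fst p) (snd p)))" by (intro integrable_norm K0_integrable)
  have "(\<integral>p. norm (K0 x (fst p) (snd p)) \<partial>lborel) = (\<integral>t. \<integral>y. norm (K0 x t y) \<partial>lborel \<partial>lborel)"
    by (rule lborel_iterated[where g="\<lambda>t y. norm (K0 x t y)", OF i])
  also have "\<dots> \<le> (\<integral>t. indicator {0..1::real} t * (exp (k\<^sup>2) * N) \<partial>lborel)"
  proof (rule integral_mono)
    show "integrable lborel (\<lambda>t. \<integral>y. norm (K0 x t y) \<partial>lborel)"
      by (rule lborel_integrable_fst[where g="\<lambda>t y. norm (K0 x t y)", OF i])
    show "integrable lborel (\<lambda>t::real. indicator {0..1} t * (exp (k\<^sup>2) * N))"
      by (intro integrable_mult_left integrable_real_indicator) auto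
  qed (rule K0_norm_integral)
  finally show ?thesis by simp
qed

lemma W_ind_integrable: "integrable lborel (\<lambda>p. N * W (fst p) * indicator {-R..R} (snd p :: real))"
proof -
  define h where "h \<eta> s = N * W \<eta> * indicator {-R..R} s" for \<eta> :: 'v and s :: real
  have "integrable lborel (\<lambda>p. h (fst p) (snd p))"
  proof (rule lborel_integrable_iterated[where g=h and B="\<lambda>\<eta>. N * (2 * R) * W \<eta>"])
    show "integrable lborel (\<lambda>\<eta>. N * (2 * R) * W \<eta>)" by (intro integrable_mult_right W_integrable)
    show "(\<lambda>p. h (fst p) (snd p)) \<in> borel_measurable borel" unfolding h_def W_def by measurable
    fix \<eta>
    show "integrable lborel (h \<eta>)"
      unfolding h_def by (intro integrable_mult_right integrable_real_indicator) (use R in auto)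
    have "(\<lambda>s. norm (h \<eta> s)) = (\<lambda>s. N * W \<eta> * indicator {-R..R} s)"
      using N W_nonneg[of \<eta>] by (auto simp: h_def abs_mult fun_eq_iff)
    then show "(\<integral>s. norm (h \<eta> s) \<partial>lborel) \<le> N * (2 * R) * W \<eta>"
      using R by simp
  qed
  then show ?thesis unfolding h_def .
qed

lemma Vint_bound: "norm (Vint x \<eta> s) \<le> N * W \<eta> * indicator {-R..R} s"
proof -
  have "norm (Vint x \<eta> s) = heat 1 (snd x - s) * norm (complex_of_real (exp (- ((norm \<eta>)\<^sup>2 - k\<^sup>2))) * P \<eta> s)"
    unfolding Vint_alt norm_mult[of "_ * complex_of_real (heat 1 _)"] by (simp add: norm_mult[of "cis _"] heat_nonneg)
  also have "\<dots> \<le> 1 * (N * W \<eta> * indicator {-R..R} s)"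
    by (intro mult_mono heat_1_le WP_bound) auto
  finally show ?thesis by simp
qed

lemma Vint_measurable [measurable (raw)]:
  assumes [measurable]: "g1 \<in> borel_measurable M" "g2 \<in> borel_measurable M" "g3 \<in> borel_measurable M"
  shows "(\<lambda>p. Vint (g1 p) (g2 p) (g3 p)) \<in> borel_measurable M"
  unfolding Vint_def by measurable

text \<open>Fubini brings the test function under the heat kernel, where
  \<open>heat_parametrix\<close> applies for each source point. The value of the evolution at time 0
  is the wanted \<open>- f\<close>, the value at time 1 a smooth remainder.\<close>

lemma pairing_U0:
  assumes T: "test_function r w w1 w2"
  shows "integrable lborel (\<lambda>x. U0 x * (test_function.lap w2 x + complex_of_real (k\<^sup>2) * w x))"
    and "(\<integral>x. U0 x * (test_function.lap w2 x + complex_of_real (k\<^sup>2) * w x) \<partial>lborel)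
      = complex_of_real (exp (k\<^sup>2)) * (\<integral>y. f y * (\<integral>x. complex_of_real (heat 1 (x - y)) * w x \<partial>lborel) \<partial>lborel) - (\<integral>y. f y * w y \<partial>lborel)"
proof -
  interpret tf: test_function r w w1 w2 by (rule T)
  define g where "g x = tf.lap x + complex_of_real (k\<^sup>2) * w x" for x
  have gc: "continuous_on UNIV g" unfolding g_def by (intro continuous_intros tf.lap_cont tf.w_cont)
  have gs: "norm x > r \<Longrightarrow> g x = 0" for x unfolding g_def by (simp add: tf.lap_supp tf.w_supp)
  have [measurable]: "g \<in> borel_measurable borel" using gc by (rule borel_measurable_continuous_onI)
  have gi: "integrable lborel g" using integrable_continuous_support[OF gc gs] by blast
  define Z where "Z x p = K0 x (fst p) (snd p) * g x" for x and p :: "real \<times> ('v \<times> real)"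
  have Zi: "integrable lborel (\<lambda>q. Z (fst q) (snd q))"
  proof (rule lborel_integrable_iterated[where g=Z and B="\<lambda>x. exp (k\<^sup>2) * N * norm (g x)"])
    show "(\<lambda>q. Z (fst q) (snd q)) \<in> borel_measurable borel" unfolding Z_def by measurable
    show "integrable lborel (\<lambda>x. exp (k\<^sup>2) * N * norm (g x))" by (intro integrable_mult_right integrable_norm gi)
    fix x
    show "integrable lborel (Z x)" unfolding Z_def by (intro integrable_mult_left K0_integrable)
    have "(\<integral>p. norm (Z x p) \<partial>lborel) = (\<integral>p. norm (K0 x (fst p) (snd p)) \<partial>lborel) * norm (g x)"
      unfolding Z_def norm_mult by (rule integral_mult_left_zero)
    also have "\<dots> \<le> exp (k\<^sup>2) * N * norm (g x)" by (intro mult_right_mono K0_norm) auto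
    finally show "(\<integral>p. norm (Z x p) \<partial>lborel) \<le> exp (k\<^sup>2) * N * norm (g x)" .
  qed
  have Zp: "(\<integral>p. Z x p \<partial>lborel) = U0 x * g x" for x
    unfolding Z_def U0_alt integral_mult_left_zero lborel_iterated[where g="K0 x", OF K0_integrable] ..
  define Y where "Y t y = (\<integral>x. Z x (t, y) \<partial>lborel)" for t y
  have Yi: "integrable lborel (\<lambda>p. Y (fst p) (snd p))"
    using lborel_integrable_snd[where g=Z, OF Zi] by (simp add: Y_def)
  have Ye: "Y t y = f y * (indicator {0..1} t *\<^sub>R (complex_of_real (exp (k\<^sup>2 * t)) * (\<integral>x. complex_of_real (heat t (x - y)) * g x \<partial>lborel)))" for t y
  proof -
    have "Z x (t, y) = (f y * (indicator {0..1} t *\<^sub>R complex_of_real (exp (k\<^sup>2 * t)))) * (complex_of_real (heat t (x - y)) * g x)" for x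
      by (simp add: Z_def K0_def scaleR_conv_of_real mult_ac)
    then have "Y t y = (f y * (indicator {0..1} t *\<^sub>R complex_of_real (exp (k\<^sup>2 * t)))) * (\<integral>x. complex_of_real (heat t (x - y)) * g x \<partial>lborel)"
      unfolding Y_def by (simp only: integral_mult_right_zero)
    then show ?thesis by (simp add: scaleR_conv_of_real mult_ac)
  qed
  define H where "H y = (\<integral>x. complex_of_real (heat 1 (x - y)) * w x \<partial>lborel)" for y
  have Yt: "(\<integral>t. Y t y \<partial>lborel) = f y * (complex_of_real (exp (k\<^sup>2)) * H y - w y)" for y
    unfolding Ye integral_mult_right_zero g_def tf.heat_parametrix H_def ..
  obtain M where M: "\<And>x. norm (w x) \<le> M" using integrable_continuous_support[OF tf.w_cont(1) tf.w_supp] by blast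
  have fw: "integrable lborel (\<lambda>y. f y * w y)"
    by (rule f_integrable[where B=M]) (auto intro: M)
  have fYi: "integrable lborel (\<lambda>y. f y * (complex_of_real (exp (k\<^sup>2)) * H y - w y))"
    using lborel_integrable_snd[where g=Y, OF Yi] unfolding Yt .
  have fH: "integrable lborel (\<lambda>y. complex_of_real (exp (k\<^sup>2)) * (f y * H y))"
    using Bochner_Integration.integrable_add[OF fYi fw] by (simp add: algebra_simps)
  show "integrable lborel (\<lambda>x. U0 x * (test_function.lap w2 x + complex_of_real (k\<^sup>2) * w x))"
    using lborel_integrable_fst[where g=Z, OF Zi] unfolding Zp g_def .
  have "(\<integral>x. U0 x * g x \<partial>lborel) = (\<integral>x. \<integral>p. Z x p \<partial>lborel \<partial>lborel)" unfolding Zp ..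
  also have "\<dots> = (\<integral>p. \<integral>x. Z x p \<partial>lborel \<partial>lborel)" by (rule lborel_Fubini[where g=Z, OF Zi])
  also have "\<dots> = (\<integral>p. Y (fst p) (snd p) \<partial>lborel)" by (simp add: Y_def)
  also have "\<dots> = (\<integral>t. \<integral>y. Y t y \<partial>lborel \<partial>lborel)" by (rule lborel_iterated[where g=Y, OF Yi])
  also have "\<dots> = (\<integral>y. \<integral>t. Y t y \<partial>lborel \<partial>lborel)" by (rule lborel_Fubini[where g=Y, OF Yi])
  also have "\<dots> = (\<integral>y. complex_of_real (exp (k\<^sup>2)) * (f y * H y) - f y * w y \<partial>lborel)"
    unfolding Yt by (intro Bochner_Integration.integral_cong) (auto simp: algebra_simps)
  also have "\<dots> = complex_of_real (exp (k\<^sup>2)) * (\<integral>y. f y * H y \<partial>lborel) - (\<integral>y. f y * w y \<partial>lborel)"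
    unfolding integral_mult_right_zero[symmetric] by (rule Bochner_Integration.integral_diff[OF fH fw])
  finally show "(\<integral>x. U0 x * (test_function.lap w2 x + complex_of_real (k\<^sup>2) * w x) \<partial>lborel)
      = complex_of_real (exp (k\<^sup>2)) * (\<integral>y. f y * (\<integral>x. complex_of_real (heat 1 (x - y)) * w x \<partial>lborel) \<partial>lborel) - (\<integral>y. f y * w y \<partial>lborel)"
    unfolding g_def H_def .
qed

text \<open>The Helmholtz operator goes onto the plane wave by \<open>plane_wave_lap\<close>;
  \<open>P_ode\<close> at time 1 then replaces \<open>P\<close> by the transform of
  \<open>f\<close>, and the Gaussian integral over the frequency restores the full heat kernel at
  time 1. The result is the remainder left by \<open>U0\<close>.\<close>

lemma pairing_V:
  assumes T: "test_function r w w1 w2"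
  shows "integrable lborel (\<lambda>x. V x * (test_function.lap w2 x + complex_of_real (k\<^sup>2) * w x))"
    and "(\<integral>x. V x * (test_function.lap w2 x + complex_of_real (k\<^sup>2) * w x) \<partial>lborel)
      = complex_of_real (exp (k\<^sup>2)) * (\<integral>y. f y * (\<integral>x. complex_of_real (heat 1 (x - y)) * w x \<partial>lborel) \<partial>lborel)"
proof -
  interpret tf: test_function r w w1 w2 by (rule T)
  define c where "c = (2 * pi) ^ DIM('v)"
  have c0: "c > 0" by (simp add: c_def)
  define g where "g x = tf.lap x + complex_of_real (k\<^sup>2) * w x" for x
  have gc: "continuous_on UNIV g" unfolding g_def by (intro continuous_intros tf.lap_cont tf.w_cont)
  have gs: "norm x > r \<Longrightarrow> g x = 0" for x unfolding g_def by (simp add: tf.lap_supp tf.w_supp)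
  have [measurable]: "g \<in> borel_measurable borel" using gc by (rule borel_measurable_continuous_onI)
  have gi: "integrable lborel g" using integrable_continuous_support[OF gc gs] by blast
  obtain M where M: "\<And>x. norm (w x) \<le> M" using integrable_continuous_support[OF tf.w_cont(1) tf.w_supp] by blast
  have M0: "M \<ge> 0" using M[of 0] norm_ge_zero order_trans by blast
  define BV where "BV = (\<integral>p. N * W (fst p) * indicator {-R..R} (snd p :: real) \<partial>lborel)"
  define a where "a \<eta> = (norm \<eta>)\<^sup>2 - k\<^sup>2" for \<eta> :: 'v
  define Z where "Z x p = Vint x (fst p) (snd p) * g x" for x and p :: "'v \<times> real"
  have Zi: "integrable lborel (\<lambda>q. Z (fst q) (snd q))"
  proof (rule lborel_integrable_iterated[where g=Z and B="\<lambda>x. BV * norm (g x)"])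
    show "(\<lambda>q. Z (fst q) (snd q)) \<in> borel_measurable borel" unfolding Z_def by measurable
    show "integrable lborel (\<lambda>x. BV * norm (g x))" by (intro integrable_mult_right integrable_norm gi)
    fix x
    show "integrable lborel (Z x)" unfolding Z_def by (intro integrable_mult_left Vint_integrable)
    have "(\<integral>p. norm (Z x p) \<partial>lborel) = (\<integral>p. norm (Vint x (fst p) (snd p)) \<partial>lborel) * norm (g x)"
      unfolding Z_def norm_mult by (rule integral_mult_left_zero)
    also have "\<dots> \<le> BV * norm (g x)"
      unfolding BV_def by (intro mult_right_mono integral_mono integrable_norm Vint_integrable W_ind_integrable Vint_bound) auto
    finally show "(\<integral>p. norm (Z x p) \<partial>lborel) \<le> BV * norm (g x)" .
  qed
  have Zp: "(\<integral>p. Z x p \<partial>lborel) = complex_of_real c * (V x * g x)" for x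
    unfolding Z_def V_def integral_mult_left_zero lborel_iterated[where g="Vint x", OF Vint_integrable] using c0 by (simp add: c_def)
  show "integrable lborel (\<lambda>x. V x * (test_function.lap w2 x + complex_of_real (k\<^sup>2) * w x))"
    using integrable_mult_right[OF lborel_integrable_fst[where g=Z, OF Zi], of "complex_of_real (1 / c)"] c0 unfolding Zp g_def
    by (simp add: mult.assoc[symmetric])
  define Y where "Y \<eta> s = (\<integral>x. Z x (\<eta>, s) \<partial>lborel)" for \<eta> s
  have Yi: "integrable lborel (\<lambda>p. Y (fst p) (snd p))"
    using lborel_integrable_snd[where g=Z, OF Zi] by (simp add: Y_def)
  define q where "q \<eta> s = heat2 1 s - a \<eta> * heat 1 s" for \<eta> s
  have Ye: "Y \<eta> s = complex_of_real (exp (- a \<eta>)) * (\<integral>x. P \<eta> s * (cis (\<eta> \<bullet> fst x) * complex_of_real (q \<eta> (snd x - s)) * w x) \<partial>lborel)" for \<eta> s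
  proof -
    have "Z x (\<eta>, s) = (complex_of_real (exp (- a \<eta>)) * P \<eta> s) * (cis (\<eta> \<bullet> fst x) * complex_of_real (heat 1 (snd x - s)) * g x)" for x
      by (simp add: Z_def Vint_def a_def mult_ac)
    then have "Y \<eta> s = (complex_of_real (exp (- a \<eta>)) * P \<eta> s) * (\<integral>x. cis (\<eta> \<bullet> fst x) * complex_of_real (heat 1 (snd x - s)) * g x \<partial>lborel)"
      unfolding Y_def by (simp only: integral_mult_right_zero)
    also have "\<dots> = complex_of_real (exp (- a \<eta>)) * (\<integral>x. P \<eta> s * (cis (\<eta> \<bullet> fst x) * complex_of_real (q \<eta> (snd x - s)) * w x) \<partial>lborel)"
      unfolding g_def plane_wave_lap[OF T] q_def a_def integral_mult_right_zero by (simp only: mult.assoc)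
    finally show ?thesis .
  qed
  \<comment> \<open>The integrand after \<open>P\<close> has been replaced by \<open>f\<close>, with
    both spatial variables in one pair. Being dominated by a Gaussian in \<eta> on a compact set of
    pairs, it can be integrated in any order.\<close>
  define L where "L p \<eta> = complex_of_real (heat 1 (snd (fst p) - snd (snd p))) * w (fst p) * f (snd p) * (complex_of_real (exp (k\<^sup>2)) *
     (cis (\<eta> \<bullet> (fst (fst p) - fst (snd p))) * complex_of_real (exp (- 1 * (norm \<eta>)\<^sup>2))))"
    for p :: "('v \<times> real) \<times> ('v \<times> real)" and \<eta> :: 'v
  have supp: "w (fst p) * f (snd p) = 0" if "norm p > \<bar>r\<bar> + R" for p :: "('v \<times> real) \<times> ('v \<times> real)"
  proof -
    have "norm (fst p) + norm (snd p) > \<bar>r\<bar> + R" using that norm_Pair_le[of "fst p" "snd p"] by simp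
    then have "norm (fst p) > r \<or> norm (snd p) > R" by linarith
    then show ?thesis using tf.w_supp[of "fst p"] f_supp[of "snd p"] by auto
  qed
  have Lm: "(\<lambda>p. L (fst p) (snd p)) \<in> borel_measurable borel" unfolding L_def by measurable
  have wfb: "norm (w (fst p) * f (snd p)) \<le> M * N" for p :: "('v \<times> real) \<times> ('v \<times> real)"
    unfolding norm_mult using M f_bound M0 by (intro mult_mono) auto
  have Li: "integrable lborel (\<lambda>p. L (fst p) (snd p))"
  proof (rule lborel_integrable_iterated[where g=L, OF Lm, where B="\<lambda>p. indicator (cball 0 (\<bar>r\<bar> + R)) p *\<^sub>R (M * N * (exp (k\<^sup>2) * pi powr (real DIM('v) / 2)))"])
    show "integrable lborel (\<lambda>p :: ('v \<times> real) \<times> ('v \<times> real). indicator (cball 0 (\<bar>r\<bar> + R)) p *\<^sub>R (M * N * (exp (k\<^sup>2) * pi powr (real DIM('v) / 2))))"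
      by (intro borel_integrable_compact) auto
    fix p :: "('v \<times> real) \<times> ('v \<times> real)"
    show "integrable lborel (L p)" unfolding L_def by (intro integrable_mult_right fourier_gauss) auto
    have ge: "(\<integral>\<eta>. exp (- 1 * (norm (\<eta>::'v))\<^sup>2) \<partial>lborel) = pi powr (real DIM('v) / 2)"
    proof -
      have "complex_of_real (\<integral>\<eta>. exp (- 1 * (norm (\<eta>::'v))\<^sup>2) \<partial>lborel) = complex_of_real (pi powr (real DIM('v) / 2))"
        using fourier_gauss(2)[of 1 "0::'v"] by simp
      then show ?thesis by (simp only: of_real_eq_iff)
    qed
    have ne: "norm (L p \<eta>) = (heat 1 (snd (fst p) - snd (snd p)) * norm (w (fst p) * f (snd p)) * exp (k\<^sup>2)) * exp (- 1 * (norm \<eta>)\<^sup>2)" for \<eta>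
      by (simp add: L_def norm_mult heat_nonneg)
    have "(\<integral>\<eta>. norm (L p \<eta>) \<partial>lborel) = (heat 1 (snd (fst p) - snd (snd p)) * norm (w (fst p) * f (snd p)) * exp (k\<^sup>2)) * pi powr (real DIM('v) / 2)"
      unfolding ne integral_mult_right_zero ge ..
    also have "\<dots> \<le> (1 * norm (w (fst p) * f (snd p)) * exp (k\<^sup>2)) * pi powr (real DIM('v) / 2)"
      by (intro mult_right_mono heat_1_le) auto
    also have "\<dots> \<le> indicator (cball 0 (\<bar>r\<bar> + R)) p *\<^sub>R (M * N * (exp (k\<^sup>2) * pi powr (real DIM('v) / 2)))"
    proof (cases "norm p \<le> \<bar>r\<bar> + R")
      case True
      then show ?thesis using mult_right_mono[OF wfb[of p], of "exp (k\<^sup>2) * pi powr (real DIM('v) / 2)"] by (simp add: mult.assoc)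
    next
      case False
      then have e: "w (fst p) * f (snd p) = 0" by (intro supp) simp
      show ?thesis unfolding e using False by simp
    qed
    finally show "(\<integral>\<eta>. norm (L p \<eta>) \<partial>lborel) \<le> indicator (cball 0 (\<bar>r\<bar> + R)) p *\<^sub>R (M * N * (exp (k\<^sup>2) * pi powr (real DIM('v) / 2)))" .
  qed
  have L\<eta>: "(\<integral>\<eta>. L p \<eta> \<partial>lborel) = complex_of_real (c * exp (k\<^sup>2)) * (f (snd p) * (complex_of_real (heat 1 (fst p - snd p)) * w (fst p)))" for p
    unfolding L_def integral_mult_right_zero fourier_heat[OF zero_less_one] c_def
    by (simp add: heat_pair)
  have inner: "(\<integral>s. Y \<eta> s \<partial>lborel) = (\<integral>p. L p \<eta> \<partial>lborel)" if \<eta>: "norm \<eta> \<noteq> k" for \<eta>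
  proof -
    define b where "b = \<bar>r\<bar> + R"
    have qc: "continuous_on {-b..b} (q \<eta>)" unfolding q_def by (intro continuous_intros continuous_on_heat12) auto
    obtain G where G: "\<And>s. s \<in> {-b..b} \<Longrightarrow> \<bar>q \<eta> s\<bar> \<le> G" using continuous_on_Icc_abs_bounded[OF qc] by blast
    have "0 \<in> {-b..b}" using R by (simp add: b_def)
    from order_trans[OF abs_ge_zero G[OF this]] have G0: "G \<ge> 0" .
    have [measurable]: "q \<eta> \<in> borel_measurable borel" unfolding q_def by measurable
    define X where "X s x = P \<eta> s * (cis (\<eta> \<bullet> fst x) * complex_of_real (q \<eta> (snd x - s)) * w x)" for s and x :: "'v \<times> real"
    have Xi: "integrable lborel (\<lambda>p. X (fst p) (snd p))"
    proof (rule integrable_bounded_support[where r=b and B="pb \<eta> * (G * M)"])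
      show "(\<lambda>p. X (fst p) (snd p)) \<in> borel_measurable borel" unfolding X_def by measurable
      have z: "X (fst p) (snd p) = 0" if "\<not> (\<bar>fst p\<bar> \<le> R \<and> norm (snd p) \<le> \<bar>r\<bar>)" for p
      proof -
        have "\<bar>fst p\<bar> > R \<or> norm (snd p) > r" using that by linarith
        then show ?thesis
        proof
          assume "\<bar>fst p\<bar> > R"
          then have "P \<eta> (fst p) = 0" by (auto simp: P_def indicator_def)
          then show ?thesis by (simp add: X_def)
        qed (simp add: X_def tf.w_supp)
      qed
      fix p :: "real \<times> ('v \<times> real)"
      show "norm (X (fst p) (snd p)) \<le> pb \<eta> * (G * M)"
      proof (cases "\<bar>fst p\<bar> \<le> R \<and> norm (snd p) \<le> \<bar>r\<bar>")
        case True
        then have "\<bar>snd (snd p)\<bar> \<le> \<bar>r\<bar>" using norm_snd_le[of "snd (snd p)" "fst (snd p)"] by simp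
        then have "snd (snd p) - fst p \<in> {-b..b}" using True by (auto simp: b_def abs_le_iff)
        from G[OF this] have q: "\<bar>q \<eta> (snd (snd p) - fst p)\<bar> \<le> G" .
        have Pb: "norm (P \<eta> (fst p)) \<le> pb \<eta>" using order_trans[OF P_bound[of \<eta> "fst p"], of "pb \<eta>"] pb_nonneg[of \<eta>] by (auto simp: indicator_def)
        show ?thesis unfolding X_def norm_mult using q Pb M[of "snd p"] M0 G0 pb_nonneg[of \<eta>]
          by (intro mult_mono) auto
      next
        case False
        then show ?thesis using z[OF False] pb_nonneg[of \<eta>] G0 M0 by simp
      qed
      assume "norm p > b"
      then have "\<bar>fst p\<bar> + norm (snd p) > \<bar>r\<bar> + R" using norm_Pair_le[of "fst p" "snd p"] by (simp add: b_def)
      then show "X (fst p) (snd p) = 0" by (intro z) linarith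
    qed
    have pi_: "integrable lborel (\<lambda>p. L (fst p, snd p) \<eta>)"
    proof (rule integrable_bounded_support[where r=b and B="M * N * exp (k\<^sup>2)"])
      show "(\<lambda>p. L (fst p, snd p) \<eta>) \<in> borel_measurable borel" unfolding L_def by measurable
      fix p :: "('v \<times> real) \<times> ('v \<times> real)"
      have "norm (L (fst p, snd p) \<eta>) = (heat 1 (snd (fst p) - snd (snd p)) * norm (w (fst p) * f (snd p)) * exp (k\<^sup>2)) * exp (- 1 * (norm \<eta>)\<^sup>2)"
        by (simp add: L_def norm_mult heat_nonneg)
      also have "\<dots> \<le> (1 * (M * N) * exp (k\<^sup>2)) * 1"
        using wfb[of p] M0 N by (intro mult_mono heat_1_le) (auto simp: heat_nonneg)
      finally show "norm (L (fst p, snd p) \<eta>) \<le> M * N * exp (k\<^sup>2)" by simp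
      assume "norm p > b"
      then show "L (fst p, snd p) \<eta> = 0" using supp[of p] by (auto simp: L_def b_def)
    qed
    have "(\<integral>s. Y \<eta> s \<partial>lborel) = complex_of_real (exp (- a \<eta>)) * (\<integral>s. \<integral>x. X s x \<partial>lborel \<partial>lborel)"
      unfolding Ye X_def integral_mult_right_zero ..
    also have "(\<integral>s. \<integral>x. X s x \<partial>lborel \<partial>lborel) = (\<integral>x. \<integral>s. X s x \<partial>lborel \<partial>lborel)" by (rule lborel_Fubini[where g=X, OF Xi])
    also have "\<dots> = (\<integral>x. cis (\<eta> \<bullet> fst x) * w x * (\<integral>y. f y * (cis (- (\<eta> \<bullet> fst y)) * complex_of_real (heat 1 (snd x - snd y))) \<partial>lborel) \<partial>lborel)"
    proof (intro Bochner_Integration.integral_cong refl)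
      fix x
      have "X s x = (cis (\<eta> \<bullet> fst x) * w x) * (complex_of_real (heat2 1 (snd x - s) - ((norm \<eta>)\<^sup>2 - k\<^sup>2) * heat 1 (snd x - s)) * P \<eta> s)" for s
        by (simp add: X_def q_def a_def mult_ac)
      then show "(\<integral>s. X s x \<partial>lborel) = cis (\<eta> \<bullet> fst x) * w x * (\<integral>y. f y * (cis (- (\<eta> \<bullet> fst y)) * complex_of_real (heat 1 (snd x - snd y))) \<partial>lborel)"
        by (simp only: integral_mult_right_zero P_ode[OF \<eta> zero_less_one])
    qed
    also have "complex_of_real (exp (- a \<eta>)) * \<dots> = (\<integral>x. \<integral>y. L (x, y) \<eta> \<partial>lborel \<partial>lborel)"
    proof -
      have "L (x, y) \<eta> = (complex_of_real (exp (- a \<eta>)) * (cis (\<eta> \<bullet> fst x) * w x)) * (f y * (cis (- (\<eta> \<bullet> fst y)) * complex_of_real (heat 1 (snd x - snd y))))" for x y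
      proof -
        have "complex_of_real (exp (- a \<eta>)) = complex_of_real (exp (k\<^sup>2)) * complex_of_real (exp (- 1 * (norm \<eta>)\<^sup>2))"
          by (simp add: a_def exp_diff exp_minus field_simps)
        moreover have "cis (\<eta> \<bullet> (fst x - fst y)) = cis (\<eta> \<bullet> fst x) * cis (- (\<eta> \<bullet> fst y))"
          by (simp add: cis_mult inner_diff_right)
        ultimately show ?thesis by (simp add: L_def mult_ac)
      qed
      then show ?thesis by (simp only: integral_mult_right_zero mult.assoc)
    qed
    also have "\<dots> = (\<integral>p. L p \<eta> \<partial>lborel)"
      using lborel_iterated[where g="\<lambda>x y. L (x, y) \<eta>", OF pi_] by simp
    finally show ?thesis .
  qed
  have "complex_of_real c * (\<integral>x. V x * g x \<partial>lborel) = (\<integral>x. \<integral>p. Z x p \<partial>lborel \<partial>lborel)" unfolding Zp integral_mult_right_zero ..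
  also have "\<dots> = (\<integral>p. \<integral>x. Z x p \<partial>lborel \<partial>lborel)" by (rule lborel_Fubini[where g=Z, OF Zi])
  also have "\<dots> = (\<integral>p. Y (fst p) (snd p) \<partial>lborel)" by (simp add: Y_def)
  also have "\<dots> = (\<integral>\<eta>. \<integral>s. Y \<eta> s \<partial>lborel \<partial>lborel)" by (rule lborel_iterated[where g=Y, OF Yi])
  also have "\<dots> = (\<integral>\<eta>. \<integral>p. L p \<eta> \<partial>lborel \<partial>lborel)"
  proof (rule integral_cong_AE)
    show "AE \<eta> in lborel. (\<integral>s. Y \<eta> s \<partial>lborel) = (\<integral>p. L p \<eta> \<partial>lborel)"
      using AE_norm_neq_k by eventually_elim (simp add: inner)
    show "(\<lambda>\<eta>. \<integral>s. Y \<eta> s \<partial>lborel) \<in> borel_measurable lborel"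
      using lborel_integrable_fst[where g=Y, OF Yi] borel_measurable_integrable by blast
    show "(\<lambda>\<eta>. \<integral>p. L p \<eta> \<partial>lborel) \<in> borel_measurable lborel"
      using lborel_integrable_snd[where g=L, OF Li] borel_measurable_integrable by blast
  qed
  also have "\<dots> = (\<integral>p. \<integral>\<eta>. L p \<eta> \<partial>lborel \<partial>lborel)" by (rule lborel_Fubini[where g=L, OF Li, symmetric])
  also have "\<dots> = (\<integral>x. \<integral>y. (\<integral>\<eta>. L (x, y) \<eta> \<partial>lborel) \<partial>lborel \<partial>lborel)"
    using lborel_iterated[where g="\<lambda>x y. \<integral>\<eta>. L (x, y) \<eta> \<partial>lborel"] lborel_integrable_fst[where g=L, OF Li] by simp
  also have "\<dots> = (\<integral>y. \<integral>x. (\<integral>\<eta>. L (x, y) \<eta> \<partial>lborel) \<partial>lborel \<partial>lborel)"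
    by (rule lborel_Fubini[where g="\<lambda>x y. \<integral>\<eta>. L (x, y) \<eta> \<partial>lborel"]) (use lborel_integrable_fst[where g=L, OF Li] in simp)
  also have "\<dots> = complex_of_real c * (complex_of_real (exp (k\<^sup>2)) * (\<integral>y. f y * (\<integral>x. complex_of_real (heat 1 (x - y)) * w x \<partial>lborel) \<partial>lborel))"
    unfolding L\<eta> fst_conv snd_conv integral_mult_right_zero of_real_mult mult.assoc ..
  finally have "(\<integral>x. V x * g x \<partial>lborel) = complex_of_real (exp (k\<^sup>2)) * (\<integral>y. f y * (\<integral>x. complex_of_real (heat 1 (x - y)) * w x \<partial>lborel) \<partial>lborel)"
    using c0 by simp
  then show "(\<integral>x. V x * (test_function.lap w2 x + complex_of_real (k\<^sup>2) * w x) \<partial>lborel)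
      = complex_of_real (exp (k\<^sup>2)) * (\<integral>y. f y * (\<integral>x. complex_of_real (heat 1 (x - y)) * w x \<partial>lborel) \<partial>lborel)"
    unfolding g_def .
qed

text \<open>The heat-smoothed source appears in both pairings and cancels in the difference.\<close>

lemma pairing:
  assumes T: "test_function r w w1 w2"
  shows "integrable lborel (\<lambda>x. u x * (test_function.lap w2 x + complex_of_real (k\<^sup>2) * w x))"
    and "(\<integral>x. u x * (test_function.lap w2 x + complex_of_real (k\<^sup>2) * w x) \<partial>lborel) = (\<integral>y. f y * w y \<partial>lborel)"
proof -
  note i = pairing_V(1)[OF T] pairing_U0(1)[OF T]
  have e: "u x * (test_function.lap w2 x + complex_of_real (k\<^sup>2) * w x) = V x * (test_function.lap w2 x + complex_of_real (k\<^sup>2) * w x) - U0 x * (test_function.lap w2 x + complex_of_real (k\<^sup>2) * w x)" for x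
    by (simp only: u_def left_diff_distrib)
  show "integrable lborel (\<lambda>x. u x * (test_function.lap w2 x + complex_of_real (k\<^sup>2) * w x))"
    unfolding e by (intro Bochner_Integration.integrable_diff i)
  show "(\<integral>x. u x * (test_function.lap w2 x + complex_of_real (k\<^sup>2) * w x) \<partial>lborel) = (\<integral>y. f y * w y \<partial>lborel)"
    unfolding e Bochner_Integration.integral_diff[OF i] pairing_V(2)[OF T] pairing_U0(2)[OF T] by simp
qed

section \<open>Unique continuation\<close>

text \<open>Along a complexified line the plane wave grows at most like
  \<open>exp (\<rho> * norm \<eta>)\<close> and the vertical Gaussian by a constant factor, and the
  Gaussian in \<open>W\<close> absorbs both. So \<open>V\<close> extends holomorphically to discs of
  every radius, wherever the source is.\<close>

lemma V_holomorphic_line: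
  assumes e: "norm e = 1" and \<rho>: "\<rho> > 0"
  shows "\<exists>g. g holomorphic_on ball 0 \<rho> \<and> (\<forall>\<tau>. g (complex_of_real \<tau>) = V (x + \<tau> *\<^sub>R e))"
proof -
  \<comment> \<open>\<open>cis\<close> and \<open>heat\<close> take real arguments, so both are
    rewritten through the complex exponential before the line parameter is made complex.\<close>
  define E where "E z \<eta> s = exp (\<i> * (complex_of_real (\<eta> \<bullet> fst x) + z * complex_of_real (\<eta> \<bullet> fst e))) *
     (complex_of_real (1 / sqrt (4 * pi)) * exp (- (complex_of_real (snd x - s) + z * complex_of_real (snd e))\<^sup>2 / 4))" for z \<eta> s
  define F where "F z p = E z (fst p) (snd p) * (complex_of_real (exp (- ((norm (fst p))\<^sup>2 - k\<^sup>2))) * P (fst p) (snd p))" for z and p :: "'v \<times> real"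
  define B where "B \<eta> s = exp (\<rho>\<^sup>2 / 4) * exp (\<rho> * norm \<eta>) * (N * W \<eta> * indicator {-R..R} s)" for \<eta> :: 'v and s :: real
  have e12: "norm (fst e) \<le> 1" "\<bar>snd e\<bar> \<le> 1" using norm_fst_le[of "fst e" "snd e"] norm_snd_le[of "snd e" "fst e"] e by auto
  have Eb: "norm (E z \<eta> s) \<le> exp (\<rho>\<^sup>2 / 4) * exp (\<rho> * norm \<eta>)" if z: "z \<in> ball 0 \<rho>" for z \<eta> s
  proof -
    have z': "\<bar>Im z\<bar> \<le> \<rho>" using z abs_Im_le_cmod[of z] by simp
    have "\<bar>\<eta> \<bullet> fst e\<bar> \<le> norm \<eta>" using Cauchy_Schwarz_ineq2[of \<eta> "fst e"] mult_left_le[OF e12(1) norm_ge_zero[of \<eta>]] by simp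
    then have "\<bar>Im z\<bar> * \<bar>\<eta> \<bullet> fst e\<bar> \<le> \<rho> * norm \<eta>" using z' \<rho> by (intro mult_mono) auto
    then have "- (Im z * (\<eta> \<bullet> fst e)) \<le> \<rho> * norm \<eta>" unfolding abs_mult[symmetric] by linarith
    then have 1: "norm (exp (\<i> * (complex_of_real (\<eta> \<bullet> fst x) + z * complex_of_real (\<eta> \<bullet> fst e)))) \<le> exp (\<rho> * norm \<eta>)"
      by (simp add: norm_exp_eq_Re)
    define c where "c = complex_of_real (snd x - s) + z * complex_of_real (snd e)"
    have "\<bar>Im c\<bar> \<le> \<rho>" using mult_mono[OF z' e12(2)] \<rho> by (simp add: c_def abs_mult)
    then have "(Im c)\<^sup>2 \<le> \<rho>\<^sup>2" using \<rho> by (metis abs_ge_zero power2_abs power_mono)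
    moreover have "Re (c\<^sup>2) = (Re c)\<^sup>2 - (Im c)\<^sup>2" by (simp add: power2_eq_square)
    ultimately have "- Re (c\<^sup>2) \<le> \<rho>\<^sup>2" using zero_le_power2[of "Re c"] by linarith
    then have 2: "norm (exp (- c\<^sup>2 / 4)) \<le> exp (\<rho>\<^sup>2 / 4)" by (simp add: norm_exp_eq_Re)
    have "1 / sqrt (4 * pi) \<le> 1 / 1" using pi_gt3 by (intro frac_le) auto
    then have 3: "norm (complex_of_real (1 / sqrt (4 * pi))) \<le> 1" unfolding norm_of_real by simp
    have "norm (E z \<eta> s) \<le> exp (\<rho> * norm \<eta>) * (1 * exp (\<rho>\<^sup>2 / 4))"
      unfolding E_def norm_mult c_def[symmetric] using 1 2 3 by (intro mult_mono) auto
    then show ?thesis by (simp add: mult.commute)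
  qed
  have Em: "(\<lambda>p. E z (fst p) (snd p)) \<in> borel_measurable borel" for z unfolding E_def by measurable
  have Bi: "integrable lborel (\<lambda>p. B (fst p) (snd p))"
  proof (rule lborel_integrable_iterated[where g=B and B="\<lambda>\<eta>. 2 * R * (exp (\<rho>\<^sup>2 / 4) * exp (\<rho> * norm \<eta>) * (N * W \<eta>))"])
    show "(\<lambda>p. B (fst p) (snd p)) \<in> borel_measurable borel" unfolding B_def W_def by measurable
    have "(\<lambda>\<eta>. 2 * R * (exp (\<rho>\<^sup>2 / 4) * exp (\<rho> * norm \<eta>) * (N * W \<eta>))) =
       (\<lambda>\<eta>. (2 * R * exp (\<rho>\<^sup>2 / 4) * N * (exp (k\<^sup>2) * (2 * R * exp (2 * R * k)) * vol)) * exp ((\<rho> + 2 * R) * norm (\<eta>::'v) - (norm \<eta>)\<^sup>2))"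
      by (auto simp: W_def fun_eq_iff exp_diff exp_add distrib_right)
    then show "integrable lborel (\<lambda>\<eta>. 2 * R * (exp (\<rho>\<^sup>2 / 4) * exp (\<rho> * norm \<eta>) * (N * W \<eta>)))"
      by (simp only: integrable_mult_right integrable_exp_norm_gauss)
    fix \<eta> :: 'v
    show "integrable lborel (B \<eta>)" unfolding B_def by (intro integrable_mult_right integrable_real_indicator) (use R in auto)
    have "(\<lambda>s. norm (B \<eta> s)) = (\<lambda>s. (exp (\<rho>\<^sup>2 / 4) * exp (\<rho> * norm \<eta>) * (N * W \<eta>)) * indicator {-R..R} s)"
      using N W_nonneg[of \<eta>] by (auto simp: B_def abs_mult fun_eq_iff)
    then show "(\<integral>s. norm (B \<eta> s) \<partial>lborel) \<le> 2 * R * (exp (\<rho>\<^sup>2 / 4) * exp (\<rho> * norm \<eta>) * (N * W \<eta>))"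
      using R by simp
  qed
  define g where "g z = complex_of_real (1 / (2 * pi) ^ DIM('v)) * (\<integral>p. F z p \<partial>lborel)" for z
  have "g holomorphic_on ball 0 \<rho>"
    unfolding g_def
  proof (intro holomorphic_on_mult holomorphic_on_const holomorphic_on_integral[where B="\<lambda>p. B (fst p) (snd p)"])
    show "(\<lambda>z. F z p) holomorphic_on ball 0 \<rho>" for p unfolding F_def E_def by (intro holomorphic_intros) auto
    show "F z \<in> borel_measurable lborel" if "z \<in> ball 0 \<rho>" for z unfolding F_def using Em[of z] by measurable
    show "norm (F z p) \<le> B (fst p) (snd p)" if "z \<in> ball 0 \<rho>" for z p
      unfolding F_def norm_mult[of "E _ _ _"] B_def by (intro mult_mono Eb that WP_bound) auto
  qed (use Bi in auto)
  moreover have "g (complex_of_real \<tau>) = V (x + \<tau> *\<^sub>R e)" for \<tau>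
  proof -
    have "F (complex_of_real \<tau>) p = Vint (x + \<tau> *\<^sub>R e) (fst p) (snd p)" for p
    proof -
      have h: "complex_of_real (heat 1 (snd x + \<tau> * snd e - s)) = complex_of_real (1 / sqrt (4 * pi)) * exp (- (complex_of_real (snd x - s) + complex_of_real \<tau> * complex_of_real (snd e))\<^sup>2 / 4)" for s
      proof -
        have "(complex_of_real (snd x - s) + complex_of_real \<tau> * complex_of_real (snd e))\<^sup>2 = complex_of_real ((snd x + \<tau> * snd e - s)\<^sup>2)"
          by (simp add: algebra_simps)
        then have "exp (- (complex_of_real (snd x - s) + complex_of_real \<tau> * complex_of_real (snd e))\<^sup>2 / 4) = complex_of_real (exp (- (snd x + \<tau> * snd e - s)\<^sup>2 / 4))"
          by (simp add: exp_of_real[symmetric])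
        then show ?thesis by (simp add: heat_real)
      qed
      have c: "cis (\<eta> \<bullet> fst (x + \<tau> *\<^sub>R e)) = exp (\<i> * (complex_of_real (\<eta> \<bullet> fst x) + complex_of_real \<tau> * complex_of_real (\<eta> \<bullet> fst e)))" for \<eta>
        by (simp add: cis_conv_exp inner_simps)
      show ?thesis unfolding F_def E_def Vint_alt c using h by simp
    qed
    then have Fe: "F (complex_of_real \<tau>) = (\<lambda>p. Vint (x + \<tau> *\<^sub>R e) (fst p) (snd p))" by (rule ext)
    show ?thesis unfolding g_def V_def Fe lborel_iterated[where g="Vint (x + \<tau> *\<^sub>R e)", OF Vint_integrable] ..
  qed
  ultimately show ?thesis by blast
qed

text \<open>The squared distance to a source point becomes a quadratic polynomial in the complex
  parameter. As long as its real part stays positive, the kernel decays as the time tends to 0; a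
  disc of a quarter of the distance to the source guarantees this.\<close>

lemma U0_holomorphic_line:
  assumes e: "norm e = 1" and r: "r > 0" and z: "\<And>y. dist x y < r \<Longrightarrow> f y = 0"
  shows "\<exists>g. g holomorphic_on ball 0 (r / 4) \<and> (\<forall>\<tau>. g (complex_of_real \<tau>) = U0 (x + \<tau> *\<^sub>R e))"
proof -
  define n where "n = real DIM('v \<times> real)"
  define q where "q \<zeta> y = complex_of_real ((norm (x - y))\<^sup>2) + 2 * \<zeta> * complex_of_real ((x - y) \<bullet> e) + \<zeta>\<^sup>2" for \<zeta> y
  define F where "F \<zeta> p = indicator {0..1} (fst p) *\<^sub>R (complex_of_real (exp (k\<^sup>2 * fst p) * (4 * pi * fst p) powr (- n / 2)) *
      (f (snd p) * exp (- q \<zeta> (snd p) / complex_of_real (4 * fst p))))" for \<zeta> and p :: "real \<times> ('v \<times> real)"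
  have "\<exists>C\<ge>0. \<forall>t. 0 < t \<longrightarrow> t \<le> 1 \<longrightarrow> (t::real) powr (- n / 2) * exp (- ((7 * r\<^sup>2 / 64) / t)) \<le> C"
    by (rule powr_exp_inverse_bounded) (use r in simp)
  then obtain C where C: "C \<ge> 0" "\<forall>t. 0 < t \<longrightarrow> t \<le> 1 \<longrightarrow> (t::real) powr (- n / 2) * exp (- ((7 * r\<^sup>2 / 64) / t)) \<le> C"
    by (elim exE conjE)
  \<comment> \<open>With \<open>d\<close> the distance and \<open>norm \<zeta> \<le> d / 4\<close>,
    the linear term costs at most \<open>d\<^sup>2 / 2\<close> and the quadratic one
    \<open>d\<^sup>2 / 16\<close>, which leaves \<open>7 / 16\<close>. Dividing by the 4 of the heat
    exponent gives the \<open>7 / 64\<close> above.\<close>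
  have qb: "Re (q \<zeta> y) \<ge> 7 / 16 * r\<^sup>2" if \<zeta>: "\<zeta> \<in> ball 0 (r / 4)" and y: "r \<le> norm (x - y)" for \<zeta> y
  proof -
    define d where "d = norm (x - y)"
    have d: "d \<ge> r" "norm \<zeta> \<le> d / 4" using y \<zeta> by (auto simp: d_def)
    have "\<bar>(x - y) \<bullet> e\<bar> \<le> d" using Cauchy_Schwarz_ineq2[of "x - y" e] e by (simp add: d_def)
    then have "\<bar>Re \<zeta>\<bar> * \<bar>(x - y) \<bullet> e\<bar> \<le> (d / 4) * d"
      using d(2) abs_Re_le_cmod[of \<zeta>] by (intro mult_mono) auto
    then have 1: "Re \<zeta> * ((x - y) \<bullet> e) \<ge> - (d\<^sup>2 / 4)" unfolding abs_mult[symmetric] by (simp add: power2_eq_square)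
    have "norm (\<zeta>\<^sup>2) \<le> (d / 4)\<^sup>2" unfolding norm_power using d(2) by (intro power_mono) auto
    then have 2: "Re (\<zeta>\<^sup>2) \<ge> - (d\<^sup>2 / 16)" using abs_Re_le_cmod[of "\<zeta>\<^sup>2"] by (simp add: power_divide)
    have "Re (q \<zeta> y) = d\<^sup>2 + 2 * (Re \<zeta> * ((x - y) \<bullet> e)) + Re (\<zeta>\<^sup>2)" by (simp add: q_def d_def)
    then have "Re (q \<zeta> y) \<ge> 7 / 16 * d\<^sup>2" using 1 2 by simp
    moreover have "r\<^sup>2 \<le> d\<^sup>2" using d(1) r by (intro power_mono) auto
    ultimately show ?thesis by linarith
  qed
  define B where "B p = indicator ({0..1} \<times> cball 0 R) p *\<^sub>R (exp (k\<^sup>2) * N * C)" for p :: "real \<times> ('v \<times> real)"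
  have Fb: "norm (F \<zeta> p) \<le> B p" if \<zeta>: "\<zeta> \<in> ball 0 (r / 4)" for \<zeta> p
  proof (cases "0 < fst p \<and> fst p \<le> 1 \<and> f (snd p) \<noteq> 0")
    case True
    then have t: "0 < fst p" "fst p \<le> 1" by auto
    have y: "r \<le> norm (x - snd p)" using z[of "snd p"] True by (force simp: dist_norm)
    have yR: "norm (snd p) \<le> R" using f_supp[of "snd p"] True by force
    have "(4 * pi * fst p) powr (- n / 2) \<le> fst p powr (- n / 2)"
      using t pi_gt3 by (intro powr_mono2') (auto simp: n_def)
    moreover have "norm (exp (- q \<zeta> (snd p) / complex_of_real (4 * fst p))) \<le> exp (- ((7 * r\<^sup>2 / 64) / fst p))"
    proof -
      have "Re (- q \<zeta> (snd p) / complex_of_real (4 * fst p)) = - Re (q \<zeta> (snd p)) / (4 * fst p)"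
        by (subst Re_divide_of_real) simp
      also have "\<dots> \<le> - (7 / 16 * r\<^sup>2) / (4 * fst p)" using qb[OF \<zeta> y] t by (intro divide_right_mono) auto
      also have "\<dots> = - ((7 * r\<^sup>2 / 64) / fst p)" by simp
      finally show ?thesis by (simp only: norm_exp_eq_Re exp_le_cancel_iff)
    qed
    ultimately have "(4 * pi * fst p) powr (- n / 2) * norm (exp (- q \<zeta> (snd p) / complex_of_real (4 * fst p))) \<le> fst p powr (- n / 2) * exp (- ((7 * r\<^sup>2 / 64) / fst p))"
      by (intro mult_mono) auto
    also have "\<dots> \<le> C" using C(2) t by blast
    finally have 1: "(4 * pi * fst p) powr (- n / 2) * norm (exp (- q \<zeta> (snd p) / complex_of_real (4 * fst p))) \<le> C" .
    have "norm (F \<zeta> p) = exp (k\<^sup>2 * fst p) * norm (f (snd p)) * ((4 * pi * fst p) powr (- n / 2) * norm (exp (- q \<zeta> (snd p) / complex_of_real (4 * fst p))))"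
      using t by (simp add: F_def norm_mult)
    also have "\<dots> \<le> exp (k\<^sup>2) * N * C"
      using 1 t f_bound[of "snd p"] N by (intro mult_mono) (auto simp: mult_left_le)
    also have "\<dots> = B p" using t yR by (simp add: B_def indicator_def mem_Times_iff)
    finally show ?thesis .
  next
    case False
    then have "F \<zeta> p = 0" by (cases "fst p = 0") (auto simp: F_def indicator_def)
    then show ?thesis using N C(1) by (simp add: B_def)
  qed
  define g where "g \<zeta> = (\<integral>p. F \<zeta> p \<partial>lborel)" for \<zeta>
  have "g holomorphic_on ball 0 (r / 4)"
    unfolding g_def
  proof (rule holomorphic_on_integral[where B=B])
    show "(\<lambda>\<zeta>. F \<zeta> p) holomorphic_on ball 0 (r / 4)" for p
    proof (cases "fst p = 0")
      case False
      then show ?thesis unfolding F_def q_def scaleR_conv_of_real by (intro holomorphic_intros) auto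
    qed (simp add: F_def)
    show "F \<zeta> \<in> borel_measurable lborel" for \<zeta> unfolding F_def q_def by measurable
    show "integrable lborel B" unfolding B_def by (intro borel_integrable_compact compact_Times) auto
  qed (use Fb in auto)
  moreover have "g (complex_of_real \<tau>) = U0 (x + \<tau> *\<^sub>R e)" for \<tau>
  proof -
    have "F (complex_of_real \<tau>) p = K0 (x + \<tau> *\<^sub>R e) (fst p) (snd p)" for p
    proof -
      have ee: "e \<bullet> e = 1" using e by (simp add: norm_eq_1)
      have "(norm (x + \<tau> *\<^sub>R e - y))\<^sup>2 = (norm (x - y))\<^sup>2 + 2 * \<tau> * ((x - y) \<bullet> e) + \<tau>\<^sup>2" for y
        unfolding power2_norm_eq_inner using ee by (simp add: inner_simps inner_commute power2_eq_square algebra_simps)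
      then have "q (complex_of_real \<tau>) y = complex_of_real ((norm (x + \<tau> *\<^sub>R e - y))\<^sup>2)" for y
        by (simp add: q_def)
      then have "exp (- q (complex_of_real \<tau>) y / complex_of_real (4 * t)) = complex_of_real (exp (- (norm (x + \<tau> *\<^sub>R e - y))\<^sup>2 / (4 * t)))" for y t
        by (simp add: exp_of_real[symmetric])
      then show ?thesis unfolding F_def K0_def heat_def n_def by (simp add: mult_ac)
    qed
    then have Fe: "F (complex_of_real \<tau>) = (\<lambda>p. K0 (x + \<tau> *\<^sub>R e) (fst p) (snd p))" by (rule ext)
    show ?thesis unfolding g_def U0_alt Fe
      by (rule lborel_iterated[where g="K0 (x + \<tau> *\<^sub>R e)", OF K0_integrable])
  qed
  ultimately show ?thesis by blast
qed

text \<open>On each line through \<open>x\<close> the field is holomorphic in a disc of radius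
  \<open>r / 4\<close> and vanishes near the centre, so the identity theorem applies. The point is
  that this radius depends on the distance to the source and not on the size \<open>s\<close> of the
  known zero set.\<close>

lemma u_zero_propagation:
  assumes r: "r > 0" and z: "\<And>y. dist x y < r \<Longrightarrow> f y = 0"
    and s: "s > 0" "\<And>y. dist x y < s \<Longrightarrow> u y = 0" and y: "dist x y < r / 4"
  shows "u y = 0"
proof (cases "y = x")
  case False
  define e where "e = (y - x) /\<^sub>R norm (y - x)"
  have e: "norm e = 1" using False by (simp add: e_def)
  obtain gV where gV: "gV holomorphic_on ball 0 (r / 4)" "\<And>\<tau>. gV (complex_of_real \<tau>) = V (x + \<tau> *\<^sub>R e)"
    using V_holomorphic_line[OF e, of "r / 4" x] r by auto
  obtain gU where gU: "gU holomorphic_on ball 0 (r / 4)" "\<And>\<tau>. gU (complex_of_real \<tau>) = U0 (x + \<tau> *\<^sub>R e)"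
    using U0_holomorphic_line[OF e r, of x] z by blast
  define g where "g \<zeta> = gV \<zeta> - gU \<zeta>" for \<zeta>
  have g: "g (complex_of_real \<tau>) = u (x + \<tau> *\<^sub>R e)" for \<tau> by (simp add: g_def gV gU u_def)
  define m where "m = min s (r / 4)"
  have m: "m > 0" "m \<le> s" "m \<le> r / 4" using r s by (auto simp: m_def)
  have "g (complex_of_real (norm (y - x))) = 0"
  proof (rule analytic_continuation[where f=g and S="ball 0 (r / 4)" and U="complex_of_real ` {-m<..<m}" and \<xi>=0])
    show "g holomorphic_on ball 0 (r / 4)" unfolding g_def by (intro holomorphic_on_diff gV gU)
    show "0 islimpt complex_of_real ` {-m<..<m}"
      unfolding islimpt_approachable
    proof (intro allI impI)
      fix d :: real assume d: "d > 0"
      show "\<exists>x'\<in>complex_of_real ` {- m<..<m}. x' \<noteq> 0 \<and> dist x' 0 < d"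
        using d m by (intro bexI[of _ "complex_of_real (min d m / 2)"] image_eqI[of _ _ "min d m / 2"]) auto
    qed
    show "g w = 0" if "w \<in> complex_of_real ` {-m<..<m}" for w
    proof -
      obtain \<tau> where \<tau>: "w = complex_of_real \<tau>" "\<bar>\<tau>\<bar> < m" using \<open>w \<in> _\<close> by auto
      then show ?thesis unfolding \<tau>(1) g using e m by (intro s(2)) (simp add: dist_norm)
    qed
  qed (use m r y in \<open>auto simp: dist_norm norm_minus_commute\<close>)
  then show ?thesis unfolding g using False by (simp add: e_def)
qed (use s in simp)

text \<open>The points off \<open>S\<close> near which \<open>u\<close> vanishes form a set
  \<open>Z\<close> that is open and relatively closed in the complement of \<open>S\<close>. Joining
  \<open>T\<close> to the exterior of the ball gives a connected set that contains a point far above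
  the source, where \<open>u\<close> is already known to vanish.\<close>

lemma unique_continuation:
  assumes S: "closed S" "\<And>y. f y \<noteq> 0 \<Longrightarrow> y \<in> S" "S \<subseteq> cball 0 R"
    and T: "connected T" "T \<subseteq> - S" "x1 \<in> T" "norm x1 > R" and x: "x \<in> T"
  shows "u x = 0"
proof -
  define Z where "Z = {x \<in> - S. \<exists>s>0. \<forall>y. dist x y < s \<longrightarrow> u y = 0}"
  have oW: "open (- S)" using S(1) by auto
  have oZ: "open Z"
    unfolding open_dist
  proof
    fix x assume "x \<in> Z"
    then obtain s where s: "s > 0" "\<And>y. dist x y < s \<Longrightarrow> u y = 0" "x \<in> - S" unfolding Z_def by blast
    obtain d where d: "d > 0" "\<And>y. dist y x < d \<Longrightarrow> y \<in> - S" using oW s(3) unfolding open_dist by blast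
    show "\<exists>e>0. \<forall>y. dist y x < e \<longrightarrow> y \<in> Z"
    proof (intro exI[of _ "min d (s / 2)"] conjI allI impI)
      fix y assume y: "dist y x < min d (s / 2)"
      have "u w = 0" if "dist y w < s / 2" for w
        using y that dist_triangle[of x w y] by (intro s(2)) (simp add: dist_commute)
      moreover have "y \<in> - S" using y d(2) by simp
      ultimately show "y \<in> Z" unfolding Z_def using s(1) by (auto intro!: exI[of _ "s / 2"])
    qed (use d s in auto)
  qed
  have cl: "x \<in> Z" if xS: "x \<in> - S" and xZ: "x \<in> closure Z" for x
  proof -
    obtain r where r: "r > 0" "ball x r \<subseteq> - S" using openE[OF oW xS] by blast
    have rS: "y \<in> - S" if "dist y x < r" for y using that r(2) by (auto simp: dist_commute)
    \<comment> \<open>The ball of radius \<open>r / 2\<close> about \<open>x1\<close> is free of the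
      source, so zeros spread over the radius \<open>r / 8\<close>. The ball of radius
      \<open>r / 20\<close> about \<open>x\<close> lies inside, since
      \<open>r / 20 + r / 20 < r / 8\<close>.\<close>
    obtain x1 where x1: "x1 \<in> Z" "dist x1 x < r / 20" using xZ r(1) unfolding closure_approachable by (auto dest!: spec[of _ "r / 20"])
    obtain s where s: "s > 0" "\<And>y. dist x1 y < s \<Longrightarrow> u y = 0" using x1(1) unfolding Z_def by blast
    have "u y = 0" if y: "dist x y < r / 20" for y
    proof (rule u_zero_propagation[where r="r / 2" and x=x1 and s=s])
      show "f w = 0" if "dist x1 w < r / 2" for w
      proof -
        have "dist w x < r" using that x1(2) dist_triangle[of w x x1] r(1) by (simp add: dist_commute)
        then show ?thesis using rS S(2) by blast
      qed
      show "dist x1 y < r / 2 / 4" using y x1(2) dist_triangle[of x1 y x] r(1) by (simp add: dist_commute)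
    qed (use r s in auto)
    then show ?thesis unfolding Z_def using xS r(1) by (auto intro!: exI[of _ "r / 20"])
  qed
  define T' where "T' = T \<union> - cball 0 R"
  \<comment> \<open>Dimension at least 2 is what keeps the exterior of a ball connected.\<close>
  have dim: "2 \<le> DIM('v \<times> real)" using DIM_positive[where 'a='v] by simp
  have cT: "connected T'"
    unfolding T'_def
  proof (rule connected_Un)
    show "connected (- cball (0::'v \<times> real) R)"
      by (intro connected_complement_bounded_convex dim) auto
  qed (use T in auto)
  have TS: "T' \<subseteq> - S" unfolding T'_def using T(2) S(3) by auto
  define x0 where "x0 = (0::'v, R + 2)"
  have n0: "norm x0 > R" using R by (simp add: x0_def norm_prod_def)
  have "u y = 0" if "dist x0 y < 1" for y
  proof (rule u_zero_top)
    have "dist (snd x0) (snd y) < 1" using dist_snd_le[of x0 y] that by linarith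
    then show "R + 1 < snd y" by (simp add: x0_def dist_real_def)
  qed
  then have x0Z: "x0 \<in> Z" unfolding Z_def using n0 S(3) by (auto intro!: exI[of _ 1])
  have x0T: "x0 \<in> T'" unfolding T'_def using n0 by simp
  have "Z \<inter> T' = {} \<or> (- S - closure Z) \<inter> T' = {}"
  proof (rule connectedD[OF cT oZ])
    show "open (- S - closure Z)" using oW by (intro open_Diff) auto
    show "Z \<inter> (- S - closure Z) \<inter> T' = {}" using closure_subset[of Z] by blast
    show "T' \<subseteq> Z \<union> (- S - closure Z)" using TS cl by blast
  qed
  then have "T' \<subseteq> Z" using x0Z x0T TS cl by blast
  then have "x \<in> Z" using x by (auto simp: T'_def)
  then obtain s where "s > 0" "\<And>y. dist x y < s \<Longrightarrow> u y = 0" unfolding Z_def by blast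
  then show ?thesis by simp
qed

text \<open>The part \<open>G\<close> of the cylinder below the graph is connected, since vertical
  segments join it to a slab at negative height. A path from infinity that ends at 0 outside the
  closure of \<Omega> must enter \<open>G\<close>, so unique continuation reaches all of
  \<open>G\<close>. Points on the graph itself lie in the closure of \<Omega> and are reached by a
  limit.\<close>

lemma exterior_zero:
  fixes b h :: real
  assumes \<Omega>: "open \<Omega>" "\<And>y. f y \<noteq> 0 \<Longrightarrow> y \<in> \<Omega>" "closure \<Omega> \<subseteq> cball 0 R"
    and b: "b > 0" and h: "h > 0"
    and graph: "\<Omega> \<inter> (ball 0 b \<times> {-h<..<h}) = {(x', t). norm x' < b \<and> - h < t \<and> t < h \<and> \<omega> x' < t}"
    and \<omega>: "continuous_on (ball 0 b) \<omega>" "\<And>x'. norm x' < b \<Longrightarrow> 0 \<le> \<omega> x'"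
    and \<gamma>: "connected_to_infinity (- closure \<Omega>) 0"
    and x: "norm (fst x) < b" "- h < snd x" "snd x < h" "x \<notin> \<Omega>"
  shows "u x = 0"
proof -
  define C where "C = ball (0::'v) b \<times> {-h<..<h}"
  have oC: "open C" unfolding C_def by (intro open_Times) auto
  define G where "G = {p \<in> C. snd p < \<omega> (fst p)}"
  have oG: "open G"
  proof -
    have "continuous_on C (\<lambda>p. \<omega> (fst p) - snd p)"
      unfolding C_def by (intro continuous_intros continuous_on_compose2[OF \<omega>(1)]) auto
    from continuous_open_preimage[OF this oC, of "{0<..}"] have "open (C \<inter> (\<lambda>p. \<omega> (fst p) - snd p) -` {0<..})" by simp
    also have "C \<inter> (\<lambda>p. \<omega> (fst p) - snd p) -` {0<..} = G" by (auto simp: G_def)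
    finally show ?thesis .
  qed
  have inO: "p \<in> \<Omega> \<longleftrightarrow> \<omega> (fst p) < snd p" if "p \<in> C" for p
    using graph that unfolding C_def by (cases p) (auto simp: set_eq_iff)
  have G\<Omega>: "G \<inter> closure \<Omega> = {}"
    using open_Int_closure_eq_empty[OF oG, of \<Omega>] inO by (force simp: G_def)
  define B where "B = ball (0::'v) b \<times> {-h<..<0}"
  have BG: "B \<subseteq> G" using \<omega>(2) h by (force simp: B_def G_def C_def)
  have cB: "connected B" unfolding B_def by (intro connected_Times) auto
  define L where "L p = closed_segment p (fst p, - h / 2)" for p :: "'v \<times> real"
  have LG: "L p \<subseteq> G" if "p \<in> G" for p
  proof
    fix y assume "y \<in> L p"
    then obtain \<theta> where \<theta>: "0 \<le> \<theta>" "\<theta> \<le> 1" "y = (1 - \<theta>) *\<^sub>R p + \<theta> *\<^sub>R (fst p, - h / 2)"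
      unfolding L_def closed_segment_def by blast
    have f: "fst y = fst p" unfolding \<theta>(3) by (simp add: algebra_simps flip: scaleR_add_left)
    have s: "snd y = (1 - \<theta>) * snd p + \<theta> * (- h / 2)" unfolding \<theta>(3) by simp
    have p: "norm (fst p) < b" "- h < snd p" "snd p < h" "snd p < \<omega> (fst p)" using that by (auto simp: G_def C_def mem_Times_iff)
    have "snd y \<le> max (snd p) (- h / 2)"
      unfolding s using \<theta> by (intro convex_bound_le) auto
    moreover have "- snd y \<le> max (- snd p) (h / 2)"
    proof -
      have "- snd y = (1 - \<theta>) * (- snd p) + \<theta> * (h / 2)" unfolding s by simp
      also have "\<dots> \<le> max (- snd p) (h / 2)" using \<theta> by (intro convex_bound_le) auto
      finally show ?thesis .
    qed
    ultimately show "y \<in> G" using p \<omega>(2)[OF p(1)] h by (auto simp: G_def C_def mem_Times_iff f)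
  qed
  have cG: "connected G"
  proof -
    have "connected (\<Union>p\<in>G. L p \<union> B)"
    proof (rule connected_Union)
      fix X assume "X \<in> (\<lambda>p. L p \<union> B) ` G"
      then obtain p where p: "p \<in> G" "X = L p \<union> B" by blast
      have "(fst p, - h / 2) \<in> L p \<inter> B" using p(1) h by (auto simp: L_def B_def G_def C_def mem_Times_iff)
      then show "connected X" unfolding p(2) by (intro connected_Un cB) (auto simp: L_def)
    next
      have "(0, - h / 2) \<in> B" using b h by (simp add: B_def)
      then show "\<Inter> ((\<lambda>p. L p \<union> B) ` G) \<noteq> {}" by blast
    qed
    also have "(\<Union>p\<in>G. L p \<union> B) = G" using LG BG by (auto simp: L_def)
    finally show ?thesis .
  qed
  obtain \<gamma> :: "real \<Rightarrow> 'v \<times> real" where g: "continuous_on {0<..} \<gamma>" "\<gamma> ` {0<..} \<subseteq> - closure \<Omega>"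
    "(\<gamma> \<longlongrightarrow> 0) (at_right 0)" "filterlim (\<lambda>s. norm (\<gamma> s)) at_top at_top"
    using \<gamma> unfolding connected_to_infinity_def by blast
  have "0 \<in> C" using b h by (simp add: C_def mem_Times_iff)
  then have "\<forall>\<^sub>F s in at_right 0. \<gamma> s \<in> C" by (rule topological_tendstoD[OF g(3) oC])
  moreover have "\<forall>\<^sub>F s in at_right 0. (0::real) < s" by (rule eventually_at_right_less)
  ultimately have "\<forall>\<^sub>F s in at_right (0::real). 0 < s \<and> \<gamma> s \<in> C" by eventually_elim simp
  then obtain s0 where s0: "s0 > 0" "\<gamma> s0 \<in> C"
    using eventually_happens'[OF trivial_limit_at_right_real] by blast
  have "\<gamma> s0 \<in> G"
  proof -
    have nc: "\<gamma> s0 \<notin> closure \<Omega>" using g(2) s0(1) by auto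
    \<comment> \<open>A point on the graph is a limit of points just above it, which belong to
      \<Omega>; the path avoids the closure.\<close>
    have "snd (\<gamma> s0) \<noteq> \<omega> (fst (\<gamma> s0))"
    proof
      assume eq: "snd (\<gamma> s0) = \<omega> (fst (\<gamma> s0))"
      have "\<gamma> s0 \<in> closure \<Omega>"
        unfolding closure_approachable
      proof (intro allI impI)
        fix d :: real assume d: "d > 0"
        define v where "v = min d (h - snd (\<gamma> s0)) / 2"
        have sh: "norm (fst (\<gamma> s0)) < b" "snd (\<gamma> s0) < h" "- h < snd (\<gamma> s0)" using s0(2) by (auto simp: C_def mem_Times_iff)
        have v: "v > 0" "v < d" "v < h - snd (\<gamma> s0)" using d sh by (auto simp: v_def min_def)
        define y where "y = (fst (\<gamma> s0), snd (\<gamma> s0) + v)"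
        have "y \<in> C" using sh v by (simp add: y_def C_def mem_Times_iff)
        then have "y \<in> \<Omega>" using inO[of y] v eq by (simp add: y_def)
        moreover have "dist y (\<gamma> s0) < d"
        proof -
          have "dist y (\<gamma> s0) = \<bar>v\<bar>" unfolding y_def by (cases "\<gamma> s0") (simp add: dist_prod_def dist_real_def)
          then show ?thesis using v by simp
        qed
        ultimately show "\<exists>y\<in>\<Omega>. dist y (\<gamma> s0) < d" by blast
      qed
      then show False using nc by simp
    qed
    moreover have "\<not> \<omega> (fst (\<gamma> s0)) < snd (\<gamma> s0)"
      using nc closure_subset[of \<Omega>] inO[OF s0(2)] by blast
    ultimately show ?thesis using s0(2) by (simp add: G_def)
  qed
  define T where "T = G \<union> \<gamma> ` {0<..}"
  have cT: "connected T" unfolding T_def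
  proof (rule connected_Un[OF cG])
    show "connected (\<gamma> ` {0<..})" by (intro connected_continuous_image g) auto
    show "G \<inter> \<gamma> ` {0<..} \<noteq> {}" using \<open>\<gamma> s0 \<in> G\<close> s0(1) by auto
  qed
  have "\<forall>\<^sub>F s in at_top. norm (\<gamma> s) > R" using g(4) by (simp add: filterlim_at_top_dense)
  moreover have "\<forall>\<^sub>F s in at_top. (s::real) > 0" by (rule eventually_gt_at_top)
  ultimately have "\<forall>\<^sub>F s in at_top. norm (\<gamma> s) > R \<and> s > 0" by eventually_elim simp
  then obtain s1 where s1: "norm (\<gamma> s1) > R" "s1 > 0" using eventually_happens'[OF trivial_limit_at_top_linorder] by blast
  have uG: "u p = 0" if "p \<in> G" for p
  proof (rule unique_continuation[where S="closure \<Omega>" and T=T and ?x1.0="\<gamma> s1"])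
    show "T \<subseteq> - closure \<Omega>" unfolding T_def using G\<Omega> g(2) by auto
    show "y \<in> closure \<Omega>" if "f y \<noteq> 0" for y using \<Omega>(2)[OF that] closure_subset by blast
  qed (use cT s1 that \<Omega> in \<open>auto simp: T_def\<close>)
  have xC: "x \<in> C" using x by (simp add: C_def mem_Times_iff)
  show ?thesis
  proof (cases "snd x < \<omega> (fst x)")
    case True
    then show ?thesis using xC by (intro uG) (simp add: G_def)
  next
    case False
    then have eq: "snd x = \<omega> (fst x)" using inO[OF xC] x(4) by simp
    \<comment> \<open>The second difference is centred at distance \<open>v\<close> below the graph
      point, so its two other nodes lie strictly below the graph. The bound tends to 0 with
      \<open>v\<close>, which replaces a continuity argument for \<open>u\<close>.\<close>
    have bound: "norm (u x) \<le> 2 * N * CU * v" if v: "0 < v" "v \<le> 1" "2 * v < snd x + h" for v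
    proof -
      have v1: "u (x - (0, v)) = 0" using x v eq by (intro uG) (simp add: G_def C_def mem_Times_iff)
      have v2: "u (x - (0, v) - (0, v)) = 0" using x v eq by (intro uG) (simp add: G_def C_def mem_Times_iff)
      have "norm (u x) \<le> N * CU * (v\<^sup>2 * (1 + ln (1 / v)))"
        using u_second_difference[OF v(1,2), of "x - (0, v)"] v1 v2 by simp
      also have "\<dots> \<le> N * CU * (2 * v)"
      proof (intro mult_left_mono mult_nonneg_nonneg N CU_nonneg)
        have "ln (1 / v) \<le> 1 / v" using ln_le_minus_one[of "1 / v"] v by simp
        then have "v\<^sup>2 * (1 + ln (1 / v)) \<le> v\<^sup>2 * (1 + 1 / v)" by (intro mult_left_mono) auto
        also have "\<dots> = v * v + v" using v by (simp add: field_simps power2_eq_square)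
        also have "\<dots> \<le> 2 * v" using v mult_left_le[of v v] by simp
        finally show "v\<^sup>2 * (1 + ln (1 / v)) \<le> 2 * v" .
      qed
      finally show ?thesis by simp
    qed
    have "norm (u x) \<le> 0"
    proof (rule tendsto_lowerbound[of "\<lambda>v. 2 * N * CU * v" _ "at_right 0"])
      have "((\<lambda>v. 2 * N * CU * v) \<longlongrightarrow> 2 * N * CU * 0) (at_right 0)" by (intro tendsto_intros)
      then show "((\<lambda>v. 2 * N * CU * v) \<longlongrightarrow> 0) (at_right 0)" by simp
      have "\<forall>\<^sub>F v in at_right 0. v \<in> {0<..<min 1 ((snd x + h) / 2)}"
        by (rule eventually_at_right_real) (use x in auto)
      then show "\<forall>\<^sub>F v in at_right 0. norm (u x) \<le> 2 * N * CU * v"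
        by eventually_elim (intro bound; auto)
    qed simp
    then show ?thesis by simp
  qed
qed

text \<open>A second difference with its two lower nodes in the zero strip controls the value at the
  upper node, so the order \<open>h\<^sup>2 * ln (1 / h)\<close> transfers from differences to
  values.\<close>

lemma u_bound:
  assumes h: "0 < h" "h \<le> 1"
    and z: "\<And>y. fst y = fst x \<Longrightarrow> - h < snd y \<Longrightarrow> snd y < 0 \<Longrightarrow> u y = 0"
    and x: "- h < snd x" "snd x < h"
  shows "norm (u x) \<le> N * CU * (h\<^sup>2 * (1 + ln (4 / h)))"
proof (cases "snd x < 0")
  case True
  then show ?thesis using z[OF refl x(1)] N CU_nonneg h by simp
next
  case False
  \<comment> \<open>The nodes below \<open>x\<close> then have the heights
    \<open>- (h - snd x) / 4\<close> and \<open>- (h + snd x) / 2\<close>, both strictly between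
    \<open>- h\<close> and 0.\<close>
  define v where "v = snd x + (h - snd x) / 4"
  have ve: "v = 3 / 4 * snd x + h / 4" by (simp add: v_def field_simps)
  have v1: "h / 4 \<le> v" using False by (simp add: ve)
  have v2: "v \<le> h" using x by (simp add: ve)
  have v: "h / 4 \<le> v" "v \<le> h" "0 < v" "v \<le> 1" using v1 v2 h by linarith+
  have 1: "u (x - (0, v)) = 0" using x h False by (intro z) (auto simp: v_def field_simps)
  have 2: "u (x - (0, v) - (0, v)) = 0" using x h False by (intro z) (auto simp: v_def field_simps)
  have "norm (u x) \<le> N * CU * (v\<^sup>2 * (1 + ln (1 / v)))"
    using u_second_difference[OF v(3,4), of "x - (0, v)"] 1 2 by simp
  also have "\<dots> \<le> N * CU * (h\<^sup>2 * (1 + ln (4 / h)))"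
  proof (intro mult_left_mono mult_mono mult_nonneg_nonneg N CU_nonneg)
    show "v\<^sup>2 \<le> h\<^sup>2" using v by (intro power_mono) auto
    have "1 / v \<le> 4 / h" using v h by (simp add: field_simps)
    then have "ln (1 / v) \<le> ln (4 / h)" using v h by (subst ln_le_cancel_iff) auto
    then show "1 + ln (1 / v) \<le> 1 + ln (4 / h)" by simp
    have "0 \<le> ln (1 / v)" using v by simp
    then show "0 \<le> 1 + ln (1 / v)" by simp
  qed auto
  finally show ?thesis .
qed

end

section \<open>The exponential integral over a paraboloid\<close>

lemma exp_tail_integral:
  fixes a \<tau> :: real
  assumes "\<tau> > 0"
  shows "integrable lborel (\<lambda>t. indicator {a..} t * exp (- \<tau> * t))"
    and "(\<integral>t. indicator {a..} t * exp (- \<tau> * t) \<partial>lborel) = exp (- \<tau> * a) / \<tau>"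
proof -
  have "(\<integral>\<^sup>+t. ennreal (exp (- \<tau> * t)) * indicator {a..} t \<partial>lborel) = ennreal (0 - (- exp (- \<tau> * a) / \<tau>))"
  proof (rule nn_integral_FTC_atLeast)
    show "((\<lambda>t. - exp (- \<tau> * t) / \<tau>) has_real_derivative exp (- \<tau> * t)) (at t)" for t
      using assms by (auto intro!: derivative_eq_intros)
    show "((\<lambda>t. - exp (- \<tau> * t) / \<tau>) \<longlongrightarrow> 0) at_top"
      using assms by real_asymp
  qed auto
  then have n: "(\<integral>\<^sup>+t. ennreal (indicator {a..} t * exp (- \<tau> * t)) \<partial>lborel) = ennreal (exp (- \<tau> * a) / \<tau>)"
    by (simp add: ennreal_mult' mult.commute flip: ennreal_indicator)
  show "integrable lborel (\<lambda>t. indicator {a..} t * exp (- \<tau> * t))"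
  proof (rule integrableI_nonneg)
    show "(\<integral>\<^sup>+t. ennreal (indicator {a..} t * exp (- \<tau> * t)) \<partial>lborel) < \<infinity>" unfolding n by simp
  qed auto
  show "(\<integral>t. indicator {a..} t * exp (- \<tau> * t) \<partial>lborel) = exp (- \<tau> * a) / \<tau>"
    by (subst integral_eq_nn_integral, simp, simp, subst n) (use assms in simp)
qed

definition paraboloid :: "real \<Rightarrow> ('v::euclidean_space \<times> real) set" where
  "paraboloid K = {x. K * (norm (fst x))\<^sup>2 \<le> snd x}"

lemma paraboloid_measurable [measurable]: "paraboloid K \<in> sets borel"
  unfolding paraboloid_def by measurable

text \<open>Integrating the height first turns the paraboloid into a Gaussian of width
  \<open>1 / sqrt (\<tau> * K)\<close> in \<open>x'\<close>; the oscillating factor then gives its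
  Fourier transform. With \<open>s\<close> close to \<tau> the factor
  \<open>exp (- s\<^sup>2 / (4 * \<tau> * K))\<close> is the size
  \<open>exp (- \<tau> / (4 * K))\<close> of the main term.\<close>

lemma
  fixes e :: "'v::euclidean_space"
  assumes K: "K > 0" and \<tau>: "\<tau> > 0"
  shows paraboloid_integrable: "integrable lborel (\<lambda>x. indicator (paraboloid K) x *\<^sub>R (cis (s * (e \<bullet> fst x)) * complex_of_real (exp (- \<tau> * snd x))))"
    and paraboloid_integral: "(\<integral>x. indicator (paraboloid K) x *\<^sub>R (cis (s * (e \<bullet> fst x)) * complex_of_real (exp (- \<tau> * snd x))) \<partial>lborel)
      = complex_of_real (1 / \<tau> * (pi / (\<tau> * K)) powr (DIM('v) / 2) * exp (- (s * norm e)\<^sup>2 / (4 * (\<tau> * K))))"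
    and paraboloid_exp_integrable: "integrable lborel (\<lambda>x::'v \<times> real. indicator (paraboloid K) x * exp (- \<tau> * snd x))"
    and paraboloid_exp_integral: "(\<integral>x. indicator (paraboloid K :: ('v \<times> real) set) x * exp (- \<tau> * snd x) \<partial>lborel) = 1 / \<tau> * (pi / (\<tau> * K)) powr (DIM('v) / 2)"
proof -
  have \<tau>K: "\<tau> * K > 0" using K \<tau> by simp
  have main: "integrable lborel (\<lambda>x. indicator (paraboloid K) x *\<^sub>R (cis (s * (e \<bullet> fst x)) * complex_of_real (exp (- \<tau> * snd x))))
    \<and> (\<integral>x. indicator (paraboloid K) x *\<^sub>R (cis (s * (e \<bullet> fst x)) * complex_of_real (exp (- \<tau> * snd x))) \<partial>lborel)
      = complex_of_real (1 / \<tau> * (pi / (\<tau> * K)) powr (DIM('v) / 2) * exp (- (s * norm e)\<^sup>2 / (4 * (\<tau> * K))))" for s and e :: 'v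
  proof -
    define g where "g x' t = cis (s * (e \<bullet> x')) * complex_of_real (indicator {K * (norm x')\<^sup>2..} t * exp (- \<tau> * t))" for x' :: 'v and t
    have ge: "indicator (paraboloid K) x *\<^sub>R (cis (s * (e \<bullet> fst x)) * complex_of_real (exp (- \<tau> * snd x))) = g (fst x) (snd x)" for x
      by (simp add: g_def paraboloid_def indicator_def)
    have gm: "(\<lambda>x. g (fst x) (snd x)) \<in> borel_measurable borel"
      unfolding ge[symmetric] by measurable
    have gt: "(\<integral>t. g x' t \<partial>lborel) = complex_of_real (1 / \<tau>) * (cis (x' \<bullet> (s *\<^sub>R e)) * complex_of_real (exp (- (\<tau> * K) * (norm x')\<^sup>2)))" for x'
      unfolding g_def integral_mult_right_zero integral_complex_of_real exp_tail_integral(2)[OF \<tau>]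
      by (simp add: inner_commute mult_ac)
    have i: "integrable lborel (\<lambda>x. g (fst x) (snd x))"
    proof (rule lborel_integrable_iterated[where g=g, OF gm])
      show "integrable lborel (g x')" for x'
        unfolding g_def by (intro integrable_mult_right integrable_of_real exp_tail_integral \<tau>)
      have "norm (g x' t) = indicator {K * (norm x')\<^sup>2..} t * exp (- \<tau> * t)" for x' t
        by (simp add: g_def norm_mult)
      then have "(\<integral>t. norm (g x' t) \<partial>lborel) = exp (- \<tau> * (K * (norm x')\<^sup>2)) / \<tau>" for x'
        using exp_tail_integral(2)[OF \<tau>] by presburger
      then show "(\<integral>t. norm (g x' t) \<partial>lborel) \<le> 1 / \<tau> * norm (cis (x' \<bullet> 0) * complex_of_real (exp (- (\<tau> * K) * (norm x')\<^sup>2)))" for x'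
        by (simp add: norm_mult mult_ac)
      show "integrable lborel (\<lambda>x'. 1 / \<tau> * norm (cis (x' \<bullet> 0) * complex_of_real (exp (- (\<tau> * K) * (norm (x'::'v))\<^sup>2))))"
        by (intro integrable_mult_right integrable_norm fourier_gauss \<tau>K)
    qed
    have "(\<integral>x. g (fst x) (snd x) \<partial>lborel) = complex_of_real (1 / \<tau>) * complex_of_real ((pi / (\<tau> * K)) powr (DIM('v) / 2) * exp (- (norm (s *\<^sub>R e))\<^sup>2 / (4 * (\<tau> * K))))"
      unfolding lborel_iterated[where g=g, OF i] gt integral_mult_right_zero fourier_gauss(2)[OF \<tau>K] ..
    then show ?thesis unfolding ge using i by (simp add: power_mult_distrib mult.assoc)
  qed
  show "integrable lborel (\<lambda>x. indicator (paraboloid K) x *\<^sub>R (cis (s * (e \<bullet> fst x)) * complex_of_real (exp (- \<tau> * snd x))))"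
    "(\<integral>x. indicator (paraboloid K) x *\<^sub>R (cis (s * (e \<bullet> fst x)) * complex_of_real (exp (- \<tau> * snd x))) \<partial>lborel)
      = complex_of_real (1 / \<tau> * (pi / (\<tau> * K)) powr (DIM('v) / 2) * exp (- (s * norm e)\<^sup>2 / (4 * (\<tau> * K))))"
    using main by blast+
  \<comment> \<open>Frequency 0 removes the oscillation and yields the two statements on the real
    integrand.\<close>
  have r: "indicator (paraboloid K) x *\<^sub>R (cis (0 * (0 \<bullet> fst x)) * complex_of_real (exp (- \<tau> * snd x))) = complex_of_real (indicator (paraboloid K) x * exp (- \<tau> * snd x))" for x :: "'v \<times> real"
    by (simp add: scaleR_conv_of_real)
  have m0: "integrable lborel (\<lambda>x::'v \<times> real. complex_of_real (indicator (paraboloid K) x * exp (- \<tau> * snd x)))"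
    "complex_of_real (\<integral>x. indicator (paraboloid K :: ('v \<times> real) set) x * exp (- \<tau> * snd x) \<partial>lborel) = complex_of_real (1 / \<tau> * (pi / (\<tau> * K)) powr (DIM('v) / 2))"
    using main[of 0 0] unfolding r integral_complex_of_real by simp_all
  show "integrable lborel (\<lambda>x::'v \<times> real. indicator (paraboloid K) x * exp (- \<tau> * snd x))"
    using m0(1) by (simp only: complex_of_real_integrable_eq)
  show "(\<integral>x. indicator (paraboloid K :: ('v \<times> real) set) x * exp (- \<tau> * snd x) \<partial>lborel) = 1 / \<tau> * (pi / (\<tau> * K)) powr (DIM('v) / 2)"
    using m0(2) by (simp only: of_real_eq_iff)
qed

section \<open>The localised exponential test function\<close>

lemma DERIV_max_cube:
  "((\<lambda>y::real. (max 0 y) ^ 3) has_field_derivative 3 * (max 0 y)\<^sup>2) (at y)"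
  "((\<lambda>y::real. (max 0 y)\<^sup>2) has_field_derivative 2 * max 0 y) (at y)"
proof -
  have gen: "((\<lambda>y::real. (max 0 y) ^ Suc (Suc n)) has_field_derivative real (Suc (Suc n)) * (max 0 y) ^ Suc n) (at y)" for n
  proof (cases "y = 0")
    case False
    show ?thesis
    proof (cases "y > 0")
      case True
      have "((\<lambda>y::real. y ^ Suc (Suc n)) has_field_derivative real (Suc (Suc n)) * y ^ Suc n) (at y)"
        using DERIV_pow[of "Suc (Suc n)" y UNIV] by simp
      then have "((\<lambda>y::real. (max 0 y) ^ Suc (Suc n)) has_field_derivative real (Suc (Suc n)) * y ^ Suc n) (at y)"
        by (rule has_field_derivative_transform_within_open[where S="{0<..}"]) (use True in auto)
      then show ?thesis using True by simp
    next
      case False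
      with \<open>y \<noteq> 0\<close> have "y < 0" by simp
      have "((\<lambda>y::real. 0) has_field_derivative 0) (at y)" by simp
      then have "((\<lambda>y::real. (max 0 y) ^ Suc (Suc n)) has_field_derivative 0) (at y)"
        by (rule has_field_derivative_transform_within_open[where S="{..<0}"]) (use \<open>y < 0\<close> in \<open>auto simp: max_def\<close>)
      then show ?thesis using \<open>y < 0\<close> by (simp add: max_def)
    qed
  next
    case True
    have "((\<lambda>h::real. ((max 0 (0 + h)) ^ Suc (Suc n) - (max 0 0) ^ Suc (Suc n)) / h) \<longlongrightarrow> 0) (at 0)"
    proof (rule Lim_null_comparison[where g="\<lambda>h. \<bar>h\<bar> ^ Suc n"])
      show "\<forall>\<^sub>F h in at 0. norm (((max 0 (0 + h)) ^ Suc (Suc n) - (max 0 (0::real)) ^ Suc (Suc n)) / h) \<le> \<bar>h\<bar> ^ Suc n"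
      proof (unfold eventually_at_filter, rule always_eventually, intro allI impI)
        fix h :: real assume "h \<noteq> 0"
        then show "norm (((max 0 (0 + h)) ^ Suc (Suc n) - (max 0 0) ^ Suc (Suc n)) / h) \<le> \<bar>h\<bar> ^ Suc n"
        proof (cases "h > 0")
          case False
          then have m: "max 0 (0 + h) = 0" by simp
          show ?thesis unfolding m by simp
        qed (simp add: abs_mult)
      qed
      have "((\<lambda>h::real. \<bar>h\<bar> ^ Suc n) \<longlongrightarrow> \<bar>0\<bar> ^ Suc n) (at 0)" by (intro tendsto_intros)
      then show "((\<lambda>h::real. \<bar>h\<bar> ^ Suc n) \<longlongrightarrow> 0) (at 0)" by simp
    qed
    then show ?thesis unfolding True DERIV_def by simp
  qed
  show "((\<lambda>y::real. (max 0 y) ^ 3) has_field_derivative 3 * (max 0 y)\<^sup>2) (at y)"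
    using gen[of 1] by (simp add: numeral_eq_Suc)
  show "((\<lambda>y::real. (max 0 y)\<^sup>2) has_field_derivative 2 * max 0 y) (at y)"
    using gen[of 0] by (simp add: numeral_eq_Suc)
qed

text \<open>With \<open>p y = (max 0 y) ^ 3\<close>, twice continuously differentiable, the quotient
  \<open>p (b - s) / (p (b - s) + p (s - a))\<close> has a positive denominator everywhere and the
  required plateaus. Two derivatives suffice for a test function.\<close>

lemma smooth_cutoff:
  fixes a b :: real
  assumes ab: "a < b"
  shows "\<exists>c c1 c2 B. (\<forall>s. (c has_field_derivative c1 s) (at s)) \<and> (\<forall>s. (c1 has_field_derivative c2 s) (at s)) \<and> continuous_on UNIV c2
     \<and> (\<forall>s\<le>a. c s = 1 \<and> c1 s = 0 \<and> c2 s = 0) \<and> (\<forall>s\<ge>b. c s = 0 \<and> c1 s = 0 \<and> c2 s = 0)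
     \<and> (\<forall>s. 0 \<le> c s \<and> c s \<le> 1) \<and> (\<forall>s. \<bar>c1 s\<bar> \<le> B) \<and> (\<forall>s. \<bar>c2 s\<bar> \<le> B)"
proof -
  define p p1 p2 where "p y = (max 0 y) ^ 3" and "p1 y = 3 * (max 0 y)\<^sup>2" and "p2 y = 6 * max 0 y" for y :: real
  have dp: "(p has_field_derivative p1 y) (at y)" for y unfolding p_def p1_def by (rule DERIV_max_cube)
  have dp1: "(p1 has_field_derivative p2 y) (at y)" for y
    using DERIV_cmult[OF DERIV_max_cube(2)[of y], of 3] unfolding p1_def p2_def by simp
  define A B where "A s = p (b - s)" and "B s = p (s - a)" for s
  define A1 B1 where "A1 s = - p1 (b - s)" and "B1 s = p1 (s - a)" for s
  define A2 B2 where "A2 s = p2 (b - s)" and "B2 s = p2 (s - a)" for s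
  have dm: "((\<lambda>s. b - s) has_field_derivative -1) (at s)" "((\<lambda>s. s - a) has_field_derivative 1) (at s)" for s
    by (auto intro!: derivative_eq_intros)
  have dA: "(A has_field_derivative A1 s) (at s)" for s
    using DERIV_chain2[OF dp dm(1)] unfolding A_def A1_def by simp
  have dB: "(B has_field_derivative B1 s) (at s)" for s
    using DERIV_chain2[OF dp dm(2)] unfolding B_def B1_def by simp
  have dA1: "(A1 has_field_derivative A2 s) (at s)" for s
    using DERIV_minus[OF DERIV_chain2[OF dp1 dm(1)]] unfolding A1_def A2_def by simp
  have dB1: "(B1 has_field_derivative B2 s) (at s)" for s
    using DERIV_chain2[OF dp1 dm(2)] unfolding B1_def B2_def by simp
  have A0: "A s \<ge> 0" and B0: "B s \<ge> 0" for s by (simp_all add: A_def B_def p_def)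
  have pos: "A s + B s > 0" for s
  proof (cases "s < b")
    case True
    then have "A s > 0" by (simp add: A_def p_def)
    then show ?thesis using B0[of s] by linarith
  next
    case False
    then have "B s > 0" using ab by (simp add: B_def p_def)
    then show ?thesis using A0[of s] by linarith
  qed
  then have ne: "A s + B s \<noteq> 0" for s by (metis less_irrefl)
  define c where "c s = A s / (A s + B s)" for s
  define m where "m s = A1 s * B s - A s * B1 s" for s
  define c1 where "c1 s = m s / (A s + B s)\<^sup>2" for s
  define m1 where "m1 s = A2 s * B s - A s * B2 s" for s
  define c2 where "c2 s = (m1 s * (A s + B s) - 2 * m s * (A1 s + B1 s)) / (A s + B s) ^ 3" for s
  have dc: "(c has_field_derivative c1 s) (at s)" for s
  proof -
    have "(c has_field_derivative (A1 s * (A s + B s) - A s * (A1 s + B1 s)) / ((A s + B s) * (A s + B s))) (at s)"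
      unfolding c_def by (intro DERIV_divide dA DERIV_add dB ne)
    also have "(A1 s * (A s + B s) - A s * (A1 s + B1 s)) / ((A s + B s) * (A s + B s)) = c1 s"
      by (simp add: c1_def m_def power2_eq_square algebra_simps)
    finally show ?thesis .
  qed
  have dmm: "(m has_field_derivative m1 s) (at s)" for s
  proof -
    have "(m has_field_derivative (A1 s * B1 s + A2 s * B s) - (A s * B2 s + A1 s * B1 s)) (at s)"
      unfolding m_def by (intro DERIV_diff DERIV_mult' dA dB dA1 dB1)
    then show ?thesis by (simp add: m1_def)
  qed
  have dc1: "(c1 has_field_derivative c2 s) (at s)" for s
  proof -
    have dq: "((\<lambda>s. (A s + B s)\<^sup>2) has_field_derivative 2 * (A s + B s) * (A1 s + B1 s)) (at s)"
      by (rule DERIV_cong[OF DERIV_power[OF DERIV_add[OF dA dB], where n=2]]) (simp add: algebra_simps)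
    have "(c1 has_field_derivative (m1 s * (A s + B s)\<^sup>2 - m s * (2 * (A s + B s) * (A1 s + B1 s))) / ((A s + B s)\<^sup>2 * (A s + B s)\<^sup>2)) (at s)"
      unfolding c1_def by (intro DERIV_divide dmm dq) (use ne in simp)
    also have "(m1 s * (A s + B s)\<^sup>2 - m s * (2 * (A s + B s) * (A1 s + B1 s))) / ((A s + B s)\<^sup>2 * (A s + B s)\<^sup>2) = c2 s"
    proof -
      have "(m1 s * D\<^sup>2 - m s * (2 * D * E)) / (D\<^sup>2 * D\<^sup>2) = (m1 s * D - 2 * m s * E) / D ^ 3" if "D \<noteq> 0" for D E
        using that by (simp add: field_simps power2_eq_square power3_eq_cube)
      from this[OF ne] show ?thesis unfolding c2_def .
    qed
    finally show ?thesis .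
  qed
  have cont: "continuous_on UNIV A" "continuous_on UNIV B" "continuous_on UNIV A1" "continuous_on UNIV B1" "continuous_on UNIV A2" "continuous_on UNIV B2"
    unfolding A_def B_def A1_def B1_def A2_def B2_def p_def p1_def p2_def by (intro continuous_intros)+
  have cc1: "continuous_on UNIV c1" unfolding c1_def m_def by (intro continuous_intros cont) (use ne in simp)
  have cc2: "continuous_on UNIV c2" unfolding c2_def m_def m1_def by (intro continuous_intros cont) (use ne in simp)
  have lo: "c s = 1 \<and> c1 s = 0 \<and> c2 s = 0" if "s \<le> a" for s
  proof -
    have "B s = 0" "B1 s = 0" "B2 s = 0" using that by (auto simp: B_def B1_def B2_def p_def p1_def p2_def max_def)
    then show ?thesis using ne[of s] by (simp add: c_def c1_def c2_def m_def m1_def)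
  qed
  have hi: "c s = 0 \<and> c1 s = 0 \<and> c2 s = 0" if "s \<ge> b" for s
  proof -
    have "A s = 0" "A1 s = 0" "A2 s = 0" using that by (auto simp: A_def A1_def A2_def p_def p1_def p2_def max_def)
    then show ?thesis by (simp add: c_def c1_def c2_def m_def m1_def)
  qed
  obtain G1 where G1: "\<forall>s\<in>{a..b}. \<bar>c1 s\<bar> \<le> G1" using continuous_on_Icc_abs_bounded continuous_on_subset[OF cc1] by blast
  obtain G2 where G2: "\<forall>s\<in>{a..b}. \<bar>c2 s\<bar> \<le> G2" using continuous_on_Icc_abs_bounded continuous_on_subset[OF cc2] by blast
  define G where "G = max 0 (max G1 G2)"
  have "\<bar>c1 s\<bar> \<le> G \<and> \<bar>c2 s\<bar> \<le> G" for s
  proof (cases "s \<in> {a..b}")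
    case True
    then show ?thesis using G1 G2 by (auto simp: G_def max.coboundedI2 le_max_iff_disj)
  next
    case False
    then have "s \<le> a \<or> s \<ge> b" by auto
    then show ?thesis using lo hi by (auto simp: G_def)
  qed
  moreover have "0 \<le> c s \<and> c s \<le> 1" for s
    using A0[of s] B0[of s] pos[of s] by (simp add: c_def divide_le_eq)
  ultimately show ?thesis using dc dc1 cc2 lo hi by blast
qed

text \<open>The exponential \<open>v\<close>, a solution of the Helmholtz equation when
  \<open>s\<^sup>2 = \<tau>\<^sup>2 + k\<^sup>2\<close>, oscillating horizontally and decaying
  upwards. The cutoff is a function of \<open>K\<^sup>2 * (norm x)\<^sup>2\<close>, hence smooth at
  the origin; it is supported in the ball of radius \<open>1 / K\<close>, and its transition layer
  is the thin shell where this quantity lies between \<open>98/100\<close> and 1.\<close>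

locale cutoff_wave =
  fixes c c1 c2 :: "real \<Rightarrow> real" and B K \<tau> s :: real and e :: "'v::euclidean_space"
  assumes dc: "\<And>z. (c has_field_derivative c1 z) (at z)" and dc1: "\<And>z. (c1 has_field_derivative c2 z) (at z)"
    and cc2: "continuous_on UNIV c2"
    and lo: "\<And>z. z \<le> 98/100 \<Longrightarrow> c z = 1 \<and> c1 z = 0 \<and> c2 z = 0"
    and hi: "\<And>z. z \<ge> 1 \<Longrightarrow> c z = 0 \<and> c1 z = 0 \<and> c2 z = 0"
    and c01: "\<And>z. 0 \<le> c z \<and> c z \<le> 1" and c1b: "\<And>z. \<bar>c1 z\<bar> \<le> B" and c2b: "\<And>z. \<bar>c2 z\<bar> \<le> B"
    and K: "K > 0" and \<tau>: "\<tau> > 0" and s: "s \<ge> 0" and e: "norm e = 1"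
begin

definition v :: "'v \<times> real \<Rightarrow> complex" where "v x = cis (s * (e \<bullet> fst x)) * complex_of_real (exp (- \<tau> * snd x))"
text \<open>The logarithmic derivative of \<open>v\<close> in direction \<open>b\<close>. It is
  linear in \<open>b\<close>, and its squares sum to \<open>- k\<^sup>2\<close> over a basis under
  the relation between \<open>s\<close> and \<tau>.\<close>

definition kap :: "'v \<times> real \<Rightarrow> complex" where "kap b = \<i> * complex_of_real (s * (e \<bullet> fst b)) - complex_of_real (\<tau> * snd b)"
definition Q :: "'v \<times> real \<Rightarrow> real" where "Q x = K\<^sup>2 * (norm x)\<^sup>2"
definition X1 :: "'v \<times> real \<Rightarrow> 'v \<times> real \<Rightarrow> real" where "X1 b x = c1 (Q x) * (2 * K\<^sup>2 * (x \<bullet> b))"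
definition X2 :: "'v \<times> real \<Rightarrow> 'v \<times> real \<Rightarrow> real" where "X2 b x = c2 (Q x) * (2 * K\<^sup>2 * (x \<bullet> b))\<^sup>2 + c1 (Q x) * (2 * K\<^sup>2 * (b \<bullet> b))"
definition w :: "'v \<times> real \<Rightarrow> complex" where "w x = complex_of_real (c (Q x)) * v x"
definition w1 :: "'v \<times> real \<Rightarrow> 'v \<times> real \<Rightarrow> complex" where "w1 b x = complex_of_real (X1 b x) * v x + kap b * w x"
definition w2 :: "'v \<times> real \<Rightarrow> 'v \<times> real \<Rightarrow> complex" where
  "w2 b x = (complex_of_real (X2 b x) * v x + complex_of_real (X1 b x) * (kap b * v x)) + kap b * w1 b x"

lemma norm_v: "norm (v x) = exp (- \<tau> * snd x)" by (simp add: v_def norm_mult)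

lemma norm_w_le: "norm (w x) \<le> exp (- \<tau> * snd x)"
  using c01[of "Q x"] by (simp add: w_def norm_mult norm_v mult_left_le_one_le)

lemma Q_ge_1: assumes "norm x \<ge> 1 / K" shows "Q x \<ge> 1"
proof -
  have "(1 / K)\<^sup>2 \<le> (norm x)\<^sup>2" using assms K by (intro power_mono) auto
  then have "K\<^sup>2 * (1 / K)\<^sup>2 \<le> Q x" unfolding Q_def by (intro mult_left_mono) auto
  then show ?thesis using K by (simp add: power_divide)
qed

lemma test_function: "test_function (1 / K) w w1 w2"
proof
  fix b x :: "'v \<times> real"
  have dQ: "((\<lambda>t. Q (x + t *\<^sub>R b)) has_field_derivative 2 * K\<^sup>2 * (x \<bullet> b)) (at 0)"
  proof -
    have "Q (x + t *\<^sub>R b) = K\<^sup>2 * (x \<bullet> x + 2 * t * (x \<bullet> b) + t\<^sup>2 * (b \<bullet> b))" for t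
      unfolding Q_def power2_norm_eq_inner by (simp add: inner_simps inner_commute power2_eq_square algebra_simps)
    then show ?thesis by (auto intro!: derivative_eq_intros)
  qed
  have dc': "((\<lambda>t. c (Q (x + t *\<^sub>R b))) has_field_derivative X1 b x) (at 0)"
    unfolding X1_def by (rule DERIV_chain2[OF _ dQ]) (use dc in simp)
  have dX1: "((\<lambda>t. X1 b (x + t *\<^sub>R b)) has_field_derivative X2 b x) (at 0)"
  proof -
    have "((\<lambda>t. c1 (Q (x + t *\<^sub>R b))) has_field_derivative c2 (Q x) * (2 * K\<^sup>2 * (x \<bullet> b))) (at 0)"
      by (rule DERIV_chain2[OF _ dQ]) (use dc1 in simp)
    moreover have "((\<lambda>t. 2 * K\<^sup>2 * ((x + t *\<^sub>R b) \<bullet> b)) has_field_derivative 2 * K\<^sup>2 * (b \<bullet> b)) (at 0)"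
      unfolding inner_simps by (auto intro!: derivative_eq_intros)
    ultimately have "((\<lambda>t. c1 (Q (x + t *\<^sub>R b)) * (2 * K\<^sup>2 * ((x + t *\<^sub>R b) \<bullet> b))) has_field_derivative
        c1 (Q (x + 0 *\<^sub>R b)) * (2 * K\<^sup>2 * (b \<bullet> b)) + c2 (Q x) * (2 * K\<^sup>2 * (x \<bullet> b)) * (2 * K\<^sup>2 * ((x + 0 *\<^sub>R b) \<bullet> b))) (at 0)"
      by (rule DERIV_mult')
    then show ?thesis unfolding X1_def X2_def by (rule DERIV_cong) (simp add: power2_eq_square algebra_simps)
  qed
  have dv: "((\<lambda>t. v (x + t *\<^sub>R b)) has_vector_derivative kap b * v x) (at 0)"
  proof -
    have 1: "((\<lambda>t. cis (s * (e \<bullet> fst (x + t *\<^sub>R b)))) has_vector_derivative \<i> * complex_of_real (s * (e \<bullet> fst b)) * cis (s * (e \<bullet> fst x))) (at 0)"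
      using has_vector_derivative_cis_line[of "s * (e \<bullet> fst x)" "s * (e \<bullet> fst b)"] by (simp add: inner_simps algebra_simps)
    have 2: "((\<lambda>t. complex_of_real (exp (- \<tau> * snd (x + t *\<^sub>R b)))) has_vector_derivative complex_of_real (- \<tau> * snd b * exp (- \<tau> * snd x))) (at 0)"
      by (rule has_vector_derivative_complex_of_real) (auto intro!: derivative_eq_intros)
    show ?thesis unfolding v_def kap_def
      using has_vector_derivative_mult[OF 1 2] by (simp add: algebra_simps)
  qed
  show dw: "((\<lambda>t. w (x + t *\<^sub>R b)) has_vector_derivative w1 b x) (at 0)"
    unfolding w_def[abs_def] w1_def
    using has_vector_derivative_mult[OF has_vector_derivative_complex_of_real[OF dc'] dv] by (simp add: w_def algebra_simps)
  show "((\<lambda>t. w1 b (x + t *\<^sub>R b)) has_vector_derivative w2 b x) (at 0)"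
  proof -
    have "((\<lambda>t. complex_of_real (X1 b (x + t *\<^sub>R b)) * v (x + t *\<^sub>R b)) has_vector_derivative
        (complex_of_real (X2 b x) * v x + complex_of_real (X1 b x) * (kap b * v x))) (at 0)"
      using has_vector_derivative_mult[OF has_vector_derivative_complex_of_real[OF dX1] dv] by (simp add: algebra_simps)
    then show ?thesis unfolding w1_def[of b "_ + _"] w2_def
      by (intro has_vector_derivative_add has_vector_derivative_mult_right dw)
  qed
  show "w x = 0" if "norm x > 1 / K"
    using hi[OF Q_ge_1[of x]] that by (simp add: w_def)
next
  have cQ: "continuous_on UNIV Q" unfolding Q_def by (intro continuous_intros)
  have cv: "continuous_on UNIV v" unfolding v_def by (intro continuous_intros)
  have cc: "continuous_on UNIV c" using dc by (meson DERIV_isCont continuous_at_imp_continuous_on)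
  have cc1: "continuous_on UNIV c1" using dc1 by (meson DERIV_isCont continuous_at_imp_continuous_on)
  have X: "continuous_on UNIV (\<lambda>x. c (Q x))" "continuous_on UNIV (\<lambda>x. c1 (Q x))" "continuous_on UNIV (\<lambda>x. c2 (Q x))"
    using continuous_on_compose2[OF cc cQ] continuous_on_compose2[OF cc1 cQ] continuous_on_compose2[OF cc2 cQ] by auto
  show cw: "continuous_on UNIV w" unfolding w_def by (intro continuous_intros X cv)
  show cw1: "continuous_on UNIV (w1 b)" for b unfolding w1_def X1_def by (intro continuous_intros X cv cw)
  show "continuous_on UNIV (w2 b)" for b unfolding w2_def X1_def X2_def by (intro continuous_intros X cv cw1)
qed

text \<open>The terms without a derivative of the cutoff cancel, because \<open>v\<close> solves the
  Helmholtz equation. What remains carries \<open>c1\<close> or \<open>c2\<close> and lives in the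
  transition shell.\<close>

lemma lap_w:
  assumes sk: "s\<^sup>2 = \<tau>\<^sup>2 + k\<^sup>2"
  shows "test_function.lap w2 x + complex_of_real (k\<^sup>2) * w x =
    v x * (complex_of_real (c2 (Q x) * (4 * K ^ 4 * (norm x)\<^sup>2) + c1 (Q x) * (2 * K\<^sup>2 * real DIM('v \<times> real)))
      + complex_of_real (4 * K\<^sup>2 * c1 (Q x)) * kap x)"
proof -
  interpret tf: test_function "1 / K" w w1 w2 by (rule test_function)
  have sB: "(\<Sum>b\<in>Basis. (x \<bullet> b)\<^sup>2) = (norm x)\<^sup>2" by (rule norm_eq_sum_Basis[symmetric])
  have s2: "(\<Sum>b\<in>Basis. X2 b x) = c2 (Q x) * (4 * K ^ 4 * (norm x)\<^sup>2) + c1 (Q x) * (2 * K\<^sup>2 * real DIM('v \<times> real))"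
  proof -
    have "(\<Sum>b\<in>Basis. X2 b x) = (\<Sum>b\<in>Basis. c2 (Q x) * (4 * K ^ 4) * (x \<bullet> b)\<^sup>2 + c1 (Q x) * (2 * K\<^sup>2))"
      by (intro sum.cong) (auto simp: X2_def power_mult_distrib power2_eq_square power4_eq_xxxx)
    also have "\<dots> = c2 (Q x) * (4 * K ^ 4) * (norm x)\<^sup>2 + c1 (Q x) * (2 * K\<^sup>2) * real DIM('v \<times> real)"
      unfolding sum.distrib sum_distrib_left[symmetric] sB by simp
    finally show ?thesis by (simp only: mult.assoc)
  qed
  have ex: "(\<Sum>i\<in>Basis. (fst x \<bullet> i) * (e \<bullet> i)) = e \<bullet> fst x" by (subst (3) euclidean_inner) (simp add: mult.commute)
  have sk1: "(\<Sum>b\<in>Basis. complex_of_real (x \<bullet> b) * kap b) = kap x"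
  proof -
    have "(\<Sum>i\<in>Basis. complex_of_real (x \<bullet> (i, 0)) * kap (i, 0)) = (\<Sum>i\<in>Basis. \<i> * complex_of_real s * complex_of_real ((fst x \<bullet> i) * (e \<bullet> i)))"
      by (intro sum.cong) (auto simp: kap_def inner_prod_def)
    also have "\<dots> = \<i> * complex_of_real s * complex_of_real (e \<bullet> fst x)"
      unfolding sum_distrib_left[symmetric] of_real_sum[symmetric] ex ..
    finally show ?thesis unfolding sum_Basis_prod_real by (simp add: kap_def inner_prod_def algebra_simps)
  qed
  have sk2: "(\<Sum>b\<in>Basis. (kap b)\<^sup>2) = - complex_of_real (k\<^sup>2)"
  proof -
    have "(\<Sum>i\<in>Basis. (kap (i, 0))\<^sup>2) = (\<Sum>i\<in>Basis. - complex_of_real (s\<^sup>2) * complex_of_real ((e \<bullet> i)\<^sup>2))"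
      by (intro sum.cong) (auto simp: kap_def power_mult_distrib)
    also have "\<dots> = - complex_of_real (s\<^sup>2)"
      unfolding sum_distrib_left[symmetric] of_real_sum[symmetric] norm_eq_sum_Basis[symmetric] using e by simp
    finally show ?thesis unfolding sum_Basis_prod_real sk by (simp add: kap_def power_mult_distrib)
  qed
  have "tf.lap x = (\<Sum>b\<in>Basis. v x * complex_of_real (X2 b x) + v x * complex_of_real (4 * K\<^sup>2 * c1 (Q x)) * (complex_of_real (x \<bullet> b) * kap b) + w x * (kap b)\<^sup>2)"
    unfolding tf.lap_def by (intro sum.cong) (auto simp: w2_def w1_def X1_def power2_eq_square algebra_simps)
  also have "\<dots> = v x * complex_of_real (\<Sum>b\<in>Basis. X2 b x) + v x * complex_of_real (4 * K\<^sup>2 * c1 (Q x)) * kap x - w x * complex_of_real (k\<^sup>2)"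
    unfolding sum.distrib sum_distrib_left[symmetric] of_real_sum sk1 sk2 by simp
  finally show ?thesis unfolding s2 by (simp add: algebra_simps)
qed

text \<open>Each derivative of the cutoff costs a factor \<open>K\<close> on the ball of radius
  \<open>1 / K\<close>, a derivative of the exponential costs \<open>s\<close> or \<tau>; the
  second-order and the mixed terms give \<open>K\<^sup>2\<close> and
  \<open>K * (s + \<tau>)\<close>.\<close>

lemma norm_lap_w:
  assumes sk: "s\<^sup>2 = \<tau>\<^sup>2 + k\<^sup>2" and x: "norm x \<le> 1 / K"
  shows "norm (test_function.lap w2 x + complex_of_real (k\<^sup>2) * w x) \<le> exp (- \<tau> * snd x) * (B * (K\<^sup>2 * (4 + 2 * real DIM('v \<times> real)) + 4 * K * (s + \<tau>)))"
proof -
  let ?n = "real DIM('v \<times> real)"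
  have B0: "B \<ge> 0" using c1b[of 0] abs_ge_zero order_trans by blast
  have Kx: "K * norm x \<le> 1" using x K by (simp add: field_simps)
  have "K ^ 4 * (norm x)\<^sup>2 = K\<^sup>2 * (K * norm x)\<^sup>2" by (simp add: power_mult_distrib power2_eq_square power4_eq_xxxx)
  also have "\<dots> \<le> K\<^sup>2 * 1" using Kx K by (intro mult_left_mono power_le_one) auto
  finally have K4: "4 * K ^ 4 * (norm x)\<^sup>2 \<le> 4 * K\<^sup>2" by simp
  have 1: "\<bar>c2 (Q x) * (4 * K ^ 4 * (norm x)\<^sup>2) + c1 (Q x) * (2 * K\<^sup>2 * ?n)\<bar> \<le> B * (4 * K\<^sup>2) + B * (2 * K\<^sup>2 * ?n)"
  proof (rule order_trans[OF abs_triangle_ineq add_mono])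
    show "\<bar>c2 (Q x) * (4 * K ^ 4 * (norm x)\<^sup>2)\<bar> \<le> B * (4 * K\<^sup>2)" unfolding abs_mult[of "c2 _"]
      using c2b[of "Q x"] K4 B0 by (intro mult_mono) auto
    show "\<bar>c1 (Q x) * (2 * K\<^sup>2 * ?n)\<bar> \<le> B * (2 * K\<^sup>2 * ?n)" unfolding abs_mult[of "c1 _"]
      using c1b[of "Q x"] B0 by (intro mult_mono) auto
  qed
  have "norm (kap x) \<le> s * \<bar>e \<bullet> fst x\<bar> + \<tau> * \<bar>snd x\<bar>"
    unfolding kap_def using s \<tau> by (intro order_trans[OF norm_triangle_ineq4]) (simp add: norm_mult abs_mult)
  also have "\<dots> \<le> s * norm x + \<tau> * norm x"
  proof (intro add_mono mult_left_mono)
    show "\<bar>e \<bullet> fst x\<bar> \<le> norm x" using Cauchy_Schwarz_ineq2[of e "fst x"] e norm_fst_le[of "fst x" "snd x"] by simp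
    show "\<bar>snd x\<bar> \<le> norm x" using norm_snd_le[of "snd x" "fst x"] by simp
  qed (use s \<tau> in auto)
  finally have kx: "norm (kap x) \<le> (s + \<tau>) * norm x" by (simp add: distrib_right)
  have 2: "norm (complex_of_real (4 * K\<^sup>2 * c1 (Q x)) * kap x) \<le> B * (4 * K * (s + \<tau>))"
  proof -
    have "norm (complex_of_real (4 * K\<^sup>2 * c1 (Q x)) * kap x) = \<bar>c1 (Q x)\<bar> * (4 * K\<^sup>2 * norm (kap x))"
      by (simp add: norm_mult abs_mult norm_power)
    also have "\<dots> \<le> B * (4 * K\<^sup>2 * ((s + \<tau>) * norm x))"
      using c1b[of "Q x"] kx B0 by (intro mult_mono mult_left_mono) auto
    also have "\<dots> = B * (4 * K * (s + \<tau>) * (K * norm x))" by (simp add: power2_eq_square)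
    also have "\<dots> \<le> B * (4 * K * (s + \<tau>) * 1)" using Kx B0 K s \<tau> by (intro mult_left_mono) auto
    finally show ?thesis by simp
  qed
  have "norm (complex_of_real (c2 (Q x) * (4 * K ^ 4 * (norm x)\<^sup>2) + c1 (Q x) * (2 * K\<^sup>2 * ?n)) + complex_of_real (4 * K\<^sup>2 * c1 (Q x)) * kap x)
     \<le> (B * (4 * K\<^sup>2) + B * (2 * K\<^sup>2 * ?n)) + B * (4 * K * (s + \<tau>))"
    by (rule order_trans[OF norm_triangle_ineq add_mono[OF _ 2]]) (use 1 in \<open>simp only: norm_of_real\<close>)
  also have "\<dots> = B * (K\<^sup>2 * (4 + 2 * ?n) + 4 * K * (s + \<tau>))" by (simp add: algebra_simps)
  finally show ?thesis unfolding lap_w[OF sk] norm_mult[of "v x"] norm_v by (intro mult_left_mono) auto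
qed

lemma lap_w_zero:
  assumes sk: "s\<^sup>2 = \<tau>\<^sup>2 + k\<^sup>2" and x: "Q x \<le> 98/100 \<or> Q x \<ge> 1"
  shows "test_function.lap w2 x + complex_of_real (k\<^sup>2) * w x = 0"
proof -
  have "c1 (Q x) = 0 \<and> c2 (Q x) = 0" using x lo[of "Q x"] hi[of "Q x"] by blast
  then show ?thesis unfolding lap_w[OF sk] by simp
qed

end

text \<open>The saddle height of the exponential on the paraboloid is \<open>1 / (4 K)\<close>; the cutoff acts above
  \<open>3 / (5 K)\<close>, and this ratio larger than \<open>2\<close> is what makes the exponent \<open>1/2\<close> in the theorem possible.\<close>

lemma above_cutoff:
  fixes x :: "'v::euclidean_space \<times> real"
  assumes K: "K > 0" and Km: "97/100 * K \<le> Km" and x: "Km * (norm (fst x))\<^sup>2 \<le> snd x" "98/100 \<le> K\<^sup>2 * (norm x)\<^sup>2"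
  shows "3/5 / K \<le> snd x"
proof (rule ccontr)
  assume n: "\<not> 3/5 / K \<le> snd x"
  have "97/100 * K * (norm (fst x))\<^sup>2 \<le> Km * (norm (fst x))\<^sup>2" using Km by (intro mult_right_mono) auto
  then have a: "97/100 * K * (norm (fst x))\<^sup>2 \<le> snd x" using x(1) by linarith
  moreover have "0 \<le> 97/100 * K * (norm (fst x))\<^sup>2" using K by simp
  ultimately have x0: "0 \<le> snd x" by linarith
  have p: "K * snd x < 3/5" using n K by (simp add: field_simps)
  have "K * (97/100 * K * (norm (fst x))\<^sup>2) \<le> K * snd x" using a K by (intro mult_left_mono) auto
  then have q: "97/100 * (K\<^sup>2 * (norm (fst x))\<^sup>2) < 3/5" using p by (simp add: power2_eq_square)
  have "(K * snd x)\<^sup>2 \<le> (3/5)\<^sup>2" using p x0 K by (intro power_mono) auto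
  then have r: "K\<^sup>2 * (snd x)\<^sup>2 \<le> 9/25" by (simp add: power_mult_distrib power_divide)
  have "(norm x)\<^sup>2 = (norm (fst x))\<^sup>2 + (snd x)\<^sup>2" by (simp add: norm_prod_def)
  then have "K\<^sup>2 * (norm x)\<^sup>2 = K\<^sup>2 * (norm (fst x))\<^sup>2 + K\<^sup>2 * (snd x)\<^sup>2" by (simp add: distrib_left)
  \<comment> \<open>The numbers fit because \<open>60/97 + 9/25 < 98/100\<close>: the first fraction
    bounds the horizontal part, the second the vertical part of
    \<open>K\<^sup>2 * (norm x)\<^sup>2\<close>. This fixes both the inner edge of the cutoff and
    the tolerance of three percent for \<open>Km\<close>.\<close>
  then show False using x(2) q r by linarith
qed

text \<open>Within the horizontal radius \<open>h\<close> the graph lies between two paraboloids, so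
  replacing the domain by \<open>x\<^sub>n \<ge> K * (norm x')\<^sup>2\<close> changes it only
  inside this lens. Its vertical fibre has length
  \<open>(Kp - Km) * (norm x')\<^sup>2\<close>.\<close>

lemma lens_integral:
  fixes Km Kp h :: real
  assumes K: "Km \<le> Kp" and h: "h \<ge> 0"
  defines "S \<equiv> {x :: 'v::euclidean_space \<times> real. norm (fst x) \<le> h \<and> Km * (norm (fst x))\<^sup>2 \<le> snd x \<and> snd x \<le> Kp * (norm (fst x))\<^sup>2}"
  shows "integrable lborel (indicator S :: _ \<Rightarrow> real)"
    and "(\<integral>x. indicator S x \<partial>lborel) \<le> measure lborel (cball (0::'v) h) * ((Kp - Km) * h\<^sup>2)"
proof -
  define g :: "'v \<Rightarrow> real \<Rightarrow> real" where "g x' t = indicator (cball 0 h) x' * indicator {Km * (norm x')\<^sup>2..Kp * (norm x')\<^sup>2} t" for x' t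
  have S: "indicator S x = g (fst x) (snd x)" for x by (auto simp: S_def g_def indicator_def)
  have [measurable]: "S \<in> sets borel" unfolding S_def by measurable
  have le: "Km * (norm x')\<^sup>2 \<le> Kp * (norm x')\<^sup>2" for x' :: 'v using K by (intro mult_right_mono) auto
  have gt: "integrable lborel (g x')" "(\<integral>t. norm (g x' t) \<partial>lborel) \<le> indicator (cball 0 h) x' *\<^sub>R ((Kp - Km) * h\<^sup>2)" for x'
  proof -
    show "integrable lborel (g x')" unfolding g_def using le[of x'] by (intro integrable_mult_right integrable_real_indicator) auto
    have "(\<integral>t. norm (g x' t) \<partial>lborel) = (\<integral>t. g x' t \<partial>lborel)" by (simp add: g_def)
    also have "\<dots> = indicator (cball 0 h) x' * ((Kp - Km) * (norm x')\<^sup>2)"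
      unfolding g_def using le[of x'] by (simp add: left_diff_distrib)
    also have "\<dots> \<le> indicator (cball 0 h) x' *\<^sub>R ((Kp - Km) * h\<^sup>2)"
      using K by (auto simp: indicator_def intro!: mult_left_mono power_mono)
    finally show "(\<integral>t. norm (g x' t) \<partial>lborel) \<le> indicator (cball 0 h) x' *\<^sub>R ((Kp - Km) * h\<^sup>2)" .
  qed
  have Bi: "integrable lborel (\<lambda>x'::'v. indicator (cball 0 h) x' *\<^sub>R ((Kp - Km) * h\<^sup>2))"
    by (intro borel_integrable_compact) auto
  have i: "integrable lborel (\<lambda>x. g (fst x) (snd x))"
    by (rule lborel_integrable_iterated[where g=g, OF _ gt Bi]) (simp add: S[symmetric])
  then show "integrable lborel (indicator S :: _ \<Rightarrow> real)" by (simp add: S[symmetric])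
  have "(\<integral>x. indicator S x \<partial>lborel) = (\<integral>x'. \<integral>t. g x' t \<partial>lborel \<partial>lborel)"
    unfolding S by (rule lborel_iterated[where g=g, OF i])
  also have "\<dots> \<le> (\<integral>x'. indicator (cball (0::'v) h) x' *\<^sub>R ((Kp - Km) * h\<^sup>2) \<partial>lborel)"
  proof (rule integral_mono[OF lborel_integrable_fst[where g=g, OF i] Bi])
    fix x'
    have "(\<integral>t. norm (g x' t) \<partial>lborel) = (\<integral>t. g x' t \<partial>lborel)" by (simp add: g_def)
    then show "(\<integral>t. g x' t \<partial>lborel) \<le> indicator (cball 0 h) x' *\<^sub>R ((Kp - Km) * h\<^sup>2)" using gt(2)[of x'] by simp
  qed
  also have "\<dots> = measure lborel (cball (0::'v) h) * ((Kp - Km) * h\<^sup>2)" by simp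
  finally show "(\<integral>x. indicator S x \<partial>lborel) \<le> measure lborel (cball (0::'v) h) * ((Kp - Km) * h\<^sup>2)" .
qed

section \<open>The estimate at the curvature point\<close>

context source
begin

text \<open>The weak equation is tested with the localised exponential. On one side \<open>f\<close>
  is replaced by \<open>\<phi>0\<close> and the cut domain by the full paraboloid, which isolates
  the Gaussian integral. On the other side the integrand lives in the transition shell inside
  \<Omega>, at heights above \<open>3 / (5 * K)\<close>, where the exponential is small, and
  \<open>u\<close> is small near the origin. The four terms on the right are the Holder error, the
  lens, the cutoff of the main term and the pairing with \<open>u\<close>.\<close>

lemma core_estimate:
  assumes CW: "cutoff_wave c c1 c2 B K \<tau> s (e :: 'v)" and sk: "s\<^sup>2 = \<tau>\<^sup>2 + k\<^sup>2" and K\<tau>: "K \<le> \<tau>" and K1: "K \<ge> 1"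
    and \<Omega>: "open \<Omega>" "\<And>y. f y \<noteq> 0 \<Longrightarrow> y \<in> \<Omega>" "closure \<Omega> \<subseteq> cball 0 R" and b: "b \<ge> 1 / K"
    and graph: "\<Omega> \<inter> (ball 0 b \<times> {- (1 / K)<..<1 / K}) = {(x', t). norm x' < b \<and> - (1 / K) < t \<and> t < 1 / K \<and> \<omega> x' < t}"
    and \<omega>: "continuous_on (ball 0 b) \<omega>" "\<And>x'. norm x' < b \<Longrightarrow> Km * (norm x')\<^sup>2 \<le> \<omega> x' \<and> \<omega> x' \<le> Kp * (norm x')\<^sup>2"
    and Km: "97/100 * K \<le> Km" "Km \<le> K" "K \<le> Kp"
    and \<gamma>: "connected_to_infinity (- closure \<Omega>) 0"
    and \<phi>: "\<And>y. y \<in> \<Omega> \<Longrightarrow> norm (f y - \<phi>0) \<le> N * norm y powr \<alpha>" "norm \<phi>0 \<le> N" and \<alpha>: "\<alpha> > 0"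
  shows "norm \<phi>0 * (1 / \<tau> * (pi / (\<tau> * K)) powr (DIM('v) / 2) * exp (- s\<^sup>2 / (4 * (\<tau> * K))))
    \<le> N * (measure lborel (cball (0::'v \<times> real) (1 / K)) * (1 / K) powr \<alpha>
        + measure lborel (cball (0::'v) (1 / K)) * ((Kp - Km) * (1 / K)\<^sup>2)
        + exp (3/5) * exp (- (3/5 * \<tau> / K)) * (1 / K * (pi / (K * K)) powr (DIM('v) / 2))
        + CU * ((1 / K)\<^sup>2 * (1 + ln (4 * K))) * (exp (- (3/5 * \<tau> / K)) * (B * (K\<^sup>2 * (4 + 2 * real DIM('v \<times> real)) + 4 * K * (s + \<tau>))))
            * measure lborel (cball (0::'v \<times> real) (1 / K)))"
proof -
  interpret cw: cutoff_wave c c1 c2 B K \<tau> s e by (rule CW)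
  define h where "h = 1 / K"
  have h: "h > 0" "h \<le> 1" using K1 by (auto simp: h_def)
  have T: "test_function h cw.w cw.w1 cw.w2" unfolding h_def by (rule cw.test_function)
  note K = cw.K
  have K0: "K > 0" by (rule K)
  have Km0: "Km > 0" using Km(1) K by linarith
  have b0: "b > 0" using b h(1) unfolding h_def by linarith
  have \<omega>0: "0 \<le> \<omega> x'" if "norm x' < b" for x'
    using \<omega>(2)[OF that] Km0 by (meson mult_nonneg_nonneg less_imp_le zero_le_power2 order_trans)
  have cyl: "norm (fst x) < b" "- h < snd x" "snd x < h" if "norm x < h" for x :: "'v \<times> real"
    using that norm_fst_le[of "fst x" "snd x"] norm_snd_le[of "snd x" "fst x"] b by (auto simp: h_def abs_le_iff)
  have inC: "x \<in> \<Omega> \<longleftrightarrow> \<omega> (fst x) < snd x" if "norm (fst x) < b" "- h < snd x" "snd x < h" for x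
    using graph that unfolding h_def by (cases x) (auto simp: set_eq_iff)
  have inO: "x \<in> \<Omega> \<longleftrightarrow> \<omega> (fst x) < snd x" if "norm x < h" for x
    by (intro inC cyl that)
  have uz: "u x = 0" if "norm (fst x) < b" "- h < snd x" "snd x < h" "x \<notin> \<Omega>" for x
    by (rule exterior_zero[OF \<Omega> b0 h(1) graph[folded h_def] \<omega>(1) \<omega>0 \<gamma> that])
  define Mu where "Mu = N * CU * (h\<^sup>2 * (1 + ln (4 / h)))"
  \<comment> \<open>The graph is nonnegative, so the cylinder below height 0 is outside \<Omega> and
    \<open>u\<close> vanishes there, as \<open>u_bound\<close> requires.\<close>
  have ub: "norm (u x) \<le> Mu" if x: "norm x < h" for x
    unfolding Mu_def
  proof (rule u_bound[OF h])
    fix y assume y: "fst y = fst x" "- h < snd y" "snd y < 0"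
    have "y \<notin> \<Omega>"
    proof
      assume "y \<in> \<Omega>"
      then have "\<omega> (fst y) < snd y" using inC[of y] y cyl(1)[OF x] h by simp
      then show False using \<omega>0[of "fst y"] y cyl(1)[OF x] by simp
    qed
    then show "u y = 0" using y cyl(1)[OF x] h by (intro uz) auto
  qed (use cyl[OF x] in auto)
  have Mu0: "Mu \<ge> 0" unfolding Mu_def using N CU_nonneg h by (intro mult_nonneg_nonneg add_nonneg_nonneg) auto
  define Mg where "Mg = exp (- (3/5 * \<tau> / K)) * (B * (K\<^sup>2 * (4 + 2 * real DIM('v \<times> real)) + 4 * K * (s + \<tau>)))"
  have B0: "B \<ge> 0" using cw.c1b[of 0] abs_ge_zero order_trans by blast
  have Mg0: "Mg \<ge> 0" unfolding Mg_def using B0 K0 cw.s cw.\<tau> by (intro mult_nonneg_nonneg add_nonneg_nonneg) auto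
  define g where "g x = test_function.lap cw.w2 x + complex_of_real (k\<^sup>2) * cw.w x" for x
  note p = pairing[OF T, folded g_def]
  \<comment> \<open>Outside \<Omega> the factor \<open>u\<close> vanishes, outside the shell the
    factor \<open>g\<close>. In the remaining part the graph lies above the paraboloid with
    coefficient \<open>Km\<close>, which forces the height \<open>3 / (5 * K)\<close>.\<close>
  have ugb: "norm (u x * g x) \<le> Mu * Mg * indicator (cball 0 h) x" for x
  proof (cases "norm x < h \<and> x \<in> \<Omega> \<and> \<not> cw.Q x \<le> 98/100")
    case True
    have "Km * (norm (fst x))\<^sup>2 \<le> snd x" using inO[of x] True \<omega>(2)[OF cyl(1)[of x]] by linarith
    then have sx: "3/5 / K \<le> snd x" using True by (intro above_cutoff[OF K0 Km(1)]) (auto simp: cw.Q_def)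
    have "\<tau> * (3/5 / K) \<le> \<tau> * snd x" using sx cw.\<tau> by (intro mult_left_mono) auto
    then have ex: "exp (- \<tau> * snd x) \<le> exp (- (3/5 * \<tau> / K))" by (simp add: field_simps)
    have "norm (g x) \<le> exp (- \<tau> * snd x) * (B * (K\<^sup>2 * (4 + 2 * real DIM('v \<times> real)) + 4 * K * (s + \<tau>)))"
      unfolding g_def using True by (intro cw.norm_lap_w[OF sk]) (simp add: h_def)
    also have "\<dots> \<le> Mg" unfolding Mg_def using ex B0 K0 cw.s cw.\<tau> by (intro mult_right_mono mult_nonneg_nonneg add_nonneg_nonneg) auto
    finally have "norm (u x * g x) \<le> Mu * Mg" unfolding norm_mult using ub[of x] True Mu0 by (intro mult_mono) auto
    then show ?thesis using True by simp
  next
    case False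
    have z: "u x * g x = 0"
    proof (cases "norm x < h \<and> x \<notin> \<Omega>")
      case True
      then show ?thesis using uz[OF cyl[of x]] by simp
    next
      case F: False
      have "cw.Q x \<le> 98/100 \<or> cw.Q x \<ge> 1" using False F cw.Q_ge_1[of x] by (auto simp: h_def)
      then have "g x = 0" unfolding g_def by (rule cw.lap_w_zero[OF sk])
      then show ?thesis by simp
    qed
    show ?thesis unfolding z using Mu0 Mg0 by simp
  qed
  have ibc: "integrable lborel (indicator (cball (0::'v \<times> real) h) :: _ \<Rightarrow> real)"
    using borel_integrable_compact[of "cball (0::'v \<times> real) h" "\<lambda>_. 1::real"] by simp
  have J1: "norm (\<integral>y. f y * cw.w y \<partial>lborel) \<le> Mu * Mg * measure lborel (cball (0::'v \<times> real) h)"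
  proof -
    have "norm (\<integral>x. u x * g x \<partial>lborel) \<le> (\<integral>x. Mu * Mg * indicator (cball (0::'v \<times> real) h) x \<partial>lborel)"
      by (intro Bochner_Integration.integral_norm_bound_integral p integrable_mult_right ibc ugb)
    then show ?thesis unfolding p(2) by simp
  qed
  define S where "S = {x :: 'v \<times> real. norm (fst x) \<le> h \<and> Km * (norm (fst x))\<^sup>2 \<le> snd x \<and> snd x \<le> Kp * (norm (fst x))\<^sup>2}"
  have KK: "Km \<le> Kp" using Km by linarith
  note Si = lens_integral[where 'v='v, OF KK less_imp_le[OF h(1)], folded S_def]
  define cE where "cE = exp (3/5) * exp (- (3/5 * \<tau> / K))"
  \<comment> \<open>Writing \<tau> as \<open>(\<tau> - K) + K\<close>, only the first part is frozen
    at the height \<open>3 / (5 * K)\<close>. The rest \<open>exp (- K * x\<^sub>n)\<close> is kept,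
    since the bound must be integrable over the unbounded paraboloid; the factor
    \<open>exp (3/5)\<close> is the loss.\<close>
  have tail: "exp (- \<tau> * snd x) \<le> cE * exp (- K * snd x)" if "3/5 / K \<le> snd x" for x :: "'v \<times> real"
  proof -
    have "(\<tau> - K) * (3/5 / K) \<le> (\<tau> - K) * snd x" using that K\<tau> by (intro mult_left_mono) auto
    moreover have "(\<tau> - K) * (3/5 / K) = 3/5 * \<tau> / K - 3/5" using K0 by (simp add: field_simps)
    ultimately have "- \<tau> * snd x \<le> 3/5 + - (3/5 * \<tau> / K) + - K * snd x" by (simp add: algebra_simps)
    then have "exp (- \<tau> * snd x) \<le> exp (3/5 + - (3/5 * \<tau> / K) + - K * snd x)" by (simp only: exp_le_cancel_iff)
    then show ?thesis by (simp only: cE_def exp_add)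
  qed
  let ?P = "paraboloid K :: ('v \<times> real) set"
  define D where "D x = f x * cw.w x - \<phi>0 * (indicator ?P x *\<^sub>R cw.v x)" for x
  have vP: "integrable lborel (\<lambda>x. indicator ?P x *\<^sub>R cw.v x)"
    "(\<integral>x. indicator ?P x *\<^sub>R cw.v x \<partial>lborel) = complex_of_real (1 / \<tau> * (pi / (\<tau> * K)) powr (DIM('v) / 2) * exp (- s\<^sup>2 / (4 * (\<tau> * K))))"
    using paraboloid_integrable[OF K0 cw.\<tau>, of s e] paraboloid_integral[OF K0 cw.\<tau>, of s e] cw.e unfolding cw.v_def by simp_all
  interpret tf: test_function h cw.w cw.w1 cw.w2 by (rule T)
  obtain Bw where Bw: "\<And>x. norm (cw.w x) \<le> Bw" using integrable_continuous_support(2)[OF tf.w_cont(1) tf.w_supp] by blast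
  have fwi: "integrable lborel (\<lambda>x. f x * cw.w x)" by (rule f_integrable[where B=Bw]) (auto intro: Bw)
  have Di: "integrable lborel D" unfolding D_def by (intro Bochner_Integration.integrable_diff fwi integrable_mult_right vP)
  \<comment> \<open>One summand for each deviation of \<open>f * w\<close> from
    \<open>\<phi>0 * v\<close> on the paraboloid: variation of the source, the lens, and the region
    where the cutoff is not 1.\<close>
  define E where "E x = N * h powr \<alpha> * indicator (cball 0 h) x + N * indicator S x + N * cE * (indicator ?P x * exp (- K * snd x))" for x
  have N0: "N \<ge> 0" by (rule N)
  have cE0: "cE \<ge> 0" by (simp add: cE_def)
  have w0: "cw.w x = 0" if "\<not> norm x < h" for x
    using cw.hi[OF cw.Q_ge_1[of x]] that by (simp add: cw.w_def h_def)
  have Eparts: "N * h powr \<alpha> * indicator (cball 0 h) x \<ge> 0" "N * indicator S x \<ge> 0" "N * cE * (indicator ?P x * exp (- K * snd x)) \<ge> 0" for x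
    using N0 cE0 by auto
  have DE: "norm (D x) \<le> E x" for x
  proof -
    have tailP: "norm (\<phi>0 * cw.v x) \<le> N * cE * (indicator ?P x * exp (- K * snd x))" if "x \<in> ?P" "98/100 \<le> cw.Q x"
    proof -
      have "3/5 / K \<le> snd x" using that by (intro above_cutoff[OF K0, of K]) (use K0 in \<open>auto simp: cw.Q_def paraboloid_def\<close>)
      from tail[OF this] have "norm \<phi>0 * exp (- \<tau> * snd x) \<le> N * (cE * exp (- K * snd x))"
        using \<phi>(2) N0 by (intro mult_mono) auto
      then show ?thesis using that(1) by (simp add: norm_mult cw.norm_v)
    qed
    have v1: "norm (cw.v x) \<le> 1" "norm (cw.w x) \<le> 1" if "0 \<le> snd x"
      using that cw.\<tau> cw.norm_w_le[of x] by (auto simp: cw.norm_v intro: order_trans)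
    show ?thesis
    proof (cases "norm x < h")
      case False
      show ?thesis
      proof (cases "x \<in> ?P")
        case True
        have "98/100 \<le> cw.Q x" using cw.Q_ge_1[of x] False by (simp add: h_def)
        then show ?thesis using tailP True w0[OF False] Eparts[of x] by (simp add: D_def E_def)
      next
        case F: False
        then show ?thesis using w0[OF False] Eparts[of x] by (simp add: D_def E_def)
      qed
    next
      case True
      note cy = cyl[OF True]
      have om: "Km * (norm (fst x))\<^sup>2 \<le> \<omega> (fst x)" "\<omega> (fst x) \<le> Kp * (norm (fst x))\<^sup>2" using \<omega>(2)[OF cy(1)] by auto
      have nf: "norm (fst x) \<le> h" using norm_fst_le[of "fst x" "snd x"] True by simp
      have sq: "0 \<le> Km * (norm (fst x))\<^sup>2" using Km0 by simp
      have mk: "Km * (norm (fst x))\<^sup>2 \<le> K * (norm (fst x))\<^sup>2" "K * (norm (fst x))\<^sup>2 \<le> Kp * (norm (fst x))\<^sup>2"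
        using Km by (auto intro: mult_right_mono)
      show ?thesis
      proof (cases "x \<in> \<Omega>")
        case xO: True
        then have xo: "\<omega> (fst x) < snd x" using inO[OF True] by simp
        then have s0: "0 \<le> snd x" using om sq by linarith
        show ?thesis
        proof (cases "x \<in> ?P")
          case xP: True
          have 1: "norm ((f x - \<phi>0) * cw.w x) \<le> N * h powr \<alpha>"
          proof -
            have "norm x powr \<alpha> \<le> h powr \<alpha>" using True \<alpha> by (intro powr_mono2) auto
            then have "norm (f x - \<phi>0) \<le> N * h powr \<alpha>" using \<phi>(1)[OF xO] N0 mult_left_mono order_trans by blast
            then have "norm (f x - \<phi>0) * norm (cw.w x) \<le> (N * h powr \<alpha>) * 1" using v1(2)[OF s0] N0 by (intro mult_mono) auto
            then show ?thesis by (simp add: norm_mult)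
          qed
          have 2: "norm (\<phi>0 * (cw.w x - cw.v x)) \<le> N * cE * (indicator ?P x * exp (- K * snd x))"
          proof (cases "cw.Q x \<le> 98/100")
            case True
            then have "cw.w x = cw.v x" using cw.lo by (simp add: cw.w_def)
            then show ?thesis using Eparts(3)[of x] by simp
          next
            case False
            have "cw.w x - cw.v x = complex_of_real (c (cw.Q x) - 1) * cw.v x"
              by (simp add: cw.w_def algebra_simps)
            then have "norm (cw.w x - cw.v x) = (1 - c (cw.Q x)) * norm (cw.v x)"
              using cw.c01[of "cw.Q x"] by (simp only: norm_mult norm_of_real) simp
            also have "\<dots> \<le> norm (cw.v x)" using cw.c01[of "cw.Q x"] by (simp add: mult_left_le_one_le)
            finally have "norm (\<phi>0 * (cw.w x - cw.v x)) \<le> norm (\<phi>0 * cw.v x)" by (simp add: norm_mult mult_left_mono)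
            also have "\<dots> \<le> N * cE * (indicator ?P x * exp (- K * snd x))" using tailP[OF xP] False by simp
            finally show ?thesis .
          qed
          have "D x = (f x - \<phi>0) * cw.w x + \<phi>0 * (cw.w x - cw.v x)" using xP by (simp add: D_def algebra_simps)
          then have "norm (D x) \<le> N * h powr \<alpha> + N * cE * (indicator ?P x * exp (- K * snd x))"
            using norm_triangle_ineq[of "(f x - \<phi>0) * cw.w x" "\<phi>0 * (cw.w x - cw.v x)"] 1 2 by simp
          then show ?thesis unfolding E_def using True Eparts(2)[of x] by simp
        next
          case xP: False
          have "x \<in> S" using xP xo om mk nf unfolding S_def paraboloid_def by auto
          moreover have "norm (f x) * norm (cw.w x) \<le> N * 1" using f_bound[of x] v1(2)[OF s0] N0 by (intro mult_mono) auto
          ultimately show ?thesis using xP Eparts(1,3)[of x] by (simp add: D_def E_def norm_mult)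
        qed
      next
        case xO: False
        then have fx: "f x = 0" using \<Omega>(2) by blast
        show ?thesis
        proof (cases "x \<in> ?P")
          case xP: True
          have xn: "snd x \<le> \<omega> (fst x)" using inO[OF True] xO by simp
          have xk: "K * (norm (fst x))\<^sup>2 \<le> snd x" using xP by (simp add: paraboloid_def)
          have "x \<in> S" using xn xk om mk nf unfolding S_def by auto
          moreover have "0 \<le> snd x" using xk mk sq by linarith
          then have "norm \<phi>0 * norm (cw.v x) \<le> N * 1" using \<phi>(2) v1(1) N0 by (intro mult_mono) auto
          ultimately show ?thesis using xP fx Eparts(1,3)[of x] by (simp add: D_def E_def norm_mult)
        next
          case xP: False
          have "D x = 0" using xP fx by (simp add: D_def)
          then show ?thesis unfolding E_def using Eparts[of x] by simp
        qed
      qed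
    qed
  qed
  have pe: "integrable lborel (\<lambda>x. indicator ?P x * exp (- K * snd x))" "(\<integral>x. indicator ?P x * exp (- K * snd x) \<partial>lborel) = 1 / K * (pi / (K * K)) powr (DIM('v) / 2)"
    using paraboloid_exp_integrable[OF K0 K0, where 'v='v] paraboloid_exp_integral[OF K0 K0, where 'v='v] by simp_all
  have i1: "integrable lborel (\<lambda>x. N * h powr \<alpha> * indicator (cball (0::'v \<times> real) h) x)" by (intro integrable_mult_right ibc)
  have i2: "integrable lborel (\<lambda>x. N * indicator S x :: real)" by (intro integrable_mult_right Si)
  have i3: "integrable lborel (\<lambda>x. N * cE * (indicator ?P x * exp (- K * snd x)))" by (intro integrable_mult_right pe)
  have Ei: "integrable lborel E" unfolding E_def by (intro Bochner_Integration.integrable_add i1 i2 i3)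
  have "(\<integral>x. E x \<partial>lborel) = N * h powr \<alpha> * measure lborel (cball (0::'v \<times> real) h) + N * (\<integral>x. indicator S x \<partial>lborel)
      + N * cE * (1 / K * (pi / (K * K)) powr (DIM('v) / 2))"
    unfolding E_def Bochner_Integration.integral_add[OF Bochner_Integration.integrable_add[OF i1 i2] i3] Bochner_Integration.integral_add[OF i1 i2]
      integral_mult_right_zero pe(2) by simp
  also have "\<dots> \<le> N * h powr \<alpha> * measure lborel (cball (0::'v \<times> real) h) + N * (measure lborel (cball (0::'v) h) * ((Kp - Km) * h\<^sup>2))
      + N * cE * (1 / K * (pi / (K * K)) powr (DIM('v) / 2))"
    using mult_left_mono[OF Si(2) N0] by linarith
  finally have IE: "(\<integral>x. E x \<partial>lborel) \<le> N * h powr \<alpha> * measure lborel (cball (0::'v \<times> real) h) + N * (measure lborel (cball (0::'v) h) * ((Kp - Km) * h\<^sup>2))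
      + N * cE * (1 / K * (pi / (K * K)) powr (DIM('v) / 2))" .
  have "norm (\<integral>x. D x \<partial>lborel) \<le> (\<integral>x. E x \<partial>lborel)"
    by (rule Bochner_Integration.integral_norm_bound_integral[OF Di Ei DE])
  moreover have "(\<integral>x. D x \<partial>lborel) = (\<integral>x. f x * cw.w x \<partial>lborel) - \<phi>0 * (\<integral>x. indicator ?P x *\<^sub>R cw.v x \<partial>lborel)"
    unfolding D_def Bochner_Integration.integral_diff[OF fwi integrable_mult_right[OF vP(1)]] integral_mult_right_zero ..
  ultimately have "norm (\<phi>0 * (\<integral>x. indicator ?P x *\<^sub>R cw.v x \<partial>lborel)) \<le> norm (\<integral>x. f x * cw.w x \<partial>lborel) + (\<integral>x. E x \<partial>lborel)"
    using norm_triangle_ineq2[of "\<phi>0 * (\<integral>x. indicator ?P x *\<^sub>R cw.v x \<partial>lborel)" "\<integral>x. f x * cw.w x \<partial>lborel"] by (simp add: norm_minus_commute)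
  also have "\<dots> \<le> Mu * Mg * measure lborel (cball (0::'v \<times> real) h) + (N * h powr \<alpha> * measure lborel (cball (0::'v \<times> real) h) + N * (measure lborel (cball (0::'v) h) * ((Kp - Km) * h\<^sup>2))
      + N * cE * (1 / K * (pi / (K * K)) powr (DIM('v) / 2)))"
    using J1 IE by linarith
  also have "\<dots> = N * (measure lborel (cball (0::'v \<times> real) h) * h powr \<alpha>
        + measure lborel (cball (0::'v) h) * ((Kp - Km) * h\<^sup>2)
        + cE * (1 / K * (pi / (K * K)) powr (DIM('v) / 2))
        + CU * (h\<^sup>2 * (1 + ln (4 / h))) * Mg * measure lborel (cball (0::'v \<times> real) h))"
    unfolding Mu_def by (simp add: algebra_simps)
  also have "norm (\<phi>0 * (\<integral>x. indicator ?P x *\<^sub>R cw.v x \<partial>lborel)) = norm \<phi>0 * (1 / \<tau> * (pi / (\<tau> * K)) powr (DIM('v) / 2) * exp (- s\<^sup>2 / (4 * (\<tau> * K))))"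
    unfolding vP(2) norm_mult norm_of_real using cw.\<tau> by simp
  finally show ?thesis unfolding Mg_def cE_def h_def by simp
qed

text \<open>With \<open>\<tau> = 2 * m * K * ln K\<close> and \<open>Z = K powr - (d + 1)\<close>
  all four errors are at most constants times \<open>Z * K powr - m\<close>, while the Gaussian
  integral is at least \<open>c0 * Z * K powr (- m / 2)\<close> divided by
  \<open>ln K powr (1 + d / 2)\<close>. The quotient is the claim.\<close>

lemma core_bound:
  fixes K L :: real
  assumes cut: "\<And>z. (c has_field_derivative c1 z) (at z)" "\<And>z. (c1 has_field_derivative c2 z) (at z)" "continuous_on UNIV c2"
      "\<And>z. z \<le> 98/100 \<Longrightarrow> c z = 1 \<and> c1 z = 0 \<and> c2 z = 0" "\<And>z. z \<ge> 1 \<Longrightarrow> c z = 0 \<and> c1 z = 0 \<and> c2 z = 0"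
      "\<And>z. 0 \<le> c z \<and> c z \<le> 1" "\<And>z. \<bar>c1 z\<bar> \<le> B" "\<And>z. \<bar>c2 z\<bar> \<le> B"
    and K: "K \<ge> exp 1" and m: "0 < m" "m \<le> \<alpha>" "m \<le> \<delta>" "2 * m * ln K \<ge> 1" and L: "L \<ge> 0" "Kp - Km \<le> L * K powr (1 - \<delta>)"
    and \<Omega>: "open \<Omega>" "\<And>y. f y \<noteq> 0 \<Longrightarrow> y \<in> \<Omega>" "closure \<Omega> \<subseteq> cball 0 R" and b: "b \<ge> 1 / K"
    and graph: "\<Omega> \<inter> (ball 0 b \<times> {- (1 / K)<..<1 / K}) = {(x', t). norm x' < b \<and> - (1 / K) < t \<and> t < 1 / K \<and> \<omega> x' < t}"
    and \<omega>: "continuous_on (ball 0 b) \<omega>" "\<And>x'. norm x' < b \<Longrightarrow> Km * (norm x')\<^sup>2 \<le> \<omega> x' \<and> \<omega> x' \<le> Kp * (norm x')\<^sup>2"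
    and Km: "97/100 * K \<le> Km" "Km \<le> K" "K \<le> Kp"
    and \<gamma>: "connected_to_infinity (- closure \<Omega>) 0"
    and \<phi>: "\<And>y. y \<in> \<Omega> \<Longrightarrow> norm (f y - \<phi>0) \<le> N * norm y powr \<alpha>" "norm \<phi>0 \<le> N"
  defines "d \<equiv> real DIM('v)" and "Vn \<equiv> unit_ball_vol (real DIM('v \<times> real))" and "Vd \<equiv> unit_ball_vol (real DIM('v))"
  defines "C5 \<equiv> Vn + Vd * L + exp (3/5) * pi powr (d / 2) + CU * Vn * B * (4 * ((4 + 2 * (d + 1)) + 16 * m + 4 * k)) * (50 / m\<^sup>2)"
    and "c0 \<equiv> 1 / (2 * m) * (pi / (2 * m)) powr (d / 2) * exp (- k\<^sup>2 / (8 * m))"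
  shows "norm \<phi>0 \<le> N * (C5 / c0) * ln K powr (1 + d / 2) * K powr (- m / 2)"
proof -
  define l where "l = ln K"
  have K1: "K \<ge> 1" "K > 0" using K exp_ge_add_one_self[of 1] by linarith+
  have l1: "l \<ge> 1" unfolding l_def using K K1 by (simp add: ln_ge_iff)
  have Kl: "K = exp l" using K1 by (simp add: l_def)
  \<comment> \<open>Then \<open>\<tau> / (4 * K)\<close> is \<open>m / 2 * ln K\<close>, while
    \<open>3/5 * \<tau> / K\<close> is \<open>6/5 * m * ln K\<close>; the surplus of
    \<open>m / 5\<close> over \<open>m\<close> in the second exponent is spent on
    logarithms.\<close>
  define A where "A = 2 * m"
  have A0: "A > 0" using m by (simp add: A_def)
  define \<tau> where "\<tau> = A * K * l"
  have Al: "A * l \<ge> 1" using m(4) by (simp add: A_def l_def)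
  have K\<tau>: "K \<le> \<tau>" using mult_left_mono[OF Al, of K] K1 by (simp add: \<tau>_def mult_ac)
  have \<tau>0: "\<tau> > 0" using K\<tau> K1 by linarith
  define s where "s = sqrt (\<tau>\<^sup>2 + k\<^sup>2)"
  have s2: "s\<^sup>2 = \<tau>\<^sup>2 + k\<^sup>2" by (simp add: s_def)
  have s0: "s \<ge> 0" by (simp add: s_def)
  have sle: "s \<le> \<tau> + k"
  proof (rule power2_le_imp_le)
    show "s\<^sup>2 \<le> (\<tau> + k)\<^sup>2" using \<tau>0 k by (simp add: s2 power2_sum)
  qed (use \<tau>0 k in auto)
  have B0: "B \<ge> 0" using cut(7)[of 0] abs_ge_zero order_trans by blast
  obtain e :: 'v where e: "e \<in> Basis" using nonempty_Basis by blast
  have CW: "cutoff_wave c c1 c2 B K \<tau> s e"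
    by unfold_locales (use cut K1 \<tau>0 s0 e in auto)
  have \<alpha>0: "\<alpha> > 0" using m by linarith
  note est = core_estimate[OF CW s2 K\<tau> K1(1) \<Omega> b graph \<omega> Km \<gamma> \<phi> \<alpha>0]
  \<comment> \<open>The order of the volume of the ball of radius \<open>1 / K\<close> in dimension
    \<open>d + 1\<close>, common to the main term and all errors.\<close>
  define Z where "Z = K powr - (d + 1)"
  have Z0: "Z > 0" using K1 by (simp add: Z_def)
  have pw: "(1 / K) ^ n = K powr - real n" for n
    using K1 by (simp add: powr_minus powr_realpow power_one_over inverse_eq_divide)
  have mn: "measure lborel (cball (0::'v \<times> real) (1 / K)) = Vn * Z"
  proof -
    have dn: "real DIM('v \<times> real) = d + 1" by (simp add: d_def)
    have "measure lborel (cball (0::'v \<times> real) (1 / K)) = Vn * (1 / K) ^ DIM('v \<times> real)"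
      unfolding Vn_def using K1 by (intro content_cball) auto
    then show ?thesis unfolding pw dn Z_def .
  qed
  have md: "measure lborel (cball (0::'v) (1 / K)) = Vd * K powr - d"
    using K1 by (simp add: content_cball pw Vd_def d_def)
  have Vn0: "Vn \<ge> 0" and Vd0: "Vd \<ge> 0" by (auto simp: Vn_def Vd_def)
  have ml: "K powr - m = exp (- m * l)" using K1 by (simp add: powr_def l_def)
  have E1: "Vn * Z * (1 / K) powr \<alpha> \<le> Z * K powr - m * Vn"
  proof -
    have "(1 / K) powr \<alpha> = K powr - \<alpha>" using K1 by (simp add: powr_divide powr_minus_divide)
    also have "\<dots> \<le> K powr - m" using m K1 by (intro powr_mono) auto
    finally show ?thesis using mult_left_mono[of "(1 / K) powr \<alpha>" "K powr - m" "Vn * Z"] Vn0 Z0 by (simp add: mult_ac)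
  qed
  have E2: "Vd * K powr - d * ((Kp - Km) * (1 / K)\<^sup>2) \<le> Z * K powr - m * (Vd * L)"
  proof -
    have "(Kp - Km) * (1 / K)\<^sup>2 \<le> L * K powr (1 - \<delta>) * (1 / K)\<^sup>2" using L(2) by (intro mult_right_mono) auto
    also have "\<dots> = L * (K powr (1 - \<delta>) * K powr - 2)" using pw[of 2] by simp
    also have "\<dots> = L * (K powr - 1 * K powr - \<delta>)" unfolding powr_add[symmetric] by simp
    also have "\<dots> \<le> L * (K powr - 1 * K powr - m)" using L(1) m K1 by (intro mult_left_mono powr_mono) auto
    finally have "Vd * K powr - d * ((Kp - Km) * (1 / K)\<^sup>2) \<le> Vd * K powr - d * (L * (K powr - 1 * K powr - m))"
      using Vd0 by (intro mult_left_mono) auto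
    also have "\<dots> = (K powr - d * K powr - 1) * K powr - m * (Vd * L)" by (simp only: mult_ac)
    also have "K powr - d * K powr - 1 = Z" unfolding Z_def powr_add[symmetric] by simp
    finally show ?thesis .
  qed
  have ex: "exp (- (3/5 * \<tau> / K)) = K powr - m * exp (- (m / 5 * l))"
  proof -
    have "- (3/5 * \<tau> / K) = - m * l + - (m / 5 * l)" using K1 by (simp add: \<tau>_def A_def field_simps)
    then show ?thesis unfolding ml by (simp only: exp_add)
  qed
  have ex1: "exp (- (m / 5 * l)) \<le> 1" using m l1 by simp
  \<comment> \<open>From \<open>x\<^sup>2 / 2 \<le> exp x\<close> at \<open>x = m / 5 * l\<close>,
    hence \<open>50 = 2 * 5\<^sup>2\<close>. The two logarithms are the one in the bound for
    \<open>u\<close> and the one in \<tau>.\<close>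
  have ex2: "l\<^sup>2 * exp (- (m / 5 * l)) \<le> 50 / m\<^sup>2"
  proof -
    have x0: "0 \<le> m / 5 * l" using m l1 by simp
    have "(m / 5 * l)\<^sup>2 / 2 \<le> exp (m / 5 * l)" using exp_lower_Taylor_quadratic[OF x0] x0 by linarith
    then have "l\<^sup>2 \<le> 50 / m\<^sup>2 * exp (m / 5 * l)" using m by (simp add: power_mult_distrib power_divide field_simps)
    then have "l\<^sup>2 * exp (- (m / 5 * l)) \<le> 50 / m\<^sup>2 * exp (m / 5 * l) * exp (- (m / 5 * l))" by (intro mult_right_mono) auto
    also have "\<dots> = 50 / m\<^sup>2" unfolding mult.assoc exp_add[symmetric] by simp
    finally show ?thesis .
  qed
  have E3: "exp (3/5) * exp (- (3/5 * \<tau> / K)) * (1 / K * (pi / (K * K)) powr (DIM('v) / 2)) \<le> Z * K powr - m * (exp (3/5) * pi powr (d / 2))"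
  proof -
    have "(pi / (K * K)) powr (d / 2) = pi powr (d / 2) * K powr - d"
    proof -
      have "(K * K) powr (d / 2) = K powr (d / 2) * K powr (d / 2)" by (rule powr_mult)
      also have "\<dots> = K powr d" unfolding powr_add[symmetric] by simp
      finally show ?thesis unfolding powr_divide by (simp add: powr_minus_divide)
    qed
    moreover have "1 / K = K powr - 1" using K1 by (simp add: powr_minus_divide)
    ultimately have "1 / K * (pi / (K * K)) powr (d / 2) = pi powr (d / 2) * (K powr - d * K powr - 1)" by simp
    also have "K powr - d * K powr - 1 = Z" unfolding Z_def powr_add[symmetric] by simp
    finally have "exp (3/5) * exp (- (3/5 * \<tau> / K)) * (1 / K * (pi / (K * K)) powr (DIM('v) / 2))
       = (Z * K powr - m * (exp (3/5) * pi powr (d / 2))) * exp (- (m / 5 * l))"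
      unfolding ex d_def by (simp add: mult_ac)
    also have "\<dots> \<le> (Z * K powr - m * (exp (3/5) * pi powr (d / 2))) * 1"
      using ex1 Z0 by (intro mult_left_mono) auto
    finally show ?thesis by simp
  qed
  have E4: "CU * ((1 / K)\<^sup>2 * (1 + ln (4 * K))) * (exp (- (3/5 * \<tau> / K)) * (B * (K\<^sup>2 * (4 + 2 * real DIM('v \<times> real)) + 4 * K * (s + \<tau>)))) * (Vn * Z)
     \<le> Z * K powr - m * (CU * Vn * B * (4 * ((4 + 2 * (d + 1)) + 16 * m + 4 * k)) * (50 / m\<^sup>2))"
  proof -
    \<comment> \<open>A constant collecting both orders of the derivative bound:
      \<open>K\<^sup>2 * (q * l)\<close> dominates it because \<open>l \<ge> 1\<close>,
      \<open>K \<ge> 1\<close> and \<open>\<tau> = 2 * m * K * l\<close>. The factor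
      \<open>K\<^sup>2\<close> is then cancelled exactly by the order \<open>(1 / K)\<^sup>2\<close>
      of \<open>u\<close>.\<close>
    define q where "q = (4 + 2 * (d + 1)) + 16 * m + 4 * k"
    have d0: "d \<ge> 0" by (simp add: d_def)
    have q0: "q \<ge> 0" using d0 m k by (simp add: q_def)
    have "1 + ln (4 * K) = 1 + ln 4 + l" using K1 by (simp add: ln_mult l_def)
    also have "ln (4::real) \<le> 2"
    proof -
      have "ln (4::real) = 2 * ln 2" using ln_realpow[of 2 2] by simp
      then show ?thesis using ln_le_minus_one[of "2::real"] by simp
    qed
    then have "1 + ln 4 + l \<le> 4 * l" using l1 by linarith
    finally have ln4: "1 + ln (4 * K) \<le> 4 * l" .
    have "4 * K * (s + \<tau>) \<le> 4 * K * ((\<tau> + k) + \<tau>)" using sle K1 by (intro mult_left_mono) auto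
    also have "\<dots> = K\<^sup>2 * (16 * m * l) + 4 * k * K" by (simp add: \<tau>_def A_def algebra_simps power2_eq_square)
    also have "4 * k * K \<le> K\<^sup>2 * (4 * k * l)"
    proof -
      have "K * 1 \<le> K * (K * l)" using K1 l1 mult_mono[of 1 K 1 l] by (intro mult_left_mono) auto
      then show ?thesis using mult_left_mono[of K "K * (K * l)" "4 * k"] k by (simp add: power2_eq_square mult_ac)
    qed
    finally have "4 * K * (s + \<tau>) \<le> K\<^sup>2 * (16 * m * l) + K\<^sup>2 * (4 * k * l)" by simp
    moreover have "K\<^sup>2 * (4 + 2 * (d + 1)) \<le> K\<^sup>2 * ((4 + 2 * (d + 1)) * l)"
      using l1 d0 by (intro mult_left_mono) auto
    ultimately have "K\<^sup>2 * (4 + 2 * (d + 1)) + 4 * K * (s + \<tau>) \<le> K\<^sup>2 * ((4 + 2 * (d + 1)) * l) + (K\<^sup>2 * (16 * m * l) + K\<^sup>2 * (4 * k * l))" by linarith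
    also have "\<dots> = K\<^sup>2 * (q * l)" by (simp add: q_def algebra_simps)
    finally have big: "K\<^sup>2 * (4 + 2 * (d + 1)) + 4 * K * (s + \<tau>) \<le> K\<^sup>2 * (q * l)" .
    have dn: "real DIM('v \<times> real) = d + 1" by (simp add: d_def)
    have nn: "0 \<le> K\<^sup>2 * (4 + 2 * (d + 1)) + 4 * K * (s + \<tau>)" using K1 d0 s0 \<tau>0 by (intro add_nonneg_nonneg mult_nonneg_nonneg) auto
    have "CU * ((1 / K)\<^sup>2 * (1 + ln (4 * K))) * (exp (- (3/5 * \<tau> / K)) * (B * (K\<^sup>2 * (4 + 2 * real DIM('v \<times> real)) + 4 * K * (s + \<tau>)))) * (Vn * Z)
      \<le> CU * ((1 / K)\<^sup>2 * (4 * l)) * (exp (- (3/5 * \<tau> / K)) * (B * (K\<^sup>2 * (q * l)))) * (Vn * Z)"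
      unfolding dn using ln4 big nn B0 CU_nonneg Vn0 Z0 K1 l1
      by (intro mult_right_mono mult_mono mult_left_mono mult_nonneg_nonneg) auto
    also have "\<dots> = (((1 / K)\<^sup>2 * K\<^sup>2) * Z * K powr - m * (CU * Vn * B * (4 * q))) * (l\<^sup>2 * exp (- (m / 5 * l)))"
      unfolding ex by (simp add: power2_eq_square mult_ac)
    also have "(1 / K)\<^sup>2 * K\<^sup>2 = 1" using K1 by (simp add: power_divide)
    also have "1 * Z * K powr - m * (CU * Vn * B * (4 * q)) * (l\<^sup>2 * exp (- (m / 5 * l))) \<le> 1 * Z * K powr - m * (CU * Vn * B * (4 * q)) * (50 / m\<^sup>2)"
      using ex2 Z0 B0 CU_nonneg Vn0 q0 by (intro mult_left_mono mult_nonneg_nonneg) auto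
    finally show ?thesis unfolding q_def by (simp add: mult_ac)
  qed
  have main: "c0 * (l powr - (1 + d / 2) * (Z * K powr (- m / 2))) \<le> 1 / \<tau> * (pi / (\<tau> * K)) powr (DIM('v) / 2) * exp (- s\<^sup>2 / (4 * (\<tau> * K)))"
  proof -
    have t1: "1 / \<tau> = 1 / A * (K powr - 1 * l powr - 1)" using K1 l1 A0 by (simp add: \<tau>_def powr_minus_divide)
    have t2: "(pi / (\<tau> * K)) powr (d / 2) = (pi / A) powr (d / 2) * (K powr - d * l powr - (d / 2))"
    proof -
      have "pi / (\<tau> * K) = (pi / A) * (1 / (K * K)) * (1 / l)" by (simp add: \<tau>_def field_simps)
      then have "(pi / (\<tau> * K)) powr (d / 2) = (pi / A) powr (d / 2) * (1 / (K * K)) powr (d / 2) * (1 / l) powr (d / 2)"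
        by (simp only: powr_mult)
      moreover have "(1 / (K * K)) powr (d / 2) = K powr - d"
      proof -
        have "(K * K) powr (d / 2) = K powr (d / 2) * K powr (d / 2)" by (rule powr_mult)
        also have "\<dots> = K powr d" unfolding powr_add[symmetric] by simp
        finally show ?thesis unfolding powr_divide by (simp add: powr_minus_divide)
      qed
      moreover have "(1 / l) powr (d / 2) = l powr - (d / 2)" by (simp add: powr_divide powr_minus_divide)
      ultimately show ?thesis by (simp only: mult.assoc)
    qed
    \<comment> \<open>The difference between \<open>s\<^sup>2\<close> and
      \<open>\<tau>\<^sup>2\<close> is \<open>k\<^sup>2\<close>, and
      \<open>\<tau> * K \<ge> 2 * m\<close>; this produces the factor
      \<open>exp (- k\<^sup>2 / (8 * m))\<close> in \<open>c0\<close>.\<close>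
    have t3: "K powr (- m / 2) * exp (- k\<^sup>2 / (8 * m)) \<le> exp (- s\<^sup>2 / (4 * (\<tau> * K)))"
    proof -
      have tK: "\<tau> * K \<ge> A"
      proof -
        have "1 \<le> K * K" using K1 mult_mono[of 1 K 1 K] by simp
        then have "1 * 1 \<le> (K * K) * l" using l1 by (intro mult_mono) auto
        then have "A * 1 \<le> A * ((K * K) * l)" using A0 by (intro mult_left_mono) auto
        then show ?thesis by (simp add: \<tau>_def mult_ac)
      qed
      have "s\<^sup>2 / (4 * (\<tau> * K)) = \<tau> / (4 * K) + k\<^sup>2 / (4 * (\<tau> * K))"
        using \<tau>0 K1 unfolding s2 by (simp add: field_simps power2_eq_square)
      also have "\<tau> / (4 * K) = m / 2 * l" using K1 by (simp add: \<tau>_def A_def)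
      also have "k\<^sup>2 / (4 * (\<tau> * K)) \<le> k\<^sup>2 / (8 * m)"
      proof (rule frac_le)
        show "8 * m \<le> 4 * (\<tau> * K)" using tK unfolding A_def by linarith
      qed (use m in auto)
      finally have "s\<^sup>2 / (4 * (\<tau> * K)) \<le> m / 2 * l + k\<^sup>2 / (8 * m)" by simp
      then have "- m / 2 * l + - k\<^sup>2 / (8 * m) \<le> - s\<^sup>2 / (4 * (\<tau> * K))" by simp
      then have "exp (- m / 2 * l) * exp (- k\<^sup>2 / (8 * m)) \<le> exp (- s\<^sup>2 / (4 * (\<tau> * K)))" unfolding exp_add[symmetric] by (simp only: exp_le_cancel_iff)
      moreover have "K powr (- m / 2) = exp (- m / 2 * l)" using K1 by (simp add: powr_def l_def)
      ultimately show ?thesis by simp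
    qed
    have "c0 * (l powr - (1 + d / 2) * (Z * K powr (- m / 2))) =
      (1 / A * (K powr - 1 * l powr - 1)) * ((pi / A) powr (d / 2) * (K powr - d * l powr - (d / 2))) * (K powr (- m / 2) * exp (- k\<^sup>2 / (8 * m)))"
    proof -
      have "l powr - (1 + d / 2) = l powr - 1 * l powr - (d / 2)" unfolding powr_add[symmetric] by simp
      moreover have "Z = K powr - 1 * K powr - d" by (simp only: Z_def powr_add[symmetric] minus_add_distrib add.commute)
      ultimately show ?thesis unfolding c0_def A_def by (simp add: mult_ac)
    qed
    also have "\<dots> \<le> (1 / A * (K powr - 1 * l powr - 1)) * ((pi / A) powr (d / 2) * (K powr - d * l powr - (d / 2))) * exp (- s\<^sup>2 / (4 * (\<tau> * K)))"
      using t3 A0 by (intro mult_left_mono) auto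
    finally show ?thesis unfolding d_def[symmetric] t1 t2 .
  qed
  have "norm \<phi>0 * (c0 * (l powr - (1 + d / 2) * (Z * K powr (- m / 2)))) \<le> norm \<phi>0 * (1 / \<tau> * (pi / (\<tau> * K)) powr (DIM('v) / 2) * exp (- s\<^sup>2 / (4 * (\<tau> * K))))"
    by (intro mult_left_mono main) auto
  also have "\<dots> \<le> N * (Z * K powr - m * Vn + Z * K powr - m * (Vd * L) + Z * K powr - m * (exp (3/5) * pi powr (d / 2))
      + Z * K powr - m * (CU * Vn * B * (4 * ((4 + 2 * (d + 1)) + 16 * m + 4 * k)) * (50 / m\<^sup>2)))"
    by (rule order_trans[OF est], assumption, assumption, assumption, unfold mn md, intro mult_left_mono add_mono E1 E2 E3 E4 N)
  also have "\<dots> = N * (Z * K powr - m * C5)" unfolding C5_def by (simp only: distrib_left)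
  also have "K powr - m = K powr (- m / 2) * K powr (- m / 2)" unfolding powr_add[symmetric] by simp
  finally have fin: "norm \<phi>0 * (c0 * (l powr - (1 + d / 2) * (Z * K powr (- m / 2)))) \<le> N * (Z * (K powr (- m / 2) * K powr (- m / 2)) * C5)" .
  have c00: "c0 > 0" unfolding c0_def using m by simp
  have pp: "l powr (1 + d / 2) > 0" using l1 by simp
  have zk: "Z * K powr (- m / 2) > 0" using Z0 K1 by simp
  have "norm \<phi>0 * c0 / l powr (1 + d / 2) * (Z * K powr (- m / 2)) \<le> N * (K powr (- m / 2) * C5) * (Z * K powr (- m / 2))"
    using fin unfolding powr_minus_divide[of l "1 + d / 2"] by (simp only: divide_inverse mult_1_left mult_ac)
  then have "norm \<phi>0 * c0 / l powr (1 + d / 2) \<le> N * (K powr (- m / 2) * C5)"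
    using zk by (simp only: mult_le_cancel_right_pos)
  then have "norm \<phi>0 \<le> N * (K powr (- m / 2) * C5) * l powr (1 + d / 2) / c0"
    using c00 pp by (simp only: divide_le_eq le_divide_eq if_True)
  then show ?thesis by (simp add: l_def mult_ac)
qed

end

section \<open>Admissible curvature points\<close>

text \<open>Both summands of the norm are nonnegative, so each bounds its own quantity. The distinct
  points \<open>a\<close> and \<open>b\<close> make the set of difference quotients nonempty;
  without such a pair its \<open>Sup\<close> would carry no information.\<close>

lemma holder_norm_bounds:
  fixes f :: "'a::metric_space \<Rightarrow> complex"
  assumes h: "holder_continuous_on \<alpha> S f" and ab: "a \<in> S" "b \<in> S" "a \<noteq> b" and x: "x \<in> S" and y: "y \<in> S"
  shows "norm (f x) \<le> holder_norm \<alpha> S f" "norm (f x - f y) \<le> holder_norm \<alpha> S f * dist x y powr \<alpha>"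
proof -
  let ?T = "{norm (f x - f y) / dist x y powr \<alpha> | x y. x \<in> S \<and> y \<in> S \<and> x \<noteq> y}"
  obtain C where C: "\<forall>x\<in>S. \<forall>y\<in>S. norm (f x - f y) \<le> C * dist x y powr \<alpha>" and bd: "bounded (f ` S)"
    using h unfolding holder_continuous_on_def by blast
  have b1: "bdd_above ((\<lambda>x. norm (f x)) ` S)"
    using bd unfolding bounded_iff bdd_above_def by auto
  have b2: "bdd_above ?T"
    unfolding bdd_above_def
  proof (intro exI ballI)
    fix z assume "z \<in> ?T"
    then obtain x y where "z = norm (f x - f y) / dist x y powr \<alpha>" "x \<in> S" "y \<in> S" "x \<noteq> y" by blast
    then show "z \<le> C" using C by (simp add: divide_le_eq)
  qed
  have s1: "norm (f x) \<le> (SUP x\<in>S. norm (f x))" if "x \<in> S" for x using cSUP_upper[OF that b1] .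
  have s2: "z \<le> Sup ?T" if "z \<in> ?T" for z using cSup_upper[OF that b2] .
  have "norm (f a - f b) / dist a b powr \<alpha> \<in> ?T" using ab by blast
  from s2[OF this] have n2: "0 \<le> Sup ?T" by (rule order_trans[rotated]) simp
  have n1: "0 \<le> (SUP x\<in>S. norm (f x))" using s1[OF ab(1)] norm_ge_zero order_trans by blast
  show "norm (f x) \<le> holder_norm \<alpha> S f" unfolding holder_norm_def using s1[OF x] n2 by linarith
  show "norm (f x - f y) \<le> holder_norm \<alpha> S f * dist x y powr \<alpha>"
  proof (cases "x = y")
    case False
    have "norm (f x - f y) / dist x y powr \<alpha> \<in> ?T" using x y False by blast
    from s2[OF this] have "norm (f x - f y) \<le> Sup ?T * dist x y powr \<alpha>" using False by (simp add: divide_le_eq)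
    also have "\<dots> \<le> holder_norm \<alpha> S f * dist x y powr \<alpha>" unfolding holder_norm_def using n1 by (intro mult_right_mono) auto
    finally show ?thesis .
  qed simp
qed

section \<open>Transport to the coordinates of the curvature point\<close>

lemma connected_to_infinity_isometry:
  fixes T :: "'a::real_normed_vector \<Rightarrow> 'a"
  assumes iso: "\<And>x y. dist (T x) (T y) = dist x y" and p: "T p = 0" and c: "connected_to_infinity (- closure \<Omega>) p"
  shows "connected_to_infinity (- closure (T ` \<Omega>)) 0"
proof -
  obtain \<gamma> :: "real \<Rightarrow> 'a" where g: "continuous_on {0<..} \<gamma>" "\<gamma> ` {0<..} \<subseteq> - closure \<Omega>"
    "(\<gamma> \<longlongrightarrow> p) (at_right 0)" "filterlim (\<lambda>s. norm (\<gamma> s)) at_top at_top"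
    using c unfolding connected_to_infinity_def by blast
  have cT: "continuous_on UNIV T" unfolding continuous_on_iff iso by blast
  have "x \<in> closure \<Omega>" if "T x \<in> closure (T ` \<Omega>)" for x
    using that unfolding closure_approachable by (auto simp: iso)
  then have "(T \<circ> \<gamma>) ` {0<..} \<subseteq> - closure (T ` \<Omega>)" using g(2) by auto
  moreover have "continuous_on {0<..} (T \<circ> \<gamma>)" using g(1) continuous_on_subset[OF cT] by (intro continuous_on_compose) auto
  moreover have "((T \<circ> \<gamma>) \<longlongrightarrow> 0) (at_right 0)"
    using g(3) unfolding tendsto_iff p[symmetric] comp_def iso .
  moreover have "filterlim (\<lambda>s. norm ((T \<circ> \<gamma>) s)) at_top at_top"
  proof (rule filterlim_at_top_mono)
    show "filterlim (\<lambda>s. - norm p + norm (\<gamma> s)) at_top at_top" by (rule filterlim_tendsto_add_at_top[OF tendsto_const g(4)])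
    have "norm (T x) = dist x p" for x using iso[of x p] p by simp
    then show "\<forall>\<^sub>F s in at_top. - norm p + norm (\<gamma> s) \<le> norm ((T \<circ> \<gamma>) s)"
      using norm_triangle_ineq2[of "\<gamma> _" p] by (intro always_eventually) (simp add: dist_norm)
  qed
  ultimately show ?thesis unfolding connected_to_infinity_def by blast
qed

lemma far_field_const_nonzero: "k > 0 \<Longrightarrow> far_field_const n k \<noteq> 0"
  by (simp add: far_field_const_def)

text \<open>After a translation by \<open>p\<close> the isometry is an orthogonal map, which
  permutes the unit sphere and preserves Lebesgue measure; the translation itself multiplies the
  transform by a factor of modulus 1. So vanishing on the sphere is invariant.\<close>

lemma fourier_sphere_isometry:
  fixes T S :: "'a::euclidean_space \<Rightarrow> 'a" and F :: "'a \<Rightarrow> complex"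
  assumes iso: "\<And>x y. dist (T x) (T y) = dist x y" and p: "T p = 0" and S: "\<And>x. S (T x) = x" "\<And>x. T (S x) = x"
    and F: "F \<in> borel_measurable borel"
    and z: "\<And>\<omega>. norm \<omega> = 1 \<Longrightarrow> (\<integral>y. F y * cis (- k * (\<omega> \<bullet> y)) \<partial>lborel) = 0"
    and \<omega>: "norm \<omega> = 1"
  shows "(\<integral>y. F (S y) * cis (- k * (\<omega> \<bullet> y)) \<partial>lborel) = 0"
proof -
  define A where "A x = T (x + p)" for x
  have A: "orthogonal_transformation A"
    unfolding orthogonal_transformation_isometry by (simp add: A_def iso p)
  have [measurable]: "F \<in> borel_measurable borel" by (fact F)
  have isoS: "dist (S x) (S y) = dist x y" for x y using iso[of "S x" "S y"] S by simp
  have "continuous_on UNIV S" unfolding continuous_on_iff isoS by blast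
  then have [measurable]: "S \<in> borel_measurable borel" by (rule borel_measurable_continuous_onI)
  have "continuous_on UNIV A" using orthogonal_transformation_linear[OF A] linear_conv_bounded_linear linear_continuous_on by blast
  then have [measurable]: "A \<in> borel_measurable borel" by (rule borel_measurable_continuous_onI)
  obtain \<omega>' where w': "A \<omega>' = \<omega>" using orthogonal_transformation_surj[OF A] by (metis surjD)
  have n': "norm \<omega>' = 1" using orthogonal_transformation_norm[OF A, of \<omega>'] w' \<omega> by simp
  have "(\<integral>y. F (S y) * cis (- k * (\<omega> \<bullet> y)) \<partial>lborel) = (\<integral>y. F (S y) * cis (- k * (\<omega> \<bullet> y)) \<partial>distr lborel borel A)"
    by (simp add: lborel_distr_orthogonal[OF A])
  also have "\<dots> = (\<integral>x. F (S (A x)) * cis (- k * (\<omega> \<bullet> A x)) \<partial>lborel)"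
    by (rule integral_distr) measurable
  also have "\<dots> = (\<integral>x. F (x + p) * cis (- k * (\<omega>' \<bullet> x)) \<partial>lborel)"
  proof -
    have "\<omega> \<bullet> A x = \<omega>' \<bullet> x" for x using A w' unfolding orthogonal_transformation_def by metis
    then show ?thesis by (simp add: A_def S)
  qed
  also have "\<dots> = (\<integral>x. (\<lambda>y. cis (k * (\<omega>' \<bullet> p)) * (F y * cis (- k * (\<omega>' \<bullet> y)))) (x + p) \<partial>lborel)"
  proof (intro Bochner_Integration.integral_cong refl)
    fix x
    have "cis (- k * (\<omega>' \<bullet> x)) = cis (k * (\<omega>' \<bullet> p)) * cis (- k * (\<omega>' \<bullet> (x + p)))"
      unfolding cis_mult by (simp add: inner_simps algebra_simps)
    then show "F (x + p) * cis (- k * (\<omega>' \<bullet> x)) = (\<lambda>y. cis (k * (\<omega>' \<bullet> p)) * (F y * cis (- k * (\<omega>' \<bullet> y)))) (x + p)"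
      by (simp add: mult_ac)
  qed
  also have "\<dots> = (\<integral>y. cis (k * (\<omega>' \<bullet> p)) * (F y * cis (- k * (\<omega>' \<bullet> y))) \<partial>lborel)"
    by (rule integral_lborel_shift) measurable
  also have "\<dots> = 0" unfolding integral_mult_right_zero z[OF n'] by simp
  finally show ?thesis .
qed

lemma holder_continuous_on_imp_continuous_on:
  assumes h: "holder_continuous_on \<alpha> S f" and \<alpha>: "0 < \<alpha>"
  shows "continuous_on S f"
proof -
  obtain C where C: "\<forall>x\<in>S. \<forall>y\<in>S. norm (f x - f y) \<le> C * dist x y powr \<alpha>"
    using h unfolding holder_continuous_on_def by blast
  have "(f \<longlongrightarrow> f x) (at x within S)" if x: "x \<in> S" for x
  proof -
    have "((\<lambda>y. dist y x) \<longlongrightarrow> dist x x) (at x within S)" by (intro tendsto_intros)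
    then have "((\<lambda>y. dist y x) \<longlongrightarrow> 0) (at x within S)" by simp
    then have "((\<lambda>y. dist y x powr \<alpha>) \<longlongrightarrow> 0 powr \<alpha>) (at x within S)"
      by (rule tendsto_powr'[OF _ tendsto_const]) (use \<alpha> in auto)
    then have l: "((\<lambda>y. C * dist y x powr \<alpha>) \<longlongrightarrow> 0) (at x within S)" using tendsto_mult_right_zero by fastforce
    have "((\<lambda>y. f y - f x) \<longlongrightarrow> 0) (at x within S)"
      by (rule Lim_null_comparison[OF _ l]) (use C x in \<open>auto simp: eventually_at_filter\<close>)
    then show ?thesis by (simp add: LIM_zero_iff)
  qed
  then show ?thesis unfolding continuous_on_def by blast
qed

text \<open>Composed with the translation by \<open>p\<close>, the isometry fixes 0 and is therefore
  linear and orthogonal, hence onto; injectivity is immediate from distances.\<close>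

lemma isometry_fixed_image_inverse:
  fixes T :: "'a::euclidean_space \<Rightarrow> 'a"
  assumes iso: "\<And>x y. dist (T x) (T y) = dist x y" and p: "T p = 0"
  obtains S where "\<And>x. S (T x) = x" "\<And>x. T (S x) = x" "\<And>x y. dist (S x) (S y) = dist x y"
proof -
  have A: "orthogonal_transformation (\<lambda>x. T (x + p))"
    unfolding orthogonal_transformation_isometry by (simp add: iso p)
  have "surj T"
  proof (rule surjI)
    show "T (inv (\<lambda>x. T (x + p)) y + p) = y" for y
      using surj_f_inv_f[OF orthogonal_transformation_surj[OF A], of y] .
  qed
  then have 2: "T (inv T x) = x" for x by (rule surj_f_inv_f)
  have "inj T" by (rule injI) (metis iso dist_eq_0_iff)
  then have 1: "inv T (T x) = x" for x by (rule inv_f_f)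
  have "dist (inv T x) (inv T y) = dist x y" for x y using iso[of "inv T x" "inv T y"] 2 by simp
  with 1 2 show thesis by (rule that)
qed

text \<open>The order of the quantifiers is the content: the cutoff and all constants are chosen
  from \<open>m\<close>, \<open>D\<close>, \<open>L\<close>, \<open>k\<close> and the dimension,
  before any domain or source is given. The two conditions on the size of \<open>K\<close> provide
  \<open>\<tau> \<ge> K\<close> and \<open>Km \<ge> 97/100 * K\<close>.\<close>

lemma nonradiating_bound:
  fixes \<alpha> \<delta> m D L k :: real
  assumes m: "0 < m" "m \<le> \<alpha>" "m \<le> \<delta>" and L: "L \<ge> 0" and k: "k > 0"
  shows "\<exists>C. \<forall>(\<Omega> :: ((real^'m) \<times> real) set) p \<phi> K M.
     open \<Omega> \<and> bounded \<Omega> \<and> diameter \<Omega> \<le> D \<and> holder_continuous_on \<alpha> (closure \<Omega>) \<phi> \<and>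
     admissible_curvature_point K L M \<delta> \<Omega> p \<and> K \<ge> exp 1 \<and> 2 * m * ln K \<ge> 1 \<and> L * K powr - \<delta> \<le> 3/100 \<and>
     connected_to_infinity (- closure \<Omega>) p \<and> \<not> radiates_nonzero_far_field k \<Omega> \<phi>
     \<longrightarrow> norm (\<phi> p) \<le> max 1 (holder_norm \<alpha> (closure \<Omega>) \<phi>) * C * ln K powr (1 + real DIM(real^'m) / 2) * K powr (- m / 2)"
proof -
  obtain c c1 c2 B where cut: "\<forall>s. (c has_field_derivative c1 s) (at s)" "\<forall>s. (c1 has_field_derivative c2 s) (at s)"
     "continuous_on UNIV c2" "\<forall>s\<le>98/100. c s = 1 \<and> c1 s = 0 \<and> c2 s = 0" "\<forall>s\<ge>1. c s = 0 \<and> c1 s = 0 \<and> c2 s = 0"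
     "\<forall>s. 0 \<le> c s \<and> c s \<le> 1" "\<forall>s. \<bar>c1 s\<bar> \<le> B" "\<forall>s. \<bar>c2 s\<bar> \<le> (B::real)"
    using smooth_cutoff[of "98/100" 1] by auto
  \<comment> \<open>The point \<open>p\<close> lies in the closure and moves to 0, so the moved
    domain has radius at most its diameter; the 1 keeps the radius positive.\<close>
  define R where "R = max D 1"
  define d where "d = real DIM(real^'m)"
  define Vn where "Vn = unit_ball_vol (real DIM((real^'m) \<times> real))"
  define Vd where "Vd = unit_ball_vol (real DIM(real^'m))"
  \<comment> \<open>Outside the locale \<open>CU\<close> takes only \<open>k\<close> and
    \<open>R\<close> as parameters, so it can be named before a source exists.\<close>
  define C5 where "C5 = Vn + Vd * L + exp (3/5) * pi powr (d / 2)
    + source.CU TYPE(real^'m) k R * Vn * B * (4 * ((4 + 2 * (d + 1)) + 16 * m + 4 * k)) * (50 / m\<^sup>2)"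
  define c0 where "c0 = 1 / (2 * m) * (pi / (2 * m)) powr (d / 2) * exp (- k\<^sup>2 / (8 * m))"
  have "norm (\<phi> p) \<le> max 1 (holder_norm \<alpha> (closure \<Omega>) \<phi>) * (C5 / c0) * ln K powr (1 + d / 2) * K powr (- m / 2)"
    if \<Omega>: "open \<Omega>" "bounded \<Omega>" "diameter \<Omega> \<le> D" and \<phi>: "holder_continuous_on \<alpha> (closure \<Omega>) \<phi>"
      and adm: "admissible_curvature_point K L M \<delta> \<Omega> p" and K: "K \<ge> exp 1" "2 * m * ln K \<ge> 1" "L * K powr - \<delta> \<le> 3/100"
      and conn: "connected_to_infinity (- closure \<Omega>) p" and nr: "\<not> radiates_nonzero_far_field k \<Omega> \<phi>"
    for \<Omega> :: "((real^'m) \<times> real) set" and p \<phi> K M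
  proof -
    define N where "N = max 1 (holder_norm \<alpha> (closure \<Omega>) \<phi>)"
    have K0: "K > 0" using K(1) exp_gt_zero[of 1] by linarith
    have \<alpha>0: "\<alpha> > 0" using m by linarith
    obtain T :: "(real^'m) \<times> real \<Rightarrow> (real^'m) \<times> real" and \<omega> :: "real^'m \<Rightarrow> real" and Km Kp where pf: "p \<in> frontier \<Omega>" and iso': "\<forall>x y. dist (T x) (T y) = dist x y" and Tp: "T p = 0"
      and graph: "T ` \<Omega> \<inter> (ball 0 (sqrt M / K) \<times> {- (1 / K)<..<1 / K}) = {(x', t). norm x' < sqrt M / K \<and> - (1 / K) < t \<and> t < 1 / K \<and> \<omega> x' < t}"
      and C3: "C3_on (ball 0 (sqrt M / K)) \<omega>" and M: "M \<ge> 1"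
      and Km: "Km \<le> K" "K \<le> Kp" "Kp - Km \<le> L * K powr (1 - \<delta>)"
      and \<omega>: "\<forall>x'\<in>ball 0 (sqrt M / K). Km * (norm x')\<^sup>2 \<le> \<omega> x' \<and> \<omega> x' \<le> Kp * (norm x')\<^sup>2"
      using adm unfolding admissible_curvature_point_def Let_def by (elim conjE exE) (rule that, assumption+)
    note iso = iso'[rule_format]
    obtain S where S: "\<And>x. S (T x) = x" "\<And>x. T (S x) = x" "\<And>x y. dist (S x) (S y) = dist x y"
      by (rule isometry_fixed_image_inverse[of T p]) (use iso Tp in auto)
    have S0: "S 0 = p" using S(1)[of p] Tp by simp
    have pc: "p \<in> closure \<Omega>" using pf by (simp add: frontier_def)
    have pn: "p \<notin> \<Omega>" using pf \<Omega>(1) by (simp add: frontier_def interior_open)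
    have "\<Omega> \<noteq> {}" using pc by auto
    then obtain q where q: "q \<in> \<Omega>" by blast
    have qc: "q \<in> closure \<Omega>" "q \<noteq> p" using q pn closure_subset by blast+
    note hb = holder_norm_bounds[OF \<phi> qc(1) pc qc(2)]
    have \<phi>N: "norm (\<phi> x) \<le> N" if "x \<in> closure \<Omega>" for x using hb(1)[OF that that] unfolding N_def by linarith
    have \<phi>H: "norm (\<phi> x - \<phi> p) \<le> N * dist x p powr \<alpha>" if "x \<in> closure \<Omega>" for x
      using order_trans[OF hb(2)[OF that pc] mult_right_mono[of _ N "dist x p powr \<alpha>"]] unfolding N_def by simp
    \<comment> \<open>Extension by 0. As \<open>p\<close> is not in \<Omega>, the value of
      \<open>F\<close> at \<open>p\<close> is 0; the quantity to be estimated is the boundary value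
      \<open>\<phi> p\<close>, compared with \<open>F\<close> only at points of \<Omega>.\<close>
    define F where "F y = indicator \<Omega> y *\<^sub>R \<phi> y" for y
    have Fm: "F \<in> borel_measurable borel"
      unfolding F_def
    proof (rule borel_measurable_continuous_on_indicator)
      show "continuous_on \<Omega> \<phi>"
        using holder_continuous_on_imp_continuous_on[OF \<phi> \<alpha>0] closure_subset by (rule continuous_on_subset)
    qed (use \<Omega>(1) in auto)
    have Fz: "(\<integral>y. F y * cis (- k * (\<omega> \<bullet> y)) \<partial>lborel) = 0" if "norm \<omega> = 1" for \<omega>
    proof -
      have "far_field k \<Omega> \<phi> \<omega> = 0" using nr that unfolding radiates_nonzero_far_field_def by blast
      then have "set_lebesgue_integral lborel \<Omega> (\<lambda>y. cis (- k * (\<omega> \<bullet> y)) * \<phi> y) = 0"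
        using far_field_const_nonzero[OF k] unfolding far_field_def by simp
      moreover have "indicator \<Omega> y *\<^sub>R (cis (- k * (\<omega> \<bullet> y)) * \<phi> y) = F y * cis (- k * (\<omega> \<bullet> y))" for y
        by (simp add: F_def)
      ultimately show ?thesis unfolding set_lebesgue_integral_def by simp
    qed
    have nT: "norm (T x) = dist x p" for x using iso[of x p] Tp by simp
    have nS: "dist (S y) p = norm y" for y using S(3)[of y 0] S0 by simp
    have clR: "closure (T ` \<Omega>) \<subseteq> cball 0 R"
    proof (rule closure_minimal)
      show "T ` \<Omega> \<subseteq> cball 0 R"
      proof (rule image_subsetI)
        fix x assume "x \<in> \<Omega>"
        then have "x \<in> closure \<Omega>" using closure_subset by blast
        then have "dist x p \<le> diameter (closure \<Omega>)" using pc \<Omega>(2) by (intro diameter_bounded_bound) auto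
        then show "T x \<in> cball 0 R" using \<Omega>(2,3) by (simp add: diameter_closure nT R_def)
      qed
    qed simp
    have fS: "F (S y) \<noteq> 0 \<Longrightarrow> y \<in> T ` \<Omega>" for y
    proof -
      assume "F (S y) \<noteq> 0"
      then have "S y \<in> \<Omega>" by (auto simp: F_def indicator_def split: if_splits)
      then show "y \<in> T ` \<Omega>" using S(2)[of y] by force
    qed
    have cS: "continuous_on UNIV S" unfolding continuous_on_iff S(3) by blast
    have src: "source k N R (\<lambda>y. F (S y))"
    proof
      show "k > 0" by (rule k)
      show "R > 0" by (simp add: R_def)
      show "(\<lambda>y. F (S y)) \<in> borel_measurable borel"
        using borel_measurable_continuous_onI[OF cS] Fm by measurable
      show "norm (F (S x)) \<le> N" for x
      proof (cases "S x \<in> \<Omega>")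
        case True
        then show ?thesis using \<phi>N[of "S x"] closure_subset[of \<Omega>] by (auto simp: F_def)
      qed (simp add: F_def N_def)
      show "F (S x) = 0" if "norm x > R" for x
      proof (rule ccontr)
        assume "F (S x) \<noteq> 0"
        from fS[OF this] clR closure_subset[of "T ` \<Omega>"] that show False by force
      qed
      show "(\<integral>y. F (S y) * cis (- k * (\<omega> \<bullet> y)) \<partial>lborel) = 0" if "norm \<omega> = 1" for \<omega>
        by (rule fourier_sphere_isometry[OF iso Tp S(1,2) Fm Fz that])
    qed
    have ow: "continuous_on (ball 0 (sqrt M / K)) \<omega>"
    proof -
      obtain D1 where "\<forall>x\<in>ball 0 (sqrt M / K). (\<omega> has_derivative D1 x) (at x)"
        using C3 unfolding C3_on_def by blast
      then show ?thesis using has_derivative_continuous continuous_at_imp_continuous_on by blast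
    qed
    have oT: "open (T ` \<Omega>)"
    proof -
      have "T ` \<Omega> = S -` \<Omega>" using S(1,2) by (auto simp: image_iff) metis
      then show ?thesis using open_vimage[OF \<Omega>(1) cS] by simp
    qed
    \<comment> \<open>Since \<open>Kp \<ge> K\<close>, the gap \<open>K - Km\<close> is at most
      \<open>Kp - Km\<close>, hence at most \<open>K * (L * K powr - \<delta>)\<close>, three
      percent of \<open>K\<close>.\<close>
    have KmK: "97/100 * K \<le> Km"
    proof -
      have "L * K powr (1 - \<delta>) = K * (L * K powr - \<delta>)" using K0 powr_add[of K 1 "- \<delta>"] by simp
      also have "\<dots> \<le> K * (3/100)" using K(3) K0 by (intro mult_left_mono) auto
      finally show ?thesis using Km by linarith
    qed
    have \<omega>': "Km * (norm x')\<^sup>2 \<le> \<omega> x' \<and> \<omega> x' \<le> Kp * (norm x')\<^sup>2" if "norm x' < sqrt M / K" for x'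
      using \<omega> that by simp
    have bK: "sqrt M / K \<ge> 1 / K" using M K0 by (intro divide_right_mono) auto
    have fH: "norm (F (S y) - \<phi> p) \<le> N * norm y powr \<alpha>" if "y \<in> T ` \<Omega>" for y
    proof -
      have "S y \<in> \<Omega>" using that S(1) by auto
      then show ?thesis using \<phi>H[of "S y"] closure_subset[of \<Omega>] by (auto simp: F_def nS)
    qed
    have "norm (\<phi> p) \<le> N * (C5 / c0) * ln K powr (1 + d / 2) * K powr (- m / 2)"
      unfolding C5_def c0_def d_def Vn_def Vd_def
      by (rule source.core_bound[OF src cut(1,2)[rule_format] cut(3) cut(4-8)[rule_format] K(1) m K(2) L Km(3) oT fS clR bK graph ow \<omega>'
          KmK Km(1,2) connected_to_infinity_isometry[OF iso Tp conn] fH \<phi>N[OF pc]]; assumption)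
    then show ?thesis by (simp only: N_def)
  qed
  then show ?thesis unfolding d_def by blast
qed

section \<open>The choice of the constant and the case of moderate curvature\<close>

theorem theorem2p12:
  fixes \<alpha> \<delta> D L M k :: real
  assumes "0 < \<alpha>" and "\<alpha> < 1" and "k > 0"
  shows "\<exists>E>0. \<forall>(\<Omega> :: ((real^'m) \<times> real) set) p \<phi> K.
     open \<Omega> \<and> connected \<Omega> \<and> \<Omega> \<noteq> {} \<and> bounded \<Omega> \<and> diameter \<Omega> \<le> D \<and>
     holder_continuous_on \<alpha> (closure \<Omega>) \<phi> \<and>
     admissible_curvature_point K L M \<delta> \<Omega> p \<and> K \<ge> exp 1 \<and>
     connected_to_infinity (- closure \<Omega>) p \<and>
     norm (\<phi> p) / max 1 (holder_norm \<alpha> (closure \<Omega>) \<phi>)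
       \<ge> E * ln K powr ((real DIM((real^'m) \<times> real) + 3) / 2) * K powr (- min \<alpha> \<delta> / 2)
     \<longrightarrow> radiates_nonzero_far_field k \<Omega> \<phi>"
proof (cases "\<delta> > 0 \<and> L > 0")
  \<comment> \<open>Admissibility includes positivity of \<delta> and \<open>L\<close>, so the claim
    is vacuous and any constant will do.\<close>
  case False
  then show ?thesis unfolding admissible_curvature_point_def by (intro exI[of _ 1]) auto
next
  case True
  define m where "m = min \<alpha> \<delta>"
  have m: "0 < m" "m \<le> \<alpha>" "m \<le> \<delta>" using assms True by (auto simp: m_def)
  \<comment> \<open>The first entry makes \<open>2 * m * ln K \<ge> 1\<close>, the second makes
    \<open>L * K powr - \<delta> \<le> 3/100\<close>, for every \<open>K \<ge> K0\<close>.\<close>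
  define K0 where "K0 = max (exp (1 / (2 * m))) ((100 * L / 3) powr (1 / \<delta>))"
  have K0: "K0 > 0" unfolding K0_def using exp_gt_zero less_max_iff_disj by blast
  have large: "2 * m * ln K \<ge> 1" "L * K powr - \<delta> \<le> 3/100" if "K \<ge> K0" for K
  proof -
    have Kp: "K > 0" using that K0 by linarith
    have "1 / (2 * m) \<le> ln K" using that Kp by (simp add: K0_def ln_ge_iff)
    then show "2 * m * ln K \<ge> 1" using m by (simp add: field_simps)
    have "100 * L / 3 = ((100 * L / 3) powr (1 / \<delta>)) powr \<delta>" using True by (simp add: powr_powr)
    also have "\<dots> \<le> K powr \<delta>" using that True by (intro powr_mono2) (auto simp: K0_def)
    finally show "L * K powr - \<delta> \<le> 3/100" using Kp by (simp add: powr_minus_divide field_simps)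
  qed
  obtain C where C: "\<And>(\<Omega> :: ((real^'m) \<times> real) set) p \<phi> K M.
     open \<Omega> \<and> bounded \<Omega> \<and> diameter \<Omega> \<le> D \<and> holder_continuous_on \<alpha> (closure \<Omega>) \<phi> \<and>
     admissible_curvature_point K L M \<delta> \<Omega> p \<and> K \<ge> exp 1 \<and> 2 * m * ln K \<ge> 1 \<and> L * K powr - \<delta> \<le> 3/100 \<and>
     connected_to_infinity (- closure \<Omega>) p \<and> \<not> radiates_nonzero_far_field k \<Omega> \<phi> \<Longrightarrow>
     norm (\<phi> p) \<le> max 1 (holder_norm \<alpha> (closure \<Omega>) \<phi>) * C * ln K powr (1 + real DIM(real^'m) / 2) * K powr (- m / 2)"
    using nonradiating_bound[OF m less_imp_le[OF conjunct2[OF True]] assms(3), of D] by blast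
  \<comment> \<open>Above \<open>K0\<close> a nonradiating source obeys the bound with
    \<open>C\<close>, and \<open>E > C\<close> contradicts it. Below \<open>K0\<close>,
    \<open>E > K0 powr (m / 2)\<close> makes the assumed lower bound exceed 1, whereas
    \<open>norm (\<phi> p)\<close> is at most the maximum of 1 and the Holder norm.\<close>
  define E where "E = max (C + 1) (K0 powr (m / 2) + 1)"
  have E: "E > C" "E > K0 powr (m / 2)" "E > 0" by (auto simp: E_def less_max_iff_disj add_nonneg_pos)
  show ?thesis
  proof (intro exI[of _ E] conjI allI impI E(3), elim conjE, rule ccontr)
    fix \<Omega> :: "((real^'m) \<times> real) set" and p \<phi> K
    assume \<Omega>: "open \<Omega>" "connected \<Omega>" "\<Omega> \<noteq> {}" "bounded \<Omega>" "diameter \<Omega> \<le> D" and \<phi>: "holder_continuous_on \<alpha> (closure \<Omega>) \<phi>"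
      and adm: "admissible_curvature_point K L M \<delta> \<Omega> p" and K: "exp 1 \<le> K" and conn: "connected_to_infinity (- closure \<Omega>) p"
      and big: "E * ln K powr ((real DIM((real^'m) \<times> real) + 3) / 2) * K powr (- min \<alpha> \<delta> / 2)
        \<le> norm (\<phi> p) / max 1 (holder_norm \<alpha> (closure \<Omega>) \<phi>)"
      and nr: "\<not> radiates_nonzero_far_field k \<Omega> \<phi>"
    define N where "N = max 1 (holder_norm \<alpha> (closure \<Omega>) \<phi>)"
    define q where "q = (real DIM((real^'m) \<times> real) + 3) / 2"
    have N1: "N \<ge> 1" by (simp add: N_def)
    have Kp: "K > 0" using K exp_gt_zero[of 1] by linarith
    have l1: "ln K \<ge> 1" using K Kp by (simp add: ln_ge_iff)
    \<comment> \<open>In dimension \<open>n\<close> the argument yields the power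
      \<open>(n + 1) / 2\<close> of \<open>ln K\<close>; as \<open>ln K \<ge> 1\<close> it may be
      raised to \<open>(n + 3) / 2\<close>.\<close>
    have q0: "1 + real DIM(real^'m) / 2 \<le> q" by (simp add: q_def field_simps)
    have lq: "ln K powr q \<ge> 1" using l1 q0 by (intro ge_one_powr_ge_zero) (auto intro: order_trans[rotated])
    have pw: "K powr (- m / 2) > 0" using Kp by simp
    from big have big': "E * ln K powr q * K powr (- m / 2) \<le> norm (\<phi> p) / N" unfolding q_def m_def N_def .
    show False
    proof (cases "K \<ge> K0")
      case True
      have "norm (\<phi> p) \<le> N * C * ln K powr (1 + real DIM(real^'m) / 2) * K powr (- m / 2)"
        unfolding N_def using \<Omega> \<phi> adm K conn nr large[OF True] by (intro C) auto
      then have "norm (\<phi> p) / N \<le> C * ln K powr (1 + real DIM(real^'m) / 2) * K powr (- m / 2)"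
        using N1 by (simp add: divide_le_eq mult_ac)
      also have "\<dots> < E * ln K powr (1 + real DIM(real^'m) / 2) * K powr (- m / 2)"
        using E(1) pw l1 by (intro mult_strict_right_mono) auto
      also have "\<dots> \<le> E * ln K powr q * K powr (- m / 2)"
        using E(3) l1 q0 pw by (intro mult_right_mono mult_left_mono powr_mono) auto
      finally show False using big' by linarith
    next
      case False
      have pf: "p \<in> frontier \<Omega>" using adm unfolding admissible_curvature_point_def by blast
      then have pc: "p \<in> closure \<Omega>" "p \<notin> \<Omega>" using \<Omega>(1) by (simp_all add: frontier_def interior_open)
      obtain q where qO: "q \<in> \<Omega>" using \<Omega>(3) by blast
      have qc: "q \<in> closure \<Omega>" "q \<noteq> p" using qO pc closure_subset by blast+
      have "norm (\<phi> p) \<le> N" using holder_norm_bounds(1)[OF \<phi> qc(1) pc(1) qc(2) pc(1) pc(1)] unfolding N_def by linarith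
      then have r1: "norm (\<phi> p) / N \<le> 1" using N1 by (simp add: divide_le_eq)
      have "1 = K0 powr (m / 2) * K0 powr (- m / 2)" unfolding powr_add[symmetric] using K0 by simp
      also have "\<dots> \<le> K0 powr (m / 2) * K powr (- m / 2)"
        using False Kp K0 m by (intro mult_left_mono powr_mono2') auto
      also have "\<dots> < E * K powr (- m / 2)" using E(2) pw by (rule mult_strict_right_mono)
      also have "\<dots> = E * 1 * K powr (- m / 2)" by simp
      also have "\<dots> \<le> E * ln K powr ((real DIM((real^'m) \<times> real) + 3) / 2) * K powr (- m / 2)"
        using lq E(3) pw unfolding q_def by (intro mult_right_mono mult_left_mono) auto
      finally show False using big' r1 unfolding q_def by linarith
    qed
  qed
qed

end
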